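(* For any prime $p$, there exist a field $K$ and a central division $K$-algebra $\mathcal{D}$ of degree $p$ whose genus $\mathbf{gen}(\mathcal{D})$ is infinite.
   Context: For a finite-dimensional central division algebra $\mathcal{D}$ over a field $F$, the genus $\mathbf{gen}(\mathcal{D})$ is the set of classes $[\mathcal{D}']\in \mathrm{Br}(F)$ of central division $F$-algebras $\mathcal{D}'$ having the same maximal subfields as $\mathcal{D}$; that is, $\mathcal{D}'$ has the same degree $n$ as $\mathcal{D}$, and a field extension $E/F$ of degree $n$ admits an $F$-embedding into $\mathcal{D}$ if and only if it admits an $F$-embedding into $\mathcal{D}'$. *)

theory Defs
  imports "HOL-Algebra.Algebra"
begin

text \<open>
  Finite-dimensional algebras over a field K are encoded by structure constants:
  an algebra of dimension m over K has underlying K-vector space K^m, whose vectors are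
  functions nat => carrier K vanishing outside the index range below m, and multiplication
  determined by e_i * e_j = sum over k of c i j k * e_k.  Every finite-dimensional
  (unital, associative) K-algebra is isomorphic to one of this form.
\<close>

definition vecs :: "('a, 'b) ring_scheme \<Rightarrow> nat \<Rightarrow> (nat \<Rightarrow> 'a) set" where
  "vecs K m = {v. (\<forall>i<m. v i \<in> carrier K) \<and> (\<forall>i. m \<le> i \<longrightarrow> v i = \<zero>\<^bsub>K\<^esub>)}"

definition sc_add :: "('a, 'b) ring_scheme \<Rightarrow> nat \<Rightarrow> (nat \<Rightarrow> 'a) \<Rightarrow> (nat \<Rightarrow> 'a) \<Rightarrow> (nat \<Rightarrow> 'a)" where
  "sc_add K m u v = (\<lambda>k. if k < m then u k \<oplus>\<^bsub>K\<^esub> v k else \<zero>\<^bsub>K\<^esub>)"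

definition sc_smul :: "('a, 'b) ring_scheme \<Rightarrow> nat \<Rightarrow> 'a \<Rightarrow> (nat \<Rightarrow> 'a) \<Rightarrow> (nat \<Rightarrow> 'a)" where
  "sc_smul K m a v = (\<lambda>k. if k < m then a \<otimes>\<^bsub>K\<^esub> v k else \<zero>\<^bsub>K\<^esub>)"

definition sc_mult :: "('a, 'b) ring_scheme \<Rightarrow> nat \<Rightarrow> (nat \<Rightarrow> nat \<Rightarrow> nat \<Rightarrow> 'a)
    \<Rightarrow> (nat \<Rightarrow> 'a) \<Rightarrow> (nat \<Rightarrow> 'a) \<Rightarrow> (nat \<Rightarrow> 'a)" where
  "sc_mult K m c u v = (\<lambda>k. if k < m then
      (\<Oplus>\<^bsub>K\<^esub> i\<in>{..<m}. \<Oplus>\<^bsub>K\<^esub> j\<in>{..<m}. (u i \<otimes>\<^bsub>K\<^esub> v j) \<otimes>\<^bsub>K\<^esub> c i j k)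
    else \<zero>\<^bsub>K\<^esub>)"

definition sc_one :: "('a, 'b) ring_scheme \<Rightarrow> nat \<Rightarrow> (nat \<Rightarrow> nat \<Rightarrow> nat \<Rightarrow> 'a) \<Rightarrow> (nat \<Rightarrow> 'a)" where
  "sc_one K m c = (THE e. e \<in> vecs K m \<and>
     (\<forall>v\<in>vecs K m. sc_mult K m c e v = v \<and> sc_mult K m c v e = v))"

definition sc_ring :: "('a, 'b) ring_scheme \<Rightarrow> nat \<Rightarrow> (nat \<Rightarrow> nat \<Rightarrow> nat \<Rightarrow> 'a) \<Rightarrow> (nat \<Rightarrow> 'a) ring" where
  "sc_ring K m c = \<lparr>carrier = vecs K m, monoid.mult = sc_mult K m c, monoid.one = sc_one K m c,
                    ring.zero = (\<lambda>_. \<zero>\<^bsub>K\<^esub>), ring.add = sc_add K m\<rparr>"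

definition is_algebra :: "('a, 'b) ring_scheme \<Rightarrow> nat \<Rightarrow> (nat \<Rightarrow> nat \<Rightarrow> nat \<Rightarrow> 'a) \<Rightarrow> bool" where
  "is_algebra K m c \<longleftrightarrow> (\<forall>i<m. \<forall>j<m. \<forall>k<m. c i j k \<in> carrier K) \<and> ring (sc_ring K m c)"

definition is_central_division_algebra ::
    "('a, 'b) ring_scheme \<Rightarrow> nat \<Rightarrow> (nat \<Rightarrow> nat \<Rightarrow> nat \<Rightarrow> 'a) \<Rightarrow> bool" where
  "is_central_division_algebra K n c \<longleftrightarrow>
     (let m = n ^ 2; A = sc_ring K m c in
       is_algebra K m c \<and> \<one>\<^bsub>A\<^esub> \<noteq> \<zero>\<^bsub>A\<^esub> \<and>
       Units A = carrier A - {\<zero>\<^bsub>A\<^esub>} \<and>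
       {x \<in> carrier A. \<forall>y\<in>carrier A. x \<otimes>\<^bsub>A\<^esub> y = y \<otimes>\<^bsub>A\<^esub> x}
         = {sc_smul K m a \<one>\<^bsub>A\<^esub> | a. a \<in> carrier K})"

definition is_field_extension :: "('a, 'b) ring_scheme \<Rightarrow> nat \<Rightarrow> (nat \<Rightarrow> nat \<Rightarrow> nat \<Rightarrow> 'a) \<Rightarrow> bool" where
  "is_field_extension K n e \<longleftrightarrow> is_algebra K n e \<and> field (sc_ring K n e)"

definition alg_hom :: "('a, 'b) ring_scheme \<Rightarrow> nat \<Rightarrow> (nat \<Rightarrow> nat \<Rightarrow> nat \<Rightarrow> 'a)
    \<Rightarrow> nat \<Rightarrow> (nat \<Rightarrow> nat \<Rightarrow> nat \<Rightarrow> 'a) \<Rightarrow> ((nat \<Rightarrow> 'a) \<Rightarrow> (nat \<Rightarrow> 'a)) set" where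
  "alg_hom K m1 c1 m2 c2 = {f. f \<in> ring_hom (sc_ring K m1 c1) (sc_ring K m2 c2) \<and>
      (\<forall>a\<in>carrier K. \<forall>v\<in>vecs K m1. f (sc_smul K m1 a v) = sc_smul K m2 a (f v))}"

definition embeds :: "('a, 'b) ring_scheme \<Rightarrow> nat \<Rightarrow> (nat \<Rightarrow> nat \<Rightarrow> nat \<Rightarrow> 'a)
    \<Rightarrow> nat \<Rightarrow> (nat \<Rightarrow> nat \<Rightarrow> nat \<Rightarrow> 'a) \<Rightarrow> bool" where
  "embeds K n e m c \<longleftrightarrow>
     (\<exists>f \<in> alg_hom K n e m c. inj_on f (vecs K n))"

definition alg_isomorphic :: "('a, 'b) ring_scheme \<Rightarrow> nat \<Rightarrow> (nat \<Rightarrow> nat \<Rightarrow> nat \<Rightarrow> 'a)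
    \<Rightarrow> (nat \<Rightarrow> nat \<Rightarrow> nat \<Rightarrow> 'a) \<Rightarrow> bool" where
  "alg_isomorphic K m c1 c2 \<longleftrightarrow>
     (\<exists>f \<in> alg_hom K m c1 m c2. bij_betw f (vecs K m) (vecs K m))"

text \<open>Genus of a central division algebra D of degree n: all central division algebras D'
  of degree n with the same maximal subfields (field extensions of degree n embedding into them).\<close>
definition genus_reps :: "('a, 'b) ring_scheme \<Rightarrow> nat \<Rightarrow> (nat \<Rightarrow> nat \<Rightarrow> nat \<Rightarrow> 'a)
    \<Rightarrow> (nat \<Rightarrow> nat \<Rightarrow> nat \<Rightarrow> 'a) set" where
  "genus_reps K n d = {d'. is_central_division_algebra K n d' \<and>
     (\<forall>e. is_field_extension K n e \<longrightarrow> (embeds K n e (n ^ 2) d \<longleftrightarrow> embeds K n e (n ^ 2) d'))}"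

text \<open>The genus as a set of classes: central division algebras of the same degree are
  Brauer equivalent iff they are isomorphic, so classes = isomorphism classes.\<close>
definition genus :: "('a, 'b) ring_scheme \<Rightarrow> nat \<Rightarrow> (nat \<Rightarrow> nat \<Rightarrow> nat \<Rightarrow> 'a)
    \<Rightarrow> (nat \<Rightarrow> nat \<Rightarrow> nat \<Rightarrow> 'a) set set" where
  "genus K n d = genus_reps K n d // {(x, y). alg_isomorphic K (n ^ 2) x y}"

end

theory Submission
  imports Defs "HOL-Computational_Algebra.Computational_Algebra" "HOL-Library.Countable_Set"
    "HOL-Analysis.Continuum_Not_Denumerable" "HOL-Analysis.Complex_Transcendental" "Jordan_Normal_Form.Char_Poly"
begin

hide_const (open) module.smult Coset.order Divisibility.prime Ring_Hom.ring_hom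

text \<open>
  All fields are countable subfields \<open>M\<close> of the complex numbers with an automorphism \<open>s\<close> of order \<open>p\<close> and
  fixed field \<open>K\<close>, so that \<open>t \<in> K\<close> defines the cyclic algebra \<open>(M, s, t)\<close> of degree \<open>p\<close>. It is a division
  algebra if \<open>t\<close> is not a norm from \<open>M\<close>, and if \<open>(M, s, t)\<close> and \<open>(M, s, t')\<close> are isomorphic then
  \<open>t / t'\<close> is a norm. An extension \<open>K[x]/f\<close> of degree \<open>p\<close> embeds into \<open>(M, s, t)\<close> if \<open>f\<close> has a root in \<open>M\<close> or if
  \<open>t\<close> is a norm from \<open>M[x]/f\<close>. It therefore suffices to find \<open>M\<close> and infinitely many \<open>t\<close> in \<open>K\<close> which become
  norms from every \<open>M[x]/f\<close> while neither they nor their quotients are norms from \<open>M\<close>: all these algebras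
  contain all extensions of degree \<open>p\<close>, so they lie in one genus.

  The field is the union of a tower. New elements \<open>t\<close> are adjoined as indeterminates, and \<open>t\<close> is made a norm
  from \<open>M[x]/f\<close> generically, by passing to the invariants of \<open>M(u\<^sub>i\<^sub>l)\<close> under scaling the generic elements
  \<open>u\<^sub>i = \<Sum>\<^sub>l u\<^sub>i\<^sub>l x\<^sup>l\<close>, with \<open>s u\<^sub>i = u\<^sub>i\<^sub>+\<^sub>1\<close> and \<open>s u\<^sub>p\<^sub>-\<^sub>1 = t u\<^sub>0\<close>. No element of \<open>K\<close> becomes a norm
  in this step: a semi-invariant factor can be cancelled against its images under \<open>s\<close>, which costs powers
  of \<open>t\<^sup>d\<close>, and the degree \<open>d\<close> of a semi-invariant is divisible by \<open>p\<close> because \<open>f\<close> is irreducible.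
\<close>

section \<open>Polynomials over subrings and subfields\<close>

text \<open>Geometrically, the fixed field produced by one norm step is the function field of the
  Weil restriction, from \<open>K[x]/f\<close> to \<open>K\<close>, of the Severi-Brauer variety of
  \<open>(M, s, t)\<close> or its opposite: generic projective coordinates over
  \<open>K[x]/f\<close>, twisted by the shift. Such a field can split only multiples of the
  corestriction of the restricted class, which is \<open>p\<close> times the class of
  \<open>(M, s, t)\<close> and hence trivial; the divisibility of \<open>d\<close> by
  \<open>p\<close> is the elementary form of this fact. Brauer groups are avoided. Only norm
  equations are followed through the tower, and for every \<open>c\<close> in the old fixed field at
  once, because each \<open>t\<close> and all quotients must stay non-norms while later elements are
  treated. All fields are sets inside one type, so complex roots replace splitting fields and
  countability leaves transcendental elements to draw on. A primitive \<open>p\<close>-th root of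
  unity and an eigenvector \<open>v\<close> of \<open>s\<close> are placed in the bottom field. This
  makes \<open>M\<close> a Kummer extension of \<open>K\<close>, and averaging over powers of
  \<open>v\<close> does the work of Skolem-Noether and of Galois descent.\<close>

definition sring :: "'a::comm_ring_1 set \<Rightarrow> bool" where
  "sring S \<longleftrightarrow> 0 \<in> S \<and> 1 \<in> S \<and> (\<forall>a\<in>S. \<forall>b\<in>S. a + b \<in> S \<and> a * b \<in> S \<and> - a \<in> S)"

definition sfield :: "'a::field set \<Rightarrow> bool" where
  "sfield S \<longleftrightarrow> sring S \<and> (\<forall>a\<in>S. inverse a \<in> S)"

lemma sringD:
  assumes "sring S"
  shows "0 \<in> S" "1 \<in> S" "a \<in> S \<Longrightarrow> b \<in> S \<Longrightarrow> a + b \<in> S" "a \<in> S \<Longrightarrow> b \<in> S \<Longrightarrow> a * b \<in> S"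
    "a \<in> S \<Longrightarrow> - a \<in> S" "a \<in> S \<Longrightarrow> b \<in> S \<Longrightarrow> a - b \<in> S"
  using assms unfolding sring_def by (auto simp: diff_conv_add_uminus simp del: add_uminus_conv_diff)

lemma sfieldD:
  assumes "sfield S"
  shows "sring S" "0 \<in> S" "1 \<in> S" "a \<in> S \<Longrightarrow> b \<in> S \<Longrightarrow> a + b \<in> S" "a \<in> S \<Longrightarrow> b \<in> S \<Longrightarrow> a * b \<in> S"
    "a \<in> S \<Longrightarrow> - a \<in> S" "a \<in> S \<Longrightarrow> b \<in> S \<Longrightarrow> a - b \<in> S" "a \<in> S \<Longrightarrow> inverse a \<in> S"
    "a \<in> S \<Longrightarrow> b \<in> S \<Longrightarrow> a / b \<in> S"
  using assms unfolding sfield_def by (auto intro: sringD simp: divide_inverse)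

lemma sring_sum: "sring S \<Longrightarrow> (\<And>i. i \<in> I \<Longrightarrow> f i \<in> S) \<Longrightarrow> sum f I \<in> S"
  by (induction I rule: infinite_finite_induct) (auto intro: sringD)

lemma sring_prod: "sring S \<Longrightarrow> (\<And>i. i \<in> I \<Longrightarrow> f i \<in> S) \<Longrightarrow> prod f I \<in> S"
  by (induction I rule: infinite_finite_induct) (auto intro: sringD)

lemma sring_power: "sring S \<Longrightarrow> a \<in> S \<Longrightarrow> a ^ n \<in> S"
  by (induction n) (auto intro: sringD)

lemma sring_of_nat: "sring S \<Longrightarrow> of_nat n \<in> S"
  by (induction n) (auto intro: sringD)

definition pol :: "'a::zero set \<Rightarrow> 'a poly set" where
  "pol S = {p. \<forall>i. coeff p i \<in> S}"

lemma polI: "(\<And>i. coeff p i \<in> S) \<Longrightarrow> p \<in> pol S"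
  by (simp add: pol_def)

lemma polD: "p \<in> pol S \<Longrightarrow> coeff p i \<in> S"
  by (simp add: pol_def)

lemma pol_mono: "S \<subseteq> T \<Longrightarrow> pol S \<subseteq> pol T"
  by (auto simp: pol_def)

lemma pol_sring:
  assumes S: "sring S"
  shows "sring (pol S)"
proof -
  have "p + q \<in> pol S" if "p \<in> pol S" "q \<in> pol S" for p q
    using that by (auto intro!: sringD(3)[OF S] simp: pol_def)
  moreover have "- p \<in> pol S" if "p \<in> pol S" for p
    using that by (auto intro!: sringD(5)[OF S] simp: pol_def)
  moreover have "p * q \<in> pol S" if pq: "p \<in> pol S" "q \<in> pol S" for p q
  proof (rule polI)
    fix i
    show "coeff (p * q) i \<in> S" unfolding coeff_mult
      by (rule sring_sum[OF S]) (rule sringD(4)[OF S polD[OF pq(1)] polD[OF pq(2)]])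
  qed
  moreover have "0 \<in> pol S" "1 \<in> pol S"
    using sringD(1,2)[OF S] by (auto simp: pol_def one_pCons coeff_pCons split: nat.splits)
  ultimately show ?thesis unfolding sring_def by simp
qed

lemma pol_const [simp]: "0 \<in> S \<Longrightarrow> [:a:] \<in> pol S \<longleftrightarrow> a \<in> S"
  by (auto simp: pol_def coeff_pCons split: nat.splits)

lemma pol_pCons: "0 \<in> S \<Longrightarrow> pCons a p \<in> pol S \<longleftrightarrow> a \<in> S \<and> p \<in> pol S"
  unfolding pol_def by (auto simp: coeff_pCons split: nat.splits)

lemma pol_monom: "0 \<in> S \<Longrightarrow> a \<in> S \<Longrightarrow> monom a n \<in> pol S"
  by (auto simp: pol_def)

lemma pol_smult: "sring S \<Longrightarrow> a \<in> S \<Longrightarrow> p \<in> pol S \<Longrightarrow> smult a p \<in> pol S"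
  by (auto simp: pol_def intro: sringD)

lemma poly_in: "sring S \<Longrightarrow> p \<in> pol S \<Longrightarrow> x \<in> S \<Longrightarrow> poly p x \<in> S"
  by (auto simp: poly_altdef pol_def intro!: sring_sum sringD sring_power)

text \<open>Each elimination step divides by the leading coefficient of \<open>F\<close> only, so
  quotient and remainder, formed in the ambient field, stay over \<open>Q\<close>. Later this serves
  monic divisors over polynomial rings.\<close>

lemma pol_divmod_ring:
  assumes Q: "sring (Q::'a::{field} set)" and F: "F \<in> pol Q" "inverse (lead_coeff F) \<in> Q" and A: "A \<in> pol Q"
  shows "A div F \<in> pol Q \<and> A mod F \<in> pol Q"
  using A
proof (induction "degree A" arbitrary: A rule: less_induct)
  case less
  note R = pol_sring[OF Q]
  show ?case
  proof (cases "F = 0 \<or> degree A < degree F \<or> A = 0")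
    case True
    then show ?thesis using less.prems sringD(1)[OF R]
      by (auto simp: div_poly_less mod_poly_less)
  next
    case False
    then have F0: "F \<noteq> 0" and A0: "A \<noteq> 0" and d: "degree F \<le> degree A" by auto
    define c where "c = lead_coeff A / lead_coeff F"
    define H where "H = monom c (degree A - degree F)"
    define B where "B = A - H * F"
    have c: "c \<in> Q" "c \<noteq> 0" unfolding c_def divide_inverse using F0 A0
      by (auto intro: sringD(4)[OF Q polD[OF less.prems] F(2)])
    have H: "H \<in> pol Q" unfolding H_def by (intro pol_monom) (auto intro: sringD[OF Q] c)
    have B: "B \<in> pol Q" unfolding B_def by (intro sringD[OF R] H F(1) less.prems)
    have H0: "H \<noteq> 0" "degree H = degree A - degree F" "lead_coeff H = c"
      using c unfolding H_def by (auto simp: degree_monom_eq)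
    then have dH: "degree (H * F) = degree A" "lead_coeff (H * F) = lead_coeff A"
      using d F0 unfolding lead_coeff_mult by (auto simp: degree_mult_eq c_def)
    have IH: "B div F \<in> pol Q \<and> B mod F \<in> pol Q"
    \<comment> \<open>In degree zero the degree of the difference cannot drop, so the difference is
      shown to vanish instead of being passed to the induction.\<close>
    proof (cases "degree A = 0")
      case True
      then have "degree B = 0" "coeff B 0 = 0" unfolding B_def using dH 
        by (auto simp: degree_diff_le) (metis degree_diff_le le_0_eq order_refl)
      then have "B = 0" by (metis leading_coeff_0_iff)
      then show ?thesis using sringD(1)[OF R] by simp
    next
      case False
      have "degree B \<le> degree A" unfolding B_def using dH by (simp add: degree_diff_le)
      moreover have "coeff B (degree A) = 0" unfolding B_def using dH by simp
      ultimately have "degree B < degree A"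
        using False by (metis eq_zero_or_degree_less gr0I degree_0)
      then show ?thesis using less.hyps B by blast
    qed
    have "A div F = H + B div F" "A mod F = B mod F"
      unfolding B_def using F0 by (auto simp: poly_div_diff_left poly_mod_diff_left)
    then show ?thesis using IH H sringD(3)[OF R] by auto
  qed
qed

lemma pol_divmod:
  assumes Q: "sfield (Q::'a::{field} set)" and F: "F \<in> pol Q" and A: "A \<in> pol Q"
  shows "A div F \<in> pol Q \<and> A mod F \<in> pol Q"
  using pol_divmod_ring[OF sfieldD(1)[OF Q] F sfieldD(8)[OF Q polD[OF F]] A] .

text \<open>Factors are restricted to \<open>pol Q\<close> because over the complex numbers every
  polynomial of degree above one factors.\<close>

definition irr :: "'a::field set \<Rightarrow> 'a poly \<Rightarrow> bool" where
  "irr Q f \<longleftrightarrow> f \<in> pol Q \<and> degree f > 0 \<and> (\<forall>g\<in>pol Q. g dvd f \<longrightarrow> degree g = 0 \<or> degree g = degree f)"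

lemma irrD:
  assumes "irr Q f"
  shows "f \<in> pol Q" "degree f > 0" "f \<noteq> 0"
    "g \<in> pol Q \<Longrightarrow> g dvd f \<Longrightarrow> degree g \<noteq> 0 \<Longrightarrow> degree g = degree f"
  using assms unfolding irr_def by auto

lemma irr_mono: "irr Q f \<Longrightarrow> f \<in> pol P \<Longrightarrow> P \<subseteq> Q \<Longrightarrow> irr P f"
  unfolding irr_def using pol_mono by blast

text \<open>A polynomial \<open>H\<close> over \<open>Q\<close> of least degree vanishing at
  \<open>r\<close> divides all others by division with remainder. It divides \<open>F\<close>, hence
  has the degree of \<open>F\<close>, so \<open>F\<close> and \<open>H\<close> are associates. A
  common root in the ambient field thus replaces a gcd computation over \<open>Q\<close>.\<close>

lemma irr_dvd:
  fixes F G :: "'a::{field} poly"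
  assumes Q: "sfield Q" and F: "irr Q F" and G: "G \<in> pol Q" and r: "poly F r = 0" "poly G r = 0"
  shows "F dvd G"
proof -
  let ?P = "\<lambda>n. \<exists>H. H \<in> pol Q \<and> H \<noteq> 0 \<and> poly H r = 0 \<and> degree H = n"
  have ex: "?P (degree F)" using F r unfolding irr_def by auto
  define m where "m = (LEAST n. ?P n)"
  have "?P m" unfolding m_def using ex by (rule LeastI)
  then obtain H where H: "H \<in> pol Q" "H \<noteq> 0" "poly H r = 0" "degree H = m" by blast
  have dv: "H dvd A" if A: "A \<in> pol Q" "poly A r = 0" for A
  proof (rule ccontr)
    assume "\<not> H dvd A"
    then have nz: "A mod H \<noteq> 0" by (simp add: mod_eq_0_iff_dvd)
    have "poly (A mod H) r = 0" using A H(3) by (simp add: minus_div_mult_eq_mod[symmetric])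
    moreover have "A mod H \<in> pol Q" using pol_divmod[OF Q H(1) A(1)] by blast
    ultimately have "m \<le> degree (A mod H)" unfolding m_def by (intro Least_le) (use nz in auto)
    moreover have "degree (A mod H) < degree H" using degree_mod_less'[OF H(2) nz] .
    ultimately show False using H(4) by simp
  qed
  have HF: "H dvd F" using dv F r unfolding irr_def by blast
  have "degree H \<noteq> 0"
  proof
    assume "degree H = 0"
    then obtain a where "H = [:a:]" by (rule degree_eq_zeroE)
    then show False using H(2,3) by simp
  qed
  then have "degree H = degree F" by (rule irrD(4)[OF F H(1) HF])
  moreover have "F \<noteq> 0" using F unfolding irr_def by auto
  moreover obtain k where k: "F = H * k" using HF by (elim dvdE)
  ultimately have "k \<noteq> 0" "degree k = 0" by (auto simp: degree_mult_eq)
  then have "is_unit k" by (simp add: is_unit_iff_degree)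
  then have "F dvd H" unfolding k by (simp add: mult_unit_dvd_iff)
  then show ?thesis using dv[OF G r(2)] by (rule dvd_trans)
qed

text \<open>Primality is read off at a complex root of \<open>F\<close>, which must be a root of one
  of the factors; \<open>irr_dvd\<close> turns this back into divisibility.\<close>

lemma irr_prime:
  fixes F :: "complex poly"
  assumes Q: "sfield Q" and F: "irr Q F" and AB: "A \<in> pol Q" "B \<in> pol Q" "F dvd A * B"
  shows "F dvd A \<or> F dvd B"
proof -
  have "degree F \<noteq> 0" using F unfolding irr_def by simp
  then obtain r where r: "poly F r = 0"
    using fundamental_theorem_of_algebra constant_degree by metis
  obtain k where "A * B = F * k" using AB(3) by (elim dvdE)
  then have "poly (A * B) r = 0" using r by simp
  then have "poly A r = 0 \<or> poly B r = 0" by simp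
  then show ?thesis using irr_dvd[OF Q F _ r] AB by auto
qed

lemma pol_quot:
  assumes Q: "sfield Q" and F: "F \<in> pol Q" and A: "A \<in> pol Q" and d: "A = F * B" and F0: "F \<noteq> 0"
  shows "B \<in> pol Q"
  using pol_divmod[OF Q F A] F0 d by simp

lemma irr_root_degree:
  fixes A :: "'a::field poly"
  assumes Q: "sfield Q" and F: "irr Q F" and A: "A \<in> pol Q" "degree A < degree F"
    and r: "poly F r = 0" "poly A r = 0"
  shows "A = 0"
  using irr_dvd[OF Q F A(1) r] A(2) dvd_imp_degree_le by (metis leD)

text \<open>As long as \<open>G\<close> is not constant, \<open>irr_dvd\<close> splits off a factor
  \<open>F\<close>, and the quotient still has only roots of \<open>F\<close>; so \<open>G\<close>
  is a constant times a power of \<open>F\<close>.\<close>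

lemma irr_power_degree:
  fixes F G :: "complex poly"
  assumes Q: "sfield Q" and F: "irr Q F" and G: "G \<in> pol Q" "G \<noteq> 0"
    and r: "\<And>r. poly G r = 0 \<Longrightarrow> poly F r = 0"
  shows "degree F dvd degree G"
  using G r
proof (induction "degree G" arbitrary: G rule: less_induct)
  case less
  show ?case
  proof (cases "degree G = 0")
    case False
    then obtain r where r: "poly G r = 0"
      using fundamental_theorem_of_algebra constant_degree by metis
    then have "F dvd G" using irr_dvd[OF Q F less.prems(1) less.prems(3)] by blast
    then obtain H where H: "G = F * H" by (elim dvdE)
    have F': "F \<noteq> 0" "degree F > 0" "F \<in> pol Q" using F unfolding irr_def by auto
    have H': "H \<in> pol Q" by (rule pol_quot[OF Q F'(3) less.prems(1) H F'(1)])
    have d: "degree G = degree F + degree H" using H less.prems(2) by (simp add: degree_mult_eq)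
    have "degree F dvd degree H"
      by (rule less.hyps) (use d F' H H' less.prems in auto)
    then show ?thesis using d by simp
  qed simp
qed

text \<open>Newton interpolation: after subtracting the value at \<open>N\<close>, the quotient by
  \<open>x - N\<close> takes values in \<open>Q\<close> at all larger integers. Hence the starting
  point \<open>N\<close> varies in the induction.\<close>

lemma pol_interpolate:
  fixes G :: "complex poly"
  assumes Q: "sfield Q" and v: "\<And>n. n \<ge> N \<Longrightarrow> poly G (of_nat n) \<in> Q"
  shows "G \<in> pol Q"
  using v
proof (induction "degree G" arbitrary: G N rule: less_induct)
  case less
  note S = sfieldD(1)[OF Q]
  show ?case
  proof (cases "degree G = 0")
    case True
    then obtain a where "G = [:a:]" using degree_eq_zeroE by blast
    then show ?thesis using less.prems[of N] sfieldD(2)[OF Q] by simp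
  next
    case False
    define a where "a = poly G (of_nat N)"
    have a: "a \<in> Q" unfolding a_def using less.prems by simp
    have "poly (G - [:a:]) (of_nat N) = 0" by (simp add: a_def)
    then obtain H where H: "G - [:a:] = [:- of_nat N, 1:] * H" using poly_eq_0_iff_dvd by (metis dvdE)
    have G: "G = [:- of_nat N, 1:] * H + [:a:]" using H by (metis diff_add_cancel)
    have H0: "H \<noteq> 0" using G False by auto
    have "degree G = degree ([:- of_nat N, 1:] * H)"
      unfolding G by (rule degree_add_eq_left) (use H0 in \<open>simp add: degree_mult_eq del: mult_pCons_left\<close>)
    then have d: "degree G = Suc (degree H)" using H0 by (simp add: degree_mult_eq del: mult_pCons_left)
    have "H \<in> pol Q"
    proof (rule less.hyps[of _ "Suc N"])
      fix n assume n: "n \<ge> Suc N"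
      have "poly H (of_nat n) = (poly G (of_nat n) - a) / (of_nat n - of_nat N)"
        using n unfolding G by (simp add: field_simps)
      moreover have "of_nat n - of_nat N \<in> Q" "poly G (of_nat n) \<in> Q"
        using n less.prems[of n] by (auto intro!: sfieldD[OF Q] sring_of_nat S)
      ultimately show "poly H (of_nat n) \<in> Q" using a by (auto intro!: sfieldD[OF Q])
    qed (use d in simp)
    then show ?thesis unfolding G
      using a sring_of_nat[OF S] sfieldD(2,3,6)[OF Q] sringD(1)[OF pol_sring[OF S]]
      by (intro sringD(3,4)[OF pol_sring[OF S]]) (auto simp: pol_pCons)
  qed
qed

text \<open>Gaussian elimination with a pivot \<open>j\<close> for the last coordinate. This is the
  dimension count used later, each time for \<open>p + 1\<close> vectors with \<open>p\<close>
  coordinates.\<close>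

lemma dependent_vectors:
  fixes x :: "nat \<Rightarrow> nat \<Rightarrow> 'a::field"
  assumes Q: "sfield Q" and x: "\<And>i k. i \<le> n \<Longrightarrow> k < n \<Longrightarrow> x i k \<in> Q"
  shows "\<exists>a. (\<forall>i\<le>n. a i \<in> Q) \<and> (\<exists>i\<le>n. a i \<noteq> 0) \<and> (\<forall>k<n. (\<Sum>i\<le>n. a i * x i k) = 0)"
  using x
proof (induction n arbitrary: x)
  case 0
  show ?case by (rule exI[of _ "\<lambda>_. 1"]) (auto intro: sfieldD[OF Q])
next
  case (Suc n)
  show ?case
  proof (cases "\<forall>i\<le>Suc n. x i n = 0")
    case True
    obtain a where a: "\<forall>i\<le>n. a i \<in> Q" "\<exists>i\<le>n. a i \<noteq> 0" "\<forall>k<n. (\<Sum>i\<le>n. a i * x i k) = 0"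
    proof -
      have xQ: "x i k \<in> Q" if "i \<le> n" "k < n" for i k using that by (intro Suc.prems) auto
      show thesis using Suc.IH[of x, OF xQ] that by blast
    qed
    have s: "(\<Sum>i\<le>Suc n. (if i \<le> n then a i else 0) * x i k) = (\<Sum>i\<le>n. a i * x i k)" for k
      by (simp add: atMost_Suc)
    have "(\<Sum>i\<le>Suc n. (if i \<le> n then a i else 0) * x i k) = 0" if "k < Suc n" for k
    proof (cases "k = n")
      case True
      then show ?thesis using \<open>\<forall>i\<le>Suc n. x i n = 0\<close> by (auto intro: sum.neutral)
    qed (use a(3) s that in auto)
    moreover have "\<exists>i\<le>Suc n. (if i \<le> n then a i else 0) \<noteq> 0" using a(2) by (auto intro: le_SucI)
    moreover have "\<forall>i\<le>Suc n. (if i \<le> n then a i else 0) \<in> Q" using a(1) sfieldD(2)[OF Q] by auto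
    ultimately show ?thesis by (intro exI[of _ "\<lambda>i. if i \<le> n then a i else 0"]) blast
  next
    case False
    then obtain j where j: "j \<le> Suc n" "x j n \<noteq> 0" by blast
    \<comment> \<open>\<open>r\<close> lists the indices other than the pivot in increasing order;
      \<open>s\<close> below is its left inverse.\<close>
    define r where "r i = (if i < j then i else Suc i)" for i
    have inj: "inj_on r A" for A by (auto simp: inj_on_def r_def split: if_splits)
    have img: "r ` {..n} = {..Suc n} - {j}"
    proof
      show "r ` {..n} \<subseteq> {..Suc n} - {j}" using j by (auto simp: r_def)
      show "{..Suc n} - {j} \<subseteq> r ` {..n}"
      proof
        fix i assume i: "i \<in> {..Suc n} - {j}"
        show "i \<in> r ` {..n}"
        proof (cases "i < j")
          case True then show ?thesis using j by (intro image_eqI[of _ _ i]) (auto simp: r_def)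
        next
          case False then show ?thesis using i by (intro image_eqI[of _ _ "i - 1"]) (auto simp: r_def)
        qed
      qed
    qed
    define y where "y i k = x (r i) k - x (r i) n / x j n * x j k" for i k
    have rle: "r i \<le> Suc n" if "i \<le> n" for i using img that by auto
    have y: "y i k \<in> Q" if "i \<le> n" "k < n" for i k unfolding y_def
      using that rle[OF that(1)] j Suc.prems by (auto intro!: sfieldD[OF Q])
    obtain b where b: "\<forall>i\<le>n. b i \<in> Q" "\<exists>i\<le>n. b i \<noteq> 0" "\<forall>k<n. (\<Sum>i\<le>n. b i * y i k) = 0"
      using Suc.IH[of y] y by auto
    define s where "s i = (if i < j then i else i - 1)" for i
    have sr: "s (r i) = i" for i by (auto simp: s_def r_def)
    define a where "a i = (if i = j then - (\<Sum>i\<le>n. b i * x (r i) n / x j n) else b (s i))" for i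
    have ar: "a (r i) = b i" for i using sr by (auto simp: a_def r_def)
    have S: "(\<Sum>i\<le>Suc n. a i * x i k) = a j * x j k + (\<Sum>i\<le>n. b i * x (r i) k)" for k
    proof -
      have "(\<Sum>i\<le>Suc n. a i * x i k) = a j * x j k + (\<Sum>i\<in>{..Suc n} - {j}. a i * x i k)"
        using j by (intro sum.remove) auto
      also have "(\<Sum>i\<in>{..Suc n} - {j}. a i * x i k) = (\<Sum>i\<le>n. b i * x (r i) k)"
        unfolding img[symmetric] by (subst sum.reindex[OF inj]) (simp add: ar)
      finally show ?thesis .
    qed
    have "(\<Sum>i\<le>Suc n. a i * x i k) = 0" if k: "k < Suc n" for k
    proof -
      have "(\<Sum>i\<le>Suc n. a i * x i k) = (\<Sum>i\<le>n. b i * y i k)"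
      proof -
        have "a j = - (\<Sum>i\<le>n. b i * x (r i) n / x j n)" by (simp add: a_def)
        then have "a j * x j k = - (\<Sum>i\<le>n. b i * (x (r i) n / x j n * x j k))"
          by (simp add: sum_distrib_right mult.assoc)
        then show ?thesis unfolding S y_def by (simp add: sum_subtractf right_diff_distrib)
      qed
      moreover have "(\<Sum>i\<le>n. b i * y i k) = 0"
      proof (cases "k = n")
        case True then show ?thesis using j by (simp add: y_def)
      qed (use b k in auto)
      ultimately show ?thesis by simp
    qed
    moreover have "a i \<in> Q" if i: "i \<le> Suc n" for i
    proof (cases "i = j")
      case True
      have "(\<Sum>i\<le>n. b i * x (r i) n / x j n) \<in> Q"
        using b(1) j rle Suc.prems by (auto intro!: sring_sum[OF sfieldD(1)[OF Q]] sfieldD[OF Q])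
      then show ?thesis using True by (auto simp: a_def intro: sfieldD[OF Q])
    next
      case False
      then have "i \<in> r ` {..n}" using img i by auto
      then show ?thesis using ar b(1) by auto
    qed
    moreover have "\<exists>i\<le>Suc n. a i \<noteq> 0" using b(2) ar rle by metis
    ultimately show ?thesis by blast
  qed
qed

section \<open>Factorial subrings\<close>

text \<open>In an ambient field divisibility is trivial, so cofactors, units and primes are taken
  inside \<open>S\<close>.\<close>

definition sdvd :: "'a::comm_ring_1 set \<Rightarrow> 'a \<Rightarrow> 'a \<Rightarrow> bool" where
  "sdvd S a b \<longleftrightarrow> (\<exists>c\<in>S. b = a * c)"

definition sunit :: "'a::comm_ring_1 set \<Rightarrow> 'a \<Rightarrow> bool" where
  "sunit S a \<longleftrightarrow> a \<in> S \<and> (\<exists>b\<in>S. a * b = 1)"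

definition sprime :: "'a::comm_ring_1 set \<Rightarrow> 'a \<Rightarrow> bool" where
  "sprime S P \<longleftrightarrow> P \<in> S \<and> P \<noteq> 0 \<and> \<not> sunit S P \<and>
     (\<forall>a\<in>S. \<forall>b\<in>S. sdvd S P (a * b) \<longrightarrow> sdvd S P a \<or> sdvd S P b)"

text \<open>The number of prime factors is kept as an index: \<open>pfac_div\<close> lowers it by
  one and \<open>content\<close> recurses on it. Factoring into primes rather than irreducible
  elements makes factorizations essentially unique.\<close>

inductive pfac :: "'a::comm_ring_1 set \<Rightarrow> nat \<Rightarrow> 'a \<Rightarrow> bool" for S where
  unit: "sunit S u \<Longrightarrow> pfac S 0 u"
| prime: "sprime S P \<Longrightarrow> pfac S n a \<Longrightarrow> pfac S (Suc n) (P * a)"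

definition factorial :: "'a::comm_ring_1 set \<Rightarrow> bool" where
  "factorial S \<longleftrightarrow> sring S \<and> (\<forall>a\<in>S. a \<noteq> 0 \<longrightarrow> (\<exists>n. pfac S n a))"

lemma sdvdI: "b = a * c \<Longrightarrow> c \<in> S \<Longrightarrow> sdvd S a b"
  unfolding sdvd_def by blast

lemma sdvdE: "sdvd S a b \<Longrightarrow> (\<And>c. b = a * c \<Longrightarrow> c \<in> S \<Longrightarrow> thesis) \<Longrightarrow> thesis"
  unfolding sdvd_def by blast

lemma sdvd_mult: "sring S \<Longrightarrow> sdvd S a b \<Longrightarrow> c \<in> S \<Longrightarrow> sdvd S a (b * c)"
  by (elim sdvdE, rule sdvdI[of _ _ "_ * c"]) (auto intro: sringD(4) simp: mult.assoc)

lemma sdvd_mult2: "sring S \<Longrightarrow> sdvd S a b \<Longrightarrow> c \<in> S \<Longrightarrow> sdvd S a (c * b)"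
  using sdvd_mult[of S a b c] by (simp add: mult.commute)

lemma sdvd_trans: "sring S \<Longrightarrow> sdvd S a b \<Longrightarrow> sdvd S b c \<Longrightarrow> sdvd S a c"
  by (metis sdvd_mult sdvd_def)

lemma sdvd_refl: "sring S \<Longrightarrow> sdvd S a a"
  by (rule sdvdI[of _ _ 1]) (auto intro: sringD)

lemma sdvd_sum: "sring S \<Longrightarrow> (\<And>i. i \<in> I \<Longrightarrow> sdvd S a (f i)) \<Longrightarrow> sdvd S a (sum f I)"
proof (induction I rule: infinite_finite_induct)
  case (insert x F)
  then have "sdvd S a (f x)" "sdvd S a (sum f F)" by auto
  then show ?case using insert(1,2)
    by (elim sdvdE) (auto intro!: sdvdI[of _ _ "_ + _"] sringD(3)[OF insert(4)] simp: distrib_left)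
qed (auto intro!: sdvdI[of _ _ 0] sringD(1))

lemma sdvd_diff: "sring S \<Longrightarrow> sdvd S a b \<Longrightarrow> sdvd S a c \<Longrightarrow> sdvd S a (b - c)"
  by (elim sdvdE, rule sdvdI[of _ _ "_ - _"]) (auto intro: sringD(6) simp: right_diff_distrib)

lemma sprimeD:
  assumes "sprime S P"
  shows "P \<in> S" "P \<noteq> 0" "\<not> sunit S P"
    "a \<in> S \<Longrightarrow> b \<in> S \<Longrightarrow> sdvd S P (a * b) \<Longrightarrow> sdvd S P a \<or> sdvd S P b"
  using assms unfolding sprime_def by auto

lemma sunit_mult: "sring S \<Longrightarrow> sunit S a \<Longrightarrow> sunit S b \<Longrightarrow> sunit S (a * b)"
  unfolding sunit_def by (metis (no_types, lifting) sringD(4) mult.assoc mult.commute mult_1)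

lemma sdvd_sunit: "sring S \<Longrightarrow> a \<in> S \<Longrightarrow> sdvd S a u \<Longrightarrow> sunit S u \<Longrightarrow> sunit S a"
  unfolding sunit_def sdvd_def by (metis mult.assoc sringD(4))

lemma sunit_sdvd: "sring S \<Longrightarrow> sunit S u \<Longrightarrow> a \<in> S \<Longrightarrow> sdvd S u a"
  unfolding sunit_def sdvd_def by (metis (no_types, lifting) sringD(4) mult.assoc mult_1)

lemma pfac_in:
  fixes S :: "'a::idom set"
  assumes "sring S" "pfac S n a"
  shows "a \<in> S" "a \<noteq> 0"
  using assms(2) by (induction) (auto simp: sunit_def dest: sprimeD intro: sringD(4)[OF assms(1)])

lemma pfac_unit: 
  assumes S: "sring S" and a: "pfac S n a" and c: "sunit S c"
  shows "pfac S n (c * a)"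
  using a
proof (induction)
  case (unit u)
  then show ?case using sunit_mult[OF S c] by (auto intro: pfac.unit)
next
  case (prime P n a)
  then have "pfac S (Suc n) (P * (c * a))" by (intro pfac.prime)
  then show ?case by (simp add: mult.left_commute)
qed

lemma pfac_mult: 
  assumes S: "sring S" and a: "pfac S n a" and b: "pfac S m b"
  shows "pfac S (n + m) (a * b)"
  using a
proof (induction)
  case (unit u)
  then show ?case using pfac_unit[OF S b] by simp
next
  case (prime P n a)
  then show ?case using pfac.prime by (fastforce simp: mult.assoc)
qed

text \<open>If \<open>P\<close> divides the first prime \<open>Q\<close>, the two differ by a unit,
  which is absorbed into the remaining factors; otherwise \<open>P\<close> divides the remaining
  product and the induction applies.\<close>

lemma pfac_div:
  fixes S :: "'a::idom set"
  assumes S: "sring S" and a: "pfac S n a" and P: "sprime S P" and b: "a = P * b" "b \<in> S"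
  shows "\<exists>m. n = Suc m \<and> pfac S m b"
  using a b
proof (induction arbitrary: b)
  case (unit u)
  then show ?case using sdvd_sunit[OF S sprimeD(1)[OF P], of u] sprimeD(3)[OF P]
    by (auto simp: sdvd_def)
next
  case (prime Q n a)
  note Q = sprimeD[OF prime.hyps(1)] and Pp = sprimeD[OF P]
  note aS = pfac_in[OF S prime.hyps(2)]
  have "sdvd S P (Q * a)" using prime.prems by (auto simp: sdvd_def)
  then consider "sdvd S P Q" | "sdvd S P a" using Pp(4) Q(1) aS by blast
  then show ?case
  proof cases
    case 1
    then obtain c where c: "Q = P * c" "c \<in> S" by (rule sdvdE)
    have "\<not> sdvd S Q c"
    proof
      assume "sdvd S Q c"
      then obtain d where d: "c = Q * d" "d \<in> S" by (rule sdvdE)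
      then have "Q * 1 = Q * (P * d)" using c by (simp add: ac_simps)
      then have "P * d = 1" using Q(2) by (metis mult_left_cancel)
      then show False using Pp(1,3) d(2) unfolding sunit_def by blast
    qed
    then have "sdvd S Q P" using Q(4)[OF Pp(1) c(2)] sdvd_refl[OF S, of Q] c(1) by auto
    then obtain e where e: "P = Q * e" "e \<in> S" by (rule sdvdE)
    have "Q * 1 = Q * (c * e)" using c(1) e(1) by (metis mult.assoc mult.commute mult.right_neutral)
    then have ce: "c * e = 1" using Q(2) by (metis mult_left_cancel)
    have "Q * a = Q * (e * b)" using prime.prems e by (simp add: ac_simps)
    then have "a = e * b" using Q(2) by simp
    then have "b = c * a" using ce by (simp add: mult.assoc[symmetric])
    moreover have "sunit S c" using ce c e unfolding sunit_def by blast
    ultimately show ?thesis using pfac_unit[OF S prime.hyps(2)] by blast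
  next
    case 2
    then obtain d where d: "a = P * d" "d \<in> S" by (rule sdvdE)
    then obtain m where m: "n = Suc m" "pfac S m d" using prime.IH by blast
    have "P * (Q * d) = P * b" using prime.prems d by (simp add: ac_simps)
    then have "b = Q * d" using Pp(2) by simp
    then show ?thesis using m pfac.prime[OF prime.hyps(1) m(2)] by blast
  qed
qed

text \<open>Recursion over the primes of \<open>a\<close>: a prime that divides \<open>b\<close> as
  well is taken into the gcd and cancelled from both, any other prime is dropped.\<close>

lemma factorial_gcd:
  fixes S :: "'a::idom set"
  assumes S: "factorial S" and a: "a \<in> S" "a \<noteq> 0" and b: "b \<in> S"
  shows "\<exists>g\<in>S. sdvd S g a \<and> sdvd S g b \<and> (\<forall>d\<in>S. sdvd S d a \<longrightarrow> sdvd S d b \<longrightarrow> sdvd S d g)"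
proof -
  have R: "sring S" using S unfolding factorial_def by blast
  obtain n where "pfac S n a" using S a unfolding factorial_def by blast
  then show ?thesis using b
  proof (induction arbitrary: b)
    case (unit u)
    have "sdvd S d 1" if "d \<in> S" "sdvd S d u" for d
      using sdvd_sunit[OF R that unit(1)] by (auto simp: sunit_def sdvd_def)
    then show ?case using unit(1,2)
      by (intro bexI[of _ 1]) (auto intro: sringD[OF R] sdvdI[of _ 1] simp: sunit_def)
  next
    case (prime P n a)
    note P = sprimeD[OF prime.hyps(1)]
    note aS = pfac_in[OF R prime.hyps(2)]
    show ?case
    proof (cases "sdvd S P b")
      case True
      then obtain b' where b': "b = P * b'" "b' \<in> S" by (rule sdvdE)
      obtain g where g: "g \<in> S" "sdvd S g a" "sdvd S g b'" "\<And>d. d \<in> S \<Longrightarrow> sdvd S d a \<Longrightarrow> sdvd S d b' \<Longrightarrow> sdvd S d g"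
        using prime.IH[OF b'(2)] by blast
      have "sdvd S d (P * g)" if d: "d \<in> S" "sdvd S d (P * a)" "sdvd S d b" for d
      proof (cases "sdvd S P d")
        case True
        then obtain d' where d': "d = P * d'" "d' \<in> S" by (rule sdvdE)
        have "sdvd S d' a" "sdvd S d' b'" using d(2,3) P(2) unfolding d'(1) b' by (auto simp: sdvd_def mult.assoc)
        then have "sdvd S d' g" using g(4) d' by blast
        then show ?thesis unfolding d' by (auto simp: sdvd_def mult.assoc)
      next
        case False
        have cancel: "sdvd S d x" if x: "x \<in> S" "sdvd S d (P * x)" for x
        proof -
          obtain e where e: "P * x = d * e" "e \<in> S" using x(2) by (rule sdvdE)
          have "sdvd S P (d * e)" by (rule sdvdI[OF e(1)[symmetric] x(1)])
          then have "sdvd S P e" using P(4)[OF d(1) e(2)] False by blast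
          then obtain k where k: "e = P * k" "k \<in> S" by (rule sdvdE)
          have "P * x = P * (d * k)" using e k by (simp add: ac_simps)
          then show ?thesis using P(2) k by (auto simp: sdvd_def)
        qed
        have "sdvd S d g" using g(4)[OF d(1)] cancel[OF aS(1)] cancel[OF b'(2)] d(2,3) b'(1) by blast
        then show ?thesis using sdvd_mult2[OF R _ P(1)] by blast
      qed
      moreover have "sdvd S (P * g) (P * a)" "sdvd S (P * g) b" "P * g \<in> S" using g b' P(1)
        by (auto simp: sdvd_def mult.assoc intro: sringD(4)[OF R])
      ultimately show ?thesis by blast
    next
      case False
      obtain g where g: "g \<in> S" "sdvd S g a" "sdvd S g b" "\<And>d. d \<in> S \<Longrightarrow> sdvd S d a \<Longrightarrow> sdvd S d b \<Longrightarrow> sdvd S d g"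
        using prime.IH[OF prime.prems] by blast
      have "sdvd S d g" if d: "d \<in> S" "sdvd S d (P * a)" "sdvd S d b" for d
      proof -
        obtain e where e: "P * a = d * e" "e \<in> S" using d(2) by (rule sdvdE)
        have "sdvd S P (d * e)" by (rule sdvdI[OF e(1)[symmetric] aS(1)])
        moreover have "\<not> sdvd S P d" using False sdvd_trans[OF R _ d(3)] by blast
        ultimately have "sdvd S P e" using P(4)[OF d(1) e(2)] by blast
        then obtain k where k: "e = P * k" "k \<in> S" by (rule sdvdE)
        have "P * a = P * (d * k)" using e k by (simp add: ac_simps)
        then have "sdvd S d a" using P(2) k by (auto simp: sdvd_def)
        then show ?thesis using g(4) d by blast
      qed
      then show ?thesis using g sdvd_mult2[OF R g(2) P(1)] by blast
    qed
  qed
qed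

text \<open>The primes of \<open>a\<close> are removed one at a time: none divides \<open>b\<close>,
  so each divides \<open>y\<close>.\<close>

lemma coprime_cancel:
  fixes S :: "'a::idom set"
  assumes S: "factorial S" and a: "a \<in> S" "a \<noteq> 0" and b: "b \<in> S" and y: "y \<in> S"
    and cop: "\<And>d. d \<in> S \<Longrightarrow> sdvd S d a \<Longrightarrow> sdvd S d b \<Longrightarrow> sunit S d"
    and dv: "sdvd S a (b * y)"
  shows "sdvd S a y"
proof -
  have R: "sring S" using S unfolding factorial_def by blast
  obtain n where "pfac S n a" using S a unfolding factorial_def by blast
  then show ?thesis using cop dv y
  proof (induction arbitrary: y)
    case (unit u)
    then show ?case using sunit_sdvd[OF R] by blast
  next
    case (prime P n a)
    note P = sprimeD[OF prime.hyps(1)]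
    note aS = pfac_in[OF R prime.hyps(2)]
    have "\<not> sdvd S P b" using prime.prems(1)[OF P(1)] P(3) aS by (auto simp: sdvd_def)
    moreover have "sdvd S P (b * y)" using sdvd_trans[OF R _ prime.prems(2), of P] aS by (auto simp: sdvd_def)
    ultimately have "sdvd S P y" using P(4) b prime.prems(3) by blast
    then obtain y' where y': "y = P * y'" "y' \<in> S" by (rule sdvdE)
    have "sdvd S a (b * y')"
    proof -
      obtain e where e: "b * y = P * a * e" "e \<in> S" using prime.prems(2) by (rule sdvdE)
      then have "P * (b * y') = P * (a * e)" using y' by (simp add: ac_simps)
      then show ?thesis using P(2) e by (auto simp: sdvd_def)
    qed
    then have "sdvd S a y'" using prime.IH[OF _ _ y'(2)] prime.prems(1) sdvd_mult2[OF R _ P(1)] by blast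
    then show ?case unfolding y' by (auto simp: sdvd_def mult.assoc)
  qed
qed

lemma factorial_reduce:
  fixes S :: "'a::idom set"
  assumes S: "factorial S" and A: "A \<in> S" "A \<noteq> 0" and B: "B \<in> S"
  shows "\<exists>g a b. g \<in> S \<and> a \<in> S \<and> b \<in> S \<and> A = g * a \<and> B = g * b \<and>
    (\<forall>d\<in>S. sdvd S d a \<longrightarrow> sdvd S d b \<longrightarrow> sunit S d)"
proof -
  have R: "sring S" using S unfolding factorial_def by blast
  obtain g where g: "g \<in> S" "sdvd S g A" "sdvd S g B" "\<And>d. d \<in> S \<Longrightarrow> sdvd S d A \<Longrightarrow> sdvd S d B \<Longrightarrow> sdvd S d g"
    using factorial_gcd[OF S A B] by blast
  obtain a where a: "A = g * a" "a \<in> S" using g(2) by (rule sdvdE)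
  obtain b where b: "B = g * b" "b \<in> S" using g(3) by (rule sdvdE)
  have "sunit S d" if d: "d \<in> S" "sdvd S d a" "sdvd S d b" for d
  proof -
    have "sdvd S (g * d) A" "sdvd S (g * d) B" using d a b by (auto simp: sdvd_def mult.assoc)
    then have "sdvd S (g * d) g" using g(4) sringD(4)[OF R g(1) d(1)] by blast
    then obtain e where e: "g = g * d * e" "e \<in> S" by (rule sdvdE)
    then have "g * 1 = g * (d * e)" by (simp add: mult.assoc)
    then have "d * e = 1" using A a by (metis mult_eq_0_iff mult_left_cancel)
    then show ?thesis using d(1) e(2) unfolding sunit_def by blast
  qed
  then show ?thesis using g a b by blast
qed

lemma factorial_field: "sfield M \<Longrightarrow> factorial M"
proof -
  assume M: "sfield M"
  have "sunit M a" if "a \<in> M" "a \<noteq> 0" for a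
    unfolding sunit_def using that sfieldD(8)[OF M that(1)] by (auto intro!: bexI[of _ "inverse a"])
  then show ?thesis unfolding factorial_def using sfieldD(1)[OF M] pfac.unit by blast
qed

text \<open>Evaluation at a transcendental \<open>v\<close> identifies \<open>pol S\<close> with
  \<open>adj S v\<close>; this lemma carries \<open>factorial_pol\<close> over to the generated
  ring.\<close>

lemma factorial_image:
  fixes S :: "'a::idom set" and h :: "'a \<Rightarrow> 'b::idom"
  assumes S: "factorial S" and inj: "inj_on h S" and h1: "h 1 = 1"
    and add: "\<And>a b. a \<in> S \<Longrightarrow> b \<in> S \<Longrightarrow> h (a + b) = h a + h b"
    and mult: "\<And>a b. a \<in> S \<Longrightarrow> b \<in> S \<Longrightarrow> h (a * b) = h a * h b"
  shows "factorial (h ` S)"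
proof -
  have R: "sring S" using S unfolding factorial_def by blast
  note RD = sringD[OF R]
  have h0: "h 0 = 0" using add[OF RD(1) RD(1)] by (metis add_0 add_cancel_right_right)
  have hm: "h (- a) = - h a" if "a \<in> S" for a
    using add[of a "- a"] RD(5) that h0 by (simp add: eq_neg_iff_add_eq_0 add.commute)
  have R': "sring (h ` S)" unfolding sring_def
  proof (intro conjI ballI)
    show "0 \<in> h ` S" using h0 RD(1) by (metis imageI)
    show "1 \<in> h ` S" using h1 RD(2) by (metis imageI)
    fix x y assume "x \<in> h ` S" "y \<in> h ` S"
    then obtain a b where "x = h a" "y = h b" "a \<in> S" "b \<in> S" by blast
    then show "x + y \<in> h ` S" "x * y \<in> h ` S" "- x \<in> h ` S"
      using add[of a b] mult[of a b] hm[of a] RD(3-5) by (metis imageI)+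
  qed
  have eq: "h a = h b \<longleftrightarrow> a = b" if "a \<in> S" "b \<in> S" for a b using inj that by (auto dest: inj_onD)
  have dv: "sdvd (h ` S) (h a) (h b) \<longleftrightarrow> sdvd S a b" if "a \<in> S" "b \<in> S" for a b
  proof
    assume "sdvd (h ` S) (h a) (h b)"
    then obtain c where c: "h b = h a * h c" "c \<in> S" by (auto elim: sdvdE)
    then have "b = a * c" using that mult[OF that(1) c(2)] eq[OF that(2) RD(4)[OF that(1) c(2)]] by simp
    then show "sdvd S a b" using c(2) by (rule sdvdI)
  next
    assume "sdvd S a b"
    then obtain c where c: "b = a * c" "c \<in> S" by (rule sdvdE)
    then show "sdvd (h ` S) (h a) (h b)" using mult[OF that(1) c(2)] by (auto intro: sdvdI)
  qed
  have un: "sunit (h ` S) (h a) \<longleftrightarrow> sunit S a" if "a \<in> S" for a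
  proof
    assume "sunit (h ` S) (h a)"
    then obtain c where c: "h a * h c = h 1" "c \<in> S" using h1 by (auto simp: sunit_def)
    then have "a * c = 1" using that mult[OF that c(2)] eq[OF RD(4)[OF that c(2)] RD(2)] by simp
    then show "sunit S a" using c(2) that by (auto simp: sunit_def)
  next
    assume "sunit S a"
    then obtain c where c: "a * c = 1" "c \<in> S" by (auto simp: sunit_def)
    then show "sunit (h ` S) (h a)" using mult[OF that c(2)] that h1 by (auto simp: sunit_def)
  qed
  have pr: "sprime (h ` S) (h P)" if P: "sprime S P" for P
  proof -
    note P = sprimeD[OF P]
    show ?thesis unfolding sprime_def
    proof (intro conjI ballI impI)
      show "h P \<in> h ` S" "\<not> sunit (h ` S) (h P)" using P un by auto
      show "h P \<noteq> 0" using eq[OF P(1) RD(1)] P(2) h0 by simp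
      fix x y assume xy: "x \<in> h ` S" "y \<in> h ` S" "sdvd (h ` S) (h P) (x * y)"
      then obtain a b where ab: "x = h a" "y = h b" "a \<in> S" "b \<in> S" by blast
      then have "sdvd S P (a * b)" using xy(3) mult dv P(1) RD(4) by metis
      then show "sdvd (h ` S) (h P) x \<or> sdvd (h ` S) (h P) y" using P(4) ab dv P(1) by blast
    qed
  qed
  have "pfac (h ` S) n (h a)" if "pfac S n a" for n a
    using that
  proof (induction)
    case (unit u)
    then show ?case using un pfac.unit by (metis sunit_def)
  next
    case (prime P n a)
    have "pfac (h ` S) (Suc n) (h P * h a)" by (rule pfac.prime[OF pr[OF prime(1)] prime(3)])
    then show ?case using mult[OF sprimeD(1)[OF prime(1)] pfac_in(1)[OF R prime(2)]] by simp
  qed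
  moreover have "\<exists>n. pfac S n a" if "h a \<noteq> 0" "a \<in> S" for a
    using S that h0 unfolding factorial_def by metis
  ultimately show ?thesis using R' unfolding factorial_def by blast
qed

section \<open>Fraction fields inside the ambient field\<close>

definition frac :: "'a::field set \<Rightarrow> 'a set" where
  "frac S = {a / b | a b. a \<in> S \<and> b \<in> S \<and> b \<noteq> 0}"

lemma fracI: "a \<in> S \<Longrightarrow> b \<in> S \<Longrightarrow> b \<noteq> 0 \<Longrightarrow> a / b \<in> frac S"
  unfolding frac_def by blast

lemma fracE:
  assumes "x \<in> frac S"
  obtains a b where "x = a / b" "a \<in> S" "b \<in> S" "b \<noteq> 0"
  using assms unfolding frac_def by blast

lemma frac_subset: "sring S \<Longrightarrow> S \<subseteq> frac S"
  using fracI[of _ S 1] sringD(2) by fastforce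

lemma frac_sfield:
  assumes S: "sring S"
  shows "sfield (frac S)"
proof -
  note D = sringD[OF S]
  have "x + y \<in> frac S" "x * y \<in> frac S" if xy: "x \<in> frac S" "y \<in> frac S" for x y
  proof -
    obtain a b c d where e: "x = a / b" "a \<in> S" "b \<in> S" "b \<noteq> 0" "y = c / d" "c \<in> S" "d \<in> S" "d \<noteq> 0"
      using xy by (metis fracE)
    have "x + y = (a * d + c * b) / (b * d)" "x * y = (a * c) / (b * d)"
      using e by (auto simp: field_simps)
    then show "x + y \<in> frac S" "x * y \<in> frac S" using e by (auto intro!: fracI D)
  qed
  moreover have "- x \<in> frac S" "inverse x \<in> frac S" if x: "x \<in> frac S" for x
  proof -
    obtain a b where e: "x = a / b" "a \<in> S" "b \<in> S" "b \<noteq> 0" using x by (rule fracE)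
    have "- x = (- a) / b" using e by simp
    then show "- x \<in> frac S" using fracI[OF D(5)[OF e(2)] e(3,4)] by simp
    have "inverse x = (if a = 0 then 0 / 1 else b / a)" using e by auto
    then show "inverse x \<in> frac S" using e D(1,2) fracI[of 0 S 1] fracI[of b S a] by (cases "a = 0") auto
  qed
  moreover have "0 \<in> frac S" "1 \<in> frac S" using frac_subset[OF S] D by auto
  ultimately show ?thesis unfolding sfield_def sring_def by simp
qed

lemma clear_denominators:
  assumes S: "sring S" and G: "G \<in> pol (frac S)"
  shows "\<exists>d\<in>S. d \<noteq> 0 \<and> smult d G \<in> pol S"
  using G
proof (induction G)
  case 0
  then show ?case using sringD(1,2)[OF S] by (intro bexI[of _ 1]) (auto simp: pol_def)
next
  case (pCons a p)
  note Q0 = sfieldD(2)[OF frac_sfield[OF S]]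
  have ap: "a \<in> frac S" "p \<in> pol (frac S)" using pCons.prems pol_pCons[OF Q0] by auto
  obtain d where d: "d \<in> S" "d \<noteq> 0" "smult d p \<in> pol S" using pCons.IH ap by blast
  obtain x y where xy: "a = x / y" "x \<in> S" "y \<in> S" "y \<noteq> 0" using ap(1) by (rule fracE)
  have "smult (d * y) (pCons a p) = pCons (d * x) (smult y (smult d p))" using xy by (simp add: mult.commute)
  also have "\<dots> \<in> pol S" using d xy by (simp add: pol_pCons sringD[OF S] pol_smult[OF S] del: smult_smult)
  finally show ?case using d xy by (intro bexI[of _ "d * y"]) (auto intro: sringD(4)[OF S])
qed

section \<open>Gauss's lemma for polynomials over a factorial ring\<close>

lemma const_sdvd:
  assumes P: "P \<noteq> (0::'a::field)"
  shows "sdvd (pol S) [:P:] p \<longleftrightarrow> (\<forall>i. sdvd S P (coeff p i))"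
proof
  assume "sdvd (pol S) [:P:] p"
  then show "\<forall>i. sdvd S P (coeff p i)" by (elim sdvdE) (auto simp: pol_def sdvd_def)
next
  assume *: "\<forall>i. sdvd S P (coeff p i)"
  have "coeff (smult (1 / P) p) i \<in> S" for i
  proof -
    obtain c where "coeff p i = P * c" "c \<in> S" using * by (auto elim: sdvdE)
    then show ?thesis using P by simp
  qed
  then show "sdvd (pol S) [:P:] p" using P by (intro sdvdI[of _ _ "smult (1/P) p"] polI) auto
qed

text \<open>Gauss's argument: let \<open>i\<close> and \<open>j\<close> be the first places where
  the coefficients of \<open>f\<close> and \<open>g\<close> are not divisible by \<open>P\<close>.
  In the coefficient \<open>i + j\<close> of \<open>f * g\<close> every other summand is divisible
  by \<open>P\<close>.\<close>

lemma sprime_const: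
  assumes S: "sring (S::'a::field set)" and P: "sprime S P"
  shows "sprime (pol S) [:P:]"
proof -
  note P = sprimeD[OF P]
  have "\<not> sunit (pol S) [:P:]"
  proof
    assume "sunit (pol S) [:P:]"
    then obtain q where q: "q \<in> pol S" "[:P:] * q = 1" unfolding sunit_def by blast
    then have "coeff ([:P:] * q) 0 = 1" by simp
    then have "P * coeff q 0 = 1" by simp
    then show False using P(1,3) polD[OF q(1)] unfolding sunit_def by blast
  qed
  moreover have "sdvd (pol S) [:P:] f \<or> sdvd (pol S) [:P:] g"
    if fg: "f \<in> pol S" "g \<in> pol S" "sdvd (pol S) [:P:] (f * g)" for f g
  proof (rule ccontr)
    assume "\<not> ?thesis"
    then have ex: "\<exists>i. \<not> sdvd S P (coeff f i)" "\<exists>i. \<not> sdvd S P (coeff g i)"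
      using const_sdvd[OF P(2)] by blast+
    define i where "i = (LEAST i. \<not> sdvd S P (coeff f i))"
    define j where "j = (LEAST i. \<not> sdvd S P (coeff g i))"
    have i: "\<not> sdvd S P (coeff f i)" unfolding i_def using ex(1) by (rule LeastI_ex)
    have j: "\<not> sdvd S P (coeff g j)" unfolding j_def using ex(2) by (rule LeastI_ex)
    have i': "sdvd S P (coeff f k)" if "k < i" for k using not_less_Least that unfolding i_def by blast
    have j': "sdvd S P (coeff g k)" if "k < j" for k using not_less_Least that unfolding j_def by blast
    have "coeff (f * g) (i + j) = coeff f i * coeff g j + (\<Sum>k\<in>{..i+j} - {i}. coeff f k * coeff g (i + j - k))"
      unfolding coeff_mult by (subst sum.remove[of _ i]) auto
    moreover have "sdvd S P (\<Sum>k\<in>{..i+j} - {i}. coeff f k * coeff g (i + j - k))"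
    proof (rule sdvd_sum[OF S])
      fix k assume k: "k \<in> {..i+j} - {i}"
      show "sdvd S P (coeff f k * coeff g (i + j - k))"
      proof (cases "k < i")
        case True
        then show ?thesis using sdvd_mult[OF S i' polD[OF fg(2)]] by blast
      next
        case False
        then have "i + j - k < j" using k by auto
        then show ?thesis using sdvd_mult2[OF S j' polD[OF fg(1)]] by blast
      qed
    qed
    moreover have "sdvd S P (coeff (f * g) (i + j))" using fg(3) const_sdvd[OF P(2)] by blast
    ultimately have "sdvd S P (coeff f i * coeff g j)" 
      using sdvd_diff[OF S, of P "coeff (f * g) (i + j)" "\<Sum>k\<in>{..i+j} - {i}. coeff f k * coeff g (i + j - k)"] by simp
    then show False using P(4)[OF polD[OF fg(1)] polD[OF fg(2)]] i j by blast
  qed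
  ultimately show ?thesis unfolding sprime_def using P(1,2) sringD(1)[OF S] by auto
qed

text \<open>Content one, phrased through constant primes so that products of primitive polynomials
  are primitive by \<open>sprime_const\<close>.\<close>

definition primitive :: "'a::field set \<Rightarrow> 'a poly \<Rightarrow> bool" where
  "primitive S F \<longleftrightarrow> F \<in> pol S \<and> (\<forall>P. sprime S P \<longrightarrow> \<not> sdvd (pol S) [:P:] F)"

text \<open>Every prime of \<open>d\<close> divides \<open>F * B\<close> and not the primitive
  \<open>F\<close>, so it divides \<open>B\<close>; the primes are cancelled one by one.\<close>

lemma primitive_cancel:
  fixes S :: "'a::field set"
  assumes S: "sring S" and d: "pfac S n d" and F: "primitive S F"
    and A: "A \<in> pol S" and B: "B \<in> pol S" and eq: "smult d A = F * B"
  shows "\<exists>C\<in>pol S. B = smult d C"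
  using d B eq
proof (induction arbitrary: B)
  case (unit d)
  then obtain e where e: "e \<in> S" "d * e = 1" unfolding sunit_def by blast
  then show ?case using unit.prems(1) by (intro bexI[of _ "smult e B"]) (auto simp: pol_smult[OF S])
next
  case (prime P n d)
  note P = sprimeD[OF prime.hyps(1)]
  have dA: "smult d A \<in> pol S" using pol_smult[OF S pfac_in(1)[OF S prime.hyps(2)] A] .
  have "F * B = [:P:] * smult d A" using prime.prems(2) by (simp add: mult.commute)
  then have "sdvd (pol S) [:P:] (F * B)" using dA by (rule sdvdI)
  then have "sdvd (pol S) [:P:] B"
    using sprimeD(4)[OF sprime_const[OF S prime.hyps(1)]] F prime.hyps(1) prime.prems(1)
    unfolding primitive_def by blast
  then obtain B' where B': "B = [:P:] * B'" "B' \<in> pol S" by (rule sdvdE)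
  have "smult P (smult d A) = smult P (F * B')" using prime.prems(2) B' by simp
  then have "smult d A = F * B'" using P(2) by (metis smult_cancel)
  then obtain C where "C \<in> pol S" "B' = smult d C" using prime.IH B'(2) by blast
  then show ?case using B' by (auto simp: mult.commute)
qed

text \<open>A constant prime taken out of \<open>p\<close> is also taken out of the leading
  coefficient, whose number of prime factors limits how often this can happen.\<close>

lemma content:
  fixes S :: "'a::field set"
  assumes S: "sring S" and p: "p \<in> pol S" "pfac S n (lead_coeff p)"
  shows "\<exists>c F. p = smult c F \<and> c \<in> S \<and> c \<noteq> 0 \<and> primitive S F"
  using p
proof (induction n arbitrary: p)
  case 0
  show ?case
  proof (rule exI[of _ 1], rule exI[of _ p], intro conjI)
    show "primitive S p"
    proof (rule ccontr)
      assume "\<not> primitive S p"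
      then obtain P where P: "sprime S P" "sdvd (pol S) [:P:] p" using 0(1) unfolding primitive_def by blast
      then have "sdvd S P (lead_coeff p)" using const_sdvd sprimeD(2) by blast
      then obtain b where "lead_coeff p = P * b" "b \<in> S" by (rule sdvdE)
      then show False using pfac_div[OF S 0(2) P(1)] by blast
    qed
  qed (auto intro: sringD[OF S])
next
  case (Suc n)
  show ?case
  proof (cases "primitive S p")
    case True
    then show ?thesis using sringD(2)[OF S] by (intro exI[of _ 1] exI[of _ p]) auto
  next
    case False
    then obtain P where P: "sprime S P" "sdvd (pol S) [:P:] p" using Suc.prems(1) unfolding primitive_def by blast
    obtain q where q: "p = [:P:] * q" "q \<in> pol S" using P(2) by (rule sdvdE)
    have "lead_coeff p = P * lead_coeff q" using q by (simp add: lead_coeff_mult)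
    then have "pfac S n (lead_coeff q)" using pfac_div[OF S Suc.prems(2) P(1)] polD[OF q(2)] by blast
    then obtain c F where "q = smult c F" "c \<in> S" "c \<noteq> 0" "primitive S F" using Suc.IH[OF q(2)] by blast
    then show ?thesis using q sprimeD(1,2)[OF P(1)]
      by (intro exI[of _ "P * c"] exI[of _ F]) (auto intro: sringD(4)[OF S] simp: mult.commute)
  qed
qed

text \<open>Primality over the fraction field comes from a complex root. The cofactor of a primitive
  \<open>F\<close> has no denominators, since \<open>primitive_cancel\<close> removes them, so
  divisibility over \<open>frac S\<close> descends to \<open>S\<close>.\<close>

lemma primitive_irr_sprime:
  fixes S :: "complex set"
  assumes S: "factorial S" and F: "primitive S F" "irr (frac S) F"
  shows "sprime (pol S) F"
proof -
  have R: "sring S" using S unfolding factorial_def by blast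
  note Q = frac_sfield[OF R] and F' = irrD[OF F(2)]
  have FS: "F \<in> pol S" using F(1) unfolding primitive_def by blast
  have sub: "pol S \<subseteq> pol (frac S)" using pol_mono[OF frac_subset[OF R]] .
  have "\<not> sunit (pol S) F"
  proof
    assume "sunit (pol S) F"
    then have "F dvd 1" unfolding sunit_def by (metis dvd_triv_left)
    then show False using F'(2,3) by (simp add: is_unit_iff_degree)
  qed
  moreover have dv: "sdvd (pol S) F A" if A: "A \<in> pol S" "F dvd A" for A
  proof -
    obtain G where G: "A = F * G" using A(2) by (elim dvdE)
    have "G \<in> pol (frac S)" using pol_quot[OF Q F'(1) _ G F'(3)] sub A(1) by blast
    then obtain d where d: "d \<in> S" "d \<noteq> 0" "smult d G \<in> pol S" using clear_denominators[OF R] by blast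
    obtain n where n: "pfac S n d" using S d unfolding factorial_def by blast
    obtain C where C: "C \<in> pol S" "smult d G = smult d C"
      using primitive_cancel[OF R n F(1) A(1) d(3)] G by auto
    then have "G = C" using d(2) by (metis smult_cancel)
    then show ?thesis using G C(1) by (auto intro: sdvdI)
  qed
  moreover have "sdvd (pol S) F A \<or> sdvd (pol S) F B"
    if AB: "A \<in> pol S" "B \<in> pol S" "sdvd (pol S) F (A * B)" for A B
  proof -
    have "F dvd A * B" using AB(3) by (elim sdvdE) simp
    then show ?thesis using irr_prime[OF Q F(2)] AB sub dv by blast
  qed
  ultimately show ?thesis unfolding sprime_def using FS F'(3) by blast
qed

text \<open>Induction on the degree of \<open>p = c F\<close> with \<open>F\<close> primitive.
  Either \<open>F\<close> is irreducible over \<open>frac S\<close> and therefore prime, or it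
  splits over \<open>frac S\<close> and the factors can be replaced by factors over \<open>S\<close>
  of smaller degree.\<close>

theorem factorial_pol:
  fixes S :: "complex set"
  assumes S: "factorial S"
  shows "factorial (pol S)"
proof -
  have R: "sring S" using S unfolding factorial_def by blast
  note D = sringD[OF R] and Q = frac_sfield[OF R] and PR = pol_sring[OF R]
  have sub: "pol S \<subseteq> pol (frac S)" using pol_mono[OF frac_subset[OF R]] .
  have const: "pfac (pol S) n [:a:]" if "pfac S n a" for n a
    using that
  proof (induction)
    case (unit u)
    then obtain e where "u \<in> S" "e \<in> S" "u * e = 1" unfolding sunit_def by blast
    then have "sunit (pol S) [:u:]" unfolding sunit_def using D(1)
      by (auto intro!: bexI[of _ "[:e:]"] simp: one_pCons)
    then show ?case by (rule pfac.unit)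
  next
    case (prime P n a)
    then have "pfac (pol S) (Suc n) ([:P:] * [:a:])" using sprime_const[OF R] by (intro pfac.prime)
    then show ?case by (simp add: mult.commute)
  qed
  have cont: "\<exists>c F. p = smult c F \<and> c \<in> S \<and> c \<noteq> 0 \<and> primitive S F" if p: "p \<in> pol S" "p \<noteq> 0" for p
  proof -
    obtain n where "pfac S n (lead_coeff p)" using S p polD[OF p(1)] unfolding factorial_def
      by (metis leading_coeff_0_iff)
    then show ?thesis using content[OF R p(1)] by blast
  qed
  have main: "\<exists>n. pfac (pol S) n p" if "p \<in> pol S" "p \<noteq> 0" for p
    using that
  proof (induction "degree p" arbitrary: p rule: less_induct)
    case less
    have deg0: "\<exists>n. pfac (pol S) n q" if q: "q \<in> pol S" "q \<noteq> 0" "degree q = 0" for q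
    proof -
      obtain a where a: "q = [:a:]" using q(3) by (rule degree_eq_zeroE)
      then obtain n where "pfac S n a" using S q D(1) unfolding factorial_def by auto
      then show ?thesis using const a by blast
    qed
    show ?case
    proof (cases "degree p = 0")
      case True
      then show ?thesis using deg0 less.prems by blast
    next
      case False
      obtain c F where cF: "p = smult c F" "c \<in> S" "c \<noteq> 0" "primitive S F" using cont less.prems by blast
      have FS: "F \<in> pol S" using cF(4) unfolding primitive_def by blast
      have F0: "F \<noteq> 0" "degree F = degree p" using cF less.prems by auto
      have "\<exists>n. pfac (pol S) n F"
      proof (cases "irr (frac S) F")
        case True
        have "pfac (pol S) (Suc 0) (F * 1)"
          by (rule pfac.prime[OF primitive_irr_sprime[OF S cF(4) True] pfac.unit])
            (use sringD(2)[OF PR] in \<open>auto simp: sunit_def\<close>)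
        then show ?thesis by auto
      next
        case nirr: False
        then obtain g where g: "g \<in> pol (frac S)" "g dvd F" "degree g \<noteq> 0" "degree g \<noteq> degree F"
          using FS sub False F0(2) unfolding irr_def by auto
        obtain h where h: "F = g * h" using g(2) by (elim dvdE)
        have g0: "g \<noteq> 0" "h \<noteq> 0" using F0 h by auto
        have hQ: "h \<in> pol (frac S)" using pol_quot[OF Q g(1) _ h g0(1)] FS sub by blast
        have deg: "degree g + degree h = degree F" using h g0 by (simp add: degree_mult_eq)
        obtain d where d: "d \<in> S" "d \<noteq> 0" "smult d g \<in> pol S" using clear_denominators[OF R g(1)] by blast
        obtain e where e: "e \<in> S" "e \<noteq> 0" "smult e h \<in> pol S" using clear_denominators[OF R hQ] by blast
        obtain a G where G: "smult d g = smult a G" "a \<in> S" "a \<noteq> 0" "primitive S G"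
          using cont[OF d(3)] d(2) g0 by auto
        obtain b H where H: "smult e h = smult b H" "b \<in> S" "b \<noteq> 0" "primitive S H"
          using cont[OF e(3)] e(2) g0 by auto
        have GS: "G \<in> pol S" "H \<in> pol S" using G(4) H(4) unfolding primitive_def by auto
        have dG: "degree G = degree g" "degree H = degree h"
          using arg_cong[OF G(1), of degree] arg_cong[OF H(1), of degree] d(2) e(2) G(3) H(3)
          by (simp_all del: G(1) H(1))
        \<comment> \<open>\<open>d\<close> and \<open>e\<close> clear denominators, \<open>a\<close>
          and \<open>b\<close> are contents. Since \<open>G * H\<close> is primitive,
          \<open>d * e\<close> divides the constant \<open>a * b\<close>, and the quotient is the
          constant factor \<open>C\<close>.\<close>
        have eq: "smult (d * e) F = (G * H) * [:a * b:]"
        proof -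
          have "smult (d * e) F = smult d g * smult e h" using h by (simp add: mult_smult_left mult_smult_right mult.commute)
          also have "\<dots> = smult a G * smult b H" using G(1) H(1) by simp
          finally show ?thesis by (simp add: mult.commute)
        qed
        obtain n where n: "pfac S n (d * e)" using S d e D(4) unfolding factorial_def by (metis mult_eq_0_iff)
        have prim: "primitive S (G * H)"
          unfolding primitive_def
        proof (intro conjI allI impI)
          show "G * H \<in> pol S" using GS sringD(4)[OF PR] by blast
          fix P assume P: "sprime S P"
          show "\<not> sdvd (pol S) [:P:] (G * H)"
            using sprimeD(4)[OF sprime_const[OF R P] GS] G(4) H(4) P unfolding primitive_def by blast
        qed
        have abS: "[:a * b:] \<in> pol S" using G H D by simp
        obtain C where C: "C \<in> pol S" "[:a * b:] = smult (d * e) C"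
          using primitive_cancel[OF R n prim FS abS eq] by blast
        have "smult (d * e) F = smult (d * e) (G * H * C)" using eq C(2) by (metis mult_smult_right)
        then have FC: "F = G * H * C" using d(2) e(2) by (metis smult_cancel mult_eq_0_iff)
        have "degree C = 0" using arg_cong[OF C(2), of degree] d(2) e(2) by simp
        moreover have "C \<noteq> 0" using FC F0 by auto
        ultimately obtain n1 where n1: "pfac (pol S) n1 C" using deg0 C(1) by blast
        have dl: "degree G < degree p" "degree H < degree p" using deg g(3,4) dG F0(2) by auto
        have G0: "G \<noteq> 0" "H \<noteq> 0" using FC F0 by auto
        obtain n2 n3 where "pfac (pol S) n2 G" "pfac (pol S) n3 H"
          using less.hyps dl GS G0 by blast
        then show ?thesis using n1 pfac_mult[OF PR] FC by metis
      qed
      then obtain n where n: "pfac (pol S) n F" by blast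
      obtain m where "pfac S m c" using S cF unfolding factorial_def by blast
      then have "pfac (pol S) (m + n) ([:c:] * F)" using pfac_mult[OF PR const n] by blast
      then show ?thesis using cF(1) by auto
    qed
  qed
  then show ?thesis unfolding factorial_def using PR by blast
qed

section \<open>Homomorphisms and transcendental extensions\<close>

text \<open>Only the behaviour on \<open>S\<close> is prescribed, so automorphisms of different
  stages of the tower can be compared as functions on one type.\<close>

definition shom :: "'a::comm_ring_1 set \<Rightarrow> ('a \<Rightarrow> 'b::comm_ring_1) \<Rightarrow> bool" where
  "shom S h \<longleftrightarrow> h 1 = 1 \<and> (\<forall>a\<in>S. \<forall>b\<in>S. h (a + b) = h a + h b \<and> h (a * b) = h a * h b)"

lemma shomD:
  assumes "shom S h"
  shows "h 1 = 1" "a \<in> S \<Longrightarrow> b \<in> S \<Longrightarrow> h (a + b) = h a + h b" "a \<in> S \<Longrightarrow> b \<in> S \<Longrightarrow> h (a * b) = h a * h b"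
  using assms unfolding shom_def by auto

lemma shom_subset: "shom S h \<Longrightarrow> T \<subseteq> S \<Longrightarrow> shom T h"
  unfolding shom_def by blast

lemma shom_0: "shom S h \<Longrightarrow> sring S \<Longrightarrow> h 0 = 0"
  using shomD(2)[of S h 0 0] sringD(1)[of S] by (metis add_0 add_cancel_right_right)

lemma shom_minus: "shom S h \<Longrightarrow> sring S \<Longrightarrow> a \<in> S \<Longrightarrow> h (- a) = - h a"
  using shomD(2)[of S h a "- a"] sringD(5)[of S a] shom_0[of S h]
  by (simp add: eq_neg_iff_add_eq_0 add.commute)

lemma shom_diff: "shom S h \<Longrightarrow> sring S \<Longrightarrow> a \<in> S \<Longrightarrow> b \<in> S \<Longrightarrow> h (a - b) = h a - h b"
  using shomD(2)[of S h a "- b"] sringD(5)[of S b] shom_minus[of S h b] by simp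

lemma shom_sum: "shom S h \<Longrightarrow> sring S \<Longrightarrow> (\<And>i. i \<in> I \<Longrightarrow> f i \<in> S) \<Longrightarrow> h (sum f I) = (\<Sum>i\<in>I. h (f i))"
  by (induction I rule: infinite_finite_induct) (auto simp: shom_0 shomD(2) sring_sum)

lemma shom_prod: "shom S h \<Longrightarrow> sring S \<Longrightarrow> (\<And>i. i \<in> I \<Longrightarrow> f i \<in> S) \<Longrightarrow> h (prod f I) = (\<Prod>i\<in>I. h (f i))"
  by (induction I rule: infinite_finite_induct) (auto simp: shomD sring_prod)

lemma shom_power: "shom S h \<Longrightarrow> sring S \<Longrightarrow> a \<in> S \<Longrightarrow> h (a ^ n) = h a ^ n"
  by (induction n) (auto simp: shomD sring_power)

lemma shom_of_nat: "shom S h \<Longrightarrow> sring S \<Longrightarrow> h (of_nat n) = of_nat n"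
  by (induction n) (auto simp: shomD shom_0 sring_of_nat sringD(2))

lemma shom_comp: "shom S h \<Longrightarrow> shom T g \<Longrightarrow> h ` S \<subseteq> T \<Longrightarrow> shom S (\<lambda>x. g (h x))"
  unfolding shom_def by (auto simp: image_subset_iff)

lemma shom_inverse:
  fixes h :: "'a::field \<Rightarrow> 'b::field"
  assumes h: "shom S h" and S: "sfield S" and a: "a \<in> S"
  shows "h (inverse a) = inverse (h a)"
proof (cases "a = 0")
  case True
  then show ?thesis using shom_0[OF h sfieldD(1)[OF S]] by simp
next
  case False
  then have "h a * h (inverse a) = 1" using shomD(3)[OF h a sfieldD(8)[OF S a]] shomD(1)[OF h] by simp
  then show ?thesis by (metis inverse_unique)
qed

lemma shom_divide:
  fixes h :: "'a::field \<Rightarrow> 'b::field"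
  shows "shom S h \<Longrightarrow> sfield S \<Longrightarrow> a \<in> S \<Longrightarrow> b \<in> S \<Longrightarrow> h (a / b) = h a / h b"
  by (simp add: divide_inverse shomD(3) shom_inverse sfieldD(8))

lemma shom_nonzero:
  fixes h :: "'a::field \<Rightarrow> 'b::field"
  assumes h: "shom S h" and S: "sfield S" and a: "a \<in> S" "a \<noteq> 0"
  shows "h a \<noteq> 0"
  using shomD(3)[OF h a(1) sfieldD(8)[OF S a(1)]] shomD(1)[OF h] a(2) by auto

lemma map_pol:
  assumes h: "shom S h" and S: "sring S"
  shows "coeff (map_poly h p) i = h (coeff p i)"
    "p \<in> pol S \<Longrightarrow> q \<in> pol S \<Longrightarrow> map_poly h (p + q) = map_poly h p + map_poly h q"
    "p \<in> pol S \<Longrightarrow> q \<in> pol S \<Longrightarrow> map_poly h (p * q) = map_poly h p * map_poly h q"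
    "map_poly h 1 = 1" "map_poly h [:a:] = [:h a:]"
    "map_poly h (pCons a p) = pCons (h a) (map_poly h p)"
    "a \<in> S \<Longrightarrow> p \<in> pol S \<Longrightarrow> map_poly h (smult a p) = smult (h a) (map_poly h p)"
proof -
  note h0 = shom_0[OF h S]
  show c: "coeff (map_poly h p) i = h (coeff p i)" for p i by (simp add: coeff_map_poly h0)
  show "map_poly h (p + q) = map_poly h p + map_poly h q" if "p \<in> pol S" "q \<in> pol S"
    using that by (intro poly_eqI) (simp add: c shomD(2)[OF h] polD)
  show "map_poly h (p * q) = map_poly h p * map_poly h q" if "p \<in> pol S" "q \<in> pol S"
    using that by (intro poly_eqI) (simp add: c coeff_mult shom_sum[OF h S] shomD(3)[OF h] polD sringD(4)[OF S])
  show "map_poly h 1 = 1" by (simp add: map_poly_1 shomD(1)[OF h])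
  show "map_poly h [:a:] = [:h a:]" by (intro poly_eqI) (simp add: c coeff_pCons h0 split: nat.splits)
  show "map_poly h (pCons a p) = pCons (h a) (map_poly h p)"
    by (intro poly_eqI) (simp add: c coeff_pCons split: nat.splits)
  show "map_poly h (smult a p) = smult (h a) (map_poly h p)" if "a \<in> S" "p \<in> pol S"
    using that by (intro poly_eqI) (simp add: c shomD(3)[OF h] polD)
qed

lemma shom_map_poly:
  assumes h: "shom S h" and S: "sring S"
  shows "shom (pol S) (map_poly h)"
  unfolding shom_def using map_pol[OF h S] by auto

lemma shom_poly:
  assumes h: "shom S h" and S: "sring S" and p: "p \<in> pol S" and x: "x \<in> S"
  shows "h (poly p x) = poly (map_poly h p) (h x)"
  using p
proof (induction p)
  case 0
  then show ?case by (simp add: shom_0[OF h S])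
next
  case (pCons a p)
  then have "a \<in> S" "p \<in> pol S" using pol_pCons[OF sringD(1)[OF S]] by auto
  then show ?case using pCons.IH x poly_in[OF S, of p x] sringD(4)[OF S, of x "poly p x"]
    by (simp add: map_pol[OF h S] shomD(2,3)[OF h])
qed

lemma map_pol_in: "shom S h \<Longrightarrow> sring S \<Longrightarrow> (\<And>a. a \<in> S \<Longrightarrow> h a \<in> T) \<Longrightarrow> p \<in> pol S \<Longrightarrow> map_poly h p \<in> pol T"
  by (auto simp: pol_def map_pol(1))

lemma pol_0 [simp]: "0 \<in> pol S \<longleftrightarrow> 0 \<in> S"
  by (simp add: pol_def)

section \<open>Polynomial rings generated by independent transcendental elements\<close>

definition adj :: "'a::comm_ring_1 set \<Rightarrow> 'a \<Rightarrow> 'a set" where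
  "adj S v = (\<lambda>p. poly p v) ` pol S"

definition transc :: "'a::comm_ring_1 set \<Rightarrow> 'a \<Rightarrow> bool" where
  "transc S v \<longleftrightarrow> (\<forall>p\<in>pol S. poly p v = 0 \<longrightarrow> p = 0)"

lemma adj_sring:
  assumes S: "sring S"
  shows "sring (adj S v)" "S \<subseteq> adj S v" "v \<in> adj S v"
proof -
  note P = sringD[OF pol_sring[OF S]] and D = sringD[OF S]
  show "S \<subseteq> adj S v"
  proof
    fix a assume "a \<in> S"
    then show "a \<in> adj S v" unfolding adj_def using D(1) by (intro image_eqI[of _ _ "[:a:]"]) auto
  qed
  then have 01: "0 \<in> adj S v" "1 \<in> adj S v" using D by auto
  show "v \<in> adj S v" unfolding adj_def using D by (intro image_eqI[of _ _ "[:0,1:]"]) (auto simp: pol_pCons)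
  have "x + y \<in> adj S v" "x * y \<in> adj S v" "- x \<in> adj S v" if xy: "x \<in> adj S v" "y \<in> adj S v" for x y
  proof -
    obtain p where p: "x = poly p v" "p \<in> pol S" using xy(1) unfolding adj_def by blast
    obtain q where "y = poly q v" "q \<in> pol S" using xy(2) unfolding adj_def by blast
    with p show "x + y \<in> adj S v" "x * y \<in> adj S v" "- x \<in> adj S v" unfolding adj_def
      using P(3,4,5) by (metis imageI poly_add, metis imageI poly_mult, metis imageI poly_minus)
  qed
  then show "sring (adj S v)" unfolding sring_def using 01 by simp
qed

lemma adj_mono: "S \<subseteq> T \<Longrightarrow> adj S v \<subseteq> adj T v"
  unfolding adj_def using pol_mono by blast

lemma transc_subset: "transc T v \<Longrightarrow> S \<subseteq> T \<Longrightarrow> transc S v"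
  unfolding transc_def using pol_mono by blast

lemma transc_inj:
  assumes S: "sring S" and v: "transc S v"
  shows "inj_on (\<lambda>p. poly p v) (pol S)"
proof (rule inj_onI)
  fix p q assume pq: "p \<in> pol S" "q \<in> pol S" "poly p v = poly q v"
  have "poly (p - q) v = 0" using pq(3) by simp
  then have "p - q = 0" using v sringD(6)[OF pol_sring[OF S] pq(1,2)] unfolding transc_def by blast
  then show "p = q" by simp
qed

lemma factorial_adj:
  fixes S :: "complex set"
  assumes S: "factorial S" and v: "transc S v"
  shows "factorial (adj S v)"
proof -
  have "inj_on (\<lambda>p. poly p v) (pol S)" using S by (intro transc_inj[OF _ v]) (simp add: factorial_def)
  then show ?thesis unfolding adj_def by (intro factorial_image[OF factorial_pol[OF S]]) auto
qed

lemma adj_hom: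
  assumes S: "sring S" and v: "transc S v" and h: "shom S h"
  shows "\<exists>g. shom (adj S v) g \<and> (\<forall>a\<in>S. g a = h a) \<and> g v = w"
proof -
  \<comment> \<open>\<open>pre\<close> inverts evaluation at \<open>v\<close>; transcendence makes
    it well defined.\<close>
  define pre where "pre = inv_into (pol S) (\<lambda>p. poly p v)"
  have pre: "pre (poly p v) = p" if "p \<in> pol S" for p
    unfolding pre_def by (rule inv_into_f_f[OF transc_inj[OF S v] that])
  define g where "g x = poly (map_poly h (pre x)) w" for x
  note P = sringD[OF pol_sring[OF S]] and D = sringD[OF S] and m = map_pol[OF h S]
  have g: "g (poly p v) = poly (map_poly h p) w" if "p \<in> pol S" for p unfolding g_def pre[OF that] ..
  have gS: "g a = h a" if "a \<in> S" for a using g[of "[:a:]"] D(1) that m(5) by simp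
  have "g (x + y) = g x + g y" "g (x * y) = g x * g y" if "x \<in> adj S v" "y \<in> adj S v" for x y
  proof -
    obtain p q where "x = poly p v" "y = poly q v" "p \<in> pol S" "q \<in> pol S" using \<open>x \<in> adj S v\<close> \<open>y \<in> adj S v\<close> unfolding adj_def by blast
    then show "g (x + y) = g x + g y" "g (x * y) = g x * g y"
      using g[OF P(3), of p q] g[OF P(4), of p q] g[of p] g[of q] m(2,3)[of p q] by simp_all
  qed
  moreover have "g v = w" using g[of "[:0,1:]"] D(1,2) m(6) shom_0[OF h S] shomD(1)[OF h] by (simp add: pol_pCons)
  ultimately show ?thesis using gS D(2) shomD(1)[OF h] unfolding shom_def by (metis (no_types, lifting))
qed

primrec pr :: "'a::comm_ring_1 set \<Rightarrow> (nat \<Rightarrow> 'a) \<Rightarrow> nat \<Rightarrow> 'a set" where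
  "pr M u 0 = M"
| "pr M u (Suc m) = adj (pr M u m) (u m)"

definition indep :: "'a::comm_ring_1 set \<Rightarrow> (nat \<Rightarrow> 'a) \<Rightarrow> nat \<Rightarrow> bool" where
  "indep M u m \<longleftrightarrow> (\<forall>j<m. transc (pr M u j) (u j))"

lemma pr_sring: "sring M \<Longrightarrow> sring (pr M u m)"
  by (induction m) (auto intro: adj_sring)

lemma pr_base: "sring M \<Longrightarrow> M \<subseteq> pr M u m"
  by (induction m) (auto dest: adj_sring(2)[OF pr_sring])

lemma pr_var: "sring M \<Longrightarrow> j < m \<Longrightarrow> u j \<in> pr M u m"
proof (induction m)
  case (Suc m)
  then show ?case using adj_sring(2,3)[OF pr_sring[OF Suc.prems(1), of u m], where v = "u m"] by (cases "j = m") auto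
qed simp

lemma pr_mono: "M \<subseteq> T \<Longrightarrow> pr M u m \<subseteq> pr T u m"
  by (induction m) (auto dest: adj_mono)

lemma indep_subset: "indep T u m \<Longrightarrow> M \<subseteq> T \<Longrightarrow> indep M u m"
  unfolding indep_def by (metis transc_subset pr_mono)

lemma factorial_pr:
  fixes M :: "complex set"
  assumes M: "sfield M" and u: "indep M u m"
  shows "factorial (pr M u m)"
  using u
proof (induction m)
  case 0
  then show ?case using factorial_field[OF M] by simp
next
  case (Suc m)
  then show ?case by (auto simp: indep_def intro!: factorial_adj)
qed

lemma pr_hom:
  assumes M: "sring M" and u: "indep M u m" and h: "shom M h"
  shows "\<exists>g. shom (pr M u m) g \<and> (\<forall>a\<in>M. g a = h a) \<and> (\<forall>j<m. g (u j) = w j)"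
  using u
proof (induction m)
  case 0
  then show ?case using h by auto
next
  case (Suc m)
  then obtain g where g: "shom (pr M u m) g" "\<forall>a\<in>M. g a = h a" "\<forall>j<m. g (u j) = w j"
    by (auto simp: indep_def)
  obtain k where k: "shom (adj (pr M u m) (u m)) k" "\<forall>a\<in>pr M u m. k a = g a" "k (u m) = w m"
    using adj_hom[OF pr_sring[OF M] _ g(1), of "u m" "w m"] Suc.prems by (auto simp: indep_def)
  have "k a = h a" if "a \<in> M" for a using k(2) g(2) pr_base[OF M, of u m] that by auto
  moreover have "k (u j) = w j" if "j < Suc m" for j
    using k(2,3) g(3) pr_var[OF M, of j m u] that by (cases "j = m") auto
  ultimately show ?case using k(1) by auto
qed

lemma adj_hom_eq:
  assumes S: "sring S" and g: "shom (adj S v) g" and k: "shom (adj S v) k"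
    and eq: "\<And>a. a \<in> S \<Longrightarrow> g a = k a" "g v = k v" and x: "x \<in> adj S v"
  shows "g x = k x"
proof -
  obtain p where p: "x = poly p v" "p \<in> pol S" using x unfolding adj_def by blast
  have "map_poly g p = map_poly k p" using eq(1) p(2)
    by (intro poly_eqI) (simp add: map_pol(1)[OF g adj_sring(1)[OF S]] map_pol(1)[OF k adj_sring(1)[OF S]] polD)
  moreover have "p \<in> pol (adj S v)" using p(2) pol_mono[OF adj_sring(2)[OF S]] by blast
  ultimately show ?thesis unfolding p(1)
    using shom_poly[OF g adj_sring(1)[OF S] _ adj_sring(3)[OF S]] shom_poly[OF k adj_sring(1)[OF S] _ adj_sring(3)[OF S]] eq(2) by simp
qed

lemma pr_hom_eq:
  assumes M: "sring M" and g: "shom (pr M u m) g" and k: "shom (pr M u m) k"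
    and eq: "\<And>a. a \<in> M \<Longrightarrow> g a = k a" "\<And>j. j < m \<Longrightarrow> g (u j) = k (u j)" and x: "x \<in> pr M u m"
  shows "g x = k x"
  using g k eq x
proof (induction m arbitrary: x)
  case 0
  then show ?case by simp
next
  case (Suc m)
  have sub: "pr M u m \<subseteq> pr M u (Suc m)" using adj_sring(2)[OF pr_sring[OF M]] by simp
  have "g a = k a" if "a \<in> pr M u m" for a
    using Suc.IH[OF shom_subset[OF Suc.prems(1) sub] shom_subset[OF Suc.prems(2) sub] Suc.prems(3) Suc.prems(4)] that by auto
  moreover have "shom (adj (pr M u m) (u m)) g" "shom (adj (pr M u m) (u m)) k" "x \<in> adj (pr M u m) (u m)"
    "g (u m) = k (u m)" using Suc.prems by auto
  ultimately show ?case using adj_hom_eq[OF pr_sring[OF M, of u m]] by blast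
qed

lemma pr_hom_image:
  assumes M: "sring M" and g: "shom (pr M u m) g" and R: "sring R"
    and M': "\<And>a. a \<in> M \<Longrightarrow> g a \<in> R" and u': "\<And>j. j < m \<Longrightarrow> g (u j) \<in> R" and x: "x \<in> pr M u m"
  shows "g x \<in> R"
  using g u' x
proof (induction m arbitrary: x)
  case 0
  then show ?case using M' by simp
next
  case (Suc m)
  note A = adj_sring[OF pr_sring[OF M, of u m], where v = "u m"]
  have gs: "shom (adj (pr M u m) (u m)) g" using Suc.prems(1) by simp
  have a: "g a \<in> R" if "a \<in> pr M u m" for a
    using Suc.IH[OF shom_subset[OF gs A(2)]] Suc.prems(2) that by auto
  obtain p where p: "x = poly p (u m)" "p \<in> pol (pr M u m)" using Suc.prems(3) unfolding pr.simps adj_def by blast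
  have p': "p \<in> pol (adj (pr M u m) (u m))" using p(2) pol_mono[OF A(2)] by blast
  have "map_poly g p \<in> pol R" using a p(2) by (auto simp: pol_def map_pol(1)[OF gs A(1)])
  then show ?case unfolding p(1) shom_poly[OF gs A(1) p' A(3)] using poly_in[OF R] Suc.prems(2) by simp
qed

section \<open>Countability and the supply of transcendental elements\<close>

lemma countable_pol: "countable S \<Longrightarrow> countable (pol S)"
proof -
  assume S: "countable S"
  have "pol S \<subseteq> Poly ` lists S"
  proof
    fix p assume "p \<in> pol S"
    then have "coeffs p \<in> lists S" by (auto simp: pol_def coeffs_def)
    then show "p \<in> Poly ` lists S" by (intro image_eqI[of _ _ "coeffs p"]) auto
  qed
  moreover have "countable (Poly ` lists S)" using S by (intro countable_image countable_lists)
  ultimately show ?thesis by (rule countable_subset)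
qed

lemma countable_adj: "countable S \<Longrightarrow> countable (adj S v)"
  unfolding adj_def by (intro countable_image countable_pol)

lemma countable_pr: "countable M \<Longrightarrow> countable (pr M u m)"
  by (induction m) (auto intro: countable_adj)

lemma countable_frac: "countable S \<Longrightarrow> countable (frac S)"
proof -
  assume S: "countable S"
  have "frac S \<subseteq> (\<lambda>(a, b). a / b) ` (S \<times> S)" unfolding frac_def by auto
  then show ?thesis using S by (meson countable_SIGMA countable_image countable_subset)
qed

text \<open>Countably many nonzero polynomials have only countably many complex roots. This is why
  every field of the tower is kept countable.\<close>

lemma exists_transc:
  assumes "countable (S :: complex set)"
  shows "\<exists>v. transc S v"
proof (rule ccontr)
  assume no: "\<not> ?thesis"
  have "UNIV \<subseteq> (\<Union>p\<in>pol S - {0}. {x. poly p x = 0})" using no unfolding transc_def by blast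
  moreover have "countable (\<Union>p\<in>pol S - {0}. {x::complex. poly p x = 0})"
    using countable_pol[OF assms] by (intro countable_UN) (auto intro: countable_finite poly_roots_finite)
  ultimately have "countable (UNIV :: complex set)" by (rule countable_subset)
  then have "countable (Re ` UNIV)" by (rule countable_image)
  moreover have "Re ` UNIV = (UNIV :: real set)" by (metis surjI Re_complex_of_real)
  ultimately show False using uncountable_UNIV_real by simp
qed

lemma exists_indep:
  assumes T: "countable (T :: complex set)"
  shows "\<exists>u. \<forall>m. indep T u m"
proof -
  define pick where "pick S = (SOME v. transc S v)" for S :: "complex set"
  define R where "R = rec_nat T (\<lambda>_ S. adj S (pick S))"
  define u where "u j = pick (R j)" for j
  have pr: "pr T u j = R j" for j by (induction j) (auto simp: R_def u_def)
  have "transc (pr T u j) (u j)" for j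
    unfolding pr u_def pick_def using exists_transc[OF countable_pr[OF T, of u j]] by (simp add: someI_ex pr)
  then show ?thesis unfolding indep_def by blast
qed

section \<open>Homomorphisms on fractions\<close>

lemma frac_hom:
  fixes h :: "'a::field \<Rightarrow> 'b::field"
  assumes S: "sring S" and h: "shom S h" and inj: "\<And>a. a \<in> S \<Longrightarrow> h a = 0 \<Longrightarrow> a = 0"
  shows "\<exists>g. shom (frac S) g \<and> (\<forall>a\<in>S. g a = h a)"
proof -
  define g where "g x = (let ab = (SOME ab. x = fst ab / snd ab \<and> fst ab \<in> S \<and> snd ab \<in> S \<and> snd ab \<noteq> 0)
    in h (fst ab) / h (snd ab))" for x
  note D = sringD[OF S]
  have g: "g (a / b) = h a / h b" if ab: "a \<in> S" "b \<in> S" "b \<noteq> 0" for a b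
  proof -
    define cd where "cd = (SOME cd. a / b = fst cd / snd cd \<and> fst cd \<in> S \<and> snd cd \<in> S \<and> snd cd \<noteq> 0)"
    have cd: "a / b = fst cd / snd cd \<and> fst cd \<in> S \<and> snd cd \<in> S \<and> snd cd \<noteq> 0"
      unfolding cd_def by (rule someI[of _ "(a, b)"]) (use ab in auto)
    then have "a * snd cd = fst cd * b" using ab by (simp add: field_simps)
    then have "h a * h (snd cd) = h (fst cd) * h b" using shomD(3)[OF h] cd ab by metis
    moreover have "h b \<noteq> 0" "h (snd cd) \<noteq> 0" using inj ab cd by auto
    ultimately show ?thesis unfolding g_def cd_def[symmetric] Let_def by (simp add: field_simps)
  qed
  have gS: "g a = h a" if "a \<in> S" for a using g[OF that D(2)] shomD(1)[OF h] by simp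
  have "g (x + y) = g x + g y" "g (x * y) = g x * g y" if xy: "x \<in> frac S" "y \<in> frac S" for x y
  proof -
    obtain a b where x: "x = a / b" "a \<in> S" "b \<in> S" "b \<noteq> 0" using xy(1) by (rule fracE)
    obtain c d where y: "y = c / d" "c \<in> S" "d \<in> S" "d \<noteq> 0" using xy(2) by (rule fracE)
    have e: "x + y = (a * d + c * b) / (b * d)" "x * y = (a * c) / (b * d)"
      using x y by (auto simp: field_simps)
    have nz: "h b \<noteq> 0" "h d \<noteq> 0" using inj x y by auto
    have "g (x + y) = (h a * h d + h c * h b) / (h b * h d)" "g (x * y) = (h a * h c) / (h b * h d)"
      unfolding e using x y by (simp_all add: g D shomD[OF h])
    then show "g (x + y) = g x + g y" "g (x * y) = g x * g y"
      unfolding x(1) y(1) using x y nz by (simp_all add: g field_simps)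
  qed
  then show ?thesis using gS D(2) shomD(1)[OF h] unfolding shom_def by (metis (no_types, lifting))
qed

lemma frac_hom_eq:
  fixes g k :: "'a::field \<Rightarrow> 'b::field"
  assumes S: "sring S" and g: "shom (frac S) g" and k: "shom (frac S) k"
    and eq: "\<And>a. a \<in> S \<Longrightarrow> g a = k a" and x: "x \<in> frac S"
  shows "g x = k x"
proof -
  obtain a b where ab: "x = a / b" "a \<in> S" "b \<in> S" using x by (metis fracE)
  then show ?thesis using shom_divide[OF g frac_sfield[OF S]] shom_divide[OF k frac_sfield[OF S]] frac_subset[OF S] eq
    by (simp add: subset_iff)
qed

lemma frac_hom_image:
  fixes g :: "'a::field \<Rightarrow> 'b::field"
  assumes S: "sring S" and g: "shom (frac S) g" and R: "sfield R" and eq: "\<And>a. a \<in> S \<Longrightarrow> g a \<in> R"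
    and x: "x \<in> frac S"
  shows "g x \<in> R"
proof -
  obtain a b where ab: "x = a / b" "a \<in> S" "b \<in> S" using x by (metis fracE)
  then show ?thesis using shom_divide[OF g frac_sfield[OF S]] frac_subset[OF S] eq sfieldD(9)[OF R]
    by (simp add: subset_iff)
qed

text \<open>Linear independence over \<open>S\<close> of the first \<open>n\<close> powers of
  \<open>x\<close>. For \<open>n = p\<close> it records that a root of \<open>f\<close> keeps degree
  \<open>p\<close>, in a form that passes to polynomial rings and to fractions.\<close>

definition power_indep :: "'a::comm_ring_1 set \<Rightarrow> nat \<Rightarrow> 'a \<Rightarrow> bool" where
  "power_indep S n x \<longleftrightarrow> (\<forall>A\<in>pol S. degree A < n \<longrightarrow> poly A x = 0 \<longrightarrow> A = 0)"

text \<open>A relation over \<open>S[v]\<close> is regrouped by powers of \<open>v\<close>. The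
  coefficients lie in \<open>T\<close>, which contains \<open>x\<close>, and \<open>v\<close> is
  transcendental over \<open>T\<close>, so each coefficient is a relation over \<open>S\<close> and
  vanishes.\<close>

lemma power_indep_adj:
  fixes x v :: "'a::field"
  assumes S: "sring S" and T: "sring T" and ST: "S \<subseteq> T" and x: "x \<in> T" and v: "transc T v"
    and ind: "power_indep S n x"
  shows "power_indep (adj S v) n x"
  unfolding power_indep_def
proof (intro ballI impI)
  fix A assume A: "A \<in> pol (adj S v)" "degree A < n" "poly A x = 0"
  have "\<forall>l. \<exists>P. P \<in> pol S \<and> coeff A l = poly P v" using polD[OF A(1)] unfolding adj_def by blast
  then obtain P where P: "\<And>l. P l \<in> pol S" "\<And>l. coeff A l = poly (P l) v" by metis
  define R where "R = (\<Sum>l<n. smult (x ^ l) (P l))"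
  have "R \<in> pol T" unfolding R_def using P(1) pol_mono[OF ST] x
    by (intro sring_sum[OF pol_sring[OF T]] pol_smult[OF T] sring_power[OF T]) auto
  moreover have "poly R v = 0"
  proof -
    have "poly R v = (\<Sum>l<n. coeff A l * x ^ l)" unfolding R_def by (simp add: poly_sum P(2) mult.commute)
    also have "\<dots> = (\<Sum>l\<le>degree A. coeff A l * x ^ l)"
      using A(2) by (intro sum.mono_neutral_right) (auto simp: coeff_eq_0)
    finally show ?thesis using A(3) by (simp add: poly_altdef)
  qed
  ultimately have R0: "R = 0" using v unfolding transc_def by blast
  have "P l = 0" if l: "l < n" for l
  proof (rule poly_eqI)
    fix k
    define B where "B = (\<Sum>l<n. monom (coeff (P l) k) l)"
    have cB: "coeff B i = (if i < n then coeff (P i) k else 0)" for i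
      unfolding B_def by (simp add: coeff_sum if_distrib cong: if_cong)
    have "B \<in> pol S" using P(1) sringD(1)[OF S] by (auto simp: pol_def cB)
    moreover have "degree B < n" using l by (intro degree_lessI) (auto simp: cB)
    moreover have "poly B x = 0"
    proof -
      have "poly B x = coeff R k" unfolding B_def R_def by (simp add: poly_sum poly_monom coeff_sum mult.commute)
      then show ?thesis using R0 by simp
    qed
    ultimately have "B = 0" using ind unfolding power_indep_def by blast
    then show "coeff (P l) k = coeff 0 k" using cB[of l] l by simp
  qed
  then have "coeff A l = 0" if "l < n" for l using P(2) that by simp
  then have "coeff A (degree A) = 0" using A(2) by blast
  then show "A = 0" by simp
qed

lemma power_indep_pr:
  fixes x :: "'a::field"
  assumes S: "sring S" and T: "sring T" and ST: "S \<subseteq> T" and x: "x \<in> T" and u: "indep T u m"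
    and ind: "power_indep S n x"
  shows "power_indep (pr S u m) n x"
  using u
proof (induction m)
  case 0
  then show ?case using ind by simp
next
  case (Suc m)
  have "power_indep (adj (pr S u m) (u m)) n x"
    using Suc x pr_base[OF T, of u m]
    by (intro power_indep_adj[OF pr_sring[OF S] pr_sring[OF T] pr_mono[OF ST]]) (auto simp: indep_def)
  then show ?case by simp
qed

lemma power_indep_frac:
  fixes x :: "'a::field"
  assumes S: "sring S" and ind: "power_indep S n x"
  shows "power_indep (frac S) n x"
  unfolding power_indep_def
proof (intro ballI impI)
  fix A assume A: "A \<in> pol (frac S)" "degree A < n" "poly A x = 0"
  obtain d where d: "d \<in> S" "d \<noteq> 0" "smult d A \<in> pol S" using clear_denominators[OF S A(1)] by blast
  then have "smult d A = 0" using ind A(2,3) unfolding power_indep_def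
    by (metis degree_smult_eq poly_smult mult_zero_right)
  then show "A = 0" using d(2) by simp
qed

lemma degree_map_pol: "h 0 = 0 \<Longrightarrow> degree (map_poly h P) \<le> degree P"
  by (rule degree_le) (simp add: coeff_map_poly coeff_eq_0)

lemma map_mod:
  fixes g :: "complex \<Rightarrow> complex"
  assumes g: "shom S g" and S: "sring S" and F: "F \<in> pol S" "lead_coeff F = 1" "degree F > 0" and A: "A \<in> pol S"
  shows "map_poly g (A mod F) = map_poly g A mod map_poly g F"
proof -
  have dm: "A div F \<in> pol S" "A mod F \<in> pol S" using pol_divmod_ring[OF S F(1) _ A] F(2) sringD(2)[OF S] by auto
  have dF: "degree (map_poly g F) = degree F"
  proof (rule antisym)
    show "degree (map_poly g F) \<le> degree F" by (rule degree_map_pol) (rule shom_0[OF g S])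
    show "degree F \<le> degree (map_poly g F)"
      by (rule le_degree) (simp add: map_pol(1)[OF g S] F(2) shomD(1)[OF g])
  qed
  have "A mod F = 0 \<or> degree (A mod F) < degree F" using F by (metis degree_mod_less leading_coeff_0_iff zero_neq_one)
  then have d: "degree (map_poly g (A mod F)) < degree (map_poly g F)"
    using F(3) dF degree_map_pol[of g "A mod F"] shom_0[OF g S] by auto
  have "map_poly g A = map_poly g (F * (A div F) + A mod F)" by simp
  also have "\<dots> = map_poly g F * map_poly g (A div F) + map_poly g (A mod F)"
    unfolding map_pol(2)[OF g S sringD(4)[OF pol_sring[OF S] F(1) dm(1)] dm(2)] map_pol(3)[OF g S F(1) dm(1)] ..
  finally show ?thesis by (simp add: mod_poly_less[OF d])
qed

text \<open>Families of scalings with a parameter are compared at natural numbers, which lie in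
  every field considered and are fixed by all homomorphisms.\<close>

lemma poly_eq_nat:
  fixes P Q :: "complex poly"
  assumes "\<And>n. n \<ge> N \<Longrightarrow> poly P (of_nat n) = poly Q (of_nat n)"
  shows "P = Q"
proof (rule ccontr)
  assume "P \<noteq> Q"
  then have "finite {x. poly (P - Q) x = 0}" by (intro poly_roots_finite) simp
  moreover have "of_nat ` {N..} \<subseteq> {x. poly (P - Q) x = 0}" using assms by auto
  ultimately have "finite (of_nat ` {N..} :: complex set)" by (rule finite_subset[rotated])
  then have "finite {N..}" by (rule finite_imageD) (auto simp: inj_on_def)
  then show False by (simp add: infinite_Ici)
qed

section \<open>Making an element a norm\<close>

text \<open>The identity automorphism is allowed and serves as the start of
  \<open>base_field\<close>; order exactly \<open>p\<close> comes from
  \<open>s v = \<zeta> * v\<close> later.\<close>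

definition cyc :: "nat \<Rightarrow> complex set \<Rightarrow> (complex \<Rightarrow> complex) \<Rightarrow> bool" where
  "cyc p M s \<longleftrightarrow> sfield M \<and> countable M \<and> shom M s \<and> (\<forall>z\<in>M. s z \<in> M) \<and> (\<forall>z\<in>M. (s ^^ p) z = z)"

definition fixK :: "complex set \<Rightarrow> (complex \<Rightarrow> complex) \<Rightarrow> complex set" where
  "fixK M s = {z \<in> M. s z = z}"

definition nrm :: "nat \<Rightarrow> (complex \<Rightarrow> complex) \<Rightarrow> complex \<Rightarrow> complex" where
  "nrm p s z = (\<Prod>i<p. (s ^^ i) z)"

text \<open>The last clause says that no element of the old fixed field becomes a norm. Quantifying
  over all \<open>c\<close> makes the relation transitive and stable under unions of chains.\<close>

definition cext :: "nat \<Rightarrow> complex set \<Rightarrow> (complex \<Rightarrow> complex) \<Rightarrow> complex set \<Rightarrow> (complex \<Rightarrow> complex) \<Rightarrow> bool" where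
  "cext p M s M' s' \<longleftrightarrow> cyc p M' s' \<and> M \<subseteq> M' \<and> (\<forall>z\<in>M. s' z = s z) \<and>
     (\<forall>c\<in>fixK M s. \<forall>x\<in>M'. nrm p s' x = c \<longrightarrow> (\<exists>y\<in>M. nrm p s y = c))"

lemma funpow_in: "(\<And>z. z \<in> M \<Longrightarrow> s z \<in> M) \<Longrightarrow> z \<in> M \<Longrightarrow> (s ^^ i) z \<in> M"
  by (induction i) auto

lemma funpow_fix: "s z = z \<Longrightarrow> (s ^^ i) z = z"
  by (induction i) auto

lemma funpow_agree:
  assumes "\<And>z. z \<in> M \<Longrightarrow> s z \<in> M" "\<And>z. z \<in> M \<Longrightarrow> s' z = s z" "z \<in> M"
  shows "(s' ^^ i) z = (s ^^ i) z"
  using assms(3) by (induction i) (auto simp: assms funpow_in)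

lemma funpow_shom:
  assumes "shom M s" "\<And>z. z \<in> M \<Longrightarrow> s z \<in> M"
  shows "shom M (s ^^ i)"
proof (induction i)
  case 0
  then show ?case by (simp add: shom_def)
next
  case (Suc i)
  have "shom M (\<lambda>x. s ((s ^^ i) x))"
    by (rule shom_comp[OF Suc assms(1)]) (use assms(2) in \<open>auto intro: funpow_in\<close>)
  then show ?case by (simp add: o_def)
qed

lemma nrm_mult:
  assumes "shom M s" "\<And>z. z \<in> M \<Longrightarrow> s z \<in> M" "x \<in> M" "y \<in> M"
  shows "nrm p s (x * y) = nrm p s x * nrm p s y"
  unfolding nrm_def using shomD(3)[OF funpow_shom[OF assms(1,2)]] assms(3,4) by (simp add: prod.distrib)

lemma nrm_fix: "s z = z \<Longrightarrow> nrm p s z = z ^ p"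
  unfolding nrm_def by (simp add: funpow_fix)

lemma nrm_divide:
  assumes M: "sfield M" and s: "shom M s" "\<And>z. z \<in> M \<Longrightarrow> s z \<in> M" "x \<in> M" "y \<in> M"
  shows "nrm p s (x / y) = nrm p s x / nrm p s y"
  unfolding nrm_def using shom_divide[OF funpow_shom[OF s(1,2)] M s(3,4)] by (simp add: prod_dividef)

text \<open>The product for \<open>s z\<close> is the product for \<open>z\<close> with its factor
  \<open>z\<close> replaced by \<open>(s ^^ p) z\<close>. This form also fits \<open>phi\<close>,
  whose \<open>p\<close>-th power is not the identity but the scaling by \<open>t\<close>.\<close>

lemma nrm_shift:
  "nrm p s (s z) * z = nrm p s z * (s ^^ p) z"
proof -
  have "nrm p s (s z) * z = (\<Prod>i<p. (s ^^ Suc i) z) * (s ^^ 0) z" unfolding nrm_def by (simp add: funpow_swap1)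
  also have "\<dots> = (\<Prod>i<Suc p. (s ^^ i) z)" by (simp only: prod.lessThan_Suc_shift mult.commute)
  finally show ?thesis unfolding nrm_def by simp
qed

text \<open>One step of the tower. The variables are independent over \<open>adj M \<theta>\<close>
  and not just over \<open>M\<close>, so that \<open>\<theta>\<close> keeps degree \<open>p\<close>
  over the field they generate.\<close>

locale lstep =
  fixes p :: nat and M :: "complex set" and s :: "complex \<Rightarrow> complex" and f :: "complex poly"
    and t \<theta> :: complex and u :: "nat \<Rightarrow> complex"
  assumes p: "prime p" and M: "cyc p M s" and fK: "f \<in> pol (fixK M s)" and df: "degree f = p"
    and lf: "lead_coeff f = 1" and irr: "irr M f" and t: "t \<in> fixK M s" "t \<noteq> 0"
    and \<theta>: "poly f \<theta> = 0" and u: "\<And>m. indep (adj M \<theta>) u m"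
begin

lemma dvd_root: "f dvd P \<Longrightarrow> poly P \<theta> = 0"
  using \<theta> by (metis dvd_def poly_mult mult_zero_left)

lemma p2: "p \<ge> 2" using p by (rule prime_ge_2_nat)

lemma Mf: "sfield M" and Mc: "countable M" and sh: "shom M s" and sM: "z \<in> M \<Longrightarrow> s z \<in> M"
  and sp: "z \<in> M \<Longrightarrow> (s ^^ p) z = z"
  using M unfolding cyc_def by auto

lemmas Mr = sfieldD(1)[OF Mf]
lemmas MD = sfieldD[OF Mf]

lemma fM: "f \<in> pol M" and tM: "t \<in> M" "s t = t" and f0: "f \<noteq> 0"
  using fK t pol_mono[of "fixK M s" M] lf by (auto simp: fixK_def)

text \<open>\<open>S\<close> is a polynomial ring in \<open>p\<^sup>2\<close> variables \<open>U i l\<close>. They are the coordinates, with respect to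
  \<open>1, x, \<dots>, x\<^sup>p\<^sup>-\<^sup>1\<close>, of \<open>p\<close> generic elements \<open>u\<^sub>i\<close> (\<open>Up i\<close>) of \<open>L = M[x]/f\<close>.\<close>
definition S where "S = pr M u (p * p)"
definition U where "U i l = u (i * p + l)"
definition Up where "Up i = (\<Sum>l<p. monom (U i l) l)"

section \<open>The generic polynomial ring and its universal property\<close>

lemma uM: "indep M u m"
  using indep_subset[OF u adj_sring(2)[OF Mr]] .

lemma Sr: "sring S" and SM: "M \<subseteq> S" and Sfac: "factorial S" and Scount: "countable S"
  unfolding S_def by (rule pr_sring[OF Mr], rule pr_base[OF Mr], rule factorial_pr[OF Mf uM], rule countable_pr[OF Mc])

lemmas SD = sringD[OF Sr]

lemma UV: "i < p \<Longrightarrow> l < p \<Longrightarrow> i * p + l < p * p"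
proof -
  assume "i < p" "l < p"
  then have "i * p + l < Suc i * p" by simp
  also have "\<dots> \<le> p * p" using \<open>i < p\<close> by (intro mult_le_mono1) simp
  finally show ?thesis .
qed

lemma US: "i < p \<Longrightarrow> l < p \<Longrightarrow> U i l \<in> S"
  unfolding S_def U_def by (intro pr_var[OF Mr] UV)

lemma coeff_Up: "coeff (Up i) l = (if l < p then U i l else 0)"
  unfolding Up_def by (simp add: coeff_sum if_distrib cong: if_cong)

lemma UpS: "i < p \<Longrightarrow> Up i \<in> pol S"
  by (auto intro!: polI simp: coeff_Up US SD(1))

lemma Up_deg: "degree (Up i) < p"
  using p2 by (intro degree_lessI) (auto simp: coeff_Up)

lemma mod_less: "degree (A mod f) < p"
  using degree_mod_less[OF f0, of A] df p2 by auto

lemma var_split: "j < p * p \<Longrightarrow> j div p < p \<and> j mod p < p \<and> u j = U (j div p) (j mod p)"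
  using p2 by (simp add: U_def less_mult_imp_div_less)

lemma hm_ex:
  assumes "shom M h"
  shows "\<exists>g. shom S g \<and> (\<forall>a\<in>M. g a = h a) \<and> (\<forall>i<p. \<forall>l<p. g (U i l) = W i l)"
proof -
  obtain g where g: "shom S g" "\<forall>a\<in>M. g a = h a" "\<forall>j<p*p. g (u j) = W (j div p) (j mod p)"
    using pr_hom[OF Mr uM assms, of "p * p" "\<lambda>j. W (j div p) (j mod p)"] unfolding S_def by blast
  have "g (U i l) = W i l" if "i < p" "l < p" for i l
    using g(3) UV[OF that] that unfolding U_def by simp
  then show ?thesis using g by blast
qed

lemma hm_eq:
  assumes "shom S g" "shom S k" "\<And>a. a \<in> M \<Longrightarrow> g a = k a" "\<And>i l. i < p \<Longrightarrow> l < p \<Longrightarrow> g (U i l) = k (U i l)" "z \<in> S"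
  shows "g z = k z"
  by (rule pr_hom_eq[OF Mr assms(1)[unfolded S_def] assms(2)[unfolded S_def]])
    (use assms(3-5) var_split in \<open>auto simp: S_def\<close>)

lemma hm_image:
  assumes "shom S g" "sring R" "\<And>a. a \<in> M \<Longrightarrow> g a \<in> R" "\<And>i l. i < p \<Longrightarrow> l < p \<Longrightarrow> g (U i l) \<in> R" "z \<in> S"
  shows "g z \<in> R"
  by (rule pr_hom_image[OF Mr assms(1)[unfolded S_def] assms(2)])
    (use assms(3-5) var_split in \<open>auto simp: S_def\<close>)

text \<open>The substitution \<open>u\<^sub>i \<mapsto> l u\<^sub>i\<close>, with \<open>l\<close> read in \<open>L = M[x]/f\<close>.\<close>
definition rho where
  "rho l = (SOME g. shom S g \<and> (\<forall>a\<in>M. g a = a) \<and> (\<forall>i<p. \<forall>k<p. g (U i k) = coeff ((l * Up i) mod f) k))"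

lemma rho: "shom S (rho l) \<and> (\<forall>a\<in>M. rho l a = a) \<and> (\<forall>i<p. \<forall>k<p. rho l (U i k) = coeff ((l * Up i) mod f) k)"
proof -
  have "shom M (\<lambda>x. x)" by (simp add: shom_def)
  from hm_ex[OF this] show ?thesis unfolding rho_def by (rule someI_ex)
qed

lemma rho_hom: "shom S (rho l)" and rho_M: "a \<in> M \<Longrightarrow> rho l a = a"
  and rho_U: "i < p \<Longrightarrow> k < p \<Longrightarrow> rho l (U i k) = coeff ((l * Up i) mod f) k"
  using rho by blast+

lemma rho_Up: "i < p \<Longrightarrow> map_poly (rho l) (Up i) = (l * Up i) mod f"
proof (intro poly_eqI)
  fix k assume i: "i < p"
  show "coeff (map_poly (rho l) (Up i)) k = coeff ((l * Up i) mod f) k"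
  proof (cases "k < p")
    case True
    then show ?thesis using i by (simp add: map_pol(1)[OF rho_hom Sr] coeff_Up rho_U)
  next
    case False
    then show ?thesis using mod_less[of "l * Up i"]
      by (simp add: map_pol(1)[OF rho_hom Sr] coeff_Up shom_0[OF rho_hom Sr] coeff_eq_0)
  qed
qed

lemma map_rho_M: "l \<in> pol M \<Longrightarrow> map_poly (rho a) l = l"
  by (intro poly_eqI) (simp add: map_pol(1)[OF rho_hom Sr] rho_M polD)

lemma modS: "A \<in> pol S \<Longrightarrow> A mod f \<in> pol S"
  using pol_divmod_ring[OF Sr, of f A] fM pol_mono[OF SM] lf SD(2) by auto

lemma polMS: "l \<in> pol M \<Longrightarrow> l \<in> pol S"
  using pol_mono[OF SM] by blast

lemma polS_mult: "A \<in> pol S \<Longrightarrow> B \<in> pol S \<Longrightarrow> A * B \<in> pol S"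
  using sringD(4)[OF pol_sring[OF Sr]] .

lemma map_rho_mod: "A \<in> pol S \<Longrightarrow> map_poly (rho a) (A mod f) = map_poly (rho a) A mod f"
  using map_mod[OF rho_hom Sr polMS[OF fM] lf, of A a] map_rho_M[OF fM] df p2 by simp

lemma rho_in: "l \<in> pol M \<Longrightarrow> z \<in> S \<Longrightarrow> rho l z \<in> S"
proof (rule hm_image[OF rho_hom Sr])
  fix i k assume "l \<in> pol M" "i < p" "k < p"
  then have "(l * Up i) mod f \<in> pol S" by (intro modS polS_mult polMS UpS)
  then show "rho l (U i k) \<in> S" using \<open>i < p\<close> \<open>k < p\<close> by (simp add: rho_U polD)
qed (use SM in \<open>auto simp: rho_M\<close>)

lemma rho_mult:
  assumes b: "b \<in> pol M" and z: "z \<in> S"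
  shows "rho a (rho b z) = rho (a * b) z"
proof (rule hm_eq[OF _ rho_hom _ _ z])
  show "shom S (\<lambda>z. rho a (rho b z))"
    by (rule shom_comp[OF rho_hom rho_hom]) (use rho_in[OF b] in auto)
  show "rho a (rho b x) = rho (a * b) x" if "x \<in> M" for x using that by (simp add: rho_M)
  fix i k assume ik: "i < p" "k < p"
  have bU: "b * Up i \<in> pol S" by (intro polS_mult polMS b UpS ik)
  have "rho a (rho b (U i k)) = coeff (map_poly (rho a) ((b * Up i) mod f)) k"
    using ik by (simp add: rho_U map_pol(1)[OF rho_hom Sr])
  also have "map_poly (rho a) ((b * Up i) mod f) = (b * ((a * Up i) mod f)) mod f"
    using ik b by (simp add: map_rho_mod[OF bU] map_pol(3)[OF rho_hom Sr polMS UpS] map_rho_M rho_Up)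
  also have "\<dots> = (a * b * Up i) mod f" by (simp add: mod_mult_right_eq ac_simps)
  finally show "rho a (rho b (U i k)) = rho (a * b) (U i k)" using ik by (simp add: rho_U)
qed

lemma rho_cong: "a mod f = b mod f \<Longrightarrow> z \<in> S \<Longrightarrow> rho a z = rho b z"
proof (rule hm_eq[OF rho_hom rho_hom])
  assume ab: "a mod f = b mod f"
  show "rho a (U i k) = rho b (U i k)" if "i < p" "k < p" for i k
    using that mod_mult_cong[OF ab refl, of "Up i"] by (simp add: rho_U)
qed (auto simp: rho_M)

lemma rho_1: "z \<in> S \<Longrightarrow> rho 1 z = z"
proof (rule hm_eq[OF rho_hom])
  show "shom S (\<lambda>z. z)" by (simp add: shom_def)
  show "rho 1 (U i k) = U i k" if "i < p" "k < p" for i k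
    using that Up_deg[of i] by (simp add: rho_U mod_poly_less df coeff_Up)
qed (auto simp: rho_M)

lemma pcM: "a \<in> M \<Longrightarrow> b \<in> M \<Longrightarrow> [:a, b:] \<in> pol M"
  using MD(2) by (simp add: pol_pCons)

lemma natM: "of_nat n \<in> M"
  by (rule sring_of_nat[OF Mr])

text \<open>Up to the scalar \<open>f(a)\<close>, the inverse of \<open>a - x\<close> modulo \<open>f\<close>.\<close>
definition sd where "sd x = (\<Sum>k<p. smult (x ^ k) (poly_shift (Suc k) f))"

text \<open>The shifts satisfy Horner's recursion, so the product telescopes to
  \<open>f(x) - f\<close>; modulo \<open>f\<close> this is the scalar \<open>f(x)\<close>.\<close>

lemma sd_mult: "[:x, -1:] * sd x = [:poly f x:] - f"
proof -
  have shift: "pCons 0 (poly_shift (Suc k) f) = poly_shift k f - [:coeff f k:]" for k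
    by (intro poly_eqI) (simp add: coeff_pCons coeff_poly_shift split: nat.splits)
  have sd': "[:x, -1:] * smult (x ^ k) (poly_shift (Suc k) f) =
      smult (x ^ Suc k) (poly_shift (Suc k) f) - smult (x ^ k) (poly_shift k f) + [:coeff f k * x ^ k:]" for k
  proof -
    have "[:x, -1:] * smult (x ^ k) (poly_shift (Suc k) f) =
        smult (x ^ Suc k) (poly_shift (Suc k) f) - smult (x ^ k) (pCons 0 (poly_shift (Suc k) f))" for k
      by (intro poly_eqI) (simp add: coeff_pCons algebra_simps split: nat.splits)
    then show ?thesis unfolding shift by (simp add: smult_diff_right mult.commute)
  qed
  have "[:x, -1:] * sd x = (\<Sum>k<p. smult (x ^ Suc k) (poly_shift (Suc k) f) - smult (x ^ k) (poly_shift k f)) +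
      (\<Sum>k<p. [:coeff f k * x ^ k:])"
    unfolding sd_def sum_distrib_left sd' by (simp add: sum.distrib)
  also have "(\<Sum>k<p. smult (x ^ Suc k) (poly_shift (Suc k) f) - smult (x ^ k) (poly_shift k f)) =
      smult (x ^ p) (poly_shift p f) - f"
    by (subst sum_lessThan_telescope) simp
  also have "poly_shift p f = [:1:]"
    using lf df by (intro poly_eqI) (auto simp: coeff_poly_shift coeff_pCons coeff_eq_0 split: nat.splits)
  also have "(\<Sum>k<p. [:coeff f k * x ^ k:]) = [:\<Sum>k<p. coeff f k * x ^ k:]"
    by (induction p) auto
  finally have "[:x, -1:] * sd x = [:x ^ p + (\<Sum>k<p. coeff f k * x ^ k):] - f" by simp
  also have "x ^ p + (\<Sum>k<p. coeff f k * x ^ k) = poly f x"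
    using lf df by (simp add: poly_altdef lessThan_Suc_atMost[symmetric])
  finally show ?thesis .
qed

lemma rho_const_inj:
  assumes c: "c \<in> M" "c \<noteq> 0" and z: "z \<in> S" "rho [:c:] z = 0"
  shows "z = 0"
proof -
  have "rho [:inverse c:] (rho [:c:] z) = rho ([:inverse c:] * [:c:]) z"
    by (rule rho_mult) (use c z MD(2) in auto)
  also have "[:inverse c:] * [:c:] = 1" using c by (simp add: one_pCons)
  finally show ?thesis using z(2) rho_1[OF z(1)] rho_M[OF MD(2)] by simp
qed

lemma fx0: "x \<in> M \<Longrightarrow> poly f x \<noteq> 0"
proof
  assume x: "x \<in> M" "poly f x = 0"
  then have "[:-x, 1:] dvd f" by (simp add: poly_eq_0_iff_dvd)
  moreover have "[:-x, 1:] \<in> pol M" using x MD by (intro pcM) auto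
  ultimately show False using irrD(4)[OF irr, of "[:-x, 1:]"] df p2 by auto
qed

text \<open>\<open>f(x)\<close> is nonzero because \<open>f\<close> has no root in \<open>M\<close>,
  and by \<open>sd_mult\<close> the injective scaling by \<open>f(x)\<close> factors through the one
  in question.\<close>

lemma rho_lin_inj:
  assumes x: "x \<in> M" and z: "z \<in> S" "rho [:x, -1:] z = 0"
  shows "z = 0"
proof -
  have l: "[:x, -1:] \<in> pol M" using x MD by (intro pcM) auto
  have "rho [:poly f x:] z = rho (sd x * [:x, -1:]) z"
    by (rule rho_cong[OF _ z(1)]) (simp only: sd_mult mult.commute[of "sd x"], simp add: poly_mod_diff_left)
  also have "\<dots> = rho (sd x) (rho [:x, -1:] z)" by (rule rho_mult[OF l z(1), symmetric])
  also have "\<dots> = 0" using z(2) rho_M[OF MD(2)] by simp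
  finally show ?thesis using rho_const_inj[OF poly_in[OF Mr fM x] fx0[OF x] z(1)] by simp
qed

text \<open>The new field consists of the fractions fixed by these scalings. The scaling by \<open>2\<close> forces
  homogeneity, the one by \<open>t\<close> is \<open>phi\<^sup>p\<close>, and the scalings by \<open>n - x\<close> control the degree of semi-invariants.\<close>
definition Lam where "Lam = {[:2:], [:t:]} \<union> (\<lambda>n. [:of_nat n, -1:]) ` UNIV"

lemma LamM: "l \<in> Lam \<Longrightarrow> l \<in> pol M"
proof -
  have "[:of_nat n, -1:] \<in> pol M" for n using pcM[OF natM MD(6)[OF MD(3)]] by simp
  moreover have "[:2:] \<in> pol M" "[:t:] \<in> pol M" using natM[of 2] tM MD(2) by simp_all
  ultimately show "l \<in> Lam \<Longrightarrow> l \<in> pol M" unfolding Lam_def by auto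
qed

lemma Lam_inj: "l \<in> Lam \<Longrightarrow> z \<in> S \<Longrightarrow> rho l z = 0 \<Longrightarrow> z = 0"
  unfolding Lam_def using rho_const_inj[OF tM(1) t(2)] rho_const_inj[OF natM[of 2]] rho_lin_inj[OF natM] by auto

text \<open>If the coordinates of \<open>l x * Up i\<close> modulo \<open>f\<close> are polynomial
  in a parameter \<open>x\<close>, they define a homomorphism from \<open>S\<close> to polynomials
  whose value at \<open>x\<close> is \<open>rho (l x)\<close>. Semi-invariance at infinitely many
  integers then becomes a polynomial identity.\<close>

lemma family:
  assumes W: "\<And>i k x. i < p \<Longrightarrow> k < p \<Longrightarrow> poly (W i k) x = coeff ((l x * Up i) mod f) k"
  shows "\<exists>P. (\<forall>z\<in>S. \<forall>x. poly (P z) x = rho (l x) z) \<and>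
    ((\<forall>i<p. \<forall>k<p. W i k \<in> pol S) \<longrightarrow> (\<forall>z\<in>S. P z \<in> pol S))"
proof -
  have "shom M (\<lambda>a. [:a:])" by (simp add: shom_def one_pCons)
  then obtain P where P: "shom S P" "\<forall>a\<in>M. P a = [:a:]" "\<forall>i<p. \<forall>k<p. P (U i k) = W i k"
    using hm_ex by blast
  have "poly (P z) x = rho (l x) z" if z: "z \<in> S" for z x
  proof (rule hm_eq[OF _ rho_hom _ _ z])
    show "shom S (\<lambda>z. poly (P z) x)" using P(1) by (simp add: shom_def)
  qed (use P W in \<open>auto simp: rho_M rho_U\<close>)
  moreover have "P z \<in> pol S" if W': "\<forall>i<p. \<forall>k<p. W i k \<in> pol S" and z: "z \<in> S" for z
  proof (rule hm_image[OF P(1) pol_sring[OF Sr] _ _ z])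
    show "P a \<in> pol S" if "a \<in> M" for a using P(2) that SM SD(1) by auto
    show "P (U i k) \<in> pol S" if "i < p" "k < p" for i k using P(3) W' that by simp
  qed
  ultimately show ?thesis by blast
qed

lemma smult_mod: "smult x (Up i) mod f = smult x (Up i)"
  using Up_deg[of i] degree_smult_le[of x "Up i"] by (simp add: mod_poly_less df)

text \<open>Scaling all variables by one indeterminate; the degree \<open>dg\<close> in it is the total degree.\<close>
definition hom where
  "hom = (SOME P. (\<forall>z\<in>S. \<forall>x. poly (P z) x = rho [:x:] z) \<and> (\<forall>z\<in>S. P z \<in> pol S))"

lemma hom: "(\<forall>z\<in>S. \<forall>x. poly (hom z) x = rho [:x:] z) \<and> (\<forall>z\<in>S. hom z \<in> pol S)"
proof -
  have "\<exists>P. (\<forall>z\<in>S. \<forall>x. poly (P z) x = rho [:x:] z) \<and>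
    ((\<forall>i<p. \<forall>k<p. [:0, U i k:] \<in> pol S) \<longrightarrow> (\<forall>z\<in>S. P z \<in> pol S))"
    by (rule family) (simp add: smult_mod coeff_Up)
  moreover have "\<forall>i<p. \<forall>k<p. [:0, U i k:] \<in> pol S" using US SD(1) by (simp add: pol_pCons)
  ultimately have "\<exists>P. (\<forall>z\<in>S. \<forall>x. poly (P z) x = rho [:x:] z) \<and> (\<forall>z\<in>S. P z \<in> pol S)" by blast
  then show ?thesis unfolding hom_def by (rule someI_ex)
qed

lemma poly_hom: "z \<in> S \<Longrightarrow> poly (hom z) x = rho [:x:] z" and homS: "z \<in> S \<Longrightarrow> hom z \<in> pol S"
  using hom by auto

definition dg where "dg z = degree (hom z)"

lemma hom_1: "z \<in> S \<Longrightarrow> poly (hom z) 1 = z"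
  using poly_hom[of z 1] rho_1[of z] by (simp add: one_pCons)

lemma dg_mult: "a \<in> S \<Longrightarrow> b \<in> S \<Longrightarrow> a \<noteq> 0 \<Longrightarrow> b \<noteq> 0 \<Longrightarrow> dg (a * b) = dg a + dg b"
proof -
  assume ab: "a \<in> S" "b \<in> S" "a \<noteq> 0" "b \<noteq> 0"
  have "hom (a * b) = hom a * hom b"
    by (rule poly_eq_nat[of 0]) (use ab SD(4) in \<open>simp add: poly_hom shomD(3)[OF rho_hom]\<close>)
  moreover have "hom a \<noteq> 0" "hom b \<noteq> 0" using ab hom_1 by force+
  ultimately show ?thesis unfolding dg_def by (simp add: degree_mult_eq)
qed

lemma rho_0_M: "z \<in> S \<Longrightarrow> rho 0 z \<in> M"
  by (rule hm_image[OF rho_hom Mr]) (auto simp: rho_M rho_U MD)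

lemma dg_M: "a \<in> M \<Longrightarrow> dg a = 0"
proof -
  assume a: "a \<in> M"
  then have "hom a = [:a:]" using SM by (intro poly_eq_nat[of 0]) (auto simp: poly_hom rho_M)
  then show ?thesis by (simp add: dg_def)
qed

lemma dg_0: "z \<in> S \<Longrightarrow> dg z = 0 \<longleftrightarrow> z \<in> M"
proof
  assume z: "z \<in> S" "dg z = 0"
  then obtain c where c: "hom z = [:c:]" unfolding dg_def by (meson degree_eq_zeroE)
  have "z = c" "rho 0 z = c" using hom_1[OF z(1)] poly_hom[OF z(1), of 0] c by simp_all
  then show "z \<in> M" using rho_0_M[OF z(1)] by simp
qed (simp add: dg_M)

lemma unitS: "sunit S a \<longleftrightarrow> a \<in> M \<and> a \<noteq> 0"
proof
  assume "sunit S a"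
  then obtain b where b: "a \<in> S" "b \<in> S" "a * b = 1" unfolding sunit_def by blast
  then have "a \<noteq> 0" "b \<noteq> 0" by auto
  then have "dg a + dg b = 0" using dg_mult[OF b(1,2)] b(3) dg_M[OF MD(3)] by simp
  then show "a \<in> M \<and> a \<noteq> 0" using dg_0 b(1) \<open>a \<noteq> 0\<close> by simp
next
  assume "a \<in> M \<and> a \<noteq> 0"
  then show "sunit S a" unfolding sunit_def using SM MD(8)[of a] by (auto intro!: bexI[of _ "inverse a"])
qed

text \<open>\<open>g\<close> acts on the coefficients of \<open>hom z\<close>; commuting with
  integer scalings is enough to identify the result with \<open>hom (g z)\<close>, and injectivity
  keeps the leading coefficient nonzero.\<close>

lemma dg_hom:
  assumes g: "shom S g" "\<And>z. z \<in> S \<Longrightarrow> g z \<in> S" "\<And>z. z \<in> S \<Longrightarrow> g z = 0 \<Longrightarrow> z = 0"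
    and c: "\<And>n z. z \<in> S \<Longrightarrow> g (rho [:of_nat n:] z) = rho [:of_nat n:] (g z)" and z: "z \<in> S"
  shows "dg (g z) = dg z"
proof -
  have "hom (g z) = map_poly g (hom z)"
  proof (rule poly_eq_nat[of 0])
    fix n
    have "poly (hom (g z)) (of_nat n) = g (poly (hom z) (of_nat n))" using z g(2) c by (simp add: poly_hom)
    also have "\<dots> = poly (map_poly g (hom z)) (of_nat n)"
      using shom_poly[OF g(1) Sr homS[OF z], of "of_nat n"] shom_of_nat[OF g(1) Sr] sring_of_nat[OF Sr] by simp
    finally show "poly (hom (g z)) (of_nat n) = poly (map_poly g (hom z)) (of_nat n)" .
  qed
  moreover have "degree (map_poly g (hom z)) = degree (hom z)"
  proof (cases "hom z = 0")
    case False
    then have "g (lead_coeff (hom z)) \<noteq> 0"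
      using g(3)[OF polD[OF homS[OF z]], of "degree (hom z)"] by (meson leading_coeff_0_iff)
    then have "degree (hom z) \<le> degree (map_poly g (hom z))" by (intro le_degree) (simp add: map_pol(1)[OF g(1) Sr])
    then show ?thesis using degree_map_pol[of g "hom z"] shom_0[OF g(1) Sr] by simp
  qed simp
  ultimately show ?thesis by (simp add: dg_def)
qed

lemma natpM: "[:of_nat n:] \<in> pol M"
  using natM MD(2) by simp

lemma dg_rho: "l \<in> Lam \<Longrightarrow> z \<in> S \<Longrightarrow> dg (rho l z) = dg z"
  by (rule dg_hom[OF rho_hom]) (auto simp: rho_in LamM Lam_inj rho_mult natpM mult.commute)

text \<open>Numerators and denominators of invariant fractions in lowest terms are invariant only up
  to factors from \<open>M\<close>; see \<open>norm_descends\<close>.\<close>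

definition semi where
  "semi z \<longleftrightarrow> z \<in> S \<and> z \<noteq> 0 \<and> (\<forall>l\<in>Lam. \<exists>c\<in>M. rho l z = c * z)"

lemma semiD: "semi z \<Longrightarrow> z \<in> S" "semi z \<Longrightarrow> z \<noteq> 0"
  "semi z \<Longrightarrow> l \<in> Lam \<Longrightarrow> \<exists>c\<in>M. c \<noteq> 0 \<and> rho l z = c * z"
  unfolding semi_def using Lam_inj by (blast, blast, metis mult_zero_left)

lemma semi_quot:
  assumes a: "semi a" and b: "semi b" and c: "c \<in> S" "a = b * c"
  shows "semi c"
  unfolding semi_def
proof (intro conjI ballI)
  show "c \<noteq> 0" using semiD(2)[OF a] c by auto
  fix l assume l: "l \<in> Lam"
  obtain x where x: "x \<in> M" "rho l a = x * a" using semiD(3)[OF a l] by blast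
  obtain y where y: "y \<in> M" "y \<noteq> 0" "rho l b = y * b" using semiD(3)[OF b l] by blast
  have "rho l a = rho l b * rho l c" unfolding c(2) by (rule shomD(3)[OF rho_hom semiD(1)[OF b] c(1)])
  then have "b * (x * c) = b * (y * rho l c)" using x(2) y(3) unfolding c(2) by (simp add: ac_simps)
  then have "rho l c = (x / y) * c" using y(2) semiD(2)[OF b] by (simp add: field_simps)
  then show "\<exists>c'\<in>M. rho l c = c' * c" using MD(9)[OF x(1) y(1)] by blast
qed (rule c(1))

text \<open>A scaling sends the gcd to another common divisor of the same degree, which therefore
  differs from it by a constant of \<open>M\<close>.\<close>

lemma semi_gcd:
  assumes x: "semi x" and y: "semi y"
  shows "\<exists>g. semi g \<and> sdvd S g x \<and> sdvd S g y \<and> (\<forall>d\<in>S. sdvd S d x \<longrightarrow> sdvd S d y \<longrightarrow> sdvd S d g)"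
proof -
  obtain g where g: "g \<in> S" "sdvd S g x" "sdvd S g y" "\<And>d. d \<in> S \<Longrightarrow> sdvd S d x \<Longrightarrow> sdvd S d y \<Longrightarrow> sdvd S d g"
    using factorial_gcd[OF Sfac semiD(1,2)[OF x] semiD(1)[OF y]] by blast
  have g0: "g \<noteq> 0" using g(2) semiD(2)[OF x] by (auto simp: sdvd_def)
  have "semi g" unfolding semi_def
  proof (intro conjI ballI g g0)
    fix l assume l: "l \<in> Lam"
    have dv: "sdvd S (rho l g) z" if z: "semi z" "sdvd S g z" for z
    proof -
      obtain c where c: "z = g * c" "c \<in> S" using z(2) by (rule sdvdE)
      obtain y where y: "y \<in> M" "y \<noteq> 0" "rho l z = y * z" using semiD(3)[OF z(1) l] by blast
      have "z = rho l g * (rho l c * inverse y)"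
        using y shomD(3)[OF rho_hom g(1) c(2)] c(1) by (simp add: field_simps)
      then show ?thesis using SD(4)[OF rho_in[OF LamM[OF l] c(2)]] MD(8)[OF y(1)] SM by (intro sdvdI) auto
    qed
    have "sdvd S (rho l g) g" using g(4)[OF rho_in[OF LamM[OF l] g(1)] dv[OF x g(2)] dv[OF y g(3)]] .
    then obtain q where q: "g = rho l g * q" "q \<in> S" by (rule sdvdE)
    have nz: "q \<noteq> 0" "rho l g \<noteq> 0" using q(1) g0 by auto
    have "dg q = 0" using dg_mult[OF rho_in[OF LamM[OF l] g(1)] q(2) nz(2,1)] dg_rho[OF l g(1)] q(1) by simp
    then have "q \<in> M" using dg_0[OF q(2)] by simp
    moreover have "rho l g = inverse q * g" using nz by (subst q(1)) simp
    ultimately show "\<exists>c\<in>M. rho l g = c * g" using MD(8) by blast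
  qed
  then show ?thesis using g by blast
qed

text \<open>A semi-invariant \<open>P\<close> of degree \<open>d\<close> is multiplied by \<open>G(n)\<close> under the scaling by \<open>n - x\<close>, for a
  polynomial \<open>G\<close> of degree \<open>d\<close> over \<open>M\<close>. By \<open>sd_mult\<close> it divides \<open>f\<^sup>d\<close>, so that it is a power of \<open>f\<close>
  up to a constant.\<close>
lemma semi_degree:
  assumes P: "semi P"
  shows "rho [:t:] P = t ^ dg P * P" "p dvd dg P"
proof -
  note PS = semiD(1)[OF P] and P0 = semiD(2)[OF P]
  define d where "d = dg P"
  have homP: "hom P = monom P d"
  proof -
    obtain c where c: "c \<in> M" "rho [:2:] P = c * P" using semiD(3)[OF P, of "[:2:]"] by (auto simp: Lam_def)
    \<comment> \<open>Scaling by 2 multiplies the coefficient of degree \<open>i\<close> by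
      \<open>2 ^ i\<close>; these factors are distinct, so \<open>hom P\<close> has a single
      term.\<close>
    have "pcompose (hom P) [:0, 2:] = smult c (hom P)"
    proof (rule poly_eq_nat[of 0])
      fix n
      have "rho [:of_nat n * 2:] P = rho ([:of_nat n:] * [:2:]) P" by (simp add: mult.commute)
      also have "\<dots> = rho [:of_nat n:] (c * P)" using rho_mult[OF _ PS, of "[:2:]"] natM[of 2] MD(2) c by simp
      also have "\<dots> = c * rho [:of_nat n:] P" using c SM PS by (simp add: shomD(3)[OF rho_hom] rho_M subset_iff)
      finally show "poly (pcompose (hom P) [:0, 2:]) (of_nat n) = poly (smult c (hom P)) (of_nat n)"
        using PS by (simp add: poly_pcompose poly_hom mult.commute)
    qed
    then have e: "2 ^ i * coeff (hom P) i = c * coeff (hom P) i" for i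
      by (metis coeff_pcompose_linear coeff_smult)
    have hP0: "hom P \<noteq> 0" using hom_1[OF PS] P0 by auto
    then have "coeff (hom P) d \<noteq> 0" unfolding d_def dg_def by simp
    then have cd: "c = 2 ^ d" using e[of d] by simp
    have z: "coeff (hom P) i = 0" if "i \<noteq> d" for i
    proof (rule ccontr)
      assume "coeff (hom P) i \<noteq> 0"
      then have "(2::complex) ^ i = 2 ^ d" using e[of i] cd by simp
      then have "(2::nat) ^ i = 2 ^ d" by (metis of_nat_eq_iff of_nat_numeral of_nat_power)
      then show False using that by simp
    qed
    have "hom P = monom (coeff (hom P) d) d" using z by (intro poly_eqI) auto
    moreover have "coeff (hom P) d = P" using hom_1[OF PS] calculation by (metis poly_monom power_one mult.right_neutral)
    ultimately show ?thesis by simp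
  qed
  have sc: "rho [:x:] P = x ^ d * P" for x using poly_hom[OF PS, of x] homP by (simp add: poly_monom mult.commute)
  show "rho [:t:] P = t ^ dg P * P" using sc d_def by simp
  have fam: "\<exists>Q. \<forall>z\<in>S. \<forall>x. poly (Q z) x = rho (l x) z"
    if hW: "\<And>i k. i < p \<Longrightarrow> k < p \<Longrightarrow> \<exists>w. \<forall>x. poly w x = coeff ((l x * Up i) mod f) k" for l
  proof -
    obtain W where "\<And>i k x. i < p \<Longrightarrow> k < p \<Longrightarrow> poly (W i k) x = coeff ((l x * Up i) mod f) k"
      using hW by metis
    then show ?thesis using family[of W l] by blast
  qed
  have lin: "([:x, y:] * Up i) mod f = smult x (Up i) + smult y (pCons 0 (Up i) mod f)" if "i < p" for x y i
  proof -
    have "[:x, y:] * Up i = smult x (Up i) + smult y (pCons 0 (Up i))" by simp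
    moreover have "Up i mod f = Up i" using smult_mod[of 1 i] by simp
    ultimately show ?thesis by (simp only: poly_mod_add_left mod_smult_left)
  qed
  \<comment> \<open>\<open>T\<close>, \<open>Ka\<close> and \<open>H\<close> are the parametrized
    scalings by \<open>x - X\<close>, \<open>1 - x X\<close> and \<open>sd x\<close>, with
    \<open>X\<close> the variable of \<open>f\<close>.\<close>
  obtain T where T: "\<And>x z. z \<in> S \<Longrightarrow> poly (T z) x = rho [:x, -1:] z"
  proof -
    have "\<exists>w. \<forall>x. poly w x = coeff (([:x, -1:] * Up i) mod f) k" if "i < p" "k < p" for i k
      using that by (intro exI[of _ "[:- coeff (pCons 0 (Up i) mod f) k, U i k:]"]) (simp add: lin coeff_Up del: mult_pCons_left)
    from fam[OF this] that show thesis by blast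
  qed
  obtain Ka where Ka: "\<And>x z. z \<in> S \<Longrightarrow> poly (Ka z) x = rho [:1, -x:] z"
  proof -
    have "\<exists>w. \<forall>x. poly w x = coeff (([:1, -x:] * Up i) mod f) k" if "i < p" "k < p" for i k
      using that by (intro exI[of _ "[:U i k, - coeff (pCons 0 (Up i) mod f) k:]"]) (simp add: lin coeff_Up del: mult_pCons_left)
    from fam[OF this] that show thesis by blast
  qed
  obtain H where H: "\<And>x z. z \<in> S \<Longrightarrow> poly (H z) x = rho (sd x) z"
  proof -
    have "\<exists>w. \<forall>x. poly w x = coeff ((sd x * Up i) mod f) k" if "i < p" "k < p" for i k
    proof -
      have "(\<Sum>j<n. smult (x ^ j) (poly_shift (Suc j) f * Up i)) mod f =
          (\<Sum>j<n. smult (x ^ j) ((poly_shift (Suc j) f * Up i) mod f))" for x n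
        by (induction n) (auto simp: poly_mod_add_left mod_smult_left)
      then have e: "(sd x * Up i) mod f = (\<Sum>j<p. smult (x ^ j) ((poly_shift (Suc j) f * Up i) mod f))" for x
        unfolding sd_def sum_distrib_right by simp
      show ?thesis
      proof (intro exI allI)
        fix x
        show "poly (\<Sum>j<p. monom (coeff ((poly_shift (Suc j) f * Up i) mod f) k) j) x = coeff ((sd x * Up i) mod f) k"
          unfolding e coeff_sum poly_sum poly_monom coeff_smult by (intro sum.cong refl mult.commute)
      qed
    qed
    from fam[OF this] that show thesis by blast
  qed
  define G where "G = smult (inverse P) (T P)"
  have G: "rho [:x, -1:] P = poly G x * P" for x using T[OF PS] P0 by (simp add: G_def)
  have GM: "poly G (of_nat n) \<in> M" for n
  proof -
    obtain c where "c \<in> M" "rho [:of_nat n, -1:] P = c * P"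
      using semiD(3)[OF P, of "[:of_nat n, -1:]"] by (auto simp: Lam_def)
    then show ?thesis using G[of "of_nat n"] P0 by simp
  qed
  have GpM: "G \<in> pol M" by (rule pol_interpolate[OF Mf, of 0]) (rule GM)
  have "poly G 0 \<noteq> 0" using G[of 0] rho_lin_inj[OF MD(2) PS] P0 by auto
  then have G0: "G \<noteq> 0" by auto
  \<comment> \<open>Scaling by \<open>x - X\<close> and then by \<open>sd x\<close> is scaling by
    \<open>f(x)\<close>. Since \<open>sd x\<close> is not among the scalings \<open>Lam\<close>,
    \<open>H P\<close> is not known to be a multiple of \<open>P\<close>; only the roots of
    \<open>G\<close> are extracted.\<close>
  have "smult P (f ^ d) = G * H P"
  proof (rule poly_eq_nat[of 0])
    fix n
    let ?x = "of_nat n :: complex"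
    have l: "[:?x, -1:] \<in> pol M" using natM MD by (intro pcM) auto
    have "rho (sd ?x) (rho [:?x, -1:] P) = rho [:poly f ?x:] P"
      unfolding rho_mult[OF l PS]
      by (rule rho_cong[OF _ PS]) (simp only: sd_mult mult.commute[of "sd ?x"], simp add: poly_mod_diff_left)
    moreover have "rho (sd ?x) (rho [:?x, -1:] P) = poly G ?x * rho (sd ?x) P"
      unfolding G using GM[of n] SM PS by (auto simp: shomD(3)[OF rho_hom] rho_M)
    ultimately show "poly (smult P (f ^ d)) ?x = poly (G * H P) ?x"
      using sc[of "poly f ?x"] H[OF PS] by (simp add: mult.commute)
  qed
  then have roots: "poly f r = 0" if "poly G r = 0" for r
  proof -
    have "poly (smult P (f ^ d)) r = 0" using that \<open>smult P (f ^ d) = G * H P\<close> by simp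
    then show ?thesis using P0 by simp
  qed
  have "p dvd degree G" using irr_power_degree[OF Mf irr GpM G0 roots] df by simp
  \<comment> \<open>\<open>x - X = x (1 - X / x)\<close> gives \<open>G(x) = x^d Q(1/x)\<close> with
    \<open>Q(0)\<close> nonzero. Multiplying by \<open>x\<close> to the degree of \<open>Q\<close>
    turns this into an identity of polynomials, tested at positive integers.\<close>
  moreover have "degree G = d"
  proof -
    define Q where "Q = smult (inverse P) (Ka P)"
    have Q: "rho [:1, -x:] P = poly Q x * P" for x using Ka[OF PS] P0 by (simp add: Q_def)
    have Q0: "coeff Q 0 \<noteq> 0" using Q[of 0] rho_1[OF PS] P0 by (simp add: poly_0_coeff_0 one_pCons)
    have "monom 1 (degree Q) * G = monom 1 d * reflect_poly Q"
    proof (rule poly_eq_nat[of 1])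
      fix n :: nat assume n: "n \<ge> 1"
      let ?x = "of_nat n :: complex"
      have "poly G ?x * P = rho ([:1, - inverse ?x:] * [:?x:]) P" using n G[of ?x] by simp
      also have "\<dots> = rho [:1, - inverse ?x:] (rho [:?x:] P)" by (rule rho_mult[OF natpM PS, symmetric])
      also have "\<dots> = ?x ^ d * rho [:1, - inverse ?x:] P"
        unfolding sc using SM PS sring_power[OF Mr natM] by (simp add: shomD(3)[OF rho_hom] rho_M subset_iff)
      also have "\<dots> = ?x ^ d * poly Q (inverse ?x) * P" using Q by simp
      finally have "poly G ?x = ?x ^ d * poly Q (inverse ?x)" using P0 by simp
      then show "poly (monom 1 (degree Q) * G) ?x = poly (monom 1 d * reflect_poly Q) ?x"
        using n by (simp add: poly_monom poly_reflect_poly_nz)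
    qed
    then have "degree (monom 1 (degree Q) * G) = degree (monom 1 d * reflect_poly Q)" by simp
    moreover have "reflect_poly Q \<noteq> 0" using Q0 by auto
    ultimately show ?thesis using G0 Q0 by (simp add: degree_mult_eq degree_monom_eq)
  qed
  ultimately show "p dvd dg P" by (simp add: d_def)
qed

lemma Lam_mod: "l \<in> Lam \<Longrightarrow> poly l \<theta> \<noteq> 0"
proof -
  have "\<theta> \<notin> M" using fx0 \<theta> by blast
  then have "of_nat n \<noteq> \<theta>" for n using natM by blast
  then have "poly [:of_nat n, -1:] \<theta> \<noteq> 0" for n by simp
  moreover have "poly [:2:] \<theta> \<noteq> 0" "poly [:t:] \<theta> \<noteq> 0" using t(2) by simp_all
  ultimately show "l \<in> Lam \<Longrightarrow> poly l \<theta> \<noteq> 0" unfolding Lam_def by blast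
qed

text \<open>The new automorphism permutes the \<open>u\<^sub>i\<close> cyclically up to \<open>t\<close>, hence \<open>u\<^sub>1 / u\<^sub>0\<close> has norm \<open>t\<close>.\<close>
definition phi where
  "phi = (SOME g. shom S g \<and> (\<forall>a\<in>M. g a = s a) \<and>
     (\<forall>i<p. \<forall>k<p. g (U i k) = (if Suc i < p then U (Suc i) k else t * U 0 k)))"

lemma phi: "shom S phi \<and> (\<forall>a\<in>M. phi a = s a) \<and>
     (\<forall>i<p. \<forall>k<p. phi (U i k) = (if Suc i < p then U (Suc i) k else t * U 0 k))"
  unfolding phi_def using hm_ex[OF sh] by (rule someI_ex)

lemma phi_hom: "shom S phi" and phi_M: "a \<in> M \<Longrightarrow> phi a = s a"
  and phi_U: "i < p \<Longrightarrow> k < p \<Longrightarrow> phi (U i k) = (if Suc i < p then U (Suc i) k else t * U 0 k)"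
  using phi by blast+

text \<open>Continues the list of generic elements past its end with the factor \<open>t\<close>, so
  that \<open>phi\<close> is a plain shift.\<close>

definition Uq where "Uq i = (if i < p then Up i else smult t (Up (i - p)))"

lemma phi_Up: "i < p \<Longrightarrow> map_poly phi (Up i) = Uq (Suc i)"
proof (intro poly_eqI)
  fix k assume i: "i < p"
  show "coeff (map_poly phi (Up i)) k = coeff (Uq (Suc i)) k"
  proof (cases "Suc i < p")
    case True
    then show ?thesis using i by (simp add: map_pol(1)[OF phi_hom Sr] coeff_Up phi_U Uq_def shom_0[OF phi_hom Sr])
  next
    case False
    then have e: "Suc i = p" using i by simp
    show ?thesis using i by (simp add: map_pol(1)[OF phi_hom Sr] coeff_Up phi_U Uq_def shom_0[OF phi_hom Sr] e)
  qed
qed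

lemma phi_in: "z \<in> S \<Longrightarrow> phi z \<in> S"
proof (rule hm_image[OF phi_hom Sr])
  show "phi a \<in> S" if "a \<in> M" for a using that SM sM by (auto simp: phi_M)
  show "phi (U i k) \<in> S" if "i < p" "k < p" for i k
    using that US[of "Suc i" k] US[of 0 k] tM SM SD(4) p2 by (auto simp: phi_U)
qed

lemma map_phi_K: "l \<in> pol (fixK M s) \<Longrightarrow> map_poly phi l = l"
proof (intro poly_eqI)
  fix n assume "l \<in> pol (fixK M s)"
  then have "coeff l n \<in> fixK M s" by (rule polD)
  then show "coeff (map_poly phi l) n = coeff l n" by (simp add: map_pol(1)[OF phi_hom Sr] phi_M fixK_def)
qed

lemma polKM: "l \<in> pol (fixK M s) \<Longrightarrow> l \<in> pol M"
  using pol_mono[of "fixK M s" M] by (auto simp: fixK_def)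

lemma LamK: "l \<in> Lam \<Longrightarrow> l \<in> pol (fixK M s)"
proof -
  have n: "of_nat n \<in> fixK M s" for n using natM shom_of_nat[OF sh Mr] by (simp add: fixK_def)
  have m: "-1 \<in> fixK M s" "0 \<in> fixK M s"
    using MD shom_minus[OF sh Mr, of 1] shomD(1)[OF sh] shom_0[OF sh Mr] by (auto simp: fixK_def)
  have "[:of_nat n, -1:] \<in> pol (fixK M s)" for n using n m by (simp add: pol_pCons)
  moreover have "[:2:] \<in> pol (fixK M s)" "[:t:] \<in> pol (fixK M s)" using n[of 2] t m(2) by simp_all
  ultimately show "l \<in> Lam \<Longrightarrow> l \<in> pol (fixK M s)" unfolding Lam_def by auto
qed

text \<open>\<open>l\<close> and \<open>f\<close> have coefficients in the fixed field, so
  \<open>phi\<close> commutes with multiplication by \<open>l\<close> and with reduction modulo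
  \<open>f\<close>. Hence the fractions fixed by \<open>Lam\<close> are stable under the new
  automorphism.\<close>

lemma phi_rho:
  assumes l: "l \<in> pol (fixK M s)" and z: "z \<in> S"
  shows "phi (rho l z) = rho l (phi z)"
proof (rule hm_eq[OF _ _ _ _ z])
  note lM = polKM[OF l]
  show "shom S (\<lambda>z. phi (rho l z))" by (rule shom_comp[OF rho_hom phi_hom]) (use rho_in[OF lM] in auto)
  show "shom S (\<lambda>z. rho l (phi z))" by (rule shom_comp[OF phi_hom rho_hom]) (use phi_in in auto)
  show "phi (rho l a) = rho l (phi a)" if "a \<in> M" for a using that sM by (simp add: rho_M phi_M)
  fix i k assume ik: "i < p" "k < p"
  have lU: "l * Up i \<in> pol S" by (intro polS_mult polMS lM UpS ik)
  have "phi (rho l (U i k)) = coeff (map_poly phi ((l * Up i) mod f)) k"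
    using ik by (simp add: rho_U map_pol(1)[OF phi_hom Sr])
  also have "map_poly phi ((l * Up i) mod f) = (l * Uq (Suc i)) mod f"
    using map_mod[OF phi_hom Sr polMS[OF fM] lf _ lU] df p2 ik
    by (simp add: map_pol(3)[OF phi_hom Sr polMS[OF lM] UpS] map_phi_K l fK phi_Up)
  also have "coeff \<dots> k = rho l (phi (U i k))"
  proof (cases "Suc i < p")
    case True
    then show ?thesis using ik by (simp add: phi_U Uq_def rho_U)
  next
    case False
    then have e: "Suc i = p" using ik by simp
    have p0: "0 < p" using p2 by simp
    have "rho l (t * U 0 k) = t * rho l (U 0 k)"
      using shomD(3)[OF rho_hom, of t "U 0 k" l] US[OF p0 ik(2)] tM SM by (auto simp: rho_M)
    then show ?thesis using ik p0 by (simp add: phi_U Uq_def rho_U mod_smult_left e)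
  qed
  finally show "phi (rho l (U i k)) = rho l (phi (U i k))" .
qed

section \<open>Iterates of the new automorphism and norms on the generic ring\<close>

lemma phi_iter_hom: "shom S (phi ^^ j)" and phi_iter_in: "z \<in> S \<Longrightarrow> (phi ^^ j) z \<in> S"
  by (rule funpow_shom[OF phi_hom phi_in]) (auto intro: funpow_in phi_in)

lemma phi_iter_M: "z \<in> M \<Longrightarrow> (phi ^^ j) z = (s ^^ j) z"
  by (rule funpow_agree[of M]) (auto intro: sM phi_M)

lemma phi_p: "z \<in> S \<Longrightarrow> (phi ^^ p) z = rho [:t:] z"
proof (rule hm_eq[OF phi_iter_hom rho_hom])
  show "(phi ^^ p) a = rho [:t:] a" if "a \<in> M" for a using that by (simp add: phi_iter_M sp rho_M)
  fix i k assume ik: "i < p" "k < p"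
  have "j \<le> p \<Longrightarrow> (phi ^^ j) (U i k) = (if i + j < p then U (i + j) k else t * U (i + j - p) k)" for j
  proof (induction j)
    case (Suc j)
    have jp: "i + j - p < p" using Suc.prems ik by simp
    have pt: "phi t = t" using tM by (simp add: phi_M)
    show ?case
    proof (cases "i + j < p")
      case True
      then show ?thesis using Suc ik by (auto simp: phi_U not_less le_Suc_eq)
    next
      case False
      then have "Suc (i + j - p) < p" using Suc.prems ik by simp
      then show ?thesis using Suc ik jp False tM SM US[OF jp ik(2)]
        by (auto simp: phi_U shomD(3)[OF phi_hom] pt Suc_diff_le subset_iff)
    qed
  qed (use ik in simp)
  from this[of p] show "(phi ^^ p) (U i k) = rho [:t:] (U i k)" using ik by (simp add: rho_U smult_mod coeff_Up)
qed

lemma phi_inj: "z \<in> S \<Longrightarrow> phi z = 0 \<Longrightarrow> z = 0"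
proof -
  assume z: "z \<in> S" "phi z = 0"
  have "(phi ^^ p) z = (phi ^^ (p - 1)) (phi z)" using p2 by (cases p) (auto simp: funpow_swap1)
  then have "rho [:t:] z = 0" using z phi_p[OF z(1)] phi_iter_M[OF MD(2), of "p - 1"] shom_0[OF funpow_shom[OF sh sM] Mr] by simp
  then show "z = 0" using rho_const_inj[OF tM(1) t(2) z(1)] by simp
qed

lemma natpK: "[:of_nat n:] \<in> pol (fixK M s)"
  using natM shom_of_nat[OF sh Mr] shom_0[OF sh Mr] MD(2) by (simp add: fixK_def)

lemma dg_phi: "z \<in> S \<Longrightarrow> dg (phi z) = dg z"
  by (rule dg_hom[OF phi_hom]) (auto simp: phi_in phi_inj phi_rho natpK)

lemma dg_phi_iter: "z \<in> S \<Longrightarrow> dg ((phi ^^ j) z) = dg z"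
  by (induction j) (auto simp: dg_phi phi_iter_in)

lemma phi_iter_nz: "z \<in> S \<Longrightarrow> z \<noteq> 0 \<Longrightarrow> (phi ^^ j) z \<noteq> 0"
  by (induction j) (auto dest: phi_inj[OF phi_iter_in])

lemma semi_phi: "semi z \<Longrightarrow> semi (phi z)"
  unfolding semi_def
proof (intro conjI ballI; elim conjE)
  assume z: "z \<in> S" "z \<noteq> 0" "\<forall>l\<in>Lam. \<exists>c\<in>M. rho l z = c * z"
  show "phi z \<in> S" "phi z \<noteq> 0" using z phi_in phi_inj by auto
  fix l assume l: "l \<in> Lam"
  then obtain c where c: "c \<in> M" "rho l z = c * z" using z by blast
  have "rho l (phi z) = s c * phi z"
    using phi_rho[OF LamK[OF l] z(1)] c z(1) SM by (simp add: shomD(3)[OF phi_hom] phi_M subset_iff)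
  then show "\<exists>c\<in>M. rho l (phi z) = c * phi z" using sM[OF c(1)] by blast
qed

lemma semi_phi_iter: "semi z \<Longrightarrow> semi ((phi ^^ j) z)"
  by (induction j) (auto intro: semi_phi)

lemma nrm_S: "z \<in> S \<Longrightarrow> nrm p phi z \<in> S"
  unfolding nrm_def by (intro sring_prod[OF Sr] phi_iter_in)

lemma nrm_S_mult: "a \<in> S \<Longrightarrow> b \<in> S \<Longrightarrow> nrm p phi (a * b) = nrm p phi a * nrm p phi b"
  by (rule nrm_mult[OF phi_hom phi_in])

lemma nrm_S_M: "z \<in> M \<Longrightarrow> nrm p phi z = nrm p s z"
  unfolding nrm_def by (simp add: phi_iter_M)

lemma nrm_S_nz: "z \<in> S \<Longrightarrow> z \<noteq> 0 \<Longrightarrow> nrm p phi z \<noteq> 0"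
  unfolding nrm_def using phi_iter_nz by simp

lemma dg_prod:
  "finite I \<Longrightarrow> (\<And>i. i \<in> I \<Longrightarrow> g i \<in> S \<and> g i \<noteq> 0) \<Longrightarrow> dg (prod g I) = (\<Sum>i\<in>I. dg (g i))"
proof (induction I rule: finite_induct)
  case (insert x F)
  then show ?case using sring_prod[OF Sr, of F g] by (simp add: dg_mult)
qed (simp add: dg_M[OF MD(3)])

lemma dg_nrm: "z \<in> S \<Longrightarrow> z \<noteq> 0 \<Longrightarrow> dg (nrm p phi z) = p * dg z"
  unfolding nrm_def by (subst dg_prod) (auto simp: phi_iter_in phi_iter_nz dg_phi_iter)

text \<open>Replacing a factor of \<open>z\<close> by its image under \<open>phi\<close> multiplies the norm by \<open>t ^ dg z\<close>,
  and \<open>p dvd dg z\<close> makes this a norm from \<open>M\<close>.\<close>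
lemma nrm_phi_iter:
  assumes z: "semi z"
  shows "nrm p phi ((phi ^^ j) z) = (t ^ dg z) ^ j * nrm p phi z"
proof (induction j)
  case (Suc j)
  let ?y = "(phi ^^ j) z"
  have y: "semi ?y" "dg ?y = dg z" using semi_phi_iter[OF z] dg_phi_iter[OF semiD(1)[OF z]] by auto
  have "nrm p phi (phi ?y) * ?y = nrm p phi ?y * (t ^ dg z * ?y)"
    unfolding nrm_shift phi_p[OF semiD(1)[OF y(1)]] semi_degree(1)[OF y(1)] y(2) ..
  then show ?case using semiD(2)[OF y(1)] Suc by simp
qed simp

text \<open>Descent on the degree of \<open>a\<close>. A semi-invariant factor \<open>P\<close> of
  \<open>a\<close> of least positive degree divides a conjugate of \<open>b\<close>: otherwise
  minimality makes it coprime to every conjugate, and it would divide the constant \<open>c\<close>.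
  Cancelling \<open>P\<close> from \<open>a\<close> and a conjugate of \<open>P\<close> from
  \<open>b\<close> changes \<open>c\<close> by the norm of an element of \<open>M\<close>.\<close>

lemma nrm_descend:
  assumes "semi a" "semi b" "c \<in> fixK M s" "c \<noteq> 0" "nrm p phi a = c * nrm p phi b"
  shows "\<exists>y\<in>M. nrm p s y = c"
  using assms
proof (induction "dg a" arbitrary: a b c rule: less_induct)
  case less
  note a = semiD(1,2)[OF less.prems(1)] and b = semiD(1,2)[OF less.prems(2)]
  have cM: "c \<in> M" "s c = c" using less.prems(3) by (auto simp: fixK_def)
  show ?case
  proof (cases "dg a = 0")
    case True
    have "p * dg b = dg (nrm p phi b)" using dg_nrm[OF b] by simp
    also have "\<dots> = dg (c * nrm p phi b)"
      using dg_mult[of c "nrm p phi b"] cM SM less.prems(4) nrm_S[OF b(1)] nrm_S_nz[OF b] dg_M[OF cM(1)] by auto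
    also have "\<dots> = p * dg a" using less.prems(5) dg_nrm[OF a] by simp
    finally have "dg b = 0" using True p2 by simp
    then have M': "a \<in> M" "b \<in> M" using True dg_0 a(1) b(1) by auto
    have "nrm p s (a / b) = nrm p s a / nrm p s b" by (rule nrm_divide[OF Mf sh sM M'])
    also have "\<dots> = c" using less.prems(5) M' nrm_S_nz[OF b] by (simp add: nrm_S_M)
    finally show ?thesis using MD(9)[OF M'] by blast
  next
    case False
    let ?Q = "\<lambda>z. semi z \<and> dg z > 0 \<and> sdvd S z a"
    have "?Q a" using less.prems(1) False sdvd_refl[OF Sr] by simp
    then obtain P where P: "?Q P" "\<And>z. ?Q z \<Longrightarrow> dg P \<le> dg z" using ex_has_least_nat[of ?Q a dg] by blast
    note PS = semiD(1,2)[OF conjunct1[OF P(1)]]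
    have "\<exists>i<p. sdvd S P ((phi ^^ i) b)"
    proof (rule ccontr)
      assume no: "\<not> ?thesis"
      have cop: "sunit S d" if i: "i < p" and d: "d \<in> S" "sdvd S d P" "sdvd S d ((phi ^^ i) b)" for i d
      proof -
        obtain g where g: "semi g" "sdvd S g P" "sdvd S g ((phi ^^ i) b)" "sdvd S d g"
          using semi_gcd[of P "(phi ^^ i) b"] P(1) semi_phi_iter[OF less.prems(2), of i] d by blast
        have "dg g = 0"
        proof (rule ccontr)
          assume "dg g \<noteq> 0"
          then have le: "dg P \<le> dg g" using P g sdvd_trans[OF Sr g(2)] by blast
          obtain q where q: "P = g * q" "q \<in> S" using g(2) by (rule sdvdE)
          have "q \<noteq> 0" using PS q by auto
          then have "dg q = 0" using le dg_mult[OF semiD(1)[OF g(1)] q(2) semiD(2)[OF g(1)]] q(1) by simp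
          then have "q \<in> M" using dg_0[OF q(2)] by simp
          obtain e where e: "(phi ^^ i) b = g * e" "e \<in> S" using g(3) by (rule sdvdE)
          have "inverse q \<in> S" using MD(8)[OF \<open>q \<in> M\<close>] SM by blast
          moreover have "(phi ^^ i) b = P * (inverse q * e)" unfolding e(1) q(1) using \<open>q \<noteq> 0\<close> by simp
          ultimately have "sdvd S P ((phi ^^ i) b)" using SD(4)[of "inverse q" e] e(2) by (blast intro: sdvdI)
          then show False using no i by blast
        qed
        then have "sunit S g" using dg_0[OF semiD(1)[OF g(1)]] semiD(2)[OF g(1)] unitS by simp
        then show ?thesis using sdvd_sunit[OF Sr d(1) g(4)] by blast
      qed
      have "sdvd S P (nrm p phi a)"
      proof -
        have "nrm p phi a = a * (\<Prod>i\<in>{..<p} - {0}. (phi ^^ i) a)" unfolding nrm_def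
          using p2 by (subst prod.remove[of _ 0]) auto
        moreover have "(\<Prod>i\<in>{..<p} - {0}. (phi ^^ i) a) \<in> S" by (intro sring_prod[OF Sr] phi_iter_in a)
        ultimately show ?thesis using P(1) sdvd_mult[OF Sr] by simp
      qed
      then have dv: "sdvd S P ((\<Prod>i<p. (phi ^^ i) b) * c)" using less.prems(5) by (simp add: nrm_def mult.commute)
      have "sdvd S P c" if "n \<le> p" "sdvd S P ((\<Prod>i<n. (phi ^^ i) b) * c)" for n
        using that
      proof (induction n)
        case (Suc n)
        have y: "(\<Prod>i<n. (phi ^^ i) b) * c \<in> S" using cM SM by (intro SD(4) sring_prod[OF Sr] phi_iter_in b) auto
        have "sdvd S P ((phi ^^ n) b * ((\<Prod>i<n. (phi ^^ i) b) * c))" using Suc.prems(2) by (simp add: ac_simps)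
        then have "sdvd S P ((\<Prod>i<n. (phi ^^ i) b) * c)"
          using coprime_cancel[OF Sfac PS phi_iter_in[OF b(1)] y cop[of n]] Suc.prems(1) by auto
        then show ?case using Suc by simp
      qed simp
      from this[OF order_refl dv] have "sdvd S P c" .
      then have "sunit S P" using sdvd_sunit[OF Sr PS(1)] unitS cM less.prems(4) by blast
      then show False using P(1) unitS dg_M by simp
    qed
    then obtain i where i: "i < p" "sdvd S P ((phi ^^ i) b)" by blast
    \<comment> \<open>With \<open>j = p - i\<close> the map \<open>phi ^^ j\<close> carries
      \<open>(phi ^^ i) b\<close> to \<open>(phi ^^ p) b\<close>, which is \<open>b\<close> up to a
      power of \<open>t\<close>; so \<open>R\<close> divides \<open>b\<close> itself.\<close>
    define j where "j = p - i"
    define R where "R = (phi ^^ j) P"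
    have R: "semi R" unfolding R_def using semi_phi_iter P(1) by blast
    have "sdvd S R b"
    proof -
      obtain q where q: "(phi ^^ i) b = P * q" "q \<in> S" using i(2) by (rule sdvdE)
      have "(phi ^^ j) ((phi ^^ i) b) = (phi ^^ p) b" using i(1) by (simp add: j_def funpow_add[symmetric, THEN fun_cong, unfolded o_def])
      also have "\<dots> = t ^ dg b * b" unfolding phi_p[OF b(1)] by (rule semi_degree(1)[OF less.prems(2)])
      finally have "t ^ dg b * b = R * (phi ^^ j) q" unfolding R_def q(1) shomD(3)[OF phi_iter_hom PS(1) q(2)] ..
      then have "b = R * ((phi ^^ j) q * inverse (t ^ dg b))" using t(2) by (simp add: field_simps)
      moreover have "inverse (t ^ dg b) \<in> S" using SM MD(8)[OF sring_power[OF Mr tM(1)]] by blast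
      ultimately show ?thesis using SD(4)[OF phi_iter_in[OF q(2)]] by (blast intro: sdvdI)
    qed
    then obtain b1 where b1: "b = R * b1" "b1 \<in> S" by (rule sdvdE)
    obtain a1 where a1: "a = P * a1" "a1 \<in> S" using P(1) by (auto elim: sdvdE)
    have semi1: "semi a1" "semi b1"
      using semi_quot[OF less.prems(1) _ a1(2,1)] P(1) semi_quot[OF less.prems(2) R b1(2,1)] by auto
    have "nrm p phi P * nrm p phi a1 = c * (nrm p phi R * nrm p phi b1)"
      using less.prems(5) unfolding a1(1) b1(1) nrm_S_mult[OF PS(1) a1(2)] nrm_S_mult[OF semiD(1)[OF R] b1(2)] .
    then have "nrm p phi a1 = c * (t ^ dg P) ^ j * nrm p phi b1"
      using nrm_S_nz[OF PS] nrm_phi_iter[of P j] P(1) unfolding R_def[symmetric] by simp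
    moreover obtain e where e: "dg P = p * e" using semi_degree(2) P(1) by blast
    \<comment> \<open>\<open>t ^ dg P\<close> is a \<open>p\<close>-th power because
      \<open>p dvd dg P\<close>, and the \<open>p\<close>-th power of a fixed element is its
      norm.\<close>
    moreover define w where "w = (t ^ e) ^ j"
    have w: "w \<in> M" "s w = w" "w \<noteq> 0" unfolding w_def
      using tM t(2) sring_power[OF Mr tM(1)] by (auto intro!: sring_power[OF Mr] simp: shom_power[OF sh Mr])
    moreover have "(t ^ dg P) ^ j = nrm p s w"
      unfolding nrm_fix[of s w, OF w(2)] e unfolding w_def by (simp add: power_mult[symmetric] ac_simps)
    ultimately have eq: "nrm p phi a1 = c * nrm p s w * nrm p phi b1" by simp
    have "dg a1 < dg a" using a1 dg_mult[OF PS(1) a1(2) PS(2) semiD(2)[OF semi1(1)]] P(1) by simp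
    moreover have "nrm p s w = w ^ p" by (rule nrm_fix[of s w, OF w(2)])
    then have "c * nrm p s w \<in> fixK M s" "c * nrm p s w \<noteq> 0"
      using cM w less.prems(4) sring_power[OF Mr w(1)] MD(5) by (auto simp: fixK_def shomD(3)[OF sh] shom_power[OF sh Mr])
    ultimately obtain y where y: "y \<in> M" "nrm p s y = c * nrm p s w" using less.hyps semi1 eq by blast
    have "nrm p s (y / w) = c"
      using nrm_divide[OF Mf sh sM y(1) w(1)] y(2) \<open>nrm p s w = w ^ p\<close> w(3) by simp
    then show ?thesis using MD(9)[OF y(1) w(1)] by blast
  qed
qed

text \<open>In lowest terms \<open>a / b\<close>, invariance under a scaling forces \<open>a\<close>
  and \<open>b\<close> to be multiplied by the same constant: coprimality gives divisibility, and
  equality of degrees puts the quotient in \<open>M\<close>. Both are then semi-invariants and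
  \<open>nrm_descend\<close> applies.\<close>

lemma norm_descends:
  assumes \<xi>: "\<xi> \<in> frac S" and F: "shom (frac S) F" "\<And>z. z \<in> S \<Longrightarrow> F z = phi z" "\<And>z. z \<in> frac S \<Longrightarrow> F z \<in> frac S"
    and R: "\<And>l. l \<in> Lam \<Longrightarrow> shom (frac S) (R l)" "\<And>l z. l \<in> Lam \<Longrightarrow> z \<in> S \<Longrightarrow> R l z = rho l z"
    and fx: "\<And>l. l \<in> Lam \<Longrightarrow> R l \<xi> = \<xi>" and c: "c \<in> fixK M s" "nrm p F \<xi> = c"
  shows "\<exists>y\<in>M. nrm p s y = c"
proof (cases "c = 0")
  case True
  have "nrm p s 0 = 0" using nrm_fix[of s 0 p] shom_0[OF sh Mr] p2 by simp
  then show ?thesis using True MD(2) by blast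
next
  case False
  note Qf = frac_sfield[OF Sr] and SQ = frac_subset[OF Sr]
  obtain A B where AB: "\<xi> = A / B" "A \<in> S" "B \<in> S" "B \<noteq> 0" using \<xi> by (rule fracE)
  have "\<xi> \<noteq> 0"
  proof
    assume "\<xi> = 0"
    then have "nrm p F \<xi> = 0" using nrm_fix[of F \<xi> p] shom_0[OF F(1) sfieldD(1)[OF Qf]] p2 by simp
    then show False using c(2) False by simp
  qed
  then have A0: "A \<noteq> 0" using AB by auto
  obtain g a b where g: "g \<in> S" "a \<in> S" "b \<in> S" "A = g * a" "B = g * b"
    and cop: "\<forall>d\<in>S. sdvd S d a \<longrightarrow> sdvd S d b \<longrightarrow> sunit S d"
    using factorial_reduce[OF Sfac AB(2) A0 AB(3)] by blast
  have nz: "g \<noteq> 0" "a \<noteq> 0" "b \<noteq> 0" using A0 AB(4) g by auto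
  have x: "\<xi> = a / b" using AB(1) g nz by simp
  have ab: "\<exists>k\<in>M. rho l a = k * a \<and> rho l b = k * b" if l: "l \<in> Lam" for l
  proof -
    have b': "rho l b \<noteq> 0" using Lam_inj[OF l g(3)] nz by blast
    have "R l \<xi> = rho l a / rho l b"
      unfolding x using shom_divide[OF R(1)[OF l] Qf] R(2)[OF l] g SQ by (simp add: subset_iff)
    then have eq: "rho l a * b = a * rho l b" using fx[OF l] nz b' unfolding x by (simp add: field_simps)
    have ra: "rho l a \<in> S" "rho l b \<in> S" using rho_in[OF LamM[OF l]] g by auto
    have "sdvd S a (b * rho l a)" using eq ra by (intro sdvdI[of _ _ "rho l b"]) (simp_all add: mult.commute)
    then have "sdvd S a (rho l a)" using coprime_cancel[OF Sfac g(2) nz(2) g(3) ra(1)] cop by blast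
    then obtain k where k: "rho l a = a * k" "k \<in> S" by (rule sdvdE)
    have k0: "k \<noteq> 0" using k Lam_inj[OF l g(2)] nz by auto
    have "dg k = 0" using dg_mult[OF g(2) k(2) nz(2) k0] dg_rho[OF l g(2)] k(1) by simp
    then have "k \<in> M" using dg_0[OF k(2)] by simp
    moreover have "rho l b = k * b" using eq k nz by simp
    ultimately show ?thesis using k(1) by (auto simp: mult.commute)
  qed
  then have semi: "semi a" "semi b" unfolding semi_def using g nz by blast+
  have Fi: "(F ^^ i) z = (phi ^^ i) z" if "z \<in> S" for z i
    by (rule funpow_agree[OF phi_in F(2) that])
  have "nrm p F \<xi> = nrm p F a / nrm p F b" unfolding x
    by (rule nrm_divide[OF Qf F(1,3)]) (use g SQ in auto)
  also have "\<dots> = nrm p phi a / nrm p phi b" unfolding nrm_def using g by (simp add: Fi)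
  finally have "nrm p phi a = c * nrm p phi b" using c(2) nrm_S_nz[OF g(3) nz(3)] by (simp add: field_simps)
  then show ?thesis using nrm_descend[OF semi c(1) False] by blast
qed

lemma Up_\<theta>:
  assumes ind: "power_indep (frac S) p \<theta>"
  shows "i < p \<Longrightarrow> poly (Up i) \<theta> \<noteq> 0"
proof
  assume i: "i < p" and z: "poly (Up i) \<theta> = 0"
  have "Up i \<in> pol (frac S)" using UpS[OF i] pol_mono[OF frac_subset[OF Sr]] by blast
  then have "Up i = 0" using ind z Up_deg unfolding power_indep_def by blast
  then have "u (i * p) = 0" using coeff_Up[of i 0] p2 by (simp add: U_def)
  moreover have "transc (pr M u (i * p)) (u (i * p))" using uM[of "Suc (i * p)"] unfolding indep_def by blast
  moreover have "[:0, 1:] \<in> pol (pr M u (i * p))" using sringD(1,2)[OF pr_sring[OF Mr]] by (simp add: pol_pCons)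
  ultimately show False unfolding transc_def by force
qed

text \<open>\<open>A\<close> represents \<open>u_1 / u_0\<close> in the extension by
  \<open>f\<close>. Being a ratio it is fixed by all scalings, so its coefficients lie in the new
  field, and its conjugates \<open>u_(k+1) / u_k\<close> multiply to \<open>t\<close>.\<close>

theorem step: "\<exists>M' s'. cext p M s M' s' \<and> (\<exists>A\<in>pol M'. poly (\<Prod>k<p. map_poly (s' ^^ k) A) \<theta> = t)"
proof -
  let ?Q = "frac S"
  note Qf = frac_sfield[OF Sr] and SQ = frac_subset[OF Sr]
  note Qr = sfieldD(1)[OF Qf]
  have "\<forall>l\<in>Lam. \<exists>g. shom ?Q g \<and> (\<forall>a\<in>S. g a = rho l a)"
    by (intro ballI frac_hom[OF Sr rho_hom]) (auto dest: Lam_inj)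
  then obtain R where R: "\<And>l. l \<in> Lam \<Longrightarrow> shom ?Q (R l)" "\<And>l a. l \<in> Lam \<Longrightarrow> a \<in> S \<Longrightarrow> R l a = rho l a"
    by (metis bchoice)
  obtain F where F: "shom ?Q F" "\<And>a. a \<in> S \<Longrightarrow> F a = phi a" using frac_hom[OF Sr phi_hom phi_inj] by blast
  have FQ: "F z \<in> ?Q" if "z \<in> ?Q" for z
    by (rule frac_hom_image[OF Sr F(1) Qf _ that]) (use F(2) phi_in SQ in auto)
  have RQ: "R l z \<in> ?Q" if "l \<in> Lam" "z \<in> ?Q" for l z
    by (rule frac_hom_image[OF Sr R(1) Qf _ that(2)]) (use R(2) rho_in[OF LamM] SQ that in auto)
  have FR: "R l (F z) = F (R l z)" if l: "l \<in> Lam" and z: "z \<in> ?Q" for l z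
  proof (rule frac_hom_eq[OF Sr _ _ _ z])
    show "shom ?Q (\<lambda>z. R l (F z))" by (rule shom_comp[OF F(1) R(1)[OF l]]) (use FQ in auto)
    show "shom ?Q (\<lambda>z. F (R l z))" by (rule shom_comp[OF R(1)[OF l] F(1)]) (use RQ l in auto)
    show "R l (F a) = F (R l a)" if "a \<in> S" for a
      using that phi_in rho_in[OF LamM[OF l]] R(2)[OF l] F(2) phi_rho[OF LamK[OF l]] by simp
  qed
  have tL: "[:t:] \<in> Lam" by (simp add: Lam_def)
  have Fp: "(F ^^ p) z = R [:t:] z" if z: "z \<in> ?Q" for z
  proof (rule frac_hom_eq[OF Sr funpow_shom[OF F(1) FQ] R(1)[OF tL] _ z])
    show "(F ^^ p) a = R [:t:] a" if "a \<in> S" for a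
      using funpow_agree[OF phi_in F(2) that] phi_p[OF that] R(2)[OF tL that] by simp
  qed
  \<comment> \<open>Since \<open>F ^^ p\<close> is the scaling by \<open>t\<close>, restricting to
    fractions fixed by \<open>Lam\<close> restores the condition that the \<open>p\<close>-th
    iterate is the identity.\<close>
  define M' where "M' = {z \<in> ?Q. \<forall>l\<in>Lam. R l z = z}"
  have "sring M'" unfolding sring_def M'_def
    using sringD[OF Qr] shomD[OF R(1)] shom_0[OF R(1) Qr] shom_minus[OF R(1) Qr] by simp
  moreover have "inverse z \<in> M'" if "z \<in> M'" for z
    using that unfolding M'_def by (simp add: shom_inverse[OF R(1) Qf] sfieldD(8)[OF Qf])
  ultimately have M'f: "sfield M'" unfolding sfield_def by blast
  have MM': "M \<subseteq> M'" unfolding M'_def using SM SQ R(2) rho_M by auto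
  have FM: "F z = s z" if "z \<in> M" for z using that SM F(2) phi_M by auto
  have FM': "F z \<in> M'" if "z \<in> M'" for z using that FQ FR unfolding M'_def by simp
  have M'Q: "M' \<subseteq> ?Q" unfolding M'_def by blast
  have "cyc p M' F" unfolding cyc_def
  proof (intro conjI ballI)
    show "countable M'" using M'Q countable_frac[OF Scount] countable_subset by blast
    show "shom M' F" by (rule shom_subset[OF F(1) M'Q])
    show "(F ^^ p) z = z" if "z \<in> M'" for z using that Fp tL unfolding M'_def by simp
  qed (use M'f FM' in auto)
  moreover have "\<exists>y\<in>M. nrm p s y = c" if "c \<in> fixK M s" "x \<in> M'" "nrm p F x = c" for c x
  proof (rule norm_descends[OF _ F FQ R _ that(1,3)])
    show "R l x = x" if "l \<in> Lam" for l using that \<open>x \<in> M'\<close> unfolding M'_def by blast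
  qed (use that M'Q in auto)
  ultimately have ext: "cext p M s M' F" unfolding cext_def using MM' FM by blast
  have ind: "power_indep ?Q p \<theta>"
  proof (intro power_indep_frac[OF Sr])
    have "power_indep M p \<theta>" unfolding power_indep_def
      using irr_root_degree[OF Mf irr _ _ \<theta>] df by blast
    then show "power_indep S p \<theta>" unfolding S_def
      by (intro power_indep_pr[OF Mr adj_sring(1)[OF Mr, of \<theta>] adj_sring(2)[OF Mr] adj_sring(3)[OF Mr] u])
  qed
  note Upt = Up_\<theta>[OF ind]
  have polSQ: "A \<in> pol S \<Longrightarrow> A \<in> pol ?Q" for A using pol_mono[OF SQ] by blast
  have polMQ: "A \<in> pol M \<Longrightarrow> A \<in> pol ?Q" for A using pol_mono[OF SQ] pol_mono[OF SM] by blast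
  have p01: "0 < p" "1 < p" using p2 by auto
  obtain A where A: "A \<in> pol ?Q" "degree A < p" "f dvd A * Up 0 - Up 1"
  proof -
    \<comment> \<open>The \<open>p\<close> vectors \<open>x^i u_0\<close> and the vector
      \<open>u_1\<close> live in a space of dimension \<open>p\<close>, so they are dependent. The
      coefficient of \<open>u_1\<close> cannot vanish, as multiplication by \<open>u_0\<close> is
      injective, and \<open>u_1\<close> becomes a multiple of \<open>u_0\<close>.\<close>
    define V where "V i = (if i < p then (monom 1 i * Up 0) mod f else Up 1)" for i
    have VS: "V i \<in> pol S" for i unfolding V_def
      using modS[OF polS_mult[OF pol_monom[OF SD(1,2)] UpS[OF p01(1)]]] UpS[OF p01(2)] by simp
    obtain a where a: "\<forall>i\<le>p. a i \<in> ?Q" "\<exists>i\<le>p. a i \<noteq> 0" "\<forall>k<p. (\<Sum>i\<le>p. a i * coeff (V i) k) = 0"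
      using dependent_vectors[OF Qf, of p "\<lambda>i k. coeff (V i) k"] polD[OF VS] SQ by blast
    have Vd: "degree (V i) < p" for i unfolding V_def using mod_less Up_deg by simp
    have sum0: "(\<Sum>i\<le>p. smult (a i) (V i)) = 0"
    proof (rule poly_eqI)
      fix k
      show "coeff (\<Sum>i\<le>p. smult (a i) (V i)) k = coeff 0 k"
      proof (cases "k < p")
        case False
        then have "coeff (V i) k = 0" for i using Vd[of i] by (intro coeff_eq_0) simp
        then show ?thesis by (simp add: coeff_sum)
      qed (use a(3) in \<open>simp add: coeff_sum\<close>)
    qed
    define B where "B = (\<Sum>i<p. monom (a i) i)"
    have cB: "coeff B i = (if i < p then a i else 0)" for i
      unfolding B_def by (simp add: coeff_sum if_distrib cong: if_cong)
    have BQ: "B \<in> pol ?Q" using a(1) sfieldD(2)[OF Qf] by (intro polI) (auto simp: cB)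
    have Bd: "degree B < p" using p01 by (intro degree_lessI) (auto simp: cB)
    have BU: "(B * Up 0) mod f = (\<Sum>i<p. smult (a i) (V i))"
    proof -
      have "monom (a i) i * Up 0 = smult (a i) (monom 1 i * Up 0)" for i
        by (metis mult_smult_left smult_monom mult.right_neutral)
      then have "B * Up 0 = (\<Sum>i<p. smult (a i) (monom 1 i * Up 0))"
        unfolding B_def sum_distrib_right by simp
      moreover have "(\<Sum>i<n. smult (a i) (monom 1 i * Up 0)) mod f = (\<Sum>i<n. smult (a i) ((monom 1 i * Up 0) mod f))" for n
        by (induction n) (auto simp: poly_mod_add_left mod_smult_left)
      ultimately show ?thesis by (simp add: V_def)
    qed
    have Vp: "V p = Up 1" by (simp add: V_def)
    have "(\<Sum>i\<le>p. smult (a i) (V i)) = (\<Sum>i<p. smult (a i) (V i)) + smult (a p) (V p)"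
      by (simp add: lessThan_Suc_atMost[symmetric])
    then have m0: "(B * Up 0) mod f = - smult (a p) (Up 1)" using sum0 unfolding BU Vp by (simp add: eq_neg_iff_add_eq_0)
    have "f dvd B * Up 0 - (B * Up 0) mod f" by (simp add: minus_mod_eq_mult_div)
    then have fd: "f dvd B * Up 0 + smult (a p) (Up 1)" unfolding m0 by simp
    have ap: "a p \<noteq> 0"
    proof
      assume ap: "a p = 0"
      then have "f dvd B * Up 0" using fd by simp
      then have "poly (B * Up 0) \<theta> = 0" by (rule dvd_root)
      then have "poly B \<theta> = 0" using Upt[OF p01(1)] by simp
      then have "B = 0" using ind BQ Bd unfolding power_indep_def by blast
      then have "a i = 0" if "i < p" for i using cB[of i] that by simp
      then show False using a(2) ap by (metis le_neq_implies_less)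
    qed
    define A where "A = smult (- inverse (a p)) B"
    have "A * Up 0 - Up 1 = smult (- inverse (a p)) (B * Up 0 + smult (a p) (Up 1))"
      using ap by (simp add: A_def smult_add_right)
    then have "f dvd A * Up 0 - Up 1" using fd by (simp add: dvd_smult)
    moreover have "A \<in> pol ?Q" unfolding A_def using a(1) BQ by (intro pol_smult[OF Qr]) (auto intro!: sfieldD[OF Qf])
    moreover have "degree A < p" using Bd degree_smult_le[of "- inverse (a p)" B] unfolding A_def by simp
    ultimately show thesis using that by blast
  qed
  have map_dvd: "f dvd map_poly g P" if g: "shom ?Q g" "map_poly g f = f" and P: "P \<in> pol ?Q" "f dvd P" for g P
  proof -
    obtain C where C: "P = f * C" using P(2) by (elim dvdE)
    have "C \<in> pol ?Q" by (rule pol_quot[OF Qf polMQ[OF fM] P(1) C f0])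
    then have "map_poly g P = f * map_poly g C" unfolding C using map_pol(3)[OF g(1) Qr polMQ[OF fM]] g(2) by simp
    then show ?thesis by simp
  qed
  have map_diff: "map_poly g (a * b - c) = map_poly g a * map_poly g b - map_poly g c"
    if g: "shom ?Q g" and abc: "a \<in> pol ?Q" "b \<in> pol ?Q" "c \<in> pol ?Q" for g a b c
    using shom_diff[OF shom_map_poly[OF g Qr] pol_sring[OF Qr]] map_pol(3)[OF g Qr] abc sringD(4)[OF pol_sring[OF Qr]] by simp
  have map_agree: "map_poly g P = map_poly h P" if "shom ?Q g" "shom S h" "\<And>a. a \<in> S \<Longrightarrow> g a = h a" "P \<in> pol S" for g h P
    using that by (intro poly_eqI) (simp add: map_pol(1)[OF that(1) Qr] map_pol(1)[OF that(2) Sr] polD)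
  have UQ: "Up 0 \<in> pol ?Q" "Up 1 \<in> pol ?Q" using UpS p01 polSQ by auto
  \<comment> \<open>A scaling multiplies \<open>u_0\<close> and \<open>u_1\<close> by the same
    \<open>l\<close>, so the image of \<open>A\<close> solves the same congruence; degree below
    \<open>p\<close> makes the solution unique.\<close>
  have AM: "coeff A k \<in> M'" for k
  proof -
    have "R l (coeff A k) = coeff A k" if l: "l \<in> Lam" for l
    proof -
      note g = R(1)[OF l]
      have mU: "map_poly (R l) (Up i) = (l * Up i) mod f" if "i < p" for i
        using map_agree[OF g rho_hom R(2)[OF l] UpS[OF that]] rho_Up[OF that] by simp
      have mf: "map_poly (R l) f = f" using map_agree[OF g rho_hom R(2)[OF l] polMS[OF fM]] map_rho_M[OF fM] by simp
      let ?B = "map_poly (R l) A"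
      have "f dvd map_poly (R l) (A * Up 0 - Up 1)"
        by (rule map_dvd[OF g mf _ A(3)]) (intro sringD(6,4)[OF pol_sring[OF Qr]] A UQ)
      then have "f dvd ?B * ((l * Up 0) mod f) - (l * Up 1) mod f"
        unfolding map_diff[OF g A(1) UQ] using mU p01 by simp
      moreover have e: "poly (W mod f) \<theta> = poly W \<theta>" for W using \<theta> by (simp add: minus_div_mult_eq_mod[symmetric])
      ultimately have "poly ?B \<theta> * (poly l \<theta> * poly (Up 0) \<theta>) - poly l \<theta> * poly (Up 1) \<theta> = 0"
        using dvd_root[of "?B * ((l * Up 0) mod f) - (l * Up 1) mod f"] by simp
      moreover have "poly A \<theta> * poly (Up 0) \<theta> - poly (Up 1) \<theta> = 0" using dvd_root[OF A(3)] by simp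
      ultimately have "poly l \<theta> * poly (Up 0) \<theta> * (poly ?B \<theta> - poly A \<theta>) = 0" by (simp add: algebra_simps)
      then have "poly (?B - A) \<theta> = 0" using Lam_mod[OF l] Upt[OF p01(1)] by simp
      moreover have "?B - A \<in> pol ?Q" using A(1) RQ[OF l] by (intro sringD(6)[OF pol_sring[OF Qr]] map_pol_in[OF g Qr])
      moreover have "degree (?B - A) < p" using A(2) degree_map_pol[of "R l" A] shom_0[OF g Qr] by (intro degree_diff_less) auto
      ultimately have "?B - A = 0" using ind unfolding power_indep_def by blast
      then have "coeff ?B k = coeff A k" by simp
      then show ?thesis by (simp add: map_pol(1)[OF g Qr])
    qed
    then show ?thesis unfolding M'_def using polD[OF A(1)] by simp
  qed
  have hk: "shom ?Q (F ^^ k)" "map_poly (F ^^ k) f = f" "k \<le> p \<Longrightarrow> map_poly (F ^^ k) (Up 0) = Uq k" for k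
  proof -
    show h: "shom ?Q (F ^^ k)" for k by (rule funpow_shom[OF F(1) FQ])
    show "map_poly (F ^^ k) f = f"
    proof (rule poly_eqI)
      fix n
      have "coeff f n \<in> fixK M s" by (rule polD[OF fK])
      then have "F (coeff f n) = coeff f n" using FM by (simp add: fixK_def)
      then show "coeff (map_poly (F ^^ k) f) n = coeff f n" by (simp add: map_pol(1)[OF h Qr] funpow_fix)
    qed
    have FU: "map_poly F (Uq i) = Uq (Suc i)" if "i < p" for i
      using map_agree[OF F(1) phi_hom F(2) UpS[OF that]] phi_Up[OF that] that by (simp add: Uq_def)
    show "k \<le> p \<Longrightarrow> map_poly (F ^^ k) (Up 0) = Uq k"
    proof (induction k)
      case 0
      then show ?case using p01 by (intro poly_eqI) (simp add: map_pol(1)[OF h[of 0] Qr] Uq_def)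
    next
      case (Suc k)
      have "map_poly (F ^^ Suc k) (Up 0) = map_poly F (map_poly (F ^^ k) (Up 0))"
        by (intro poly_eqI) (simp add: map_pol(1)[OF h Qr] map_pol(1)[OF F(1) Qr] del: funpow.simps, simp)
      then show ?case using Suc FU[of k] by (simp add: o_def)
    qed
  qed
  have Ak: "poly (map_poly (F ^^ k) A) \<theta> * poly (Uq k) \<theta> = poly (Uq (Suc k)) \<theta>" if k: "k < p" for k
  proof -
    have "f dvd map_poly (F ^^ k) (A * Up 0 - Up 1)"
      by (rule map_dvd[OF hk(1,2) _ A(3)]) (intro sringD(6,4)[OF pol_sring[OF Qr]] A UQ)
    moreover have "map_poly (F ^^ k) (Up 1) = Uq (Suc k)"
    proof -
      have "Up 1 = map_poly F (Up 0)"
        using map_agree[OF F(1) phi_hom F(2) UpS[OF p01(1)]] phi_Up[OF p01(1)] p01 by (simp add: Uq_def)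
      then have "map_poly (F ^^ k) (Up 1) = map_poly (F ^^ Suc k) (Up 0)"
        by (intro poly_eqI) (simp add: map_pol(1)[OF hk(1) Qr] map_pol(1)[OF F(1) Qr] funpow_swap1 del: funpow.simps, simp add: funpow_swap1)
      then show ?thesis using hk(3)[of "Suc k"] k by simp
    qed
    ultimately have "f dvd map_poly (F ^^ k) A * Uq k - Uq (Suc k)"
      unfolding map_diff[OF hk(1) A(1) UQ] using hk(3)[of k] k by simp
    then have "poly (map_poly (F ^^ k) A * Uq k - Uq (Suc k)) \<theta> = 0" by (rule dvd_root)
    then show ?thesis by simp
  qed
  \<comment> \<open>The product telescopes, and at \<open>j = p\<close> the value
    \<open>Uq p\<close> is \<open>t\<close> times \<open>u_0\<close>.\<close>
  have "(\<Prod>k<j. poly (map_poly (F ^^ k) A) \<theta>) * poly (Up 0) \<theta> = poly (Uq j) \<theta>" if "j \<le> p" for j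
    using that
  proof (induction j)
    case 0
    then show ?case using p01 by (simp add: Uq_def)
  next
    case (Suc j)
    have "(\<Prod>k<Suc j. poly (map_poly (F ^^ k) A) \<theta>) * poly (Up 0) \<theta> =
        poly (map_poly (F ^^ j) A) \<theta> * ((\<Prod>k<j. poly (map_poly (F ^^ k) A) \<theta>) * poly (Up 0) \<theta>)"
      by (simp add: ac_simps)
    then show ?case using Suc Ak[of j] by simp
  qed
  from this[of p] have "(\<Prod>k<p. poly (map_poly (F ^^ k) A) \<theta>) = t" using Upt[OF p01(1)] by (simp add: Uq_def)
  then have "poly (\<Prod>k<p. map_poly (F ^^ k) A) \<theta> = t" by (simp add: poly_prod)
  moreover have "A \<in> pol M'" by (rule polI) (rule AM)
  ultimately show ?thesis using ext by blast
qed

end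

section \<open>The tower of fields\<close>

lemma cycD:
  assumes "cyc p M s"
  shows "sfield M" "countable M" "shom M s" "z \<in> M \<Longrightarrow> s z \<in> M" "z \<in> M \<Longrightarrow> (s ^^ p) z = z"
  using assms unfolding cyc_def by auto

lemma fixK_sfield: "cyc p M s \<Longrightarrow> sfield (fixK M s)"
proof -
  assume "cyc p M s"
  note D = cycD[OF this]
  note F = sfieldD[OF D(1)]
  show ?thesis unfolding sfield_def sring_def fixK_def
    using F shomD[OF D(3)] shom_0[OF D(3) F(1)] shom_minus[OF D(3) F(1)] shom_inverse[OF D(3,1)] by simp
qed

lemma cextD:
  assumes "cext p M s M' s'"
  shows "cyc p M' s'" "M \<subseteq> M'" "z \<in> M \<Longrightarrow> s' z = s z"
    "c \<in> fixK M s \<Longrightarrow> x \<in> M' \<Longrightarrow> nrm p s' x = c \<Longrightarrow> \<exists>y\<in>M. nrm p s y = c"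
    "fixK M s \<subseteq> fixK M' s'"
  using assms unfolding cext_def fixK_def by auto

lemma cext_refl: "cyc p M s \<Longrightarrow> cext p M s M s"
  unfolding cext_def by auto

lemma cext_trans:
  assumes 1: "cext p M s M' s'" and 2: "cext p M' s' M'' s''"
  shows "cext p M s M'' s''"
  unfolding cext_def
proof (intro conjI ballI impI)
  show "cyc p M'' s''" by (rule cextD(1)[OF 2])
  show "M \<subseteq> M''" using cextD(2)[OF 1] cextD(2)[OF 2] by blast
  show "s'' z = s z" if "z \<in> M" for z using that cextD(2,3)[OF 1] cextD(3)[OF 2] by auto
  fix c x assume c: "c \<in> fixK M s" "x \<in> M''" "nrm p s'' x = c"
  then obtain y where "y \<in> M'" "nrm p s' y = c" using cextD(4)[OF 2] cextD(5)[OF 1] by blast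
  then show "\<exists>y\<in>M. nrm p s y = c" using cextD(4)[OF 1 c(1)] by blast
qed

lemma cext_iter: "cext p M s M' s' \<Longrightarrow> cyc p M s \<Longrightarrow> z \<in> M \<Longrightarrow> (s' ^^ k) z = (s ^^ k) z"
  by (rule funpow_agree[of M]) (auto dest: cextD(3) cycD(4))

text \<open>Each closure property and each norm equation involves finitely many elements and so
  already lives at some stage, from which \<open>le\<close> leads back to stage
  \<open>n\<close>.\<close>

lemma chain_limit:
  assumes c0: "cyc p (M 0) (s 0)" and ch: "\<And>n. cext p (M n) (s n) (M (Suc n)) (s (Suc n))"
  shows "\<exists>s'. \<forall>n. cext p (M n) (s n) (\<Union>n. M n) s'"
proof -
  have cy: "cyc p (M n) (s n)" for n using c0 cextD(1)[OF ch] by (cases n) auto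
  have le: "cext p (M n) (s n) (M m) (s m)" if "n \<le> m" for n m
    using that by (induction m rule: dec_induct) (auto intro: cext_refl[OF cy] cext_trans[OF _ ch])
  \<comment> \<open>Taking the first stage containing \<open>z\<close> is a mere choice; the
    automorphisms of later stages agree with it.\<close>
  define s' where "s' z = s (LEAST n. z \<in> M n) z" for z
  have s': "s' z = s n z" if "z \<in> M n" for z n
  proof -
    have "z \<in> M (LEAST n. z \<in> M n)" using that by (rule LeastI)
    moreover have "(LEAST n. z \<in> M n) \<le> n" using that by (rule Least_le)
    ultimately show ?thesis unfolding s'_def using cextD(3)[OF le] by metis
  qed
  let ?M = "\<Union>n. M n"
  have two: "\<exists>n. a \<in> M n \<and> b \<in> M n" if ab: "a \<in> ?M" "b \<in> ?M" for a b
  proof -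
    obtain n m where "a \<in> M n" "b \<in> M m" using ab by blast
    then have "a \<in> M (max n m)" "b \<in> M (max n m)" using cextD(2)[OF le[of n "max n m"]] cextD(2)[OF le[of m "max n m"]] by auto
    then show ?thesis by blast
  qed
  have s'M: "s' z \<in> M n" if "z \<in> M n" for z n using s'[OF that] cycD(4)[OF cy that] by simp
  have it: "(s' ^^ k) z = (s n ^^ k) z" if "z \<in> M n" for z n k
    by (rule funpow_agree[OF _ s' that]) (auto intro: cycD(4)[OF cy])
  have cyU: "cyc p ?M s'" unfolding cyc_def
  proof (intro conjI ballI)
    have 2: "a + b \<in> ?M" "a * b \<in> ?M" "s' (a + b) = s' a + s' b" "s' (a * b) = s' a * s' b"
      if ab: "a \<in> ?M" "b \<in> ?M" for a b
    proof -
      obtain n where n: "a \<in> M n" "b \<in> M n" using two ab by blast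
      note D = sfieldD[OF cycD(1)[OF cy[of n]]] and H = shomD[OF cycD(3)[OF cy[of n]]]
      show "a + b \<in> ?M" "a * b \<in> ?M" using D(4,5)[OF n] by blast+
      show "s' (a + b) = s' a + s' b" "s' (a * b) = s' a * s' b"
        using s'[OF n(1)] s'[OF n(2)] s'[OF D(4)[OF n]] s'[OF D(5)[OF n]] H(2,3)[OF n] by simp_all
    qed
    have 1: "- a \<in> ?M" "inverse a \<in> ?M" if a: "a \<in> ?M" for a
      using a sfieldD(6,8)[OF cycD(1)[OF cy]] by blast+
    have 0: "0 \<in> M 0" "1 \<in> M 0" using sfieldD(2,3)[OF cycD(1)[OF cy]] by auto
    show "sfield ?M" unfolding sfield_def sring_def using 0 1 2(1,2) by (meson UN_I UNIV_I)
    show "shom ?M s'" unfolding shom_def using 2(3,4) s'[OF 0(2)] shomD(1)[OF cycD(3)[OF cy]] by simp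
    show "countable ?M" using cycD(2)[OF cy] by (intro countable_UN) auto
    show "s' z \<in> ?M" if "z \<in> ?M" for z using that s'M by blast
    show "(s' ^^ p) z = z" if "z \<in> ?M" for z using that it cycD(5)[OF cy] by fastforce
  qed
  have "cext p (M n) (s n) ?M s'" for n
    unfolding cext_def
  proof (intro conjI ballI impI cyU)
    fix c x assume c: "c \<in> fixK (M n) (s n)" "x \<in> ?M" "nrm p s' x = c"
    obtain m where "x \<in> M m" using c(2) by blast
    then have x: "x \<in> M (max n m)" using cextD(2)[OF le[of m "max n m"]] by auto
    have "nrm p (s (max n m)) x = c" using c(3) it[OF x] unfolding nrm_def by simp
    then show "\<exists>y\<in>M n. nrm p (s n) y = c" using cextD(4)[OF le[of n "max n m"] c(1) x] by simp
  qed (use s' in auto)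
  then show ?thesis by blast
qed

text \<open>Two uses: \<open>w = 1\<close> makes \<open>T\<close> a new element of the fixed field,
  and \<open>w = \<zeta>\<close> over the identity produces the Kummer generator of
  \<open>base_field\<close>.\<close>

lemma transc_ext:
  assumes c: "cyc p M s" and w: "w \<in> fixK M s" "w ^ p = 1" and T: "transc M T" and p: "p > 0"
  shows "\<exists>F. cyc p (frac (adj M T)) F \<and> (\<forall>z\<in>M. F z = s z) \<and> F T = w * T"
proof -
  note D = cycD[OF c] and Mr = sfieldD(1)[OF cycD(1)[OF c]]
  note A = adj_sring[OF Mr, where v = T]
  have wM: "w \<in> M" "s w = w" using w(1) by (auto simp: fixK_def)
  have T0: "T \<noteq> 0"
  proof
    assume "T = 0"
    then have "poly [:0, 1:] T = 0" by simp
    moreover have "[:0, 1:] \<in> pol M" using sringD(1,2)[OF Mr] by (simp add: pol_pCons)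
    ultimately show False using T unfolding transc_def by fastforce
  qed
  obtain g where g: "shom (adj M T) g" "\<forall>a\<in>M. g a = s a" "g T = w * T" using adj_hom[OF Mr T D(3)] by blast
  have gin: "g x \<in> adj M T" if "x \<in> adj M T" for x
  proof -
    have 1: "pr M (\<lambda>_. T) (Suc 0) = adj M T" by simp
    show ?thesis
      by (rule pr_hom_image[OF Mr, of "\<lambda>_. T" "Suc 0", unfolded 1, OF g(1) A(1) _ _ that])
        (use g D(4) A wM sringD(4)[OF A(1)] in auto)
  qed
  have gp: "(g ^^ p) x = x" if "x \<in> adj M T" for x
  proof (rule adj_hom_eq[OF Mr funpow_shom[OF g(1) gin] _ _ _ that])
    show "shom (adj M T) (\<lambda>x. x)" by (simp add: shom_def)
    show "(g ^^ p) a = a" if "a \<in> M" for a using funpow_agree[OF D(4) _ that, where s' = g and i = p] g(2) D(5)[OF that] by simp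
    have gw: "g w = w" using g(2) wM by simp
    have "(g ^^ k) T = w ^ k * T" for k
    proof (induction k)
      case (Suc k)
      have "w ^ k \<in> adj M T" using sring_power[OF Mr wM(1), of k] A(2) by blast
      moreover have "g (w ^ k) = w ^ k" using shom_power[OF g(1) A(1), of w k] gw wM A(2) by auto
      ultimately show ?case using Suc shomD(3)[OF g(1) _ A(3)] g(3) by simp
    qed simp
    then show "(g ^^ p) T = T" using w(2) by simp
  qed
  have ginj: "x = 0" if x: "x \<in> adj M T" "g x = 0" for x
  proof -
    have "(g ^^ p) x = (g ^^ (p - 1)) (g x)" using p by (cases p) (auto simp: funpow_swap1)
    also have "\<dots> = 0" unfolding x(2) by (rule funpow_fix) (rule shom_0[OF g(1) A(1)])
    finally show ?thesis using gp[OF x(1)] by simp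
  qed
  obtain F where F: "shom (frac (adj M T)) F" "\<forall>a\<in>adj M T. F a = g a" using frac_hom[OF A(1) g(1) ginj] by blast
  have Fin: "F z \<in> frac (adj M T)" if "z \<in> frac (adj M T)" for z
    by (rule frac_hom_image[OF A(1) F(1) frac_sfield[OF A(1)] _ that]) (use F(2) gin frac_subset[OF A(1)] in auto)
  have "cyc p (frac (adj M T)) F" unfolding cyc_def
  proof (intro conjI ballI frac_sfield[OF A(1)] F(1) Fin)
    show "countable (frac (adj M T))" by (intro countable_frac countable_adj D)
    fix z assume z: "z \<in> frac (adj M T)"
    show "(F ^^ p) z = z"
    proof (rule frac_hom_eq[OF A(1) funpow_shom[OF F(1) Fin] _ _ z])
      show "shom (frac (adj M T)) (\<lambda>x. x)" by (simp add: shom_def)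
      show "(F ^^ p) a = a" if "a \<in> adj M T" for a
        using funpow_agree[OF gin _ that, where s' = F and i = p] F(2) gp[OF that] by simp
    qed
  qed
  moreover have "F z = s z" if "z \<in> M" for z using that A(2) F(2) g(2) by auto
  moreover have "F T = w * T" using A(3) F(2) g(3) by simp
  ultimately show ?thesis by blast
qed

lemma poly_nrm:
  assumes c: "cyc p M s" and a: "a \<in> pol M" "a \<noteq> 0" and p: "p > 0"
  defines "P \<equiv> \<Prod>i<p. map_poly (s ^^ i) a"
  shows "P \<in> pol M" "degree P = p * degree a" "lead_coeff P = nrm p s (lead_coeff a)" "P \<noteq> 0"
proof -
  note D = cycD[OF c] and Mr = sfieldD(1)[OF cycD(1)[OF c]]
  note h = funpow_shom[OF D(3,4)]
  have "map_poly (s ^^ i) a \<in> pol M" for i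
    using a(1) by (intro map_pol_in[OF h Mr]) (auto intro: funpow_in[OF D(4)])
  then show "P \<in> pol M" unfolding P_def by (intro sring_prod[OF pol_sring[OF Mr]])
  have nz: "(s ^^ i) (lead_coeff a) \<noteq> 0" for i
    using shom_nonzero[OF h D(1) polD[OF a(1)]] a(2) by simp
  have d: "degree (map_poly (s ^^ i) a) = degree a" for i
  proof (rule antisym)
    show "degree (map_poly (s ^^ i) a) \<le> degree a" by (rule degree_map_pol) (rule shom_0[OF h Mr])
    show "degree a \<le> degree (map_poly (s ^^ i) a)" by (rule le_degree) (simp add: map_pol(1)[OF h Mr] nz)
  qed
  have z: "map_poly (s ^^ i) a \<noteq> 0" for i using nz[of i] map_pol(1)[OF h Mr, of i a "degree a"] by auto
  then show "P \<noteq> 0" unfolding P_def by simp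
  show "degree P = p * degree a" unfolding P_def by (subst degree_prod_eq_sum_degree) (auto simp: z d)
  show "lead_coeff P = nrm p s (lead_coeff a)"
    unfolding P_def lead_coeff_prod nrm_def d by (simp add: map_pol(1)[OF h Mr])
qed

text \<open>If \<open>a(T) / b(T)\<close> has norm \<open>k * T ^ e\<close>, then
  \<open>N(a) = k T^e N(b)\<close> holds as polynomials, where \<open>N\<close> multiplies the
  conjugates. Both norms have degree divisible by \<open>p\<close>, which excludes
  \<open>e = 1\<close>; for \<open>e = 0\<close> the leading coefficients show that \<open>k\<close>
  was a norm from \<open>M\<close> already.\<close>

lemma adjoin_non_norm:
  assumes c: "cyc p M s" and p: "prime p"
  shows "\<exists>M' s' T. cext p M s M' s' \<and> T \<in> fixK M' s' \<and> T \<noteq> 0 \<and>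
    (\<forall>c\<in>fixK M s. c \<noteq> 0 \<longrightarrow> (\<forall>x\<in>M'. nrm p s' x \<noteq> c * T))"
proof -
  note D = cycD[OF c] and Mr = sfieldD(1)[OF cycD(1)[OF c]]
  have p2: "p \<ge> 2" using p by (rule prime_ge_2_nat)
  obtain T where T: "transc M T" using exists_transc[OF D(2)] by blast
  have "1 \<in> fixK M s" using sfieldD(3)[OF D(1)] shomD(1)[OF D(3)] by (simp add: fixK_def)
  then obtain F where F: "cyc p (frac (adj M T)) F" "\<forall>z\<in>M. F z = s z" "F T = T"
    using transc_ext[OF c _ _ T, of 1] p2 by auto
  note A = adj_sring[OF Mr, where v = T]
  let ?M' = "frac (adj M T)"
  have sub: "M \<subseteq> ?M'" "T \<in> ?M'" using A frac_subset[OF A(1)] by auto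
  note FD = cycD[OF F(1)] and M'r = sfieldD(1)[OF cycD(1)[OF F(1)]]
  have Nm: "nrm p F (poly a T) = poly (\<Prod>i<p. map_poly (s ^^ i) a) T" if a: "a \<in> pol M" for a
  proof -
    have "(F ^^ i) (poly a T) = poly (map_poly (s ^^ i) a) T" for i
    proof -
      have h: "shom ?M' (F ^^ i)" by (rule funpow_shom[OF FD(3,4)])
      have "(F ^^ i) (poly a T) = poly (map_poly (F ^^ i) a) ((F ^^ i) T)"
        using shom_poly[OF h M'r _ sub(2)] a pol_mono[OF sub(1)] by blast
      moreover have "map_poly (F ^^ i) a = map_poly (s ^^ i) a"
        using funpow_agree[OF D(4), where s' = F] F(2) a
        by (intro poly_eqI) (simp add: map_pol(1)[OF h M'r] map_pol(1)[OF funpow_shom[OF D(3,4)] Mr] polD)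
      ultimately show ?thesis using funpow_fix[of F T i, OF F(3)] by simp
    qed
    then show ?thesis unfolding nrm_def by (simp add: poly_prod)
  qed
  have key: "\<exists>a b. a \<in> pol M \<and> b \<in> pol M \<and> a \<noteq> 0 \<and> b \<noteq> 0 \<and>
      (\<Prod>i<p. map_poly (s ^^ i) a) = monom k e * (\<Prod>i<p. map_poly (s ^^ i) b)"
    if x: "x \<in> ?M'" "nrm p F x = k * T ^ e" "k * T ^ e \<noteq> 0" and k: "k \<in> M" for x k e
  proof -
    obtain y z where yz: "x = y / z" "y \<in> adj M T" "z \<in> adj M T" "z \<noteq> 0" using x(1) by (rule fracE)
    obtain a b where ab: "y = poly a T" "a \<in> pol M" "z = poly b T" "b \<in> pol M" using yz unfolding adj_def by blast
    have "x \<noteq> 0"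
    proof
      assume "x = 0"
      then have "nrm p F x = 0" using nrm_fix[of F x p] shom_0[OF FD(3) M'r] p2 by simp
      then show False using x(2,3) by simp
    qed
    then have nz: "a \<noteq> 0" "b \<noteq> 0" using yz ab by auto
    let ?P = "\<lambda>a. \<Prod>i<p. map_poly (s ^^ i) a"
    have Pp: "?P a \<in> pol M" "?P b \<in> pol M" "?P b \<noteq> 0" using poly_nrm[OF c] ab nz p2 by auto
    have "nrm p F x = nrm p F y / nrm p F z" unfolding yz(1)
      by (rule nrm_divide[OF FD(1,3,4)]) (use yz frac_subset[OF A(1)] in auto)
    moreover have "poly (?P b) T \<noteq> 0" using T Pp unfolding transc_def by blast
    ultimately have "poly (?P a) T = k * T ^ e * poly (?P b) T"
      using x(2) Nm ab by (simp add: field_simps)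
    then have "poly (?P a - monom k e * ?P b) T = 0" by (simp add: poly_monom)
    moreover have "?P a - monom k e * ?P b \<in> pol M"
      using Pp sringD(1)[OF Mr] k by (intro sringD(6,4)[OF pol_sring[OF Mr]] pol_monom) auto
    ultimately have "?P a - monom k e * ?P b = 0" using T unfolding transc_def by blast
    then show ?thesis using ab nz by (intro exI[of _ a] exI[of _ b]) simp
  qed
  have T0: "T \<noteq> 0"
  proof
    assume "T = 0"
    then have "poly [:0, 1:] T = 0" by simp
    moreover have "[:0, 1:] \<in> pol M" using sringD(1,2)[OF Mr] by (simp add: pol_pCons)
    ultimately show False using T unfolding transc_def by fastforce
  qed
  have "\<exists>y\<in>M. nrm p s y = k" if k: "k \<in> fixK M s" and x: "x \<in> ?M'" "nrm p F x = k" for k x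
  proof (cases "k = 0")
    case True
    have "nrm p s 0 = 0" using nrm_fix[of s 0 p] shom_0[OF D(3) Mr] p2 by simp
    then show ?thesis using True sfieldD(2)[OF D(1)] by blast
  next
    case False
    have kM: "k \<in> M" using k by (simp add: fixK_def)
    obtain a b where ab: "a \<in> pol M" "b \<in> pol M" "a \<noteq> 0" "b \<noteq> 0"
      "(\<Prod>i<p. map_poly (s ^^ i) a) = monom k 0 * (\<Prod>i<p. map_poly (s ^^ i) b)"
      using key[OF x(1), of k 0] x(2) False kM by auto
    have "nrm p s (lead_coeff a) = k * nrm p s (lead_coeff b)"
      using arg_cong[OF ab(5), of lead_coeff] poly_nrm(3)[OF c ab(1,3)] poly_nrm(3)[OF c ab(2,4)] p2
      by (simp add: lead_coeff_mult monom_0)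
    moreover have "nrm p s (lead_coeff b) \<noteq> 0"
    proof -
      have "0 < p" using p2 by simp
      from poly_nrm(3,4)[OF c ab(2,4) this] show ?thesis by (metis leading_coeff_0_iff)
    qed
    ultimately have "nrm p s (lead_coeff a / lead_coeff b) = k"
      using nrm_divide[OF D(1,3,4) polD[OF ab(1)] polD[OF ab(2)]] by simp
    then show ?thesis using sfieldD(9)[OF D(1) polD[OF ab(1)] polD[OF ab(2)]] by blast
  qed
  then have "cext p M s ?M' F" unfolding cext_def using F sub by blast
  moreover have "nrm p F x \<noteq> k * T" if k: "k \<in> fixK M s" "k \<noteq> 0" and x: "x \<in> ?M'" for k x
  proof
    assume n: "nrm p F x = k * T"
    have kM: "k \<in> M" using k by (simp add: fixK_def)
    obtain a b where ab: "a \<in> pol M" "b \<in> pol M" "a \<noteq> 0" "b \<noteq> 0"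
      "(\<Prod>i<p. map_poly (s ^^ i) a) = monom k 1 * (\<Prod>i<p. map_poly (s ^^ i) b)"
      using key[OF x, of k 1] n k(2) T0 kM by auto
    have "p * degree a = degree (monom k 1 * (\<Prod>i<p. map_poly (s ^^ i) b))"
      unfolding ab(5)[symmetric] using poly_nrm(2)[OF c ab(1,3)] p2 by simp
    also have "\<dots> = 1 + p * degree b"
      using poly_nrm(2,4)[OF c ab(2,4)] p2 k(2) by (subst degree_mult_eq) (auto simp: degree_monom_eq)
    finally have "p dvd 1" by (metis dvd_add_left_iff dvd_triv_left add.commute)
    then show False using p2 by simp
  qed
  moreover have "T \<in> fixK ?M' F" using sub F(3) by (simp add: fixK_def)
  ultimately show ?thesis using T0 by blast
qed

text \<open>The root is chosen once for each \<open>f\<close>, so that \<open>solved\<close> refers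
  to the same root at every stage.\<close>

definition rt :: "complex poly \<Rightarrow> complex" where
  "rt f = (SOME x. poly f x = 0)"

lemma rt: "degree f > 0 \<Longrightarrow> poly f (rt f) = 0"
  unfolding rt_def using fundamental_theorem_of_algebra constant_degree by (metis (mono_tags, lifting) less_irrefl someI_ex)

text \<open>The congruence modulo \<open>f\<close> is replaced by evaluation at a root. The property
  then survives enlarging \<open>M\<close>, also when \<open>f\<close> becomes reducible.\<close>

definition solved :: "nat \<Rightarrow> complex set \<Rightarrow> (complex \<Rightarrow> complex) \<Rightarrow> complex poly \<Rightarrow> complex \<Rightarrow> bool" where
  "solved p M s f t \<longleftrightarrow> (\<exists>A\<in>pol M. poly (\<Prod>k<p. map_poly (s ^^ k) A) (rt f) = t)"

lemma solved_ext:
  assumes e: "cext p M s M' s'" and c: "cyc p M s" and f: "solved p M s f t"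
  shows "solved p M' s' f t"
proof -
  obtain A where A: "A \<in> pol M" "poly (\<Prod>k<p. map_poly (s ^^ k) A) (rt f) = t" using f unfolding solved_def by blast
  note D = cycD[OF c] and D' = cycD[OF cextD(1)[OF e]]
  have "map_poly (s' ^^ k) A = map_poly (s ^^ k) A" for k
    using cext_iter[OF e c] A(1)
    by (intro poly_eqI) (simp add: map_pol(1)[OF funpow_shom[OF D(3,4)] sfieldD(1)[OF D(1)]]
      map_pol(1)[OF funpow_shom[OF D'(3,4)] sfieldD(1)[OF D'(1)]] polD)
  then have "poly (\<Prod>k<p. map_poly (s' ^^ k) A) (rt f) = t" using A(2) by simp
  then show ?thesis unfolding solved_def using A(1) pol_mono[OF cextD(2)[OF e]] by blast
qed

lemma solve_one:
  assumes p: "prime p" and c: "cyc p M s" and f: "f \<in> pol (fixK M s)" "degree f = p" "lead_coeff f = 1" "irr M f"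
    and t: "t \<in> fixK M s" "t \<noteq> 0"
  shows "\<exists>M' s'. cext p M s M' s' \<and> solved p M' s' f t"
proof -
  have p0: "degree f > 0" using p f(2) prime_gt_0_nat by simp
  obtain u where "\<forall>m. indep (adj M (rt f)) u m" using exists_indep[OF countable_adj[OF cycD(2)[OF c]]] by blast
  then interpret lstep p M s f t "rt f" u
    by unfold_locales (use p c f t rt[OF p0] in auto)
  show ?thesis using step unfolding solved_def by blast
qed

text \<open>There are countably many pairs of \<open>f\<close> and \<open>t\<close> over the initial
  fixed field; stage \<open>n\<close> treats the \<open>n\<close>-th one if \<open>f\<close> is
  still irreducible over the field reached. A polynomial irreducible over the union was irreducible
  when its turn came.\<close>

lemma solve_all:
  assumes p: "prime p" and c: "cyc p M s"
  shows "\<exists>M' s'. cext p M s M' s' \<and> (\<forall>f\<in>pol (fixK M s). \<forall>t\<in>fixK M s.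
    degree f = p \<longrightarrow> lead_coeff f = 1 \<longrightarrow> irr M' f \<longrightarrow> t \<noteq> 0 \<longrightarrow> solved p M' s' f t)"
proof -
  define J where "J = pol (fixK M s) \<times> fixK M s"
  have Kc: "countable (fixK M s)" using cycD(2)[OF c] countable_subset[of "fixK M s" M] by (auto simp: fixK_def)
  have J: "countable J" "J \<noteq> {}" unfolding J_def using countable_pol[OF Kc] Kc sfieldD(2)[OF fixK_sfield[OF c]]
    by (auto intro: countable_SIGMA) (metis pol_0 empty_iff)
  define task where "task = from_nat_into J"
  have task: "fst (task n) \<in> pol (fixK M s)" "snd (task n) \<in> fixK M s" for n
    using from_nat_into[OF J(2), of n] unfolding task_def J_def by auto
  let ?ok = "\<lambda>n N. degree (fst (task n)) = p \<and> lead_coeff (fst (task n)) = 1 \<and> irr N (fst (task n)) \<and> snd (task n) \<noteq> 0"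
  have "\<exists>x. \<forall>n. cext p M s (fst (x n)) (snd (x n)) \<and>
      (cext p (fst (x n)) (snd (x n)) (fst (x (Suc n))) (snd (x (Suc n))) \<and>
       (?ok n (fst (x n)) \<longrightarrow> solved p (fst (x (Suc n))) (snd (x (Suc n))) (fst (task n)) (snd (task n))))"
  proof (rule dependent_nat_choice)
    show "\<exists>x. cext p M s (fst x) (snd x)" using cext_refl[OF c] by (intro exI[of _ "(M, s)"]) simp
    fix x :: "complex set \<times> (complex \<Rightarrow> complex)" and n
    assume x: "cext p M s (fst x) (snd x)"
    obtain N r where Nr: "x = (N, r)" by (cases x)
    have e: "cext p M s N r" using x Nr by simp
    have cN: "cyc p N r" by (rule cextD(1)[OF e])
    have K: "fixK M s \<subseteq> fixK N r" by (rule cextD(5)[OF e])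
    have "\<exists>N' r'. cext p N r N' r' \<and> (?ok n N \<longrightarrow> solved p N' r' (fst (task n)) (snd (task n)))"
    proof (cases "?ok n N")
      case True
      then show ?thesis using solve_one[OF p cN, of "fst (task n)" "snd (task n)"] task[of n] pol_mono[OF K] K by blast
    next
      case False
      then show ?thesis using cext_refl[OF cN] by blast
    qed
    then obtain N' r' where "cext p N r N' r'" "?ok n N \<longrightarrow> solved p N' r' (fst (task n)) (snd (task n))" by blast
    then show "\<exists>y. cext p M s (fst y) (snd y) \<and> (cext p (fst x) (snd x) (fst y) (snd y) \<and>
        (?ok n (fst x) \<longrightarrow> solved p (fst y) (snd y) (fst (task n)) (snd (task n))))"
      using cext_trans[OF e] Nr by (intro exI[of _ "(N', r')"]) simp
  qed
  then obtain x where x: "\<And>n. cext p M s (fst (x n)) (snd (x n))"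
    "\<And>n. cext p (fst (x n)) (snd (x n)) (fst (x (Suc n))) (snd (x (Suc n)))"
    "\<And>n. ?ok n (fst (x n)) \<Longrightarrow> solved p (fst (x (Suc n))) (snd (x (Suc n))) (fst (task n)) (snd (task n))"
    by blast
  obtain s' where s': "\<And>n. cext p (fst (x n)) (snd (x n)) (\<Union>n. fst (x n)) s'"
    using chain_limit[of p "\<lambda>n. fst (x n)" "\<lambda>n. snd (x n)", OF cextD(1)[OF x(1)] x(2)] by blast
  let ?M = "\<Union>n. fst (x n)"
  have "solved p ?M s' f t" if ft: "f \<in> pol (fixK M s)" "t \<in> fixK M s" "degree f = p" "lead_coeff f = 1" "irr ?M f" "t \<noteq> 0" for f t
  proof -
    have "(f, t) \<in> J" unfolding J_def using ft by simp
    then obtain n where n: "task n = (f, t)" unfolding task_def using J by (metis from_nat_into_surj)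
    have "f \<in> pol (fst (x n))" using ft(1) pol_mono[of "fixK M s" "fst (x n)"] cextD(2)[OF x(1)[of n]] by (auto simp: fixK_def)
    then have "irr (fst (x n)) f" using irr_mono[OF ft(5)] by blast
    then have "solved p (fst (x (Suc n))) (snd (x (Suc n))) f t" using x(3)[of n] n ft by simp
    then show ?thesis using solved_ext[OF s' cextD(1)[OF x(1)]] by blast
  qed
  moreover have "cext p M s ?M s'" using cext_trans[OF x(1) s'] .
  ultimately show ?thesis by blast
qed

text \<open>A Kummer extension to start from: \<open>v\<close> is an indeterminate over the
  cyclotomic field generated by \<open>\<zeta>\<close>, and the automorphism fixes that field and
  multiplies \<open>v\<close> by \<open>\<zeta>\<close>.\<close>

lemma base_field:
  assumes p: "prime p"
  shows "\<exists>M s \<zeta> v. cyc p M s \<and> \<zeta> \<in> fixK M s \<and> \<zeta> ^ p = 1 \<and> (\<forall>i. 0 < i \<longrightarrow> i < p \<longrightarrow> \<zeta> ^ i \<noteq> 1) \<and>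
    v \<in> M \<and> v \<noteq> 0 \<and> s v = \<zeta> * v"
proof -
  have p0: "p > 0" using p prime_gt_0_nat by simp
  define \<zeta> where "\<zeta> = exp (2 * of_real pi * \<i> * of_nat 1 / of_nat p)"
  have \<zeta>i: "\<zeta> ^ i = exp (2 * of_real pi * \<i> * of_nat i / of_nat p)" for i
    unfolding \<zeta>_def exp_of_nat_mult[symmetric] by (simp add: field_simps)
  have z1: "\<zeta> ^ i = 1 \<longleftrightarrow> p dvd i" for i
    unfolding \<zeta>i using p0 complex_root_unity_eq_1[of p i] by simp
  define Z where "Z = range (of_int :: int \<Rightarrow> complex)"
  have Z: "sring Z" unfolding sring_def Z_def
    by (auto simp: image_iff) (metis of_int_add, metis of_int_mult, metis of_int_minus)
  have "countable Z" unfolding Z_def by simp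
  define k where "k = frac (adj Z \<zeta>)"
  note A = adj_sring[OF Z, where v = \<zeta>]
  have k: "sfield k" "countable k" "\<zeta> \<in> k"
    unfolding k_def using frac_sfield[OF A(1)] countable_frac[OF countable_adj[OF \<open>countable Z\<close>]] A(3) frac_subset[OF A(1)] by auto
  have ck: "cyc p k (\<lambda>x. x)" unfolding cyc_def using k by (simp add: shom_def funpow_fix)
  obtain v where v: "transc k v" using exists_transc[OF k(2)] by blast
  have "\<zeta> \<in> fixK k (\<lambda>x. x)" using k by (simp add: fixK_def)
  then obtain F where F: "cyc p (frac (adj k v)) F" "\<forall>z\<in>k. F z = z" "F v = \<zeta> * v"
    using transc_ext[OF ck _ _ v p0, of \<zeta>] z1[of p] by auto
  note B = adj_sring[OF sfieldD(1)[OF k(1)], where v = v]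
  have v0: "v \<noteq> 0"
  proof
    assume "v = 0"
    then have "poly [:0, 1:] v = 0" by simp
    moreover have "[:0, 1:] \<in> pol k" using sfieldD(2,3)[OF k(1)] by (simp add: pol_pCons)
    ultimately show False using v unfolding transc_def by fastforce
  qed
  have "v \<in> frac (adj k v)" "\<zeta> \<in> fixK (frac (adj k v)) F"
    using B frac_subset[OF B(1)] F(2) k(3) by (auto simp: fixK_def)
  moreover have "\<zeta> ^ i \<noteq> 1" if "0 < i" "i < p" for i using z1 that by (auto dest: dvd_imp_le)
  ultimately show ?thesis using F v0 z1[of p] by (intro exI[of _ "frac (adj k v)"] exI[of _ F] exI[of _ \<zeta>] exI[of _ v]) simp
qed

lemma pol_chain:
  assumes mono: "\<And>n m. n \<le> m \<Longrightarrow> K n \<subseteq> K m" and f: "f \<in> pol (\<Union>n. K n)" and K0: "0 \<in> K (0::nat)"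
  shows "\<exists>n. f \<in> pol (K n)"
  using f
proof (induction f)
  case 0
  then show ?case using K0 by auto
next
  case (pCons a f)
  have z: "0 \<in> K n" for n using mono[of 0 n] K0 by auto
  then have "0 \<in> (\<Union>n. K n)" by blast
  then have af: "a \<in> (\<Union>n. K n)" "f \<in> pol (\<Union>n. K n)" using pCons.prems by (auto simp: pol_pCons)
  obtain n where n: "f \<in> pol (K n)" using pCons.IH af by blast
  obtain m where m: "a \<in> K m" using af by blast
  have "a \<in> K (max n m)" "f \<in> pol (K (max n m))"
    using n m mono[of m "max n m"] pol_mono[OF mono[of n "max n m"]] by auto
  then show ?case using z by (intro exI[of _ "max n m"]) (simp add: pol_pCons)
qed

text \<open>Each stage adjoins a fresh \<open>t n\<close> and then treats all pairs over the fixed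
  field it started from; any pair over the final field has entered by some stage. The factor
  \<open>c\<close> from an earlier fixed field in the non-norm clause serves twice:
  \<open>c = 1\<close> for \<open>t n\<close> itself and \<open>c = inverse (t i)\<close> for
  quotients.\<close>

theorem field_tower:
  assumes p: "prime p"
  shows "\<exists>M s \<zeta> v t. cyc p M s \<and> \<zeta> \<in> fixK M s \<and> \<zeta> ^ p = 1 \<and> (\<forall>i. 0 < i \<longrightarrow> i < p \<longrightarrow> \<zeta> ^ i \<noteq> 1) \<and>
    v \<in> M \<and> v \<noteq> 0 \<and> s v = \<zeta> * v \<and>
    (\<forall>n::nat. t n \<in> fixK M s \<and> t n \<noteq> 0 \<and> (\<forall>x\<in>M. nrm p s x \<noteq> t n)) \<and>
    (\<forall>i j. i \<noteq> j \<longrightarrow> (\<forall>x\<in>M. nrm p s x * t i \<noteq> t j)) \<and>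
    (\<forall>f\<in>pol (fixK M s). \<forall>n. degree f = p \<longrightarrow> lead_coeff f = 1 \<longrightarrow> irr M f \<longrightarrow> solved p M s f (t n))"
proof -
  obtain M0 s0 \<zeta> v where b: "cyc p M0 s0" "\<zeta> \<in> fixK M0 s0" "\<zeta> ^ p = 1" "\<forall>i. 0 < i \<longrightarrow> i < p \<longrightarrow> \<zeta> ^ i \<noteq> 1"
    "v \<in> M0" "v \<noteq> 0" "s0 v = \<zeta> * v" using base_field[OF p] by metis
  \<comment> \<open>In the last clause \<open>t\<close> is rebound: it ranges over the fixed field
    of \<open>M\<close>, while outside it names the new element of \<open>M'\<close>.\<close>
  let ?Q = "\<lambda>M s M' s' t. cext p M s M' s' \<and> t \<in> fixK M' s' \<and> t \<noteq> 0 \<and>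
    (\<forall>c\<in>fixK M s. c \<noteq> 0 \<longrightarrow> (\<forall>x\<in>M'. nrm p s' x \<noteq> c * t)) \<and>
    (\<forall>f\<in>pol (fixK M s). \<forall>t\<in>fixK M s. degree f = p \<longrightarrow> lead_coeff f = 1 \<longrightarrow> irr M' f \<longrightarrow> t \<noteq> 0 \<longrightarrow> solved p M' s' f t)"
  have Q: "\<exists>M' s' t. ?Q M s M' s' t" if c: "cyc p M s" for M s
  proof -
    obtain M1 s1 T where T: "cext p M s M1 s1" "T \<in> fixK M1 s1" "T \<noteq> 0"
      "\<forall>c\<in>fixK M s. c \<noteq> 0 \<longrightarrow> (\<forall>x\<in>M1. nrm p s1 x \<noteq> c * T)" using adjoin_non_norm[OF c p] by blast
    have c1: "cyc p M1 s1" by (rule cextD(1)[OF T(1)])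
    have K1: "fixK M s \<subseteq> fixK M1 s1" by (rule cextD(5)[OF T(1)])
    obtain M2 s2 where S: "cext p M1 s1 M2 s2" "\<forall>f\<in>pol (fixK M1 s1). \<forall>t\<in>fixK M1 s1.
      degree f = p \<longrightarrow> lead_coeff f = 1 \<longrightarrow> irr M2 f \<longrightarrow> t \<noteq> 0 \<longrightarrow> solved p M2 s2 f t" using solve_all[OF p c1] by blast
    have "nrm p s2 x \<noteq> c * T" if cx: "c \<in> fixK M s" "c \<noteq> 0" "x \<in> M2" for c x
    proof
      assume n: "nrm p s2 x = c * T"
      have "c * T \<in> fixK M1 s1" using cx(1) K1 T(2) sfieldD(5)[OF fixK_sfield[OF c1]] by blast
      then obtain y where "y \<in> M1" "nrm p s1 y = c * T" using cextD(4)[OF S(1) _ cx(3) n] by blast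
      then show False using T(4) cx(1,2) by blast
    qed
    moreover have "T \<in> fixK M2 s2" using T(2) cextD(5)[OF S(1)] by blast
    ultimately have "?Q M s M2 s2 T" using cext_trans[OF T(1) S(1)] T(3) S(2) K1 pol_mono[OF K1] by blast
    then show ?thesis by blast
  qed
  have "\<exists>x. \<forall>n. cext p M0 s0 (fst (x n)) (fst (snd (x n))) \<and>
    ?Q (fst (x n)) (fst (snd (x n))) (fst (x (Suc n))) (fst (snd (x (Suc n)))) (snd (snd (x (Suc n))))"
  proof (rule dependent_nat_choice)
    show "\<exists>x :: complex set \<times> (complex \<Rightarrow> complex) \<times> complex. cext p M0 s0 (fst x) (fst (snd x))" using cext_refl[OF b(1)]
      by (intro exI[of _ "(M0, s0, 0 :: complex)"]) simp
    fix x :: "complex set \<times> (complex \<Rightarrow> complex) \<times> complex" and n :: nat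
    assume x: "cext p M0 s0 (fst x) (fst (snd x))"
    obtain M' s' t where q: "?Q (fst x) (fst (snd x)) M' s' t" using Q[OF cextD(1)[OF x]] by blast
    then show "\<exists>y. cext p M0 s0 (fst y) (fst (snd y)) \<and>
      ?Q (fst x) (fst (snd x)) (fst y) (fst (snd y)) (snd (snd y))"
      using cext_trans[OF x] by (intro exI[of _ "(M', s', t)"]) simp
  qed
  then obtain x where x0: "\<And>n. cext p M0 s0 (fst (x n)) (fst (snd (x n)))"
    and xQ: "\<And>n. ?Q (fst (x n)) (fst (snd (x n))) (fst (x (Suc n))) (fst (snd (x (Suc n)))) (snd (snd (x (Suc n))))"
    by blast
  define Ms where "Ms n = fst (x n)" for n
  define ss where "ss n = fst (snd (x n))" for n
  define t where "t n = snd (snd (x (Suc n)))" for n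
  have e: "cext p (Ms n) (ss n) (Ms (Suc n)) (ss (Suc n))" and tK: "t n \<in> fixK (Ms (Suc n)) (ss (Suc n))" and t0: "t n \<noteq> 0"
    and tn: "c \<in> fixK (Ms n) (ss n) \<Longrightarrow> c \<noteq> 0 \<Longrightarrow> y \<in> Ms (Suc n) \<Longrightarrow> nrm p (ss (Suc n)) y \<noteq> c * t n"
    and sol: "f \<in> pol (fixK (Ms n) (ss n)) \<Longrightarrow> r \<in> fixK (Ms n) (ss n) \<Longrightarrow> degree f = p \<Longrightarrow> lead_coeff f = 1 \<Longrightarrow>
      irr (Ms (Suc n)) f \<Longrightarrow> r \<noteq> 0 \<Longrightarrow> solved p (Ms (Suc n)) (ss (Suc n)) f r" for n c y f r
    using xQ[of n] unfolding Ms_def ss_def t_def by blast+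
  have cy: "cyc p (Ms n) (ss n)" for n using cextD(1)[OF x0] unfolding Ms_def ss_def by blast
  obtain s where s: "\<And>n. cext p (Ms n) (ss n) (\<Union>n. Ms n) s" using chain_limit[of p Ms ss, OF cy e] by blast
  define M where "M = (\<Union>n. Ms n)"
  note s = s[folded M_def]
  have M0: "cext p M0 s0 M s" using cext_trans[OF x0[of 0]] s[of 0] unfolding Ms_def ss_def by blast
  have cM: "cyc p M s" by (rule cextD(1)[OF M0])
  note MD = cycD[OF cM] and KD = sfieldD[OF fixK_sfield[OF cM]]
  have KM: "fixK (Ms n) (ss n) \<subseteq> fixK M s" for n by (rule cextD(5)[OF s])
  have leM: "fixK (Ms n) (ss n) \<subseteq> fixK (Ms m) (ss m)" if "n \<le> m" for n m
    using that by (induction m rule: dec_induct) (use cextD(5)[OF e] in blast)+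
  have non: "nrm p s y \<noteq> c * t n" if cy: "c \<in> fixK (Ms n) (ss n)" "c \<noteq> 0" "y \<in> M" for c n y
  proof
    assume n: "nrm p s y = c * t n"
    have "c * t n \<in> fixK (Ms (Suc n)) (ss (Suc n))"
      using cy(1) cextD(5)[OF e[of n]] tK[of n] sfieldD(5)[OF fixK_sfield[OF cextD(1)[OF e[of n]]]] by blast
    then obtain z where "z \<in> Ms (Suc n)" "nrm p (ss (Suc n)) z = c * t n" using cextD(4)[OF s _ cy(3) n] by blast
    then show False using tn cy by blast
  qed
  have tM: "t n \<in> fixK M s" for n using tK KM by blast
  have lt: "nrm p s y * t i \<noteq> t j" if ij: "i < j" and y: "y \<in> M" for i j y
  proof
    assume n: "nrm p s y * t i = t j"
    have "t i \<in> fixK (Ms j) (ss j)" using tK[of i] leM[of "Suc i" j] ij by auto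
    then have "inverse (t i) \<in> fixK (Ms j) (ss j)" by (rule sfieldD(8)[OF fixK_sfield[OF cy]])
    moreover have "nrm p s y = inverse (t i) * t j" using n t0[of i] by (simp add: field_simps)
    ultimately show False using non[OF _ _ y] t0 by simp
  qed
  \<comment> \<open>The case \<open>j < i\<close> reduces to the other one by replacing
    \<open>y\<close> with \<open>1 / y\<close>.\<close>
  have neq: "nrm p s y * t i \<noteq> t j" if ij: "i \<noteq> j" and y: "y \<in> M" for i j y
  proof (cases "i < j")
    case True
    then show ?thesis using lt y by blast
  next
    case False
    show ?thesis
    proof
      assume n: "nrm p s y * t i = t j"
      have y1: "1 / y \<in> M" using sfieldD(9)[OF MD(1) sfieldD(3)[OF MD(1)] y] .
      have "nrm p s (1 / y) = nrm p s 1 / nrm p s y" by (rule nrm_divide[OF MD(1,3,4) sfieldD(3)[OF MD(1)] y])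
      moreover have "nrm p s 1 = 1" using nrm_fix[of s 1 p] shomD(1)[OF MD(3)] by simp
      moreover have "nrm p s y \<noteq> 0" using n t0[of j] by auto
      ultimately have "nrm p s (1 / y) * t j = t i" using n[symmetric] by simp
      then show False using lt[of j i, OF _ y1] False ij by simp
    qed
  qed
  have nont: "nrm p s y \<noteq> t n" if "y \<in> M" for y n
    using non[of 1 n y] that sfieldD(3)[OF fixK_sfield[OF cy]] by simp
  have slv: "solved p M s f (t n)"
    if f: "f \<in> pol (fixK M s)" "degree f = p" "lead_coeff f = 1" "irr M f" for f n
  proof -
    have "fixK M s \<subseteq> (\<Union>n. fixK (Ms n) (ss n))"
    proof
      fix z assume z: "z \<in> fixK M s"
      then obtain m where m: "z \<in> Ms m" unfolding fixK_def M_def by blast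
      then have "ss m z = z" using cextD(3)[OF s[of m] m] z by (simp add: fixK_def)
      then show "z \<in> (\<Union>n. fixK (Ms n) (ss n))" using m by (auto simp: fixK_def)
    qed
    then have "f \<in> pol (\<Union>n. fixK (Ms n) (ss n))" using f(1) pol_mono by blast
    then obtain m where m: "f \<in> pol (fixK (Ms m) (ss m))"
      using pol_chain[of "\<lambda>n. fixK (Ms n) (ss n)" f, OF leM] sfieldD(2)[OF fixK_sfield[OF cy[of 0]]] by blast
    \<comment> \<open>\<open>f\<close> is defined over stage \<open>m\<close> and \<open>t n\<close>
      over stage \<open>Suc n\<close>; the pair is treated in the passage from stage
      \<open>q\<close> to the next.\<close>
    define q where "q = max m (Suc n)"
    have fq: "f \<in> pol (fixK (Ms q) (ss q))" and tq: "t n \<in> fixK (Ms q) (ss q)"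
      using m pol_mono[OF leM[of m q]] tK[of n] leM[of "Suc n" q] unfolding q_def by auto
    have "f \<in> pol (Ms (Suc q))"
      using fq pol_mono[OF cextD(5)[OF e[of q]]] pol_mono[of "fixK (Ms (Suc q)) (ss (Suc q))" "Ms (Suc q)"] by (auto simp: fixK_def)
    then have "irr (Ms (Suc q)) f" using irr_mono[OF f(4)] cextD(2)[OF s] by blast
    then have "solved p (Ms (Suc q)) (ss (Suc q)) f (t n)" using sol[OF fq tq f(2,3)] t0 by blast
    then show ?thesis using solved_ext[OF s cy] by blast
  qed
  have "\<zeta> \<in> fixK M s" "v \<in> M" "s v = \<zeta> * v" using cextD(2,3,5)[OF M0] b by auto
  then show ?thesis
    by (intro exI[of _ M] exI[of _ s] exI[of _ \<zeta>] exI[of _ v] exI[of _ t] conjI allI ballI impI)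
      (use cM b tM t0 neq nont slv in simp_all)
qed

section \<open>Determinants and irreducibility\<close>

lemma det_in:
  assumes S: "sring S" and A: "A \<in> carrier_mat n n" and e: "\<And>i j. i < n \<Longrightarrow> j < n \<Longrightarrow> A $$ (i, j) \<in> S"
  shows "det A \<in> S"
  unfolding det_def'[OF A]
proof (rule sring_sum[OF S], rule sringD(4)[OF S])
  fix q assume q: "q \<in> {q. q permutes {0..<n}}"
  show "signof q \<in> S" using sringD[OF S] by (cases q rule: sign_cases) auto
  show "(\<Prod>i = 0..<n. A $$ (i, q i)) \<in> S"
    using q permutes_in_image[of q "{0..<n}"] by (intro sring_prod[OF S] e) auto
qed

lemma det_shom:
  assumes h: "shom S h" and S: "sring S" and A: "A \<in> carrier_mat n n"
    and e: "\<And>i j. i < n \<Longrightarrow> j < n \<Longrightarrow> A $$ (i, j) \<in> S"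
  shows "det (map_mat h A) = h (det A)"
proof -
  have hA: "map_mat h A \<in> carrier_mat n n" using A by simp
  let ?P = "{q. q permutes {0..<n}}"
  have qn: "q i < n" if "q \<in> ?P" "i < n" for q i using permutes_in_image[of q "{0..<n}" i] that by simp
  have sg: "signof q \<in> S" "h (signof q) = signof q" for q
    using sringD[OF S] shomD(1)[OF h] shom_minus[OF h S, of 1] by (cases q rule: sign_cases; auto)+
  have pr: "(\<Prod>i = 0..<n. A $$ (i, q i)) \<in> S" if "q \<in> ?P" for q
    using qn[OF that] by (intro sring_prod[OF S] e) auto
  have "h (det A) = (\<Sum>q\<in>?P. h (signof q * (\<Prod>i = 0..<n. A $$ (i, q i))))"
    unfolding det_def'[OF A] using sg(1) pr by (intro shom_sum[OF h S] sringD(4)[OF S])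
  also have "\<dots> = (\<Sum>q\<in>?P. signof q * (\<Prod>i = 0..<n. h (A $$ (i, q i))))"
    using sg pr shom_prod[OF h S, of "{0..<n}"] qn e
    by (intro sum.cong refl) (simp add: shomD(3)[OF h])
  also have "\<dots> = det (map_mat h A)"
    unfolding det_def'[OF hA] using A qn by (intro sum.cong refl) simp
  finally show ?thesis ..
qed

lemma exists_minpoly:
  fixes g :: "'a::field poly"
  assumes Q: "sfield Q" and g: "g \<in> pol Q" "g \<noteq> 0" "poly g r = 0"
  shows "\<exists>m. irr Q m \<and> lead_coeff m = 1 \<and> poly m r = 0"
proof -
  let ?P = "\<lambda>m. m \<in> pol Q \<and> m \<noteq> 0 \<and> poly m r = 0"
  obtain m0 where m0: "?P m0" and least: "\<And>h. ?P h \<Longrightarrow> degree m0 \<le> degree h"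
    using ex_has_least_nat[of ?P g degree] g by blast
  have dv: "m0 dvd A" if A: "A \<in> pol Q" "poly A r = 0" for A
  proof (rule ccontr)
    assume "\<not> m0 dvd A"
    then have nz: "A mod m0 \<noteq> 0" by (simp add: mod_eq_0_iff_dvd)
    have "poly (A mod m0) r = 0" using A m0 by (simp add: minus_div_mult_eq_mod[symmetric])
    then have "degree m0 \<le> degree (A mod m0)" using least pol_divmod[OF Q _ A(1), of m0] m0 nz by blast
    moreover have "degree (A mod m0) < degree m0" using degree_mod_less'[OF _ nz] m0 by blast
    ultimately show False by simp
  qed
  define m where "m = smult (inverse (lead_coeff m0)) m0"
  have c: "inverse (lead_coeff m0) \<in> Q" "inverse (lead_coeff m0) \<noteq> 0"
    using m0 sfieldD(8)[OF Q polD] by auto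
  have mQ: "m \<in> pol Q" unfolding m_def using pol_smult[OF sfieldD(1)[OF Q] c(1)] m0 by blast
  have dm: "degree m = degree m0" unfolding m_def using c by simp
  have "degree m \<noteq> 0"
  proof
    assume "degree m = 0"
    then obtain a where "m0 = [:a:]" unfolding dm by (rule degree_eq_zeroE)
    then show False using m0 by simp
  qed
  moreover have "degree h = 0 \<or> degree h = degree m" if h: "h \<in> pol Q" "h dvd m" for h
  proof -
    obtain k where k: "m = h * k" using h(2) by (elim dvdE)
    have m0': "m \<noteq> 0" using c m0 by (simp add: m_def)
    then have nz: "h \<noteq> 0" "k \<noteq> 0" using k by auto
    have kQ: "k \<in> pol Q" by (rule pol_quot[OF Q h(1) mQ k nz(1)])
    have "poly h r * poly k r = 0" using arg_cong[OF k, of "\<lambda>x. poly x r"] m0 by (simp add: m_def)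
    then consider "poly h r = 0" | "poly k r = 0" by auto
    then show ?thesis
    proof cases
      case 1
      then have "degree m0 \<le> degree h" using least h nz by blast
      then show ?thesis using dvd_imp_degree_le[OF h(2) m0'] dm by simp
    next
      case 2
      then have "degree m0 \<le> degree k" using least kQ nz by blast
      then show ?thesis using arg_cong[OF k, of degree] nz dm by (simp add: degree_mult_eq)
    qed
  qed
  ultimately have "irr Q m" unfolding irr_def using mQ by blast
  moreover have "lead_coeff m = 1" "poly m r = 0" using m0 by (auto simp: m_def)
  ultimately show ?thesis by blast
qed

text \<open>\<open>k\<close> is invertible modulo \<open>p\<close>, so on \<open>M\<close> the
  automorphism \<open>s\<close> is an iterate of \<open>s ^^ k\<close>.\<close>

lemma coprime_funpow:
  assumes c: "cyc p M s" and p: "prime p" and k: "0 < k" "k < p" and z: "z \<in> M" "(s ^^ k) z = z"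
  shows "s z = z"
proof -
  have "coprime k p" using p k by (metis coprime_commute dvd_imp_le not_le prime_imp_coprime)
  then obtain a b where ab: "k * a = p * b + 1" using coprime_bezout_strong[of k p] p by (metis prime_gt_1_nat less_irrefl)
  have "s z = ((s ^^ p) ^^ b) (s z)"
    by (rule funpow_fix[symmetric]) (rule cycD(5)[OF c cycD(4)[OF c z(1)]])
  also have "\<dots> = (s ^^ (p * b + 1)) z" by (simp add: funpow_mult mult.commute funpow_add funpow_swap1)
  also have "\<dots> = ((s ^^ k) ^^ a) z" unfolding ab[symmetric] by (simp add: funpow_mult mult.commute)
  also have "\<dots> = z" by (rule funpow_fix) (rule z(2))
  finally show ?thesis .
qed

text \<open>Let \<open>m\<close> be the minimal polynomial over \<open>M\<close> of a root of a
  proper factor. Its \<open>p\<close> conjugates are irreducible divisors of \<open>f\<close>. Two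
  of them with a common root would coincide, forcing \<open>m\<close> to have coefficients in the
  fixed field, against irreducibility of \<open>f\<close> there. So their product divides
  \<open>f\<close>, and \<open>p * degree m \<le> p\<close> makes \<open>m\<close> linear.\<close>

lemma root_or_irr:
  assumes c: "cyc p M s" and p: "prime p" and f: "irr (fixK M s) f" "degree f = p"
  shows "irr M f \<or> (\<exists>r\<in>M. poly f r = 0)"
proof (rule disjCI)
  assume nr: "\<not> (\<exists>r\<in>M. poly f r = 0)"
  note D = cycD[OF c]
  note Mr = sfieldD(1)[OF D(1)] and K = fixK_sfield[OF c]
  have KM: "fixK M s \<subseteq> M" by (auto simp: fixK_def)
  note fK = irrD(1)[OF f(1)]
  have fM: "f \<in> pol M" "f \<noteq> 0" using fK pol_mono[OF KM] irrD(3)[OF f(1)] by auto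
  show "irr M f"
  proof (rule ccontr)
    assume "\<not> irr M f"
    then obtain g where g: "g \<in> pol M" "g dvd f" "degree g \<noteq> 0" "degree g \<noteq> degree f"
      using fM f irrD(2)[OF f(1)] unfolding irr_def by blast
    obtain r where r: "poly g r = 0" using fundamental_theorem_of_algebra constant_degree g(3) by metis
    have "g \<noteq> 0" using g(3) by auto
    then obtain m where m: "irr M m" "lead_coeff m = 1" "poly m r = 0" using exists_minpoly[OF D(1) g(1) _ r] by blast
    have mg: "m dvd g" by (rule irr_dvd[OF D(1) m(1) g(1) m(3) r])
    have d: "degree m < p"
      using dvd_imp_degree_le[OF mg \<open>g \<noteq> 0\<close>] dvd_imp_degree_le[OF g(2) fM(2)] g(4) f(2) by linarith
    have mf: "m dvd f" using mg g(2) by (rule dvd_trans)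
    note h = funpow_shom[OF D(3,4)]
    define q where "q i = map_poly (s ^^ i) m" for i
    note mM = irrD(1)[OF m(1)]
    have qc: "coeff (q i) n = (s ^^ i) (coeff m n)" for i n unfolding q_def by (simp add: map_pol(1)[OF h Mr])
    have qM: "q i \<in> pol M" for i using polD[OF mM] funpow_in[OF D(4)] by (auto simp: pol_def qc)
    have lead: "coeff (q i) (degree m) = 1" for i using m(2) shomD(1)[OF h] by (simp add: qc)
    have dq: "degree (q i) = degree m" for i
    proof (rule antisym)
      show "degree (q i) \<le> degree m" unfolding q_def by (rule degree_map_pol) (rule shom_0[OF h Mr])
      show "degree m \<le> degree (q i)" by (rule le_degree) (simp add: lead)
    qed
    have qf: "q i dvd f" for i
    proof -
      obtain k where k: "f = m * k" using mf by (elim dvdE)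
      have kM: "k \<in> pol M" by (rule pol_quot[OF D(1) mM fM(1) k]) (use m(2) in auto)
      have "map_poly (s ^^ i) f = f"
      proof (rule poly_eqI)
        fix n
        have "coeff f n \<in> fixK M s" by (rule polD[OF fK])
        then show "coeff (map_poly (s ^^ i) f) n = coeff f n" by (simp add: map_pol(1)[OF h Mr] funpow_fix fixK_def)
      qed
      moreover have "map_poly (s ^^ i) f = q i * map_poly (s ^^ i) k" unfolding k q_def by (rule map_pol(3)[OF h Mr mM kM])
      ultimately show ?thesis by (metis dvd_triv_left)
    qed
    have irq: "irr M (q i)" if "i \<le> p" for i
      unfolding irr_def
    proof (intro conjI ballI impI qM)
      show "0 < degree (q i)" using irrD(2)[OF m(1)] dq by simp
      fix a assume a: "a \<in> pol M" "a dvd q i"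
      \<comment> \<open>\<open>s ^^ (p - i)\<close> undoes \<open>s ^^ i\<close>, so a factor of
        \<open>q i\<close> is carried back to a factor of \<open>m\<close>.\<close>
      have inv: "map_poly (s ^^ (p - i)) (q i) = m"
        using that D(5) polD[OF mM] by (intro poly_eqI) (simp add: map_pol(1)[OF h Mr] qc funpow_add[symmetric, THEN fun_cong, unfolded o_def])
      obtain b where b: "q i = a * b" using a(2) by (elim dvdE)
      have "q i \<noteq> 0" using lead[of i] by auto
      then have a0: "a \<noteq> 0" using b by auto
      have bM: "b \<in> pol M" by (rule pol_quot[OF D(1) a(1) qM b a0])
      let ?a = "map_poly (s ^^ (p - i)) a"
      have "m = ?a * map_poly (s ^^ (p - i)) b" using inv unfolding b by (simp add: map_pol(3)[OF h Mr a(1) bM])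
      then have "?a dvd m" by simp
      moreover have "?a \<in> pol M" using polD[OF a(1)] funpow_in[OF D(4)] by (auto simp: pol_def map_pol(1)[OF h Mr])
      moreover have "degree ?a = degree a"
      proof (rule antisym)
        show "degree ?a \<le> degree a" by (rule degree_map_pol) (rule shom_0[OF h Mr])
        show "degree a \<le> degree ?a"
          by (rule le_degree) (use shom_nonzero[OF h D(1) polD[OF a(1)]] a0 in \<open>simp add: map_pol(1)[OF h Mr]\<close>)
      qed
      ultimately show "degree a = 0 \<or> degree a = degree (q i)" using irrD(4)[OF m(1)] dq by metis
    qed
    have nocommon: "poly (q j) x \<noteq> 0" if ij: "i < j" "j < p" and x: "poly (q i) x = 0" for i j x
    proof
      assume "poly (q j) x = 0"
      then have "q i dvd q j" using irr_dvd[OF D(1) irq qM x] ij by simp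
      then obtain k where k: "q j = q i * k" by (elim dvdE)
      have nz: "q i \<noteq> 0" "k \<noteq> 0" using k lead[of j] lead[of i] by auto
      have "degree k = 0" using arg_cong[OF k, of degree] nz dq by (simp add: degree_mult_eq)
      then obtain a where a: "k = [:a:]" by (rule degree_eq_zeroE)
      have "a = 1" using arg_cong[OF k, of "\<lambda>q. coeff q (degree m)"] lead by (simp add: a)
      then have eq: "q j = q i" using k a by simp
      have "s (coeff m n) = coeff m n" for n
      proof (rule coprime_funpow[OF c p _ _ polD[OF mM]])
        show "0 < j - i" "j - i < p" using ij by auto
        have "(s ^^ (j - i)) (coeff m n) = (s ^^ (p - i)) ((s ^^ j) (coeff m n))"
        proof -
          have "(s ^^ (p - i)) ((s ^^ j) (coeff m n)) = (s ^^ (p - i + j)) (coeff m n)" by (simp add: funpow_add)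
          also have "p - i + j = (j - i) + p" using ij by simp
          also have "(s ^^ (j - i + p)) (coeff m n) = (s ^^ (j - i)) ((s ^^ p) (coeff m n))" by (simp add: funpow_add)
          finally show ?thesis using D(5)[OF polD[OF mM]] by simp
        qed
        also have "(s ^^ j) (coeff m n) = (s ^^ i) (coeff m n)" using qc eq by metis
        also have "(s ^^ (p - i)) ((s ^^ i) (coeff m n)) = (s ^^ (p - i + i)) (coeff m n)" by (simp add: funpow_add)
        also have "\<dots> = coeff m n" using ij D(5)[OF polD[OF mM]] by simp
        finally show "(s ^^ (j - i)) (coeff m n) = coeff m n" .
      qed
      then have "m \<in> pol (fixK M s)" using polD[OF mM] by (auto simp: pol_def fixK_def)
      then have "degree m = 0 \<or> degree m = degree f" using irrD(4)[OF f(1) _ mf] by blast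
      then show False using irrD(2)[OF m(1)] d f(2) by simp
    qed
    have "(\<Prod>i<n. q i) dvd f" if "n \<le> p" for n
      using that
    proof (induction n)
      case (Suc n)
      then obtain k where k: "f = (\<Prod>i<n. q i) * k" by (auto elim: dvdE)
      have Pn: "(\<Prod>i<n. q i) \<in> pol M" by (intro sring_prod[OF pol_sring[OF Mr]] qM)
      have "(\<Prod>i<n. q i) \<noteq> 0" using k fM(2) by auto
      then have kM: "k \<in> pol M" by (rule pol_quot[OF D(1) Pn fM(1) k])
      obtain x where x: "poly (q n) x = 0"
        using fundamental_theorem_of_algebra constant_degree dq[of n] irrD(2)[OF m(1)] by (metis less_irrefl)
      have "poly f x = 0" using qf[of n] x by (metis dvd_def poly_mult mult_zero_left)
      moreover have "poly (\<Prod>i<n. q i) x \<noteq> 0" using nocommon[of _ n x] x Suc.prems by (auto simp: poly_prod)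
      ultimately have "poly k x = 0" unfolding k by simp
      then have "q n dvd k" using irr_dvd[OF D(1) irq kM x] Suc.prems by simp
      then show ?case unfolding k by (auto simp: mult_dvd_mono)
    qed simp
    from this[of p] have "(\<Prod>i<p. q i) dvd f" by simp
    then have "degree (\<Prod>i<p. q i) \<le> p" using dvd_imp_degree_le fM(2) f(2) by blast
    moreover have "degree (\<Prod>i<p. q i) = p * degree m"
    proof (subst degree_prod_eq_sum_degree)
      show "\<forall>i\<in>{..<p}. q i \<noteq> 0" using lead by (metis coeff_0 zero_neq_one)
    qed (simp add: dq)
    ultimately have "p * degree m \<le> p * 1" by simp
    then have "degree m \<le> 1" using prime_gt_0_nat[OF p] by simp
    then have "degree m = 1" using irrD(2)[OF m(1)] by linarith
    define a b where "a = coeff m 0" and "b = coeff m 1"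
    have ab: "m = [:a, b:]"
      by (rule poly_eqI) (use \<open>degree m = 1\<close> in \<open>auto simp: a_def b_def coeff_pCons coeff_eq_0 split: nat.split\<close>)
    have "b = 1" using m(2) \<open>degree m = 1\<close> by (simp add: b_def)
    then have "a + r = 0" using m(3) by (simp add: ab)
    then have "r = - coeff m 0" by (simp add: a_def eq_neg_iff_add_eq_0 add.commute)
    then have "r \<in> M" using polD[OF mM] sfieldD(6)[OF D(1)] by simp
    moreover have "poly f r = 0" using mf m(3) by (metis dvd_def poly_mult mult_zero_left)
    ultimately show False using nr by blast
  qed
qed

section \<open>Cyclic algebras\<close>

text \<open>The cyclic algebra \<open>(M, s, t) = \<Oplus>\<^sub>j M y\<^sup>j\<close> with \<open>y a = s(a) y\<close> and \<open>y\<^sup>p = t\<close>: the element \<open>\<Sum>\<^sub>j d\<^sub>j y\<^sup>j\<close>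
  is encoded as the polynomial with coefficients \<open>d\<^sub>j\<close>, and \<open>cyclic_shift\<close> is left multiplication by \<open>y\<close>.\<close>
definition cyclic_shift :: "nat \<Rightarrow> (complex \<Rightarrow> complex) \<Rightarrow> complex \<Rightarrow> complex poly \<Rightarrow> complex poly" where
  "cyclic_shift p s t e = (\<Sum>k<p. monom (if k = 0 then t * s (coeff e (p - 1)) else s (coeff e (k - 1))) k)"

definition cyclic_mult :: "nat \<Rightarrow> (complex \<Rightarrow> complex) \<Rightarrow> complex \<Rightarrow> complex poly \<Rightarrow> complex poly \<Rightarrow> complex poly" where
  "cyclic_mult p s t d e = (\<Sum>j<p. smult (coeff d j) ((cyclic_shift p s t ^^ j) e))"

definition cyclic_carrier :: "nat \<Rightarrow> complex set \<Rightarrow> complex poly set" where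
  "cyclic_carrier p M = {d \<in> pol M. \<forall>j\<ge>p. coeff d j = 0}"

lemma coeff_sum_monom: "coeff (\<Sum>k<n. monom (a k) k) i = (if i < n then a i else 0)"
  by (simp add: coeff_sum)

lemma coeff_tw:
  "coeff (cyclic_shift p s t e) k = (if k < p then if k = 0 then t * s (coeff e (p - 1)) else s (coeff e (k - 1)) else 0)"
  unfolding cyclic_shift_def coeff_sum_monom by simp

locale csa =
  fixes p :: nat and M :: "complex set" and s :: "complex \<Rightarrow> complex" and t :: complex
  assumes p: "prime p" and c: "cyc p M s" and t: "t \<in> fixK M s" "t \<noteq> 0"
begin

abbreviation "D \<equiv> cyclic_carrier p M"
abbreviation "Y \<equiv> cyclic_shift p s t"
abbreviation "dmul \<equiv> cyclic_mult p s t"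
abbreviation "K \<equiv> fixK M s"

lemmas MF = cycD(1)[OF c]
lemmas Mr = sfieldD(1)[OF MF]
lemmas sM = cycD(4)[OF c]
lemmas sh = cycD(3)[OF c]
lemmas sp = cycD(5)[OF c]
lemmas KF = fixK_sfield[OF c]
lemmas Kr = sfieldD(1)[OF KF]

lemma p0: "0 < p"
  using p by (rule prime_gt_0_nat)

lemma KM: "a \<in> K \<Longrightarrow> a \<in> M"
  by (simp add: fixK_def)

lemma Ks: "a \<in> K \<Longrightarrow> s a = a"
  by (simp add: fixK_def)

lemma tM: "t \<in> M"
  using t KM by blast

lemma DI: "(\<And>i. i < p \<Longrightarrow> coeff d i \<in> M) \<Longrightarrow> (\<And>i. i \<ge> p \<Longrightarrow> coeff d i = 0) \<Longrightarrow> d \<in> D"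
  unfolding cyclic_carrier_def pol_def using sfieldD(2)[OF MF] by (simp, metis not_less)

lemma DD: "d \<in> D \<Longrightarrow> coeff d i \<in> M" "d \<in> D \<Longrightarrow> i \<ge> p \<Longrightarrow> coeff d i = 0"
  unfolding cyclic_carrier_def pol_def by auto

lemma D_eqI: "d \<in> D \<Longrightarrow> e \<in> D \<Longrightarrow> (\<And>i. i < p \<Longrightarrow> coeff d i = coeff e i) \<Longrightarrow> d = e"
  by (rule poly_eqI) (metis DD(2) not_less)

lemma D_add: "d \<in> D \<Longrightarrow> e \<in> D \<Longrightarrow> d + e \<in> D"
  by (rule DI) (auto intro: sfieldD(4)[OF MF] simp: DD)

lemma D_uminus: "d \<in> D \<Longrightarrow> - d \<in> D"
  by (rule DI) (auto intro: sfieldD(6)[OF MF] simp: DD)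

lemma D_diff: "d \<in> D \<Longrightarrow> e \<in> D \<Longrightarrow> d - e \<in> D"
  by (rule DI) (auto intro: sfieldD(7)[OF MF] simp: DD)

lemma D_smult: "a \<in> M \<Longrightarrow> d \<in> D \<Longrightarrow> smult a d \<in> D"
  by (rule DI) (auto intro: sfieldD(5)[OF MF] simp: DD)

lemma D_0: "0 \<in> D"
  by (rule DI) (auto simp: sfieldD(2)[OF MF])

lemma D_monom: "a \<in> M \<Longrightarrow> j < p \<Longrightarrow> monom a j \<in> D"
  by (rule DI) (auto simp: sfieldD(2)[OF MF])

lemma D_const: "a \<in> M \<Longrightarrow> [:a:] \<in> D"
  using D_monom[of a 0] p0 by (simp add: monom_0)

lemma D_1: "1 \<in> D"
  using D_const[of 1] sfieldD(3)[OF MF] by (simp add: one_pCons)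

lemma D_sum: "(\<And>i. i \<in> I \<Longrightarrow> f i \<in> D) \<Longrightarrow> sum f I \<in> D"
  by (induction I rule: infinite_finite_induct) (auto intro: D_0 D_add)

lemma Y_in: "d \<in> D \<Longrightarrow> Y d \<in> D"
  by (rule DI) (auto simp: coeff_tw intro: sfieldD(5)[OF MF] sM DD tM)

lemma Yp_in: "d \<in> D \<Longrightarrow> (Y ^^ j) d \<in> D"
  by (induction j) (auto intro: Y_in)

lemma dm_in: "d \<in> D \<Longrightarrow> e \<in> D \<Longrightarrow> dmul d e \<in> D"
  unfolding cyclic_mult_def by (intro D_sum D_smult Yp_in DD)

lemma Y_lin:
  assumes "\<And>i. i \<in> I \<Longrightarrow> a i \<in> M" "\<And>i. i \<in> I \<Longrightarrow> f i \<in> D"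
  shows "Y (\<Sum>i\<in>I. smult (a i) (f i)) = (\<Sum>i\<in>I. smult (s (a i)) (Y (f i)))"
proof (rule poly_eqI)
  fix k
  have "s (\<Sum>i\<in>I. a i * coeff (f i) n) = (\<Sum>i\<in>I. s (a i) * s (coeff (f i) n))" for n
    by (subst shom_sum[OF sh Mr]) (auto intro!: sum.cong sfieldD(5)[OF MF] assms DD shomD(3)[OF sh])
  then show "coeff (Y (\<Sum>i\<in>I. smult (a i) (f i))) k = coeff (\<Sum>i\<in>I. smult (s (a i)) (Y (f i))) k"
    by (simp add: coeff_tw coeff_sum sum_distrib_left mult.left_commute)
qed

lemma Y_smult: "a \<in> M \<Longrightarrow> d \<in> D \<Longrightarrow> Y (smult a d) = smult (s a) (Y d)"
  using Y_lin[of "{0::nat}" "\<lambda>_. a" "\<lambda>_. d"] by simp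

lemma Y_add: "d \<in> D \<Longrightarrow> e \<in> D \<Longrightarrow> Y (d + e) = Y d + Y e"
  using Y_lin[of "{0::nat, 1}" "\<lambda>_. 1" "\<lambda>i. if i = 0 then d else e"] sfieldD(3)[OF MF] shomD(1)[OF sh] by simp

lemma Yp_lin:
  assumes "\<And>i. i \<in> I \<Longrightarrow> a i \<in> M" "\<And>i. i \<in> I \<Longrightarrow> f i \<in> D"
  shows "(Y ^^ j) (\<Sum>i\<in>I. smult (a i) (f i)) = (\<Sum>i\<in>I. smult ((s ^^ j) (a i)) ((Y ^^ j) (f i)))"
proof (induction j)
  case (Suc j)
  show ?case
    using Y_lin[of I "\<lambda>i. (s ^^ j) (a i)" "\<lambda>i. (Y ^^ j) (f i)"] assms funpow_in[of M s] sM Yp_in by (simp add: Suc)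
qed simp

lemma coeff_Yp:
  assumes e: "e \<in> D" and "j \<le> p" "k < p"
  shows "coeff ((Y ^^ j) e) k = (if j \<le> k then (s ^^ j) (coeff e (k - j)) else t * (s ^^ j) (coeff e (p + k - j)))"
  using assms(2,3)
proof (induction j arbitrary: k)
  case (Suc j)
  have s: "s (t * z) = t * s z" if "z \<in> M" for z using that tM Ks[OF t(1)] by (simp add: shomD(3)[OF sh])
  have m: "(s ^^ j) (coeff e i) \<in> M" for i using DD(1)[OF e] funpow_in[of M s] sM by simp
  show ?case
  proof (cases k)
    case 0
    moreover have "j \<le> p - 1" using Suc.prems by linarith
    ultimately show ?thesis using Suc by (simp add: coeff_tw)
  next
    case (Suc k')
    then show ?thesis using Suc.IH[of k'] Suc.prems s m by (auto simp: coeff_tw)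
  qed
qed simp

lemma Yp_p: "e \<in> D \<Longrightarrow> (Y ^^ p) e = smult t e"
  by (rule D_eqI) (auto simp: coeff_Yp sp DD intro!: Yp_in D_smult tM)

text \<open>Left multiplication by \<open>y\<close> commutes with right multiplication; the
  wrap-around term is supplied by \<open>Yp_p\<close>. Associativity of the product reduces to
  this.\<close>

lemma Y_dm: "d \<in> D \<Longrightarrow> e \<in> D \<Longrightarrow> Y (dmul d e) = dmul (Y d) e"
proof -
  assume d: "d \<in> D" and e: "e \<in> D"
  obtain q where q: "p = Suc q" using p0 by (cases p) auto
  have "Y (dmul d e) = (\<Sum>j<p. smult (s (coeff d j)) ((Y ^^ Suc j) e))"
    unfolding cyclic_mult_def using d e by (subst Y_lin) (auto intro: DD Yp_in)
  also have "\<dots> = smult (t * s (coeff d q)) e + (\<Sum>j<q. smult (s (coeff d j)) ((Y ^^ Suc j) e))"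
    using Yp_p[OF e] unfolding q by (simp add: mult.commute)
  also have "\<dots> = dmul (Y d) e"
    unfolding cyclic_mult_def q sum.lessThan_Suc_shift by (simp add: coeff_tw)
  finally show ?thesis .
qed

lemma Yp_dm: "d \<in> D \<Longrightarrow> e \<in> D \<Longrightarrow> (Y ^^ j) (dmul d e) = dmul ((Y ^^ j) d) e"
  by (induction j) (auto simp: Y_dm Yp_in)

lemma dm_lin1: "dmul (\<Sum>i\<in>I. smult (a i) (f i)) e = (\<Sum>i\<in>I. smult (a i) (dmul (f i) e))"
  unfolding cyclic_mult_def by (simp add: coeff_sum smult_sum2 smult_sum sum.swap[of _ I])

lemma dm_lin2:
  assumes "\<And>i. i \<in> I \<Longrightarrow> a i \<in> K" "\<And>i. i \<in> I \<Longrightarrow> f i \<in> D"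
  shows "dmul d (\<Sum>i\<in>I. smult (a i) (f i)) = (\<Sum>i\<in>I. smult (a i) (dmul d (f i)))"
proof -
  have "(s ^^ j) (a i) = a i" if "i \<in> I" for i j using funpow_fix[of s] Ks assms(1)[OF that] by blast
  then have "(Y ^^ j) (\<Sum>i\<in>I. smult (a i) (f i)) = (\<Sum>i\<in>I. smult (a i) ((Y ^^ j) (f i)))" for j
    by (subst Yp_lin) (auto intro: assms KM)
  then show ?thesis unfolding cyclic_mult_def by (simp add: smult_sum2 sum.swap[of _ I] mult.commute)
qed

lemma dm_assoc:
  assumes d: "d \<in> D" and e: "e \<in> D" and f: "f \<in> D"
  shows "dmul (dmul d e) f = dmul d (dmul e f)"
proof -
  have "dmul (dmul d e) f = (\<Sum>j<p. smult (coeff d j) (dmul ((Y ^^ j) e) f))"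
    unfolding cyclic_mult_def[of p s t d e] by (rule dm_lin1)
  also have "\<dots> = dmul d (dmul e f)" unfolding cyclic_mult_def[of p s t d] by (simp add: Yp_dm e f)
  finally show ?thesis .
qed

lemma dm_add1: "dmul (d + e) f = dmul d f + dmul e f"
  using dm_lin1[of "\<lambda>_. 1" "\<lambda>i. if i = 0 then d else e" "{0::nat, 1}"] by simp

lemma dm_smult1: "dmul (smult a d) f = smult a (dmul d f)"
  using dm_lin1[of "\<lambda>_. a" "\<lambda>i. d" "{0::nat}"] by simp

lemma dm_add2: "e \<in> D \<Longrightarrow> f \<in> D \<Longrightarrow> dmul d (e + f) = dmul d e + dmul d f"
  using dm_lin2[of "{0::nat, 1}" "\<lambda>_. 1" "\<lambda>i. if i = 0 then e else f" d] sfieldD(3)[OF KF] by simp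

lemma dm_smult2: "a \<in> K \<Longrightarrow> e \<in> D \<Longrightarrow> dmul d (smult a e) = smult a (dmul d e)"
  using dm_lin2[of "{0::nat}" "\<lambda>_. a" "\<lambda>i. e" d] by simp

lemma dm_const: "dmul [:a:] e = smult a e"
proof -
  obtain q where q: "p = Suc q" using p0 by (cases p) auto
  show ?thesis unfolding cyclic_mult_def q sum.lessThan_Suc_shift by simp
qed

lemma dm_1: "dmul 1 e = e"
  using dm_const[of 1] by (simp add: one_pCons)

lemma Yp_1: "j < p \<Longrightarrow> (Y ^^ j) 1 = monom 1 j"
proof (rule D_eqI)
  fix i assume ij: "j < p" "i < p"
  have "(s ^^ j) 1 = 1" "(s ^^ j) 0 = 0" by (rule funpow_fix, simp add: shomD(1)[OF sh] shom_0[OF sh Mr])+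
  moreover have "coeff (1::complex poly) n = (if n = 0 then 1 else 0)" for n
    by (simp add: one_pCons coeff_pCons split: nat.split)
  ultimately show "coeff ((Y ^^ j) 1) i = coeff (monom 1 j) i"
    using ij by (auto simp: coeff_Yp D_1)
qed (auto intro: Yp_in D_1 D_monom sfieldD(3)[OF MF])

lemma dm_1_right: "d \<in> D \<Longrightarrow> dmul d 1 = d"
  unfolding cyclic_mult_def
  by (rule poly_eqI) (auto simp: Yp_1 smult_monom coeff_sum_monom DD(2))

lemma dm_monom: "j < p \<Longrightarrow> dmul (monom a j) e = smult a ((Y ^^ j) e)"
  unfolding cyclic_mult_def by (simp add: if_distrib[of "\<lambda>z. smult z _"] cong: if_cong)

lemma dm_0: "dmul 0 e = 0" "dmul d 0 = 0"
  using dm_smult1[of 0 0 e] dm_smult2[of 0 0 d] sfieldD(2)[OF KF] D_0 by simp_all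

end

context csa
begin

lemma Yp_const: "a \<in> M \<Longrightarrow> (Y ^^ j) [:a:] = smult ((s ^^ j) a) ((Y ^^ j) 1)"
  using Yp_lin[of "{0::nat}" "\<lambda>_. a" "\<lambda>_. 1" j] D_1 by simp

text \<open>If the left ideal of \<open>d\<close> has codimension \<open>r\<close> over \<open>M\<close>, then \<open>y\<close> acts semi-linearly on the quotient;
  its \<open>p\<close>-th power being \<open>t\<close>, the determinant of this action has norm \<open>t\<^sup>r\<close>. If \<open>0 < r < p\<close>, a
  Bezout relation makes \<open>t\<close> itself a norm.\<close>
lemma left_inverse:
  assumes nn: "\<And>x. x \<in> M \<Longrightarrow> nrm p s x \<noteq> t" and d: "d \<in> D" "d \<noteq> 0"
  shows "\<exists>d'\<in>D. dmul d' d = 1"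
proof -
  define I where "I = (\<lambda>x. dmul x d) ` D"
  have I_add: "x + y \<in> I" if "x \<in> I" "y \<in> I" for x y
    using that by (auto simp: I_def dm_add1[symmetric] intro!: imageI D_add)
  have I_smult: "smult a x \<in> I" if "a \<in> M" "x \<in> I" for a x
    using that by (auto simp: I_def dm_smult1[symmetric] intro!: imageI D_smult)
  have I_Y: "Y x \<in> I" if "x \<in> I" for x
    using that d by (auto simp: I_def Y_dm intro!: imageI Y_in)
  have I_Yp: "(Y ^^ k) x \<in> I" if "x \<in> I" for x k
    using that by (induction k) (auto intro: I_Y)
  have I_0: "0 \<in> I" using D_0 dm_0(1)[of d] unfolding I_def by force
  have I_sum: "sum f A \<in> I" if "\<And>i. i \<in> A \<Longrightarrow> f i \<in> I" for f and A :: "nat set"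
    using that by (induction A rule: infinite_finite_induct) (auto intro: I_add I_0)
  have I_uminus: "- x \<in> I" if "x \<in> I" for x
    using I_smult[OF sfieldD(6)[OF MF sfieldD(3)[OF MF]] that] by simp
  have I_diff: "x - y \<in> I" if "x \<in> I" "y \<in> I" for x y
    using I_add[OF that(1) I_uminus[OF that(2)]] by simp
  have ID: "x \<in> D" if "x \<in> I" for x using that d by (auto simp: I_def intro: dm_in)
  have dI: "d \<in> I" unfolding I_def using D_1 dm_1[of d] by force
  let ?P = "\<lambda>g. g \<in> I \<and> g \<noteq> 0"
  \<comment> \<open>The left ideal \<open>I\<close> is stable under \<open>M\<close> and
    \<open>y\<close>. The least degree \<open>r\<close> of its nonzero elements is its codimension
    over \<open>M\<close>, with the powers of \<open>y\<close> below \<open>r\<close> representing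
    the quotient.\<close>
  obtain g0 where g0: "?P g0" and least: "\<And>h. ?P h \<Longrightarrow> degree g0 \<le> degree h"
    using ex_has_least_nat[of ?P d degree] dI d(2) by blast
  define g where "g = smult (inverse (lead_coeff g0)) g0"
  define r where "r = degree g0"
  have c0: "lead_coeff g0 \<noteq> 0" using g0 by simp
  have gI: "g \<in> I" unfolding g_def
    by (rule I_smult[OF sfieldD(8)[OF MF DD(1)[OF ID]]]) (use g0 in auto)
  have dg: "degree g = r" unfolding g_def r_def using c0 by simp
  have lg: "coeff g r = 1" unfolding g_def r_def using c0 by simp
  note gD = ID[OF gI]
  have rp: "r < p"
  proof (rule ccontr)
    assume "\<not> r < p"
    then show False using DD(2)[OF gD, of r] lg by simp
  qed
  have "r = 0"
  proof (rule ccontr)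
    assume r0: "r \<noteq> 0"
    define small where "small z \<longleftrightarrow> z \<in> D \<and> (\<forall>i\<ge>r. coeff z i = 0)" for z
    have uniq: "z = 0" if z: "z \<in> I" "\<forall>i\<ge>r. coeff z i = 0" for z
    proof (rule ccontr)
      assume nz: "z \<noteq> 0"
      then have "coeff z (degree z) \<noteq> 0" by simp
      then have "degree z < r" using z(2) not_less by blast
      then show False using least[of z] z nz r_def by simp
    qed
    have "\<exists>z'. small z' \<and> z - z' \<in> I" if "z \<in> D" "\<forall>i\<ge>n. coeff z i = 0" for z n
      using that
    proof (induction n arbitrary: z)
      case 0
      then have "z = 0" by (intro poly_eqI) simp
      then show ?case using I_0 D_0 by (intro exI[of _ 0]) (simp add: small_def)
    next
      case (Suc n)
      show ?case
      proof (cases "n < r")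
        case True
        then show ?thesis using Suc.prems I_0 by (intro exI[of _ z]) (simp add: small_def)
      next
        case nr: False
        show ?thesis
        proof (cases "n < p")
          case False
          then have "coeff z n = 0" using DD(2)[OF Suc.prems(1)] by simp
          then have "\<forall>i\<ge>n. coeff z i = 0" using Suc.prems(2) by (metis le_neq_implies_less Suc_leI)
          then show ?thesis using Suc.IH[OF Suc.prems(1)] by blast
        next
          case True
          \<comment> \<open>Monic of degree \<open>n\<close>, because \<open>s\<close> fixes
            \<open>1\<close> and \<open>n < p\<close> prevents wrap-around; subtracting a multiple
            of it lowers the degree bound on \<open>z\<close>.\<close>
          define h where "h = (Y ^^ (n - r)) g"
          have hI: "h \<in> I" unfolding h_def by (rule I_Yp[OF gI])
          have s0: "(s ^^ k) 0 = 0" "(s ^^ k) 1 = 1" for k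
            by (rule funpow_fix, simp add: shom_0[OF sh Mr] shomD(1)[OF sh])+
          have hn: "coeff h n = 1"
            unfolding h_def using nr True gD rp lg s0 by (subst coeff_Yp) auto
          have hi: "coeff h i = 0" if "n < i" for i
          proof (cases "i < p")
            case False
            then show ?thesis using DD(2)[OF ID[OF hI]] by simp
          next
            case ip: True
            have "coeff g (i - (n - r)) = 0" by (rule coeff_eq_0) (use that nr dg in linarith)
            then show ?thesis unfolding h_def using that ip True gD s0 by (subst coeff_Yp) auto
          qed
          define z1 where "z1 = z - smult (coeff z n) h"
          have zn: "coeff z n \<in> M" using DD(1)[OF Suc.prems(1)] .
          have z1D: "z1 \<in> D" unfolding z1_def by (rule D_diff[OF Suc.prems(1) D_smult[OF zn ID[OF hI]]])
          have "\<forall>i\<ge>n. coeff z1 i = 0"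
          proof (intro allI impI)
            fix i assume i: "n \<le> i"
            show "coeff z1 i = 0"
            proof (cases "i = n")
              case True
              then show ?thesis unfolding z1_def by (simp add: hn)
            next
              case False
              then have "n < i" using i by simp
              then show ?thesis unfolding z1_def using hi[OF \<open>n < i\<close>] Suc.prems(2) by simp
            qed
          qed
          then obtain z' where z': "small z'" "z1 - z' \<in> I" using Suc.IH[OF z1D] by blast
          have "(z1 - z') + smult (coeff z n) h \<in> I" by (rule I_add[OF z'(2) I_smult[OF zn hI]])
          then have "z - z' \<in> I" unfolding z1_def by simp
          then show ?thesis using z'(1) by blast
        qed
      qed
    qed
    from this[where n = p] have ex: "\<exists>z'. small z' \<and> z - z' \<in> I" if "z \<in> D" for z using that DD(2) by blast
    define red where "red z = (SOME z'. small z' \<and> z - z' \<in> I)" for z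
    have red: "small (red z) \<and> z - red z \<in> I" if "z \<in> D" for z
      unfolding red_def by (rule someI_ex[OF ex[OF that]])
    have red_eqI: "red z = z'" if "z \<in> D" "small z'" "z - z' \<in> I" for z z'
    proof -
      have "z' - red z = (z - red z) - (z - z')" by simp
      then have "z' - red z \<in> I" using I_diff[OF _ that(3)] red[OF that(1)] by metis
      then have "z' - red z = 0" by (rule uniq) (use red[OF that(1)] that(2) in \<open>simp add: small_def\<close>)
      then show ?thesis by simp
    qed
    define e where "e l = monom (1::complex) l" for l
    have eD: "e l \<in> D" if "l < r" for l unfolding e_def using that rp sfieldD(3)[OF MF] by (intro D_monom) auto
    \<comment> \<open>Matrix of \<open>y^k\<close> on the quotient in the basis \<open>y^l\<close>,
      \<open>l < r\<close>.\<close>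
    define P where "P k = mat r r (\<lambda>(i, l). coeff (red ((Y ^^ k) (e l))) i)" for k
    have PM: "P k $$ (i, l) \<in> M" if "i < r" "l < r" for k i l
      using that red[OF Yp_in[OF eD]] DD(1) by (simp add: P_def small_def)
    have Pc: "P k \<in> carrier_mat r r" for k by (simp add: P_def)
    have small_e: "smult a (e l) = red (smult a (e l))" if "l < r" "a \<in> M" for l a
      using that I_0 by (intro red_eqI[symmetric]) (auto simp: small_def e_def D_smult eD[unfolded e_def])
    \<comment> \<open>\<open>y\<close> is only semilinear, hence the entries of the second factor
      are twisted by \<open>s\<close>; the determinants therefore multiply up to the norm of
      \<open>det (P 1)\<close>.\<close>
    have P_Suc: "P (Suc k) = P 1 * map_mat s (P k)" for k
    proof (rule eq_matI)
      fix i l assume "i < dim_row (P 1 * map_mat s (P k))" "l < dim_col (P 1 * map_mat s (P k))"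
      then have il: "i < r" "l < r" by (simp_all add: P_def)
      define z where "z = (Y ^^ k) (e l)"
      have zD: "z \<in> D" unfolding z_def using il by (intro Yp_in eD)
      note rz = red[OF zD]
      have rD: "red z \<in> D" using rz by (simp add: small_def)
      have rze: "red z = (\<Sum>j<r. smult (coeff (red z) j) (e j))"
        by (rule poly_eqI) (use rz in \<open>simp add: e_def smult_monom coeff_sum_monom small_def\<close>)
      have Yr: "Y (red z) = (\<Sum>j<r. smult (s (coeff (red z) j)) (Y (e j)))"
        by (subst rze, subst Y_lin) (auto intro: DD(1)[OF rD] eD)
      define w where "w = (\<Sum>j<r. smult (s (coeff (red z) j)) (red (Y (e j))))"
      have sm: "s (coeff (red z) j) \<in> M" for j by (intro sM DD(1)[OF rD])
      have re: "small (red (Y (e j))) \<and> Y (e j) - red (Y (e j)) \<in> I" if "j < r" for j by (rule red[OF Y_in[OF eD[OF that]]])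
      have "Y (red z) - w = (\<Sum>j<r. smult (s (coeff (red z) j)) (Y (e j) - red (Y (e j))))"
        unfolding Yr w_def by (simp add: sum_subtractf smult_diff_right)
      also have "\<dots> \<in> I" using re sm by (intro I_sum I_smult) auto
      finally have i1: "Y (red z) - w \<in> I" .
      have "Y z - Y (red z) = Y (z - red z)"
        using Y_add[OF D_diff[OF zD rD] rD] by simp
      then have "Y z - Y (red z) \<in> I" using I_Y rz by simp
      then have "(Y z - Y (red z)) + (Y (red z) - w) \<in> I" using i1 by (rule I_add)
      then have i2: "Y z - w \<in> I" by simp
      have "small w" unfolding small_def w_def
        using re sm by (auto intro!: D_sum D_smult simp: small_def coeff_sum)
      then have "red (Y z) = w" using i2 by (intro red_eqI Y_in zD)
      then have "P (Suc k) $$ (i, l) = coeff w i" using il by (simp add: P_def z_def)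
      also have "\<dots> = (\<Sum>j<r. coeff (red (Y (e j))) i * s (coeff (red z) j))"
        unfolding w_def by (simp add: coeff_sum mult.commute)
      also have "\<dots> = (P 1 * map_mat s (P k)) $$ (i, l)"
        using il by (simp add: P_def scalar_prod_def z_def atLeast0LessThan)
      finally show "P (Suc k) $$ (i, l) = (P 1 * map_mat s (P k)) $$ (i, l)" .
    qed (simp_all add: P_def)
    have detM: "det (P k) \<in> M" for k by (rule det_in[OF Mr Pc PM])
    have e1: "smult a (e l) = monom a l" for a l by (simp add: e_def smult_monom)
    have P0: "P 0 = 1\<^sub>m r"
      using small_e[of _ 1] sfieldD(3)[OF MF] by (intro eq_matI) (auto simp: P_def e_def)
    have Pp: "P p = t \<cdot>\<^sub>m 1\<^sub>m r"
      using small_e[of _ t] tM eD Yp_p by (intro eq_matI) (auto simp: P_def e1)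
    define w where "w = det (P 1)"
    have wM: "w \<in> M" unfolding w_def by (rule detM)
    have wi: "(s ^^ i) w \<in> M" for i using funpow_in[of M s, OF sM wM] .
    have "det (P k) = (\<Prod>i<k. (s ^^ i) w)" for k
    proof (induction k)
      case 0
      then show ?case by (simp add: P0)
    next
      case (Suc k)
      have "det (P (Suc k)) = w * s (det (P k))"
        unfolding P_Suc w_def using det_mult[OF Pc, of "map_mat s (P k)"] det_shom[OF sh Mr Pc PM] Pc by simp
      also have "s (det (P k)) = (\<Prod>i<k. (s ^^ Suc i) w)"
        unfolding Suc using shom_prod[OF sh Mr, of "{..<k}" "\<lambda>i. (s ^^ i) w"] wi by simp
      finally show ?case unfolding prod.lessThan_Suc_shift by simp
    qed
    from this[of p] have nw: "nrm p s w = t ^ r" unfolding nrm_def Pp by (simp add: det_smult)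
    have "coprime r p" using p r0 rp by (metis coprime_commute dvd_imp_le not_le prime_imp_coprime gr0I)
    then obtain a b where ab: "r * a = p * b + 1" using coprime_bezout_strong[of r p] p by (metis prime_gt_1_nat less_irrefl)
    have h: "shom M (s ^^ i)" for i by (rule funpow_shom[OF sh sM])
    \<comment> \<open>From \<open>r * a = p * b + 1\<close> the norm of \<open>x\<close> is
      \<open>t^(r a - p b) = t\<close>.\<close>
    define x where "x = w ^ a * inverse t ^ b"
    have it: "inverse t \<in> M" using tM sfieldD(8)[OF MF] by blast
    have sit: "(s ^^ i) (inverse t) = inverse t" for i
      by (rule funpow_fix) (use shom_inverse[OF sh MF tM] Ks[OF t(1)] in simp)
    have xM: "x \<in> M" unfolding x_def using wM it by (intro sfieldD(5)[OF MF] sring_power[OF Mr])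
    have "(s ^^ i) x = (s ^^ i) w ^ a * inverse t ^ b" for i
      unfolding x_def using wM it shom_power[OF h Mr] sit
      by (subst shomD(3)[OF h]) (auto intro: sring_power[OF Mr])
    then have "nrm p s x = nrm p s w ^ a * (inverse t ^ b) ^ p"
      unfolding nrm_def by (simp add: prod.distrib prod_power_distrib)
    also have "\<dots> = t ^ (r * a) * inverse t ^ (p * b)" unfolding nw by (simp add: power_mult[symmetric] mult.commute)
    also have "\<dots> = t" unfolding ab using t(2) by (simp add: power_inverse)
    finally show False using nn xM by blast
  qed
  then have "g = 1" using dg lg by (metis degree_eq_zeroE coeff_pCons_0 one_pCons)
  then show ?thesis using gI unfolding I_def by auto
qed

lemma inverse_exists:
  assumes nn: "\<And>x. x \<in> M \<Longrightarrow> nrm p s x \<noteq> t" and d: "d \<in> D" "d \<noteq> 0"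
  shows "\<exists>d'\<in>D. dmul d' d = 1 \<and> dmul d d' = 1"
proof -
  obtain d' where d': "d' \<in> D" "dmul d' d = 1" using left_inverse[OF nn d] by blast
  have "d' \<noteq> 0" using d'(2) dm_0(1) by auto
  then obtain d'' where d'': "d'' \<in> D" "dmul d'' d' = 1" using left_inverse[OF nn d'(1)] by blast
  have "d'' = dmul d'' (dmul d' d)" unfolding d'(2) using dm_1_right[OF d''(1)] by simp
  also have "\<dots> = d" using dm_assoc[OF d''(1) d'(1) d(1)] unfolding d''(2) by (simp add: dm_1)
  finally show ?thesis using d' d'' by auto
qed

end

text \<open>\<open>v\<close> is a Kummer generator: its conjugates \<open>\<zeta> ^ j * v\<close>
  are distinct, so conjugation by \<open>v\<close> separates the components \<open>M y^j\<close>,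
  and the powers of \<open>v\<close> form a basis of \<open>M\<close> over \<open>K\<close>.\<close>

locale csz = csa +
  fixes \<zeta> v :: complex
  assumes \<zeta>: "\<zeta> \<in> K" "\<zeta> ^ p = 1" "\<And>i. 0 < i \<Longrightarrow> i < p \<Longrightarrow> \<zeta> ^ i \<noteq> 1"
    and v: "v \<in> M" "v \<noteq> 0" "s v = \<zeta> * v"
begin

lemma \<zeta>0: "\<zeta> \<noteq> 0"
  using \<zeta>(2) p0 by (metis power_0_left less_irrefl zero_neq_one)

lemma sv: "(s ^^ j) v = \<zeta> ^ j * v"
proof (induction j)
  case (Suc j)
  then show ?case
    using v KM[OF \<zeta>(1)] Ks[OF \<zeta>(1)] shom_power[OF sh Mr KM[OF \<zeta>(1)]] sring_power[OF Mr]
    by (simp add: shomD(3)[OF sh])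
qed simp

lemma zeta_inj:
  assumes "i < p" "j < p" "\<zeta> ^ i = \<zeta> ^ j"
  shows "i = j"
  using assms
proof (induction i j rule: linorder_wlog)
  case (le i j)
  show ?case
  proof (rule ccontr)
    assume "i \<noteq> j"
    then have ij: "0 < j - i" "j - i < p" "i + (j - i) = j" using le by auto
    have "\<zeta> ^ i * \<zeta> ^ (j - i) = \<zeta> ^ j" unfolding power_add[symmetric] ij(3) ..
    then have "\<zeta> ^ i * \<zeta> ^ (j - i) = \<zeta> ^ i * 1" using le by simp
    then show False using \<zeta>(3)[OF ij(1,2)] \<zeta>0 by simp
  qed
qed simp

text \<open>Right multiplication by \<open>v\<close> acts on the component of \<open>y^j\<close> as
  \<open>\<zeta> ^ j * v\<close>; comparing with \<open>\<zeta> ^ i * v\<close> leaves only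
  \<open>j = i\<close>.\<close>

lemma commutes_v:
  assumes d: "d \<in> D" and e: "dmul d [:v:] = smult (\<zeta> ^ i * v) d" and i: "i < p" and j: "j < p" "j \<noteq> i"
  shows "coeff d j = 0"
proof -
  have "dmul d [:v:] = (\<Sum>j<p. monom (coeff d j * (\<zeta> ^ j * v)) j)"
    unfolding cyclic_mult_def using v by (intro sum.cong refl) (simp add: Yp_const Yp_1 sv smult_monom)
  then have "coeff d j * (\<zeta> ^ j * v) = \<zeta> ^ i * v * coeff d j"
    using arg_cong[OF e, of "\<lambda>q. coeff q j"] j by (simp add: coeff_sum_monom)
  moreover have "\<zeta> ^ j \<noteq> \<zeta> ^ i" using zeta_inj[OF j(1) i] j(2) by blast
  ultimately show ?thesis using v(2) by simp
qed

text \<open>Commuting with \<open>v\<close> leaves only the component in \<open>M\<close>, and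
  commuting with \<open>y\<close> makes it fixed by \<open>s\<close>.\<close>

lemma center: "x \<in> D \<Longrightarrow> (\<forall>y\<in>D. dmul x y = dmul y x) \<longleftrightarrow> (\<exists>a\<in>K. x = [:a:])"
proof
  assume x: "x \<in> D" and c: "\<forall>y\<in>D. dmul x y = dmul y x"
  have "coeff x j = 0" if "j < p" "j \<noteq> 0" for j
    using commutes_v[OF x, of 0 j] c D_const[OF v(1)] that p0 by (simp add: dm_const)
  then have "x = [:coeff x 0:]" by (intro D_eqI[OF x] D_const DD(1)[OF x]) (auto simp: coeff_pCons split: nat.split)
  then obtain a where a: "x = [:a:]" by blast
  have aM: "a \<in> M" using DD(1)[OF x, of 0] by (simp add: a)
  have p1: "1 < p" using p by (rule prime_gt_1_nat)
  have y: "monom 1 1 \<in> D" using p1 sfieldD(3)[OF MF] by (intro D_monom)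
  have "dmul (monom 1 1) x = smult a (monom 1 1)" using c y a by (simp add: dm_const)
  then have "Y x = smult a (monom 1 1)" using p1 by (simp add: dm_monom)
  then have "coeff (Y x) 1 = a" by simp
  then have "s a = a" using p1 a by (simp add: coeff_tw)
  then show "\<exists>a\<in>K. x = [:a:]" using a aM by (auto simp: fixK_def)
next
  assume "\<exists>a\<in>K. x = [:a:]"
  then obtain a where a: "a \<in> K" "x = [:a:]" by blast
  show "\<forall>y\<in>D. dmul x y = dmul y x"
  proof
    fix y assume y: "y \<in> D"
    have "dmul y x = smult a (dmul y 1)" using dm_smult2[OF a(1) D_1, of y] by (simp add: a one_pCons)
    then show "dmul x y = dmul y x" using dm_1_right[OF y] by (simp add: a dm_const)
  qed
qed

end

context csz
begin

lemma root_of_unity_sum: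
  assumes "0 < k" "k < p"
  shows "(\<Sum>i<p. (inverse \<zeta> ^ i) ^ k) = 0"
proof -
  let ?z = "inverse \<zeta> ^ k"
  have "?z \<noteq> 1" using \<zeta>(3)[OF assms] by (simp add: power_inverse)
  moreover have "?z ^ p = 1" using \<zeta>(2) by (simp add: power_inverse power_mult[symmetric] mult.commute[of k]) (simp add: power_mult)
  ultimately have "(\<Sum>i<p. ?z ^ i) = 0" by (simp add: geometric_sum)
  then show ?thesis by (simp add: power_mult[symmetric] mult.commute)
qed

lemma vp_K: "v ^ p \<in> K"
proof -
  have "s (v ^ p) = v ^ p" using v \<zeta>(2) by (simp add: shom_power[OF sh Mr] power_mult_distrib)
  then show ?thesis using sring_power[OF Mr v(1)] by (simp add: fixK_def)
qed

text \<open>The elements \<open>u i\<close> in the proof satisfy \<open>f(v) u\<^sub>i = \<zeta>\<^sup>i u\<^sub>i v\<close> and add up to \<open>p\<close>, so that one of them is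
  invertible. Conjugation by it moves \<open>f(y)\<close> to an element of the form \<open>m y\<close>.\<close>
lemma hom_norm:
  assumes nn: "\<And>x. x \<in> M \<Longrightarrow> nrm p s x \<noteq> t" and t': "t' \<in> K" "t' \<noteq> 0"
    and f: "\<And>d. d \<in> D \<Longrightarrow> f d \<in> D" "\<And>d e. d \<in> D \<Longrightarrow> e \<in> D \<Longrightarrow> f (cyclic_mult p s t' d e) = dmul (f d) (f e)"
      "f 1 = 1" "\<And>a d. a \<in> K \<Longrightarrow> d \<in> D \<Longrightarrow> f (smult a d) = smult a (f d)"
  shows "\<exists>x\<in>M. nrm p s x * t = t'"
proof -
  interpret t': csz p M s t' \<zeta> v by unfold_locales (use p c t' \<zeta> v in auto)
  have p1: "1 < p" using p by (rule prime_gt_1_nat)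
  have vk: "v ^ k \<in> M" "inverse v ^ k \<in> M" for k
    using sring_power[OF Mr] sfieldD(8)[OF MF] v(1) by auto
  have yD: "monom 1 1 \<in> D" using p1 sfieldD(3)[OF MF] by (intro D_monom)
  note vD = D_const[OF v(1)]
  define W where "W = f [:v:]"
  define Z where "Z = f (monom 1 1)"
  have WD: "W \<in> D" and ZD: "Z \<in> D" unfolding W_def Z_def using f(1) yD vD by auto
  have ZW: "dmul Z W = smult \<zeta> (dmul W Z)"
  proof -
    have "cyclic_mult p s t' (monom 1 1) [:v:] = smult \<zeta> (cyclic_mult p s t' [:v:] (monom 1 1))"
      using t'.Yp_const[OF v(1), of 1] t'.Yp_1[OF p1] p1 v(3) by (simp add: t'.dm_monom t'.dm_const)
    then show ?thesis unfolding W_def Z_def using f yD vD \<zeta>(1) t'.dm_in by (metis (no_types, lifting))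
  qed
  have LZ: "((\<lambda>x. dmul Z x) ^^ j) x = dmul (f ((cyclic_shift p s t' ^^ j) 1)) x" if "x \<in> D" for j x
  proof (induction j)
    case 0
    then show ?case by (simp add: f(3) dm_1)
  next
    case (Suc j)
    have e: "(cyclic_shift p s t' ^^ j) 1 \<in> D" by (rule t'.Yp_in[OF D_1])
    have "f ((cyclic_shift p s t' ^^ Suc j) 1) = dmul Z (f ((cyclic_shift p s t' ^^ j) 1))"
      unfolding Z_def using f(2)[OF yD e] p1 by (simp add: t'.dm_monom)
    then show ?case using Suc dm_assoc[OF ZD f(1)[OF e] that] by simp
  qed
  have LZp: "((\<lambda>x. dmul Z x) ^^ p) x = smult t' x" if "x \<in> D" for x
    unfolding LZ[OF that] t'.Yp_p[OF D_1] f(4)[OF t'(1) D_1] f(3) dm_smult1 dm_1 ..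
  \<comment> \<open>Fourier components of the sequence \<open>f(v^k) v^(-k)\<close>, which has
    period \<open>p\<close> because \<open>v ^ p\<close> lies in \<open>K\<close> and
    \<open>f\<close> is linear over \<open>K\<close>.\<close>
  define u where "u i = (\<Sum>k<p. smult ((inverse \<zeta> ^ i) ^ k) (dmul (f [:v ^ k:]) [:inverse v ^ k:]))" for i
  have kD: "dmul (f [:v ^ k:]) [:inverse v ^ k:] \<in> D" for k by (intro dm_in f(1) D_const vk)
  have iz: "inverse \<zeta> \<in> K" using \<zeta>(1) sfieldD(8)[OF KF] by blast
  then have izk: "(inverse \<zeta> ^ i) ^ k \<in> K" for i k by (intro sring_power[OF Kr])
  have uD: "u i \<in> D" for i unfolding u_def by (intro D_sum D_smult kD KM izk)
  have Wu: "dmul W (u i) = smult (\<zeta> ^ i) (dmul (u i) [:v:])" for i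
  proof -
    \<comment> \<open>Multiplying by \<open>f(v)\<close> shifts the summation index by one; the
      boundary terms \<open>g p\<close> and \<open>g 0\<close> agree by periodicity.\<close>
    define g where "g k = smult (\<zeta> ^ i * (inverse \<zeta> ^ i) ^ k) (dmul (f [:v ^ k:]) [:v * inverse v ^ k:])" for k
    have e1: "dmul W (dmul (f [:v ^ k:]) [:inverse v ^ k:]) = dmul (f [:v ^ Suc k:]) [:inverse v ^ k:]" for k
      using dm_assoc[OF WD f(1)[OF D_const[OF vk(1)]] D_const[OF vk(2)], of k k]
        f(2)[OF vD D_const[OF vk(1)], of k] by (simp add: W_def t'.dm_const mult.commute)
    have e2: "v * inverse v ^ Suc k = inverse v ^ k" for k using v(2) by simp
    have e3: "\<zeta> ^ i * (inverse \<zeta> ^ i) ^ Suc k = (inverse \<zeta> ^ i) ^ k" for k using \<zeta>0 by (simp add: power_inverse)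
    have "dmul W (u i) = (\<Sum>k<p. smult ((inverse \<zeta> ^ i) ^ k) (dmul W (dmul (f [:v ^ k:]) [:inverse v ^ k:])))"
      unfolding u_def by (rule dm_lin2) (auto intro: kD izk)
    also have "\<dots> = (\<Sum>k<p. g (Suc k))" unfolding g_def e1 e2 e3 ..
    also have "\<dots> = (\<Sum>k<p. g k) + g p - g 0"
      using sum.lessThan_Suc[of g p] sum.lessThan_Suc_shift[of g p] by simp
    also have "g p = g 0"
    proof -
      have "f [:v ^ p:] = [:v ^ p:]" using f(4)[OF vp_K D_1] f(3) by (simp add: one_pCons)
      moreover have "f [:1:] = [:1:]" using f(3) by (simp add: one_pCons)
      moreover have "(inverse \<zeta> ^ i) ^ p = 1"
        using \<zeta>(2) by (simp add: power_inverse power_mult[symmetric] mult.commute[of i]) (simp add: power_mult)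
      ultimately show ?thesis unfolding g_def using v(2) by (simp add: dm_const power_inverse)
    qed
    also have "(\<Sum>k<p. g k) = smult (\<zeta> ^ i) (dmul (u i) [:v:])"
    proof -
      have "dmul (dmul (f [:v ^ k:]) [:inverse v ^ k:]) [:v:] = dmul (f [:v ^ k:]) [:v * inverse v ^ k:]" for k
        using dm_assoc[OF f(1)[OF D_const[OF vk(1)]] D_const[OF vk(2)] vD, of k k] by (simp add: dm_const mult.commute)
      then show ?thesis unfolding g_def u_def dm_lin1 by (simp add: smult_sum2)
    qed
    finally show ?thesis by simp
  qed
  \<comment> \<open>Orthogonality of the roots of unity keeps only \<open>k = 0\<close>, where the
    product is \<open>1\<close>.\<close>
  have "(\<Sum>i<p. u i) = (\<Sum>k<p. smult (\<Sum>i<p. (inverse \<zeta> ^ i) ^ k) (dmul (f [:v ^ k:]) [:inverse v ^ k:]))"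
    unfolding u_def by (subst sum.swap) (simp add: smult_sum)
  also have "\<dots> = (\<Sum>k<p. if k = 0 then [:of_nat p:] else 0)"
    using root_of_unity_sum f(3) by (intro sum.cong refl) (auto simp: one_pCons dm_const)
  also have "\<dots> = [:of_nat p:]" using p0 by simp
  finally have "(\<Sum>i<p. u i) \<noteq> 0" using p0 by simp
  then obtain i where i: "u i \<noteq> 0" by (metis sum.neutral)
  obtain u' where u': "u' \<in> D" "dmul u' (u i) = 1" "dmul (u i) u' = 1" using inverse_exists[OF nn uD i] by blast
  \<comment> \<open>From \<open>Z W = \<zeta> W Z\<close> and
    \<open>W u_i = \<zeta>^i u_i v\<close>, the conjugate \<open>y\<close> of \<open>Z\<close>
    satisfies \<open>y v = \<zeta> v y\<close>; by \<open>commutes_v\<close> only its component of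
    degree one survives.\<close>
  define y where "y = dmul u' (dmul Z (u i))"
  have yD': "y \<in> D" unfolding y_def by (intro dm_in u' ZD uD)
  have uy: "dmul (u i) y = dmul Z (u i)"
    unfolding y_def using dm_assoc[OF uD u'(1) dm_in[OF ZD uD], of i i] u'(3) by (simp add: dm_1)
  have \<zeta>i: "\<zeta> ^ i \<in> K" using \<zeta>(1) by (rule sring_power[OF Kr])
  have "smult (\<zeta> ^ i) (dmul y [:v:]) = smult (\<zeta> ^ i) (dmul u' (dmul Z (dmul (u i) [:v:])))"
    unfolding y_def using u' ZD uD vD dm_in by (simp add: dm_assoc)
  also have "\<dots> = dmul u' (dmul Z (dmul W (u i)))"
    unfolding Wu using \<zeta>i u' ZD uD vD dm_in by (simp add: dm_smult2)
  also have "\<dots> = dmul u' (dmul (smult \<zeta> (dmul W Z)) (u i))" using dm_assoc[OF ZD WD uD] ZW by simp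
  also have "\<dots> = smult \<zeta> (dmul u' (dmul W (dmul (u i) y)))"
    unfolding uy using dm_assoc[OF WD ZD uD] \<zeta>(1) WD ZD uD dm_in by (simp add: dm_smult1 dm_smult2)
  also have "dmul W (dmul (u i) y) = smult (\<zeta> ^ i) (dmul (u i) (dmul [:v:] y))"
    using dm_assoc[OF WD uD yD', of i] dm_assoc[OF uD vD yD', of i] by (simp add: Wu dm_smult1)
  also have "dmul u' (smult (\<zeta> ^ i) (dmul (u i) (dmul [:v:] y))) = smult (\<zeta> ^ i) (smult v y)"
    by (subst dm_smult2[OF \<zeta>i dm_in[OF uD dm_in[OF vD yD']]],
      subst dm_assoc[OF u'(1) uD dm_in[OF vD yD'], symmetric], simp only: u'(2) dm_1 dm_const)
  finally have "smult (\<zeta> ^ i) (dmul y [:v:]) = smult (\<zeta> ^ i) (smult (\<zeta> * v) y)" by (simp add: ac_simps)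
  then have "dmul y [:v:] = smult (\<zeta> ^ 1 * v) y" using \<zeta>0 by (metis power_one_right power_not_zero smult_cancel)
  then have "coeff y j = 0" if "j < p" "j \<noteq> 1" for j using commutes_v[OF yD' _ p1 that] by blast
  then obtain m where y: "y = monom m 1" and m: "m \<in> M"
    using D_eqI[OF yD' D_monom[OF DD(1)[OF yD'] p1], of 1] DD(1)[OF yD', of 1] by (metis coeff_monom)
  have "((\<lambda>x. dmul y x) ^^ j) x = dmul u' (((\<lambda>x. dmul Z x) ^^ j) (dmul (u i) x))" if "x \<in> D" for x j
    using that
  proof (induction j)
    case 0
    then show ?case using dm_assoc[OF u'(1) uD 0, of i] u'(2) by (simp add: dm_1)
  next
    case (Suc j)
    define z where "z = ((\<lambda>x. dmul Z x) ^^ j) (dmul (u i) x)"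
    have zD: "z \<in> D" unfolding z_def LZ[OF dm_in[OF uD Suc.prems]]
      by (intro dm_in f(1) t'.Yp_in D_1 uD Suc.prems)
    have "dmul y (dmul u' z) = dmul u' (dmul (dmul Z (u i)) (dmul u' z))"
      unfolding y_def by (rule dm_assoc) (intro dm_in u' ZD uD zD)+
    also have "dmul (dmul Z (u i)) (dmul u' z) = dmul Z (dmul (u i) (dmul u' z))"
      by (rule dm_assoc) (intro dm_in u' ZD uD zD)+
    also have "dmul (u i) (dmul u' z) = z" using dm_assoc[OF uD u'(1) zD, of i] u'(3) by (simp add: dm_1)
    finally show ?case using Suc by (simp add: z_def)
  qed
  \<comment> \<open>The \<open>p\<close>-th power of \<open>y\<close> is computed twice: conjugation
    from \<open>Z\<close> gives \<open>t'\<close>, and expanding \<open>monom m 1\<close> gives the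
    norm of \<open>m\<close> times \<open>t\<close>.\<close>
  from this[of 1 p] have "((\<lambda>x. dmul y x) ^^ p) 1 = smult t' 1"
    using D_1 uD u' t'(1) by (simp add: LZp dm_1_right dm_smult2)
  moreover have "((\<lambda>x. dmul y x) ^^ j) 1 = smult (\<Prod>i<j. (s ^^ i) m) ((Y ^^ j) 1)" for j
  proof (induction j)
    case (Suc j)
    have mi: "(s ^^ i) m \<in> M" for i using funpow_in[of M s, OF sM m] .
    have "((\<lambda>x. dmul y x) ^^ Suc j) 1 = smult (m * s (\<Prod>i<j. (s ^^ i) m)) ((Y ^^ Suc j) 1)"
      using Suc p1 Y_smult[OF sring_prod[OF Mr, of "{..<j}" "\<lambda>i. (s ^^ i) m", OF mi] Yp_in[OF D_1]] by (simp add: y dm_monom)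
    also have "m * s (\<Prod>i<j. (s ^^ i) m) = (\<Prod>i<Suc j. (s ^^ i) m)"
      unfolding prod.lessThan_Suc_shift using shom_prod[OF sh Mr, of "{..<j}" "\<lambda>i. (s ^^ i) m"] mi by simp
    finally show ?case .
  qed simp
  ultimately have "smult (nrm p s m * t) 1 = smult t' 1" using Yp_p[OF D_1] by (simp add: nrm_def)
  then have "nrm p s m * t = t'" by (simp add: one_pCons)
  then show ?thesis using m by blast
qed

end

context csa
begin

section \<open>Subfields of cyclic algebras\<close>

text \<open>The algebra acts on \<open>M[x]/f\<close>, with \<open>y\<close> acting by \<open>B \<mapsto> A s(B)\<close>, as soon as the norm of \<open>A\<close> is \<open>t\<close>
  modulo \<open>f\<close>. The action commutes with \<open>K[x]/f\<close>, and both sides have dimension \<open>p\<close> over \<open>M\<close>.\<close>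
definition wact :: "complex poly \<Rightarrow> complex poly \<Rightarrow> complex poly" where
  "wact A B = A * map_poly s B"

definition act :: "complex poly \<Rightarrow> complex poly \<Rightarrow> complex poly \<Rightarrow> complex poly" where
  "act A d B = (\<Sum>j<p. smult (coeff d j) ((wact A ^^ j) B))"

lemma act_Suc:
  assumes "p = Suc q"
  shows "act A d B = smult (coeff d 0) B + (\<Sum>j<q. smult (coeff d (Suc j)) ((wact A ^^ Suc j) B))"
proof -
  have "act A d B = (\<Sum>j<Suc q. smult (coeff d j) ((wact A ^^ j) B))" unfolding act_def using assms by simp
  then show ?thesis unfolding sum.lessThan_Suc_shift by simp
qed

text \<open>\<open>lam d\<close> is the value at \<open>\<theta>\<close> of the result of
  \<open>d\<close> acting on \<open>1\<close>. It is injective because a nonzero \<open>d\<close>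
  has a left inverse, and it reaches all of \<open>adj K \<theta>\<close> by counting dimensions;
  \<open>j\<close> is its inverse there. Multiplicativity holds since the action commutes with
  multiplication by polynomials over \<open>K\<close>.\<close>

lemma irr_embeds:
  assumes nn: "\<And>x. x \<in> M \<Longrightarrow> nrm p s x \<noteq> t"
    and f: "f \<in> pol K" "irr M f" "degree f = p" and \<theta>: "poly f \<theta> = 0"
    and A: "A \<in> pol M" "poly (\<Prod>k<p. map_poly (s ^^ k) A) \<theta> = t"
  shows "\<exists>j. (\<forall>z\<in>adj K \<theta>. j z \<in> D) \<and> j 1 = 1 \<and>
    (\<forall>x\<in>adj K \<theta>. \<forall>y\<in>adj K \<theta>. j (x + y) = j x + j y \<and> j (x * y) = dmul (j x) (j y)) \<and>
    (\<forall>a\<in>K. \<forall>x\<in>adj K \<theta>. j (a * x) = smult a (j x))"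
proof -
  note PM = pol_sring[OF Mr]
  note PMD = sringD[OF PM]
  have fM: "f \<in> pol M" by (rule irrD(1)[OF f(2)])
  have f0: "f \<noteq> 0" by (rule irrD(3)[OF f(2)])
  have KMs: "K \<subseteq> M" by (auto simp: fixK_def)
  have KP: "h \<in> pol M" if "h \<in> pol K" for h using pol_mono[OF KMs] that by blast
  let ?w = "wact A"
  have sP: "map_poly s B \<in> pol M" if "B \<in> pol M" for B by (rule map_pol_in[OF sh Mr sM that])
  have w_in: "?w B \<in> pol M" if "B \<in> pol M" for B unfolding wact_def by (intro PMD(4) A sP that)
  have wi_in: "(?w ^^ j) B \<in> pol M" if "B \<in> pol M" for B j using that by (induction j) (auto intro: w_in)
  have w_lin: "?w (\<Sum>i\<in>I. smult (a i) (B i)) = (\<Sum>i\<in>I. smult (s (a i)) (?w (B i)))"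
    if "\<And>i. i \<in> I \<Longrightarrow> a i \<in> M" "\<And>i. i \<in> I \<Longrightarrow> B i \<in> pol M" for I :: "nat set" and a B
  proof -
    have "map_poly s (\<Sum>i\<in>I. smult (a i) (B i)) = (\<Sum>i\<in>I. map_poly s (smult (a i) (B i)))"
      by (rule shom_sum[OF shom_map_poly[OF sh Mr] PM]) (intro pol_smult[OF Mr] that)
    also have "\<dots> = (\<Sum>i\<in>I. smult (s (a i)) (map_poly s (B i)))"
      using that by (intro sum.cong refl map_pol(7)[OF sh Mr])
    finally show ?thesis unfolding wact_def by (simp add: sum_distrib_left)
  qed
  have w_diff: "?w (B - C) = ?w B - ?w C" if "B \<in> pol M" "C \<in> pol M" for B C
    unfolding wact_def using shom_diff[OF shom_map_poly[OF sh Mr] PM that] by (simp add: right_diff_distrib)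
  have sK: "map_poly s h = h" if "h \<in> pol K" for h
    by (rule poly_eqI) (simp add: map_pol(1)[OF sh Mr] Ks polD[OF that])
  have wK: "?w (h * B) = h * ?w B" if "h \<in> pol K" "B \<in> pol M" for h B
    unfolding wact_def using map_pol(3)[OF sh Mr KP[OF that(1)] that(2)] sK[OF that(1)] by (simp add: mult.left_commute)
  have wiK: "(?w ^^ j) (h * B) = h * (?w ^^ j) B" if "h \<in> pol K" "B \<in> pol M" for h B j
    using that by (induction j) (auto simp: wK wi_in)
  \<comment> \<open>Values at \<open>\<theta>\<close> stand for classes modulo \<open>f\<close>;
    \<open>w_cong\<close> shows that the semilinear operator respects them.\<close>
  define ev where "ev B = poly B \<theta>" for B :: "complex poly"
  have ev_simps: "ev (B + C) = ev B + ev C" "ev (B - C) = ev B - ev C" "ev (B * C) = ev B * ev C"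
    "ev (smult a B) = a * ev B" "ev 0 = 0" "ev 1 = 1" for a B C by (simp_all add: ev_def)
  have ev_sum: "ev (sum g I) = (\<Sum>i\<in>I. ev (g i))" for g and I :: "nat set" by (simp add: ev_def poly_sum)
  have w_cong: "ev (?w B) = ev (?w C)" if B: "B \<in> pol M" and C: "C \<in> pol M" and e: "ev B = ev C" for B C
  proof -
    have BC: "B - C \<in> pol M" by (rule PMD(6)[OF B C])
    have "poly (B - C) \<theta> = 0" using e by (simp add: ev_def)
    then have "f dvd B - C" by (rule irr_dvd[OF MF f(2) BC \<theta>])
    then obtain E where E: "B - C = f * E" by (elim dvdE)
    have EM: "E \<in> pol M" by (rule pol_quot[OF MF fM BC E f0])
    have "?w B - ?w C = f * ?w E" unfolding w_diff[OF B C, symmetric] E by (rule wK[OF f(1) EM])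
    then have "ev (?w B) - ev (?w C) = ev f * ev (?w E)" by (metis ev_simps(2,3))
    then show ?thesis using \<theta> by (simp add: ev_def)
  qed
  have wi_cong: "ev ((?w ^^ j) B) = ev ((?w ^^ j) C)" if "B \<in> pol M" "C \<in> pol M" "ev B = ev C" for B C j
    using that by (induction j) (auto intro: w_cong wi_in)
  \<comment> \<open>Here the norm condition on \<open>A\<close> enters: the \<open>p\<close>-fold
    operator multiplies by the product of the conjugates of \<open>A\<close>.\<close>
  have w_p: "ev ((?w ^^ p) B) = t * ev B" if B: "B \<in> pol M" for B
  proof -
    have h: "shom M (s ^^ k)" for k by (rule funpow_shom[OF sh sM])
    have AkM: "map_poly (s ^^ k) A \<in> pol M" for k
      by (rule map_pol_in[OF h Mr _ A(1)]) (rule funpow_in[of M s, OF sM])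
    have BkM: "map_poly (s ^^ k) B \<in> pol M" for k
      by (rule map_pol_in[OF h Mr _ B]) (rule funpow_in[of M s, OF sM])
    have mS: "map_poly s (map_poly (s ^^ k) C) = map_poly (s ^^ Suc k) C" for k C
      by (rule poly_eqI) (simp only: map_pol(1)[OF sh Mr] map_pol(1)[OF h Mr], simp)
    have "(?w ^^ k) B = (\<Prod>i<k. map_poly (s ^^ i) A) * map_poly (s ^^ k) B" for k
    proof (induction k)
      case 0
      show ?case by (rule poly_eqI) (simp add: coeff_map_poly)
    next
      case (Suc k)
      have PA: "(\<Prod>i<k. map_poly (s ^^ i) A) \<in> pol M" by (rule sring_prod[OF PM]) (rule AkM)
      have "(?w ^^ Suc k) B = A * (map_poly s (\<Prod>i<k. map_poly (s ^^ i) A) * map_poly s (map_poly (s ^^ k) B))"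
        using map_pol(3)[OF sh Mr PA BkM, of k] by (simp add: Suc wact_def[of A "_ * _"])
      also have "map_poly s (\<Prod>i<k. map_poly (s ^^ i) A) = (\<Prod>i<k. map_poly (s ^^ Suc i) A)"
        by (subst shom_prod[OF shom_map_poly[OF sh Mr] PM]) (auto intro: AkM simp: mS)
      finally show ?case
        unfolding prod.lessThan_Suc_shift mS
        by (simp add: mult.assoc del: funpow.simps(2))
    qed
    moreover have "map_poly (s ^^ p) B = B"
      by (rule poly_eqI) (simp add: map_pol(1)[OF h Mr] sp polD[OF B])
    ultimately show ?thesis using A(2) by (simp add: ev_def)
  qed
  have act_in: "act A d B \<in> pol M" if "d \<in> D" "B \<in> pol M" for d B
    unfolding act_def using that by (intro sring_sum[OF PM] pol_smult[OF Mr] wi_in DD(1))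
  have act_lin: "act A (\<Sum>i\<in>I. smult (a i) (d i)) B = (\<Sum>i\<in>I. smult (a i) (act A (d i) B))" for I :: "nat set" and a d B
    unfolding act_def by (simp add: coeff_sum smult_sum smult_sum2 sum.swap[of _ I])
  have act_cong: "ev (act A d B) = ev (act A d C)" if "B \<in> pol M" "C \<in> pol M" "ev B = ev C" for d B C
    unfolding act_def by (simp add: ev_sum ev_simps wi_cong[OF that])
  have actK: "act A d (h * B) = h * act A d B" if "h \<in> pol K" "B \<in> pol M" for h B d
    unfolding act_def by (simp add: wiK that sum_distrib_left)
  have act_Y: "ev (act A (Y e) B) = ev (?w (act A e B))" if e: "e \<in> D" and B: "B \<in> pol M" for e B
  proof -
    obtain q where q: "p = Suc q" using p0 by (cases p) auto
    have "ev (?w (act A e B)) = (\<Sum>j<p. s (coeff e j) * ev ((?w ^^ Suc j) B))"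
      unfolding act_def by (subst w_lin) (auto simp: ev_sum ev_simps DD(1)[OF e] wi_in[OF B])
    also have "\<dots> = t * s (coeff e q) * ev B + (\<Sum>j<q. s (coeff e j) * ev ((?w ^^ Suc j) B))"
      using w_p[OF B] unfolding q by simp
    also have "\<dots> = ev (act A (Y e) B)"
      unfolding act_Suc[OF q] by (simp add: coeff_tw ev_simps ev_sum q)
    finally show ?thesis ..
  qed
  have act_Yp: "ev (act A ((Y ^^ j) e) B) = ev ((?w ^^ j) (act A e B))" if e: "e \<in> D" and B: "B \<in> pol M" for e B j
  proof (induction j)
    case (Suc j)
    have "ev (act A ((Y ^^ Suc j) e) B) = ev (?w (act A ((Y ^^ j) e) B))" using act_Y[OF Yp_in[OF e] B] by simp
    also have "\<dots> = ev (?w ((?w ^^ j) (act A e B)))"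
      by (intro w_cong Suc act_in wi_in Yp_in e B)
    finally show ?case by simp
  qed simp
  have act_dm: "ev (act A (dmul d e) B) = ev (act A d (act A e B))" if d: "d \<in> D" and e: "e \<in> D" and B: "B \<in> pol M" for d e B
    unfolding cyclic_mult_def act_lin by (simp add: ev_sum ev_simps act_Yp[OF e B] act_def[of A d])
  have act_1: "act A 1 B = B" for B
  proof -
    obtain q where q: "p = Suc q" using p0 by (cases p) auto
    show ?thesis unfolding act_Suc[OF q] by (simp add: one_pCons)
  qed
  define lam where "lam d = ev (act A d 1)" for d
  have lam_sum: "lam d = (\<Sum>j<p. coeff d j * ev ((?w ^^ j) 1))" for d
    unfolding lam_def act_def by (simp add: ev_sum ev_simps)
  have lam_add: "lam (d + e) = lam d + lam e" "lam (d - e) = lam d - lam e" "lam (smult a d) = a * lam d" for d e a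
    unfolding lam_sum by (simp_all add: sum.distrib sum_subtractf algebra_simps sum_distrib_left)
  have lam_0: "d = 0" if d: "d \<in> D" and 0: "lam d = 0" for d
  proof (rule ccontr)
    assume "d \<noteq> 0"
    then obtain d' where d': "d' \<in> D" "dmul d' d = 1" using left_inverse[OF nn d] by blast
    have "1 = ev (act A (dmul d' d) 1)" using d' by (simp add: act_1 ev_simps)
    also have "\<dots> = ev (act A d' (act A d 1))" by (rule act_dm[OF d'(1) d PMD(2)])
    also have "\<dots> = ev (act A d' (0 * 1))"
      by (rule act_cong) (use 0 act_in[OF d PMD(2)] PMD(1) in \<open>auto simp: lam_def ev_simps\<close>)
    also have "\<dots> = 0" using actK[of 0 1 d'] sfieldD(2)[OF KF] PMD(2) by (simp add: ev_simps)
    finally show False by simp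
  qed
  have lam_inj: "d = e" if "d \<in> D" "e \<in> D" "lam d = lam e" for d e
    using lam_0[OF D_diff[OF that(1,2)]] that(3) by (simp add: lam_add)
  have lam_surj: "\<exists>d\<in>D. lam d = z" if z: "z \<in> adj K \<theta>" for z
  proof -
    obtain h where h: "h \<in> pol K" "z = poly h \<theta>" using z unfolding adj_def by blast
    \<comment> \<open>The images of \<open>1\<close> under the powers of \<open>y\<close>, together
      with \<open>h\<close>, are \<open>p + 1\<close> vectors of length \<open>p\<close> over
      \<open>M\<close>; injectivity of \<open>lam\<close> keeps the coefficient of \<open>h\<close>
      nonzero.\<close>
    define x where "x i = (if i < p then (?w ^^ i) 1 else h) mod f" for i
    have xM: "x i \<in> pol M" for i unfolding x_def using pol_divmod[OF MF fM] wi_in[OF PMD(2)] KP[OF h(1)] by auto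
    obtain a where a: "\<And>i. i \<le> p \<Longrightarrow> a i \<in> M" "\<exists>i\<le>p. a i \<noteq> 0" "\<And>k. k < p \<Longrightarrow> (\<Sum>i\<le>p. a i * coeff (x i) k) = 0"
      using dependent_vectors[OF MF, of p "\<lambda>i. coeff (x i)"] polD[OF xM] by blast
    have "(\<Sum>i\<le>p. smult (a i) (x i)) = 0"
    proof (rule poly_eqI)
      fix k
      show "coeff (\<Sum>i\<le>p. smult (a i) (x i)) k = coeff 0 k"
      proof (cases "k < p")
        case True
        then show ?thesis using a(3) by (simp add: coeff_sum)
      next
        case False
        have "coeff (x i) k = 0" for i
          unfolding x_def using False f(3) degree_mod_less[OF f0] by (metis coeff_0 coeff_eq_0 le_less_trans not_le_imp_less not_less)
        then show ?thesis by (simp add: coeff_sum)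
      qed
    qed
    then have "ev (\<Sum>i\<le>p. smult (a i) (x i)) = 0" by (simp add: ev_simps)
    then have "(\<Sum>i\<le>p. a i * ev (x i)) = 0" by (simp add: ev_def poly_sum)
    moreover have "ev (x i) = (if i < p then ev ((?w ^^ i) 1) else z)" for i
      unfolding x_def ev_def using \<theta> h(2) by (simp add: poly_mod)
    ultimately have rel: "(\<Sum>i<p. a i * ev ((?w ^^ i) 1)) + a p * z = 0"
      by (simp add: lessThan_Suc_atMost[symmetric])
    have lm: "lam (\<Sum>i<p. monom (b i) i) = (\<Sum>i<p. b i * ev ((?w ^^ i) 1))" for b
      unfolding lam_sum by (simp add: coeff_sum_monom)
    have mD: "(\<Sum>i<p. monom (b i) i) \<in> D" if "\<And>i. i < p \<Longrightarrow> b i \<in> M" for b using that by (intro D_sum D_monom) auto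
    have "a p \<noteq> 0"
    proof
      assume ap: "a p = 0"
      then have "(\<Sum>i<p. monom (a i) i) = 0" using rel lm[of a] a(1) by (intro lam_0 mD) auto
      then have "a i = 0" if "i < p" for i using that arg_cong[of _ _ "\<lambda>q. coeff q i"] by (metis coeff_0 coeff_sum_monom)
      then show False using a(2) ap by (metis le_neq_implies_less)
    qed
    then have "lam (\<Sum>i<p. monom (- a i / a p) i) = z"
      unfolding lm using rel by (simp add: field_simps sum_divide_distrib[symmetric] sum_negf) (metis add.commute minus_unique)
    moreover have "(\<Sum>i<p. monom (- a i / a p) i) \<in> D"
      using a(1) by (intro mD sfieldD(9)[OF MF] sfieldD(6)[OF MF]) auto
    ultimately show ?thesis by blast
  qed
  define j where "j z = (SOME d. d \<in> D \<and> lam d = z)" for z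
  have j: "j z \<in> D \<and> lam (j z) = z" if "z \<in> adj K \<theta>" for z
    unfolding j_def by (rule someI_ex) (use lam_surj[OF that] in blast)
  have jI: "j z = d" if "z \<in> adj K \<theta>" "d \<in> D" "lam d = z" for z d using lam_inj j that by metis
  note AD = sringD[OF adj_sring(1)[OF Kr, of \<theta>]] and AK = adj_sring(2)[OF Kr, of \<theta>]
  have lam_mult: "lam (dmul d e) = lam d * lam e" if d: "d \<in> D" and e: "e \<in> D" and l: "lam e \<in> adj K \<theta>" for d e
  proof -
    obtain h where h: "h \<in> pol K" "lam e = poly h \<theta>" using l unfolding adj_def by blast
    have "lam (dmul d e) = ev (act A d (act A e 1))" unfolding lam_def by (rule act_dm[OF d e PMD(2)])
    also have "\<dots> = ev (act A d (h * 1))"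
      by (rule act_cong) (use h act_in[OF e PMD(2)] KP[OF h(1)] in \<open>auto simp: lam_def ev_def\<close>)
    also have "\<dots> = lam d * lam e" unfolding actK[OF h(1) PMD(2)] lam_def[of d] h(2) by (simp add: ev_simps ev_def[of h])
    finally show ?thesis .
  qed
  have l1: "lam 1 = 1" unfolding lam_def act_1 by (simp add: ev_simps)
  have "j (x + y) = j x + j y \<and> j (x * y) = dmul (j x) (j y)" if "x \<in> adj K \<theta>" "y \<in> adj K \<theta>" for x y
    using j[OF that(1)] j[OF that(2)] that
    by (auto intro!: jI AD D_add dm_in simp: lam_add lam_mult)
  moreover have "j (a * x) = smult a (j x)" if "a \<in> K" "x \<in> adj K \<theta>" for a x
    using j[OF that(2)] that AK by (auto intro!: jI AD D_smult KM simp: lam_add)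
  moreover have "j 1 = 1" by (intro jI AD D_1 l1)
  ultimately show ?thesis using j by blast
qed

text \<open>The root \<open>\<theta>\<close> is part of the conclusion because it depends on the
  case: \<open>rt f\<close> when \<open>f\<close> stays irreducible over \<open>M\<close>, otherwise
  a root inside \<open>M\<close>, where constants give the embedding.\<close>

lemma adj_embeds:
  assumes nn: "\<And>x. x \<in> M \<Longrightarrow> nrm p s x \<noteq> t"
    and f: "irr K f" "degree f = p" and sol: "irr M f \<Longrightarrow> solved p M s f t"
  shows "\<exists>\<theta> j. poly f \<theta> = 0 \<and> (\<forall>z\<in>adj K \<theta>. j z \<in> D) \<and> j 1 = 1 \<and>
    (\<forall>x\<in>adj K \<theta>. \<forall>y\<in>adj K \<theta>. j (x + y) = j x + j y \<and> j (x * y) = dmul (j x) (j y)) \<and>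
    (\<forall>a\<in>K. \<forall>x\<in>adj K \<theta>. j (a * x) = smult a (j x))"
proof (cases "irr M f")
  case True
  obtain A where A: "A \<in> pol M" "poly (\<Prod>k<p. map_poly (s ^^ k) A) (rt f) = t"
    using sol[OF True] unfolding solved_def by blast
  have r: "poly f (rt f) = 0" using rt f(2) p0 by simp
  show ?thesis using irr_embeds[OF nn irrD(1)[OF f(1)] True f(2) r A] r by blast
next
  case False
  then obtain r where r: "r \<in> M" "poly f r = 0" using root_or_irr[OF c p f] by blast
  have "adj K r \<subseteq> M" unfolding adj_def using poly_in[OF Mr _ r(1)] pol_mono[of K M] KM by blast
  then show ?thesis using r
    by (intro exI[of _ r] exI[of _ "\<lambda>z. [:z:]"]) (auto simp: D_const one_pCons dm_const)
qed

end

section \<open>Field extensions of prime degree\<close>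

text \<open>Complex counterpart of \<open>vecs\<close>, as \<open>cmul\<close> is of
  \<open>sc_mult\<close>, so that algebras over an abstract field are handled with ordinary
  sums.\<close>

definition cvec :: "complex set \<Rightarrow> nat \<Rightarrow> (nat \<Rightarrow> complex) set" where
  "cvec Q m = {x. (\<forall>i<m. x i \<in> Q) \<and> (\<forall>i\<ge>m. x i = 0)}"

definition cmul :: "nat \<Rightarrow> (nat \<Rightarrow> nat \<Rightarrow> nat \<Rightarrow> complex) \<Rightarrow> (nat \<Rightarrow> complex) \<Rightarrow> (nat \<Rightarrow> complex) \<Rightarrow> nat \<Rightarrow> complex" where
  "cmul m e x y k = (if k < m then \<Sum>i<m. \<Sum>j<m. x i * y j * e i j k else 0)"

definition bas :: "nat \<Rightarrow> nat \<Rightarrow> complex" where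
  "bas i k = (if k = i then 1 else 0)"

lemma cvecD: "x \<in> cvec Q m \<Longrightarrow> i < m \<Longrightarrow> x i \<in> Q" "x \<in> cvec Q m \<Longrightarrow> i \<ge> m \<Longrightarrow> x i = 0"
  unfolding cvec_def by auto

lemma cvecI: "(\<And>i. i < m \<Longrightarrow> x i \<in> Q) \<Longrightarrow> (\<And>i. i \<ge> m \<Longrightarrow> x i = 0) \<Longrightarrow> x \<in> cvec Q m"
  unfolding cvec_def by auto

lemma cmul_lin1: "cmul m e (\<lambda>k. \<Sum>i\<in>I. a i * f i k) y = (\<lambda>k. \<Sum>i\<in>I. a i * cmul m e (f i) y k)"
proof
  fix k
  have "(\<Sum>i'<m. \<Sum>j<m. (\<Sum>i\<in>I. a i * f i i') * y j * e i' j k) = (\<Sum>i\<in>I. \<Sum>i'<m. \<Sum>j<m. a i * (f i i' * y j * e i' j k))"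
    by (simp add: sum_distrib_right sum.swap[of _ I] mult.assoc)
  then show "cmul m e (\<lambda>k. \<Sum>i\<in>I. a i * f i k) y k = (\<Sum>i\<in>I. a i * cmul m e (f i) y k)"
    by (simp add: cmul_def sum_distrib_left)
qed

lemma cmul_in:
  assumes Q: "sring Q" and e: "\<And>i j k. i < m \<Longrightarrow> j < m \<Longrightarrow> k < m \<Longrightarrow> e i j k \<in> Q"
    and x: "x \<in> cvec Q m" and y: "y \<in> cvec Q m"
  shows "cmul m e x y \<in> cvec Q m"
  by (rule cvecI) (auto simp: cmul_def intro!: sring_sum[OF Q] sringD(4)[OF Q] e cvecD[OF x] cvecD[OF y])

lemma char_poly_in:
  fixes Q :: "complex set"
  assumes Q: "sring Q" and A: "A \<in> carrier_mat n n" and e: "\<And>i j. i < n \<Longrightarrow> j < n \<Longrightarrow> A $$ (i, j) \<in> Q"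
  shows "char_poly A \<in> pol Q"
  unfolding char_poly_def
proof (rule det_in[OF pol_sring[OF Q] char_poly_matrix_closed[OF A]])
  fix i j assume ij: "i < n" "j < n"
  then have "- A $$ (i, j) \<in> Q" using e sringD(5)[OF Q] by blast
  then show "char_poly_matrix A $$ (i, j) \<in> pol Q"
    using ij A sringD(1,2)[OF Q] sringD(2)[OF pol_sring[OF Q]] by (auto simp: char_poly_matrix_def pol_pCons)
qed

lemma poly_bound:
  fixes g :: "'a::comm_ring_1 poly"
  assumes "degree g \<le> n"
  shows "poly g z = (\<Sum>i\<le>n. coeff g i * z ^ i)"
  unfolding poly_altdef using assms by (intro sum.mono_neutral_left) (auto simp: coeff_eq_0)

text \<open>Row \<open>i\<close> of \<open>A\<close> holds the coordinates of \<open>w\<close> times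
  the \<open>i\<close>-th basis vector, so a right eigenvector of \<open>A\<close> is a linear
  functional that \<open>w\<close> multiplies by \<open>\<theta>\<close>.\<close>

lemma left_eigenfunctional:
  assumes A: "A = mat m m (\<lambda>(i, k). cmul m e w (bas i) k)" and r: "poly (char_poly A) \<theta> = 0"
  shows "\<exists>Y. (\<exists>k<m. Y k \<noteq> 0) \<and> (\<forall>x. (\<Sum>k<m. cmul m e w x k * Y k) = \<theta> * (\<Sum>k<m. x k * Y k))"
proof -
  have Ac: "A \<in> carrier_mat m m" unfolding A by simp
  obtain y where y: "y \<in> carrier_vec m" "y \<noteq> 0\<^sub>v m" "A *\<^sub>v y = \<theta> \<cdot>\<^sub>v y"
    using r Ac unfolding eigenvalue_root_char_poly[OF Ac, symmetric] eigenvalue_def eigenvector_def by auto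
  define Y where "Y k = vec_index y k" for k
  have "\<exists>k<m. Y k \<noteq> 0"
  proof (rule ccontr)
    assume "\<not> ?thesis"
    then have "y = 0\<^sub>v m" using y(1) by (intro eq_vecI) (auto simp: Y_def)
    then show False using y(2) by simp
  qed
  moreover have "(\<Sum>k<m. cmul m e w x k * Y k) = \<theta> * (\<Sum>k<m. x k * Y k)" for x
  proof -
    have row: "(\<Sum>k<m. cmul m e w (bas i) k * Y k) = \<theta> * Y i" if "i < m" for i
      using arg_cong[OF y(3), of "\<lambda>v. vec_index v i"] that y(1)
      by (simp add: A Y_def scalar_prod_def atLeast0LessThan)
    have b: "cmul m e w (bas i) k = (\<Sum>a<m. w a * e a i k)" if "k < m" "i < m" for i k
    proof -
      have "(\<Sum>j<m. w a * bas i j * e a j k) = (\<Sum>j<m. if j = i then w a * e a j k else 0)" for a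
        by (intro sum.cong) (auto simp: bas_def)
      then show ?thesis using that by (simp add: cmul_def)
    qed
    have "cmul m e w x k = (\<Sum>i<m. x i * cmul m e w (bas i) k)" if "k < m" for k
    proof -
      have "cmul m e w x k = (\<Sum>a<m. \<Sum>i<m. x i * (w a * e a i k))" using that by (simp add: cmul_def ac_simps)
      also have "\<dots> = (\<Sum>i<m. x i * cmul m e w (bas i) k)"
        by (subst sum.swap) (use that in \<open>simp add: b sum_distrib_left\<close>)
      finally show ?thesis .
    qed
    then have "(\<Sum>k<m. cmul m e w x k * Y k) = (\<Sum>k<m. \<Sum>i<m. x i * (cmul m e w (bas i) k * Y k))"
      by (simp add: sum_distrib_right mult.assoc)
    also have "\<dots> = (\<Sum>i<m. x i * (\<Sum>k<m. cmul m e w (bas i) k * Y k))"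
      by (subst sum.swap) (simp add: sum_distrib_left)
    finally show ?thesis by (simp add: row sum_distrib_left mult.left_commute)
  qed
  ultimately show ?thesis by blast
qed

text \<open>An extension of prime degree is sent into the complex numbers by a common eigenvector of its
  multiplications: an eigenvector for a single \<open>w\<close> outside \<open>Q\<close> suffices, since \<open>w\<close> generates.\<close>
lemma field_extension_functional:
  fixes p :: nat
  assumes Q: "sfield Q" and p: "prime p"
    and e: "\<And>i j k. i < p \<Longrightarrow> j < p \<Longrightarrow> k < p \<Longrightarrow> e i j k \<in> Q"
  defines "V \<equiv> cvec Q p" and "mul \<equiv> cmul p e"
  assumes assoc: "\<And>x y z. x \<in> V \<Longrightarrow> y \<in> V \<Longrightarrow> z \<in> V \<Longrightarrow> mul (mul x y) z = mul x (mul y z)"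
    and comm: "\<And>x y. x \<in> V \<Longrightarrow> y \<in> V \<Longrightarrow> mul x y = mul y x"
    and u: "u \<in> V" "\<And>x. x \<in> V \<Longrightarrow> mul u x = x"
    and inv: "\<And>x. x \<in> V \<Longrightarrow> x \<noteq> (\<lambda>_. 0) \<Longrightarrow> \<exists>y\<in>V. mul x y = u"
  shows "\<exists>f. irr Q f \<and> degree f = p \<and> lead_coeff f = 1 \<and> (\<forall>\<theta>. poly f \<theta> = 0 \<longrightarrow>
    (\<exists>\<phi>. (\<forall>x\<in>V. \<phi> x \<in> adj Q \<theta>) \<and> \<phi> u = 1 \<and>
      (\<forall>x\<in>V. \<forall>y\<in>V. \<phi> (\<lambda>k. x k + y k) = \<phi> x + \<phi> y \<and> \<phi> (mul x y) = \<phi> x * \<phi> y) \<and>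
      (\<forall>a\<in>Q. \<forall>x\<in>V. \<phi> (\<lambda>k. a * x k) = a * \<phi> x)))"
proof -
  note Qr = sfieldD(1)[OF Q]
  note QD = sringD[OF Qr]
  have p1: "1 < p" using p by (rule prime_gt_1_nat)
  have mul_in: "mul x y \<in> V" if "x \<in> V" "y \<in> V" for x y
    unfolding mul_def V_def by (rule cmul_in[OF Qr e]) (use that V_def in auto)
  have bV: "bas i \<in> V" if "i < p" for i
    using that QD unfolding V_def by (intro cvecI) (auto simp: bas_def)
  have "\<exists>w\<in>V. \<forall>a\<in>Q. w \<noteq> (\<lambda>k. a * u k)"
  proof (rule ccontr)
    assume "\<not> ?thesis"
    then have n: "\<exists>a\<in>Q. w = (\<lambda>k. a * u k)" if "w \<in> V" for w using that by blast
    obtain a where a: "bas 0 = (\<lambda>k. a * u k)" using n[OF bV[of 0]] p1 by auto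
    obtain b where b: "bas 1 = (\<lambda>k. b * u k)" using n[OF bV[OF p1]] by auto
    have "a * u 0 = 1" using fun_cong[OF a, of 0] by (simp add: bas_def)
    moreover have "b * u 0 = 0" "b * u 1 = 1" using fun_cong[OF b, of 0] fun_cong[OF b, of 1] by (simp_all add: bas_def)
    ultimately show False by auto
  qed
  then obtain w where w: "w \<in> V" "\<And>a. a \<in> Q \<Longrightarrow> w \<noteq> (\<lambda>k. a * u k)" by blast
  define A where "A = mat p p (\<lambda>(i, k). mul w (bas i) k)"
  have Ac: "A \<in> carrier_mat p p" by (simp add: A_def)
  define C where "C = char_poly A"
  have CQ: "C \<in> pol Q" unfolding C_def
    by (rule char_poly_in[OF Qr Ac]) (use cvecD(1)[OF mul_in[OF w(1) bV, unfolded V_def]] in \<open>simp add: A_def\<close>)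
  have dC: "degree C = p" "coeff C p = 1" using degree_monic_char_poly[OF Ac] by (auto simp: C_def)
  then have C0: "C \<noteq> 0" by auto
  define W where "W i = (mul w ^^ i) u" for i
  have WV: "W i \<in> V" for i unfolding W_def by (induction i) (auto intro: u mul_in w)
  note Vc = cvecD[where Q = Q and m = p, folded V_def]
  note Wc = Vc[OF WV]
  have Wmul: "mul (W i) x = (mul w ^^ i) x" if x: "x \<in> V" for i x
  proof (induction i)
    case 0
    then show ?case using u(2)[OF x] by (simp add: W_def)
  next
    case (Suc i)
    then show ?case using assoc[OF w(1) WV x, of i] by (simp add: W_def)
  qed
  define G where "G g k = (\<Sum>i\<le>p. coeff g i * W i k)" for g k
  have GV: "G g \<in> V" if "g \<in> pol Q" for g
    unfolding V_def G_def by (intro cvecI sring_sum[OF Qr] QD(4) polD[OF that]) (auto simp: Wc)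
  define func where "func \<theta> Y \<longleftrightarrow> (\<exists>k<p. Y k \<noteq> 0) \<and> (\<forall>x. (\<Sum>k<p. mul w x k * Y k) = \<theta> * (\<Sum>k<p. x k * Y k))" for \<theta> Y
  have func_ex: "\<exists>Y. func \<theta> Y" if "poly C \<theta> = 0" for \<theta>
    unfolding func_def mul_def by (rule left_eigenfunctional) (use that in \<open>auto simp: C_def A_def mul_def\<close>)
  define ph where "ph Y x = (\<Sum>k<p. x k * Y k)" for Y x :: "nat \<Rightarrow> complex"
  have ph_bas: "ph Y (bas k) = Y k" if "k < p" for k Y
  proof -
    have "ph Y (bas k) = (\<Sum>j<p. if j = k then Y j else 0)" unfolding ph_def by (intro sum.cong) (auto simp: bas_def)
    then show ?thesis using that by simp
  qed
  have ph_lin: "ph Y (\<lambda>k. \<Sum>i\<in>I. a i * E i k) = (\<Sum>i\<in>I. a i * ph Y (E i))" for Y a E and I :: "nat set"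
    unfolding ph_def by (simp add: sum_distrib_right sum_distrib_left sum.swap[of _ I] mult.assoc)
  have ph_G: "ph Y (mul (G g) x) = poly g \<theta> * ph Y x" if Y: "func \<theta> Y" and g: "degree g \<le> p" and x: "x \<in> V" for Y \<theta> g x
  proof -
    have "ph Y ((mul w ^^ i) x) = \<theta> ^ i * ph Y x" for i
      by (induction i) (use Y in \<open>auto simp: func_def ph_def\<close>)
    then have "ph Y (mul (G g) x) = (\<Sum>i\<le>p. coeff g i * (\<theta> ^ i * ph Y x))"
      unfolding G_def mul_def cmul_lin1 ph_lin using Wmul[OF x] by (simp add: mul_def)
    then show ?thesis by (simp add: poly_bound[OF g] sum_distrib_right mult.assoc)
  qed
  obtain \<theta>\<^sub>0 where \<theta>\<^sub>0: "poly C \<theta>\<^sub>0 = 0"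
    using fundamental_theorem_of_algebra constant_degree dC(1) p1 by (metis not_less_zero)
  obtain f where f: "irr Q f" "lead_coeff f = 1" "poly f \<theta>\<^sub>0 = 0" using exists_minpoly[OF Q CQ C0 \<theta>\<^sub>0] by blast
  note fQ = irrD(1)[OF f(1)]
  have fC: "f dvd C" by (rule irr_dvd[OF Q f(1) CQ f(3) \<theta>\<^sub>0])
  have df: "degree f \<le> p" using dvd_imp_degree_le[OF fC C0] dC(1) by simp
  have 0: "mul (\<lambda>_. 0) x = (\<lambda>_. 0)" "ph Y (\<lambda>_. 0) = 0" for x Y
    by (auto simp: mul_def cmul_def ph_def)
  \<comment> \<open>Otherwise the element \<open>f(w)\<close> would be invertible, and the
    functional for \<open>\<theta>\<^sub>0\<close>, which it multiplies by
    \<open>f(\<theta>\<^sub>0) = 0\<close>, would vanish identically.\<close>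
  have Gf: "G f = (\<lambda>_. 0)"
  proof (rule ccontr)
    assume "G f \<noteq> (\<lambda>_. 0)"
    then obtain y where y: "y \<in> V" "mul (G f) y = u" using inv[OF GV[OF fQ]] by blast
    obtain Y where Y: "func \<theta>\<^sub>0 Y" using func_ex[OF \<theta>\<^sub>0] by blast
    have "ph Y x = 0" if x: "x \<in> V" for x
      using ph_G[OF Y df mul_in[OF y(1) x]] assoc[OF GV[OF fQ] y(1) x] y(2) u(2)[OF x] f(3) by simp
    then have "Y k = 0" if "k < p" for k using ph_bas bV that by metis
    then show False using Y unfolding func_def by blast
  qed
  have root_f: "poly g \<theta> = 0" if g: "G g = (\<lambda>_. 0)" "degree g \<le> p" and r: "poly C \<theta> = 0" for g \<theta>
  proof -
    obtain Y where Y: "func \<theta> Y" using func_ex[OF r] by blast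
    then obtain k where k: "k < p" "Y k \<noteq> 0" unfolding func_def by blast
    show ?thesis using ph_G[OF Y g(2) bV[OF k(1)]] k by (simp add: g(1) 0 ph_bas)
  qed
  \<comment> \<open>As \<open>f(w) = 0\<close>, every root of the characteristic polynomial
    \<open>C\<close> is a root of \<open>f\<close>, so \<open>C\<close> is a power of
    \<open>f\<close>. Its degree is prime, and degree one for \<open>f\<close> would make
    \<open>w\<close> a scalar.\<close>
  have "degree f dvd degree C"
    by (rule irr_power_degree[OF Q f(1) CQ C0]) (rule root_f[OF Gf df])
  then consider "degree f = 1" | "degree f = p" using p dC(1) unfolding prime_nat_iff by auto
  then have degf: "degree f = p"
  proof cases
    case 1
    have "G f k = coeff f 0 * u k + w k" for k
    proof -
      have "G f k = (\<Sum>i\<in>{0, 1}. coeff f i * W i k)"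
        unfolding G_def using p1 1 by (intro sum.mono_neutral_right) (auto simp: coeff_eq_0)
      moreover have "W 1 = w" using comm[OF w(1) u(1)] u(2)[OF w(1)] by (simp add: W_def)
      ultimately show ?thesis using f(2) 1 by (simp add: W_def)
    qed
    then have "w k = - coeff f 0 * u k" for k using Gf by (metis add_eq_0_iff mult_minus_left)
    then have "w = (\<lambda>k. - coeff f 0 * u k)" by blast
    then show ?thesis using w(2)[OF QD(5)[OF polD[OF fQ]]] by blast
  qed
  have f0: "f \<noteq> 0" by (rule irrD(3)[OF f(1)])
  \<comment> \<open>The first \<open>p\<close> powers of \<open>w\<close> are independent because
    \<open>f\<close> has degree \<open>p\<close>; hence they span.\<close>
  have gen: "\<exists>g\<in>pol Q. degree g \<le> p \<and> x = G g" if x: "x \<in> V" for x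
  proof -
    define E where "E i = (if i < p then W i else x)" for i
    have XQ: "E i k \<in> Q" if "i \<le> p" "k < p" for i k using Wc Vc[OF x] that by (auto simp: E_def)
    obtain a where a: "\<And>i. i \<le> p \<Longrightarrow> a i \<in> Q" "\<exists>i\<le>p. a i \<noteq> 0" "\<And>k. k < p \<Longrightarrow> (\<Sum>i\<le>p. a i * E i k) = 0"
      using dependent_vectors[OF Q, of p E] XQ by blast
    define g where "g b = (\<Sum>i<p. monom (b i) i)" for b :: "nat \<Rightarrow> complex"
    have gc: "coeff (g b) i = (if i < p then b i else 0)" for b i unfolding g_def by (simp add: coeff_sum)
    have dg: "degree (g b) < p" for b
      by (rule le_less_trans[OF degree_le[of "p - 1"]]) (use p1 in \<open>auto simp: gc\<close>)
    have Gg: "G (g b) k = (\<Sum>i<p. b i * W i k)" for b k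
      unfolding G_def by (simp add: gc lessThan_Suc_atMost[symmetric])
    have rel: "(\<Sum>i<p. a i * W i k) + a p * x k = 0" for k
    proof (cases "k < p")
      case True
      then show ?thesis using a(3)[OF True] by (simp add: E_def lessThan_Suc_atMost[symmetric])
    next
      case False
      then show ?thesis using Wc Vc[OF x] by simp
    qed
    have "a p \<noteq> 0"
    proof
      assume ap: "a p = 0"
      have gQ: "g a \<in> pol Q" using a(1) QD(1) by (auto simp: pol_def gc)
      have "G (g a) = (\<lambda>_. 0)" using rel ap by (intro ext) (simp add: Gg)
      then have "poly (g a) \<theta>\<^sub>0 = 0" using root_f[OF _ _ \<theta>\<^sub>0] dg less_imp_le by blast
      then have "f dvd g a" by (rule irr_dvd[OF Q f(1) gQ f(3)])
      then have "g a = 0" using dvd_imp_degree_le dg degf by (metis leD)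
      then have "a i = 0" if "i < p" for i using gc[of a i] that by simp
      then show False using a(2) ap by (metis le_neq_implies_less)
    qed
    have "x k = (\<Sum>i<p. (- a i / a p) * W i k)" for k
    proof -
      have "(\<Sum>i<p. (- a i / a p) * W i k) = - (\<Sum>i<p. a i * W i k) / a p"
        by (simp add: sum_divide_distrib sum_negf)
      also have "- (\<Sum>i<p. a i * W i k) = a p * x k" using rel[of k] by (simp add: minus_unique)
      finally show ?thesis using \<open>a p \<noteq> 0\<close> by simp
    qed
    then have "x = G (g (\<lambda>i. - a i / a p))" by (intro ext) (simp only: Gg)
    moreover have "g (\<lambda>i. - a i / a p) \<in> pol Q" using a(1) QD(1,5) sfieldD(9)[OF Q] by (auto simp: pol_def gc)
    ultimately show ?thesis using dg less_imp_le by blast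
  qed
  have "\<exists>\<phi>. (\<forall>x\<in>V. \<phi> x \<in> adj Q \<theta>) \<and> \<phi> u = 1 \<and>
      (\<forall>x\<in>V. \<forall>y\<in>V. \<phi> (\<lambda>k. x k + y k) = \<phi> x + \<phi> y \<and> \<phi> (mul x y) = \<phi> x * \<phi> y) \<and>
      (\<forall>a\<in>Q. \<forall>x\<in>V. \<phi> (\<lambda>k. a * x k) = a * \<phi> x)" if r: "poly f \<theta> = 0" for \<theta>
  proof -
    have "poly C \<theta> = 0" using fC r by (metis dvd_def poly_mult mult_zero_left)
    then obtain Y where Y: "func \<theta> Y" using func_ex by blast
    have G: "\<exists>g\<in>pol Q. degree g \<le> p \<and> x = G g \<and> ph Y x = poly g \<theta> * ph Y u" if x: "x \<in> V" for x
    proof -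
      obtain g where g: "g \<in> pol Q" "degree g \<le> p" "x = G g" using gen[OF x] by blast
      have "ph Y x = poly g \<theta> * ph Y u" using ph_G[OF Y g(2) u(1)] comm[OF x u(1)] u(2)[OF x] g(3) by simp
      then show ?thesis using g by blast
    qed
    have nz: "ph Y u \<noteq> 0"
    proof
      assume "ph Y u = 0"
      then have "ph Y x = 0" if "x \<in> V" for x using G[OF that] by auto
      then have "Y k = 0" if "k < p" for k using ph_bas bV that by metis
      then show False using Y unfolding func_def by blast
    qed
    \<comment> \<open>The functional is scaled to the value \<open>1\<close> at the unit. It is
      multiplicative since each \<open>x\<close> is a polynomial in \<open>w\<close>, on which it is
      evaluation at \<open>\<theta>\<close>.\<close>
    define \<phi> where "\<phi> x = ph Y x / ph Y u" for x
    have "\<phi> x \<in> adj Q \<theta>" "\<phi> (mul x y) = \<phi> x * \<phi> y" if x: "x \<in> V" and y: "y \<in> V" for x y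
    proof -
      obtain g where g: "g \<in> pol Q" "degree g \<le> p" "x = G g" "ph Y x = poly g \<theta> * ph Y u" using G[OF x] by blast
      have gx: "\<phi> x = poly g \<theta>" unfolding \<phi>_def g(4) using nz by simp
      then show "\<phi> x \<in> adj Q \<theta>" unfolding adj_def using g(1) by blast
      show "\<phi> (mul x y) = \<phi> x * \<phi> y" unfolding gx using ph_G[OF Y g(2) y] by (simp add: \<phi>_def g(3))
    qed
    moreover have "\<phi> (\<lambda>k. x k + y k) = \<phi> x + \<phi> y" "\<phi> (\<lambda>k. a * x k) = a * \<phi> x" for x y a
      unfolding \<phi>_def ph_def by (simp_all add: distrib_right sum.distrib add_divide_distrib sum_distrib_left mult.assoc)
    moreover have "\<phi> u = 1" unfolding \<phi>_def using nz by simp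
    ultimately show ?thesis using u(1) by blast
  qed
  then show ?thesis using f degf by blast
qed

section \<open>Structure constants\<close>

text \<open>The basis \<open>v\<^sup>i y\<^sup>j\<close> over \<open>K\<close> is numbered by \<open>i + p * j\<close>.\<close>
definition theta :: "nat \<Rightarrow> complex \<Rightarrow> (nat \<Rightarrow> complex) \<Rightarrow> complex poly" where
  "theta p v x = (\<Sum>j<p. monom (\<Sum>i<p. x (i + p * j) * v ^ i) j)"

lemma theta_lin: "theta p v (\<lambda>k. \<Sum>i\<in>I. a i * f i k) = (\<Sum>i\<in>I. smult (a i) (theta p v (f i)))"
proof (rule poly_eqI)
  fix n
  show "coeff (theta p v (\<lambda>k. \<Sum>i\<in>I. a i * f i k)) n = coeff (\<Sum>i\<in>I. smult (a i) (theta p v (f i))) n"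
    unfolding theta_def
    by (simp add: coeff_sum sum_distrib_right sum_distrib_left sum.swap[of _ I] mult.assoc)
qed

lemma theta_smult: "theta p v (\<lambda>k. a * x k) = smult a (theta p v x)"
  using theta_lin[of p v "\<lambda>_. a" "\<lambda>_. x" "{0::nat}"] by simp

lemma theta_add: "theta p v (\<lambda>k. x k + y k) = theta p v x + theta p v y"
  using theta_lin[of p v "\<lambda>_. 1" "\<lambda>i. if i = 0 then x else y" "{0::nat, 1}"] by simp

context csz
begin

text \<open>Coordinates by traces: \<open>b i\<close> is the trace of \<open>z * v^(-i)\<close>, and
  summing \<open>b i * v ^ i\<close> over \<open>i\<close> gives \<open>p * z\<close> by
  orthogonality of the roots of unity.\<close>

lemma K_basis_exists:
  assumes z: "z \<in> M"
  shows "\<exists>a. (\<forall>i<p. a i \<in> K) \<and> z = (\<Sum>i<p. a i * v ^ i)"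
proof -
  define y where "y i = z * inverse v ^ i" for i
  have ivM: "inverse v ^ i \<in> M" for i by (intro sring_power[OF Mr] sfieldD(8)[OF MF] v)
  have yM: "y i \<in> M" for i unfolding y_def by (intro sfieldD(5)[OF MF] z ivM)
  have ykM: "(s ^^ k) (y i) \<in> M" for k i using funpow_in[of M s, OF sM yM] .
  define b where "b i = (\<Sum>k<p. (s ^^ k) (y i))" for i
  have bM: "b i \<in> M" for i unfolding b_def by (intro sring_sum[OF Mr] ykM)
  have sb: "s (b i) = b i" for i
  proof -
    have "s (b i) = (\<Sum>k<p. (s ^^ Suc k) (y i))"
      unfolding b_def by (subst shom_sum[OF sh Mr]) (auto intro: ykM)
    also have "\<dots> = b i + (s ^^ p) (y i) - (s ^^ 0) (y i)"
      using sum.lessThan_Suc[of "\<lambda>k. (s ^^ k) (y i)" p] sum.lessThan_Suc_shift[of "\<lambda>k. (s ^^ k) (y i)" p]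
      unfolding b_def by simp
    finally show ?thesis using sp[OF yM] by simp
  qed
  then have bK: "b i \<in> K" for i using bM by (simp add: fixK_def)
  have h: "shom M (s ^^ k)" for k by (rule funpow_shom[OF sh sM])
  have "(s ^^ k) (y i) * v ^ i = (s ^^ k) z * (inverse \<zeta> ^ i) ^ k" for k i
  proof -
    have "(s ^^ k) (y i) = (s ^^ k) z * inverse ((s ^^ k) v) ^ i"
      unfolding y_def using shomD(3)[OF h z ivM] shom_power[OF h Mr] shom_inverse[OF h MF v(1)] sfieldD(8)[OF MF v(1)] by simp
    also have "inverse ((s ^^ k) v) ^ i = (inverse \<zeta> ^ i) ^ k * inverse v ^ i"
      unfolding sv by (simp add: power_mult_distrib power_mult[symmetric] power_inverse[symmetric] mult.commute)
    finally show ?thesis using v(2) by (simp add: power_inverse)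
  qed
  then have "(\<Sum>i<p. b i * v ^ i) = (\<Sum>i<p. \<Sum>k<p. (s ^^ k) z * (inverse \<zeta> ^ i) ^ k)"
    unfolding b_def by (simp add: sum_distrib_right)
  also have "\<dots> = (\<Sum>k<p. (s ^^ k) z * (\<Sum>i<p. (inverse \<zeta> ^ i) ^ k))"
    by (subst sum.swap) (simp add: sum_distrib_left)
  also have "\<dots> = (\<Sum>k<p. if k = 0 then z * of_nat p else 0)"
    using root_of_unity_sum by (intro sum.cong refl) auto
  also have "\<dots> = z * of_nat p" using p0 by simp
  finally have eq: "(\<Sum>i<p. b i * v ^ i) = z * of_nat p" .
  have "(\<Sum>i<p. b i / of_nat p * v ^ i) = z"
    using eq p0 by (simp add: sum_divide_distrib[symmetric] field_simps)
  moreover have "b i / of_nat p \<in> K" for i by (intro sfieldD(9)[OF KF] bK sring_of_nat[OF Kr])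
  ultimately show ?thesis by (intro exI[of _ "\<lambda>i. b i / of_nat p"]) auto
qed

text \<open>A relation is a polynomial of degree below \<open>p\<close> over \<open>K\<close> that
  vanishes at the \<open>p\<close> distinct conjugates of \<open>v\<close>.\<close>

lemma K_basis_unique:
  assumes a: "\<And>i. i < p \<Longrightarrow> a i \<in> K" and z: "(\<Sum>i<p. a i * v ^ i) = 0" and i: "i < p"
  shows "a i = 0"
proof (rule ccontr)
  assume nz: "a i \<noteq> 0"
  define P where "P = (\<Sum>i<p. monom (a i) i)"
  have Pc: "coeff P n = (if n < p then a n else 0)" for n unfolding P_def by (rule coeff_sum_monom)
  have P0: "P \<noteq> 0" using Pc[of i] nz i by auto
  have d: "degree P < p"
    by (rule le_less_trans[OF degree_le[of "p - 1"]]) (use p0 in \<open>auto simp: Pc\<close>)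
  have h: "shom M (s ^^ k)" for k by (rule funpow_shom[OF sh sM])
  have vM: "v ^ n \<in> M" for n by (rule sring_power[OF Mr v(1)])
  have "poly P (\<zeta> ^ k * v) = 0" for k
  proof -
    have "0 = (s ^^ k) (\<Sum>i<p. a i * v ^ i)" unfolding z using shom_0[OF h Mr] by simp
    also have "\<dots> = (\<Sum>i<p. a i * (\<zeta> ^ k * v) ^ i)"
      using a vM funpow_fix[of s] Ks KM
      by (subst shom_sum[OF h Mr]) (auto intro!: sum.cong sfieldD(5)[OF MF] simp: shomD(3)[OF h] shom_power[OF h Mr v(1)] sv)
    also have "\<dots> = poly P (\<zeta> ^ k * v)" by (simp add: P_def poly_sum poly_monom)
    finally show ?thesis ..
  qed
  then have "(\<lambda>k. \<zeta> ^ k * v) ` {..<p} \<subseteq> {x. poly P x = 0}" by blast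
  then have "card ((\<lambda>k. \<zeta> ^ k * v) ` {..<p}) \<le> card {x. poly P x = 0}"
    by (intro card_mono poly_roots_finite P0)
  moreover have "card ((\<lambda>k. \<zeta> ^ k * v) ` {..<p}) = p"
    using v(2) zeta_inj by (subst card_image) (auto simp: inj_on_def)
  moreover have "card {x. poly P x = 0} \<le> degree P" using P0 by (rule card_poly_roots_bound)
  ultimately show False using d by linarith
qed

lemma index_less: "i < p \<Longrightarrow> j < p \<Longrightarrow> i + p * j < p ^ 2"
proof -
  assume "i < p" "j < p"
  then have "i + p * j < p * Suc j" "p * Suc j \<le> p * p" by (simp, intro mult_le_mono) auto
  then show ?thesis by (simp add: power2_eq_square)
qed

lemma theta_in: "x \<in> cvec K (p ^ 2) \<Longrightarrow> theta p v x \<in> D"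
  unfolding theta_def
  by (intro D_sum D_monom sring_sum[OF Mr] sfieldD(5)[OF MF] sring_power[OF Mr v(1)] KM cvecD(1)) (auto intro: index_less)

lemma coeff_theta: "j < p \<Longrightarrow> coeff (theta p v x) j = (\<Sum>i<p. x (i + p * j) * v ^ i)"
  unfolding theta_def by (simp add: coeff_sum_monom)

lemma theta_bij: "bij_betw (theta p v) (cvec K (p ^ 2)) D"
  unfolding bij_betw_def
proof
  show "inj_on (theta p v) (cvec K (p ^ 2))"
  proof (rule inj_onI, rule ext)
    fix x y k
    assume x: "x \<in> cvec K (p ^ 2)" and y: "y \<in> cvec K (p ^ 2)" and eq: "theta p v x = theta p v y"
    show "x k = y k"
    proof (cases "k < p ^ 2")
      case True
      define i j where "i = k mod p" and "j = k div p"
      have ij: "i < p" "j < p" "k = i + p * j"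
        using True p0 by (auto simp: i_def j_def power2_eq_square less_mult_imp_div_less)
      have "(\<Sum>i<p. (x (i + p * j) - y (i + p * j)) * v ^ i) = 0"
        using coeff_theta[OF ij(2), of x] coeff_theta[OF ij(2), of y] eq by (simp add: left_diff_distrib sum_subtractf)
      then have "x (i + p * j) - y (i + p * j) = 0"
        using ij by (intro K_basis_unique[of "\<lambda>i. x (i + p * j) - y (i + p * j)"] sfieldD(7)[OF KF] cvecD(1)[OF x] cvecD(1)[OF y] index_less)
      then show ?thesis using ij(3) by simp
    next
      case False
      then show ?thesis using cvecD(2)[OF x] cvecD(2)[OF y] by simp
    qed
  qed
  show "theta p v ` cvec K (p ^ 2) = D"
  proof
    show "theta p v ` cvec K (p ^ 2) \<subseteq> D" using theta_in by blast
    show "D \<subseteq> theta p v ` cvec K (p ^ 2)"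
    proof
      fix d assume d: "d \<in> D"
      have "\<forall>j. \<exists>a. (\<forall>i<p. a i \<in> K) \<and> coeff d j = (\<Sum>i<p. a i * v ^ i)"
        using K_basis_exists DD(1)[OF d] by blast
      then obtain a where a: "\<And>i j. i < p \<Longrightarrow> a j i \<in> K" "\<And>j. coeff d j = (\<Sum>i<p. a j i * v ^ i)" by metis
      define x where "x k = (if k < p ^ 2 then a (k div p) (k mod p) else 0)" for k
      have x: "x \<in> cvec K (p ^ 2)" unfolding x_def using a(1) p0 by (intro cvecI) auto
      have "theta p v x = d"
      proof (rule D_eqI[OF theta_in[OF x] d])
        fix j assume j: "j < p"
        have "x (i + p * j) = a j i" if "i < p" for i using that index_less[OF that j] p0 by (simp add: x_def)
        then show "coeff (theta p v x) j = coeff d j" by (simp add: coeff_theta[OF j] a(2))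
      qed
      then show "d \<in> theta p v ` cvec K (p ^ 2)" using x by blast
    qed
  qed
qed

definition con :: "nat \<Rightarrow> nat \<Rightarrow> nat \<Rightarrow> complex" where
  "con a b = the_inv_into (cvec K (p ^ 2)) (theta p v) (dmul (theta p v (bas a)) (theta p v (bas b)))"

lemma bas_in: "i < p ^ 2 \<Longrightarrow> bas i \<in> cvec K (p ^ 2)"
  using sfieldD(2,3)[OF KF] by (intro cvecI) (auto simp: bas_def)

lemma con:
  assumes "a < p ^ 2" "b < p ^ 2"
  shows "con a b \<in> cvec K (p ^ 2)" "theta p v (con a b) = dmul (theta p v (bas a)) (theta p v (bas b))"
proof -
  have d: "dmul (theta p v (bas a)) (theta p v (bas b)) \<in> theta p v ` cvec K (p ^ 2)"
    using theta_bij assms by (auto simp: bij_betw_def intro: dm_in theta_in bas_in)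
  note inj = bij_betw_imp_inj_on[OF theta_bij]
  show "con a b \<in> cvec K (p ^ 2)" unfolding con_def by (rule the_inv_into_into[OF inj d order_refl])
  show "theta p v (con a b) = dmul (theta p v (bas a)) (theta p v (bas b))"
    unfolding con_def by (rule f_the_inv_into_f[OF inj d])
qed

lemma theta_mul:
  assumes x: "x \<in> cvec K (p ^ 2)" and y: "y \<in> cvec K (p ^ 2)"
  shows "theta p v (cmul (p ^ 2) con x y) = dmul (theta p v x) (theta p v y)"
proof -
  let ?m = "p ^ 2" and ?t = "theta p v"
  have ex: "?t x = (\<Sum>a<?m. smult (x a) (?t (bas a)))" if x: "x \<in> cvec K ?m" for x
  proof -
    have "x k = (\<Sum>a<?m. x a * bas a k)" for k
    proof -
      have "(\<Sum>a<?m. x a * bas a k) = (\<Sum>a<?m. if a = k then x a else 0)" by (intro sum.cong) (auto simp: bas_def)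
      then show ?thesis using cvecD(2)[OF x, of k] by simp
    qed
    then have "x = (\<lambda>k. \<Sum>a<?m. x a * bas a k)" by blast
    then show ?thesis using theta_lin[of p v x bas "{..<?m}"] by simp
  qed
  have "cmul ?m con x y k = (\<Sum>a<?m. 1 * (\<Sum>b<?m. (x a * y b) * con a b k))" for k
  proof (cases "k < ?m")
    case False
    then have "con a b k = 0" if "a < ?m" "b < ?m" for a b using cvecD(2)[OF con(1)[OF that], of k] by simp
    then show ?thesis using False by (simp add: cmul_def)
  qed (simp add: cmul_def)
  then have eq: "cmul ?m con x y = (\<lambda>k. \<Sum>a<?m. 1 * (\<Sum>b<?m. (x a * y b) * con a b k))" by blast
  have "?t (cmul ?m con x y) = (\<Sum>a<?m. smult 1 (?t (\<lambda>k. \<Sum>b<?m. (x a * y b) * con a b k)))"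
    unfolding eq by (rule theta_lin)
  also have "\<dots> = (\<Sum>a<?m. \<Sum>b<?m. smult (x a * y b) (?t (con a b)))" by (simp only: theta_lin smult_1_left)
  also have "\<dots> = (\<Sum>a<?m. smult (x a) (\<Sum>b<?m. smult (y b) (dmul (?t (bas a)) (?t (bas b)))))"
    by (simp add: con(2) smult_sum2)
  also have "\<dots> = (\<Sum>a<?m. smult (x a) (dmul (?t (bas a)) (?t y)))"
    unfolding ex[OF y] by (subst dm_lin2) (auto intro: cvecD(1)[OF y] theta_in bas_in)
  also have "\<dots> = dmul (?t x) (?t y)" unfolding ex[OF x] by (rule dm_lin1[symmetric])
  finally show ?thesis .
qed

end

section \<open>Transfer to abstract fields\<close>

text \<open>The ring laws are pulled back along a bijection onto a set in a type with its own
  addition, while the product \<open>m\<close> is arbitrary. Used for the abstract field, with the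
  complex product, and for the algebra, with \<open>dmul\<close>.\<close>

lemma ring_transfer:
  fixes A :: "('a, 'c) ring_scheme" and h :: "'a \<Rightarrow> 'b::ab_group_add"
  assumes h: "bij_betw h (carrier A) B"
    and z: "\<zero>\<^bsub>A\<^esub> \<in> carrier A" "h \<zero>\<^bsub>A\<^esub> = 0"
    and o: "\<one>\<^bsub>A\<^esub> \<in> carrier A" "h \<one>\<^bsub>A\<^esub> = e"
    and add: "\<And>x y. x \<in> carrier A \<Longrightarrow> y \<in> carrier A \<Longrightarrow> x \<oplus>\<^bsub>A\<^esub> y \<in> carrier A \<and> h (x \<oplus>\<^bsub>A\<^esub> y) = h x + h y"
    and mult: "\<And>x y. x \<in> carrier A \<Longrightarrow> y \<in> carrier A \<Longrightarrow> x \<otimes>\<^bsub>A\<^esub> y \<in> carrier A \<and> h (x \<otimes>\<^bsub>A\<^esub> y) = m (h x) (h y)"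
    and neg: "\<And>x. x \<in> B \<Longrightarrow> - x \<in> B"
    and assoc: "\<And>x y z. x \<in> B \<Longrightarrow> y \<in> B \<Longrightarrow> z \<in> B \<Longrightarrow> m (m x y) z = m x (m y z)"
    and distr: "\<And>x y z. x \<in> B \<Longrightarrow> y \<in> B \<Longrightarrow> z \<in> B \<Longrightarrow> m (x + y) z = m x z + m y z"
      "\<And>x y z. x \<in> B \<Longrightarrow> y \<in> B \<Longrightarrow> z \<in> B \<Longrightarrow> m x (y + z) = m x y + m x z"
    and unit: "\<And>x. x \<in> B \<Longrightarrow> m e x = x" "\<And>x. x \<in> B \<Longrightarrow> m x e = x"
  shows "ring A"
proof -
  note a = add[THEN conjunct1] add[THEN conjunct2] and mu = mult[THEN conjunct1] mult[THEN conjunct2]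
  have hB: "h x \<in> B" if "x \<in> carrier A" for x using bij_betwE[OF h] that by blast
  have eqI: "x = y" if "x \<in> carrier A" "y \<in> carrier A" "h x = h y" for x y
    using inj_onD[OF bij_betw_imp_inj_on[OF h] that(3,1,2)] .
  have inv: "\<exists>y\<in>carrier A. y \<oplus>\<^bsub>A\<^esub> x = \<zero>\<^bsub>A\<^esub>" if x: "x \<in> carrier A" for x
  proof -
    obtain y where y: "y \<in> carrier A" "h y = - h x" using neg[OF hB[OF x]] h unfolding bij_betw_def by (metis imageE)
    have "y \<oplus>\<^bsub>A\<^esub> x = \<zero>\<^bsub>A\<^esub>" by (rule eqI) (simp_all add: a x y z)
    then show ?thesis using y by blast
  qed
  have "abelian_group A"
    by (rule abelian_groupI) (auto intro!: eqI a(1) inv z(1) simp: a z add.commute add.assoc)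
  moreover have "monoid A"
    by (rule monoidI) (auto intro!: eqI mu(1) o(1) simp: mu o assoc unit hB)
  ultimately show ?thesis
    by (rule ringI) (auto intro!: eqI mu(1) a(1) simp: mu a distr hB)
qed

locale coords =
  fixes R :: "'r ring" and \<iota> :: "'r \<Rightarrow> complex" and Q :: "complex set"
  assumes Rf: "field R" and bij: "bij_betw \<iota> (carrier R) Q"
    and add: "\<And>x y. x \<in> carrier R \<Longrightarrow> y \<in> carrier R \<Longrightarrow> \<iota> (x \<oplus>\<^bsub>R\<^esub> y) = \<iota> x + \<iota> y"
    and mult: "\<And>x y. x \<in> carrier R \<Longrightarrow> y \<in> carrier R \<Longrightarrow> \<iota> (x \<otimes>\<^bsub>R\<^esub> y) = \<iota> x * \<iota> y"
    and zero: "\<iota> \<zero>\<^bsub>R\<^esub> = 0" and one: "\<iota> \<one>\<^bsub>R\<^esub> = 1"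

lemma coords_exist:
  assumes Q: "sfield Q" and ct: "countable Q"
  shows "\<exists>(R :: nat set set ring) \<iota>. coords R \<iota> Q"
proof -
  \<comment> \<open>The theorem asks for a carrier of type \<open>nat set set\<close>. A countable
    field is numbered and each number wrapped in two singletons.\<close>
  define g :: "complex \<Rightarrow> nat set set" where "g z = {{to_nat_on Q z}}" for z
  have gi: "inj_on g Q" using inj_on_to_nat_on[OF ct] by (auto simp: g_def inj_on_def)
  define \<iota> where "\<iota> = the_inv_into Q g"
  have \<iota>g: "\<iota> (g z) = z" if "z \<in> Q" for z unfolding \<iota>_def using the_inv_into_f_f[OF gi that] .
  define R :: "nat set set ring" where
    "R = \<lparr>carrier = g ` Q, monoid.mult = (\<lambda>x y. g (\<iota> x * \<iota> y)), monoid.one = g 1,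
          ring.zero = g 0, ring.add = (\<lambda>x y. g (\<iota> x + \<iota> y))\<rparr>"
  note QD = sfieldD[OF Q]
  have bij: "bij_betw \<iota> (carrier R) Q"
    unfolding \<iota>_def R_def by (simp add: bij_betw_the_inv_into[OF inj_on_imp_bij_betw[OF gi]])
  have cl: "x \<in> carrier R \<Longrightarrow> \<iota> x \<in> Q" for x using bij_betwE[OF bij] by blast
  have add: "x \<oplus>\<^bsub>R\<^esub> y \<in> carrier R \<and> \<iota> (x \<oplus>\<^bsub>R\<^esub> y) = \<iota> x + \<iota> y" if "x \<in> carrier R" "y \<in> carrier R" for x y
    using QD(4)[OF cl[OF that(1)] cl[OF that(2)]] \<iota>g by (simp add: R_def)
  have mult: "x \<otimes>\<^bsub>R\<^esub> y \<in> carrier R \<and> \<iota> (x \<otimes>\<^bsub>R\<^esub> y) = \<iota> x * \<iota> y" if "x \<in> carrier R" "y \<in> carrier R" for x y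
    using QD(5)[OF cl[OF that(1)] cl[OF that(2)]] \<iota>g by (simp add: R_def)
  have zo: "\<zero>\<^bsub>R\<^esub> \<in> carrier R" "\<iota> \<zero>\<^bsub>R\<^esub> = 0" "\<one>\<^bsub>R\<^esub> \<in> carrier R" "\<iota> \<one>\<^bsub>R\<^esub> = 1"
    using QD(2,3) \<iota>g by (simp_all add: R_def)
  have "ring R"
    by (rule ring_transfer[where h = \<iota> and m = "(*)", OF bij zo add mult]) (auto intro: QD simp: algebra_simps)
  then interpret ring R .
  have comm: "x \<otimes>\<^bsub>R\<^esub> y = y \<otimes>\<^bsub>R\<^esub> x" for x y by (simp add: R_def mult.commute)
  have "comm_monoid R" by (rule comm_monoidI) (simp add: m_assoc | rule comm)+
  then have "cring R" by (intro cringI is_abelian_group l_distr)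
  then interpret cring R .
  have "field R"
  proof (rule cring_fieldI2)
    show "\<zero>\<^bsub>R\<^esub> \<noteq> \<one>\<^bsub>R\<^esub>" using zo(2,4) by (metis zero_neq_one)
    fix x assume x: "x \<in> carrier R" "x \<noteq> \<zero>\<^bsub>R\<^esub>"
    then have nz: "\<iota> x \<noteq> 0" using inj_onD[OF bij_betw_imp_inj_on[OF bij]] zo by metis
    obtain y where y: "y \<in> carrier R" "\<iota> y = inverse (\<iota> x)" using QD(8)[OF cl[OF x(1)]] bij unfolding bij_betw_def by (metis imageE)
    have "x \<otimes>\<^bsub>R\<^esub> y = \<one>\<^bsub>R\<^esub>"
      by (rule inj_onD[OF bij_betw_imp_inj_on[OF bij]]) (use mult[OF x(1) y(1)] y(2) nz zo in auto)
    then show "\<exists>y\<in>carrier R. x \<otimes>\<^bsub>R\<^esub> y = \<one>\<^bsub>R\<^esub>" using y(1) by blast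
  qed
  then have "coords R \<iota> Q" unfolding coords_def using bij add mult zo by blast
  then show ?thesis by blast
qed

section \<open>Vectors over the abstract field in complex coordinates\<close>

context coords
begin

sublocale R: field R
  by (rule Rf)

lemma cl: "x \<in> carrier R \<Longrightarrow> \<iota> x \<in> Q"
  using bij_betwE[OF bij] by blast

lemma iota_eqI: "x \<in> carrier R \<Longrightarrow> y \<in> carrier R \<Longrightarrow> \<iota> x = \<iota> y \<Longrightarrow> x = y"
  using bij by (auto simp: bij_betw_def inj_on_def)

definition io where "io = inv_into (carrier R) \<iota>"

lemma io: "z \<in> Q \<Longrightarrow> io z \<in> carrier R \<and> \<iota> (io z) = z"
  unfolding io_def using bij by (metis bij_betw_def f_inv_into_f inv_into_into)

lemma iota_finsum:
  assumes "finite I" "\<And>i. i \<in> I \<Longrightarrow> f i \<in> carrier R"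
  shows "\<iota> (finsum R f I) = (\<Sum>i\<in>I. \<iota> (f i))"
  using assms
proof (induction I rule: finite_induct)
  case (insert x F)
  then have f: "f \<in> F \<rightarrow> carrier R" "f x \<in> carrier R" by auto
  show ?case using insert R.finsum_insert[OF insert(1,2) f] add[OF f(2) R.finsum_closed[OF f(1)]] by simp
qed (simp add: zero)

definition co :: "(nat \<Rightarrow> 'r) \<Rightarrow> nat \<Rightarrow> complex" where
  "co u = (\<lambda>k. \<iota> (u k))"

lemma vecsD: "u \<in> vecs R m \<Longrightarrow> i < m \<Longrightarrow> u i \<in> carrier R" "u \<in> vecs R m \<Longrightarrow> i \<ge> m \<Longrightarrow> u i = \<zero>\<^bsub>R\<^esub>"
  unfolding vecs_def by auto

lemma vecs_carrier: "u \<in> vecs R m \<Longrightarrow> u i \<in> carrier R"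
  using vecsD[of u m i] by (cases "i < m") auto

lemma co_bij: "bij_betw co (vecs R m) (cvec Q m)"
  unfolding bij_betw_def
proof
  show "inj_on co (vecs R m)"
    by (rule inj_onI, rule ext) (metis co_def iota_eqI vecs_carrier)
  show "co ` vecs R m = cvec Q m"
  proof
    show "co ` vecs R m \<subseteq> cvec Q m"
      by (auto simp: co_def vecsD(2) zero intro!: cvecI cl dest: vecsD(1))
    show "cvec Q m \<subseteq> co ` vecs R m"
    proof
      fix x assume x: "x \<in> cvec Q m"
      define u where "u k = (if k < m then io (x k) else \<zero>\<^bsub>R\<^esub>)" for k
      have "u \<in> vecs R m" unfolding vecs_def u_def using io cvecD(1)[OF x] by auto
      moreover have "co u = x" unfolding co_def u_def using io cvecD[OF x] zero by (intro ext) auto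
      ultimately show "x \<in> co ` vecs R m" by blast
    qed
  qed
qed

lemma co_in: "u \<in> vecs R m \<Longrightarrow> co u \<in> cvec Q m"
  using bij_betwE[OF co_bij] by blast

lemma co_ex: "x \<in> cvec Q m \<Longrightarrow> \<exists>u\<in>vecs R m. co u = x"
  using co_bij[of m] unfolding bij_betw_def by (metis imageE)

lemma co_zero: "(\<lambda>_. \<zero>\<^bsub>R\<^esub>) \<in> vecs R m" "co (\<lambda>_. \<zero>\<^bsub>R\<^esub>) = (\<lambda>_. 0)"
  by (auto simp: vecs_def co_def zero)

lemma co_add:
  assumes u: "u \<in> vecs R m" and w: "w \<in> vecs R m"
  shows "sc_add R m u w \<in> vecs R m" "co (sc_add R m u w) = (\<lambda>k. co u k + co w k)"
  using vecsD[OF u] vecsD[OF w] by (auto simp: sc_add_def vecs_def co_def add zero intro!: ext)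

lemma co_smul:
  assumes u: "u \<in> vecs R m" and a: "a \<in> carrier R"
  shows "sc_smul R m a u \<in> vecs R m" "co (sc_smul R m a u) = (\<lambda>k. \<iota> a * co u k)"
  using vecsD[OF u] a by (auto simp: sc_smul_def vecs_def co_def mult zero intro!: ext)

lemma co_mult:
  assumes u: "u \<in> vecs R m" and w: "w \<in> vecs R m"
    and c: "\<And>i j k. i < m \<Longrightarrow> j < m \<Longrightarrow> k < m \<Longrightarrow> c i j k \<in> carrier R"
  shows "sc_mult R m c u w \<in> vecs R m" "co (sc_mult R m c u w) = cmul m (\<lambda>i j k. \<iota> (c i j k)) (co u) (co w)"
proof -
  have t: "u i \<otimes>\<^bsub>R\<^esub> w j \<otimes>\<^bsub>R\<^esub> c i j k \<in> carrier R" if "i < m" "j < m" "k < m" for i j k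
    using vecs_carrier[OF u] vecs_carrier[OF w] c[OF that] by simp
  have t2: "(\<Oplus>\<^bsub>R\<^esub> j\<in>{..<m}. u i \<otimes>\<^bsub>R\<^esub> w j \<otimes>\<^bsub>R\<^esub> c i j k) \<in> carrier R" if "i < m" "k < m" for i k
    using t[OF that(1) _ that(2)] by (intro R.finsum_closed) auto
  show "sc_mult R m c u w \<in> vecs R m"
    unfolding vecs_def sc_mult_def using t2 by (auto intro!: R.finsum_closed)
  show "co (sc_mult R m c u w) = cmul m (\<lambda>i j k. \<iota> (c i j k)) (co u) (co w)"
  proof
    fix k
    show "co (sc_mult R m c u w) k = cmul m (\<lambda>i j k. \<iota> (c i j k)) (co u) (co w) k"
    proof (cases "k < m")
      case True
      have "\<iota> (u i \<otimes>\<^bsub>R\<^esub> w j \<otimes>\<^bsub>R\<^esub> c i j k) = \<iota> (u i) * \<iota> (w j) * \<iota> (c i j k)" if "i < m" "j < m" for i j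
        using vecs_carrier[OF u] vecs_carrier[OF w] c[OF that True] by (simp add: mult)
      moreover have "\<iota> (\<Oplus>\<^bsub>R\<^esub> j\<in>{..<m}. u i \<otimes>\<^bsub>R\<^esub> w j \<otimes>\<^bsub>R\<^esub> c i j k) = (\<Sum>j<m. \<iota> (u i \<otimes>\<^bsub>R\<^esub> w j \<otimes>\<^bsub>R\<^esub> c i j k))"
        if "i < m" for i using t[OF that _ True] by (intro iota_finsum) auto
      moreover have "\<iota> (\<Oplus>\<^bsub>R\<^esub> i\<in>{..<m}. \<Oplus>\<^bsub>R\<^esub> j\<in>{..<m}. u i \<otimes>\<^bsub>R\<^esub> w j \<otimes>\<^bsub>R\<^esub> c i j k) =
          (\<Sum>i<m. \<iota> (\<Oplus>\<^bsub>R\<^esub> j\<in>{..<m}. u i \<otimes>\<^bsub>R\<^esub> w j \<otimes>\<^bsub>R\<^esub> c i j k))"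
        using t2[OF _ True] by (intro iota_finsum) auto
      ultimately show ?thesis using True by (simp add: co_def sc_mult_def cmul_def)
    qed (simp add: co_def sc_mult_def cmul_def zero)
  qed
qed

lemma field_extension_embeds:
  fixes p :: nat
  assumes Q: "sfield Q" and p: "prime p" and e: "is_field_extension R p e"
  shows "\<exists>f. irr Q f \<and> degree f = p \<and> lead_coeff f = 1 \<and> (\<forall>\<theta>. poly f \<theta> = 0 \<longrightarrow>
    (\<exists>\<phi>. (\<forall>x\<in>vecs R p. \<phi> x \<in> adj Q \<theta>) \<and> \<phi> \<one>\<^bsub>sc_ring R p e\<^esub> = 1 \<and>
      (\<forall>x\<in>vecs R p. \<forall>y\<in>vecs R p. \<phi> (sc_add R p x y) = \<phi> x + \<phi> y \<and> \<phi> (sc_mult R p e x y) = \<phi> x * \<phi> y) \<and>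
      (\<forall>a\<in>carrier R. \<forall>x\<in>vecs R p. \<phi> (sc_smul R p a x) = \<iota> a * \<phi> x)))"
proof -
  let ?E = "sc_ring R p e" and ?e = "\<lambda>i j k. \<iota> (e i j k)"
  have ec: "e i j k \<in> carrier R" if "i < p" "j < p" "k < p" for i j k
    using e that unfolding is_field_extension_def is_algebra_def by blast
  interpret E: field ?E using e unfolding is_field_extension_def by blast
  have Es: "carrier ?E = vecs R p" "x \<otimes>\<^bsub>?E\<^esub> y = sc_mult R p e x y" "x \<oplus>\<^bsub>?E\<^esub> y = sc_add R p x y"
    "\<zero>\<^bsub>?E\<^esub> = (\<lambda>_. \<zero>\<^bsub>R\<^esub>)" for x y by (simp_all add: sc_ring_def)
  note Em = E.m_assoc E.m_comm E.l_one E.one_closed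
  note Em = Em[unfolded Es]
  note cm = co_mult[where c = e and m = p, OF _ _ ec]
  define u where "u = co \<one>\<^bsub>?E\<^esub>"
  have "\<exists>f. irr Q f \<and> degree f = p \<and> lead_coeff f = 1 \<and> (\<forall>\<theta>. poly f \<theta> = 0 \<longrightarrow>
    (\<exists>\<phi>. (\<forall>x\<in>cvec Q p. \<phi> x \<in> adj Q \<theta>) \<and> \<phi> u = 1 \<and>
      (\<forall>x\<in>cvec Q p. \<forall>y\<in>cvec Q p. \<phi> (\<lambda>k. x k + y k) = \<phi> x + \<phi> y \<and> \<phi> (cmul p ?e x y) = \<phi> x * \<phi> y) \<and>
      (\<forall>a\<in>Q. \<forall>x\<in>cvec Q p. \<phi> (\<lambda>k. a * x k) = a * \<phi> x)))"
  proof (rule field_extension_functional[OF Q p])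
    show "\<iota> (e i j k) \<in> Q" if "i < p" "j < p" "k < p" for i j k using cl[OF ec[OF that]] .
    show "cmul p ?e (cmul p ?e x y) z = cmul p ?e x (cmul p ?e y z)"
      if xyz: "x \<in> cvec Q p" "y \<in> cvec Q p" "z \<in> cvec Q p" for x y z
    proof -
      obtain x' y' z' where v: "x' \<in> vecs R p" "y' \<in> vecs R p" "z' \<in> vecs R p"
        and c: "x = co x'" "y = co y'" "z = co z'" using xyz co_ex by metis
      show ?thesis using arg_cong[OF Em(1)[OF v], of co] v by (simp add: c cm)
    qed
    show "cmul p ?e x y = cmul p ?e y x" if xy: "x \<in> cvec Q p" "y \<in> cvec Q p" for x y
    proof -
      obtain x' y' where v: "x' \<in> vecs R p" "y' \<in> vecs R p" and c: "x = co x'" "y = co y'" using xy co_ex by metis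
      show ?thesis using arg_cong[OF Em(2)[OF v], of co] v by (simp add: c cm)
    qed
    show "u \<in> cvec Q p" unfolding u_def by (rule co_in[OF Em(4)])
    show "cmul p ?e u x = x" if x: "x \<in> cvec Q p" for x
    proof -
      obtain x' where v: "x' \<in> vecs R p" and c: "x = co x'" using x co_ex by metis
      show ?thesis using arg_cong[OF Em(3)[OF v], of co] v Em(4) by (simp add: c cm u_def)
    qed
    show "\<exists>y\<in>cvec Q p. cmul p ?e x y = u" if x: "x \<in> cvec Q p" "x \<noteq> (\<lambda>_. 0)" for x
    proof -
      obtain x' where v: "x' \<in> vecs R p" and c: "x = co x'" using x co_ex by metis
      have "x' \<noteq> (\<lambda>_. \<zero>\<^bsub>R\<^esub>)" using x(2) c co_zero(2) by auto
      then have "x' \<in> Units ?E" using E.field_Units v by (simp add: Es)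
      then obtain y' where y': "y' \<in> vecs R p" "sc_mult R p e x' y' = \<one>\<^bsub>?E\<^esub>"
        unfolding Units_def Es(1,2) by blast
      then show ?thesis using cm[OF v y'(1)] co_in[OF y'(1)] by (intro bexI[of _ "co y'"]) (auto simp: c u_def)
    qed
  qed
  then obtain f where f: "irr Q f" "degree f = p" "lead_coeff f = 1" and
    \<phi>: "\<And>\<theta>. poly f \<theta> = 0 \<Longrightarrow>
    (\<exists>\<phi>. (\<forall>x\<in>cvec Q p. \<phi> x \<in> adj Q \<theta>) \<and> \<phi> u = 1 \<and>
      (\<forall>x\<in>cvec Q p. \<forall>y\<in>cvec Q p. \<phi> (\<lambda>k. x k + y k) = \<phi> x + \<phi> y \<and> \<phi> (cmul p ?e x y) = \<phi> x * \<phi> y) \<and>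
      (\<forall>a\<in>Q. \<forall>x\<in>cvec Q p. \<phi> (\<lambda>k. a * x k) = a * \<phi> x))" by blast
  have "\<exists>\<phi>. (\<forall>x\<in>vecs R p. \<phi> x \<in> adj Q \<theta>) \<and> \<phi> \<one>\<^bsub>?E\<^esub> = 1 \<and>
      (\<forall>x\<in>vecs R p. \<forall>y\<in>vecs R p. \<phi> (sc_add R p x y) = \<phi> x + \<phi> y \<and> \<phi> (sc_mult R p e x y) = \<phi> x * \<phi> y) \<and>
      (\<forall>a\<in>carrier R. \<forall>x\<in>vecs R p. \<phi> (sc_smul R p a x) = \<iota> a * \<phi> x)" if r: "poly f \<theta> = 0" for \<theta>
  proof -
    obtain \<phi> where \<phi>: "\<And>x. x \<in> cvec Q p \<Longrightarrow> \<phi> x \<in> adj Q \<theta>" "\<phi> u = 1"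
      "\<And>x y. x \<in> cvec Q p \<Longrightarrow> y \<in> cvec Q p \<Longrightarrow> \<phi> (\<lambda>k. x k + y k) = \<phi> x + \<phi> y"
      "\<And>x y. x \<in> cvec Q p \<Longrightarrow> y \<in> cvec Q p \<Longrightarrow> \<phi> (cmul p ?e x y) = \<phi> x * \<phi> y"
      "\<And>a x. a \<in> Q \<Longrightarrow> x \<in> cvec Q p \<Longrightarrow> \<phi> (\<lambda>k. a * x k) = a * \<phi> x"
      using \<phi>[OF r] by blast
    show ?thesis
      by (rule exI[of _ "\<lambda>x. \<phi> (co x)"]) (auto simp: \<phi> co_in cm co_add co_smul cl u_def[symmetric])
  qed
  then show ?thesis using f by blast
qed

end

section \<open>The cyclic algebra in structure constants\<close>

locale model = csz p M s t \<zeta> v + coords R \<iota> "fixK M s"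
  for p M s t \<zeta> v and R :: "'r ring" and \<iota>
begin

definition sc :: "nat \<Rightarrow> nat \<Rightarrow> nat \<Rightarrow> 'r" where
  "sc a b k = io (con a b k)"

abbreviation "A \<equiv> sc_ring R (p ^ 2) sc"

definition Phi :: "(nat \<Rightarrow> 'r) \<Rightarrow> complex poly" where
  "Phi u = theta p v (co u)"

lemma A_simps:
  "carrier A = vecs R (p ^ 2)" "x \<otimes>\<^bsub>A\<^esub> y = sc_mult R (p ^ 2) sc x y" "x \<oplus>\<^bsub>A\<^esub> y = sc_add R (p ^ 2) x y"
  "\<zero>\<^bsub>A\<^esub> = (\<lambda>_. \<zero>\<^bsub>R\<^esub>)" "\<one>\<^bsub>A\<^esub> = sc_one R (p ^ 2) sc"
  by (simp_all add: sc_ring_def)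

lemma Phi_bij: "bij_betw Phi (vecs R (p ^ 2)) D"
  using bij_betw_trans[OF co_bij theta_bij] by (simp add: Phi_def[abs_def] comp_def)

lemma Phi_in: "u \<in> vecs R (p ^ 2) \<Longrightarrow> Phi u \<in> D"
  using bij_betwE[OF Phi_bij] by blast

lemma Phi_ex: "d \<in> D \<Longrightarrow> \<exists>u\<in>vecs R (p ^ 2). Phi u = d"
  using Phi_bij unfolding bij_betw_def by (metis imageE)

lemma Phi_eqI: "u \<in> vecs R (p ^ 2) \<Longrightarrow> w \<in> vecs R (p ^ 2) \<Longrightarrow> Phi u = Phi w \<Longrightarrow> u = w"
  using Phi_bij by (auto simp: bij_betw_def inj_on_def)

lemma sc_in: "i < p ^ 2 \<Longrightarrow> j < p ^ 2 \<Longrightarrow> k < p ^ 2 \<Longrightarrow> sc i j k \<in> carrier R \<and> \<iota> (sc i j k) = con i j k"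
  unfolding sc_def by (rule io) (rule cvecD(1)[OF con(1)])

lemma Phi_mult:
  assumes u: "u \<in> vecs R (p ^ 2)" and w: "w \<in> vecs R (p ^ 2)"
  shows "sc_mult R (p ^ 2) sc u w \<in> vecs R (p ^ 2) \<and> Phi (sc_mult R (p ^ 2) sc u w) = dmul (Phi u) (Phi w)"
proof -
  note cm = co_mult[OF u w, of sc] sc_in
  have "cmul (p ^ 2) (\<lambda>i j k. \<iota> (sc i j k)) (co u) (co w) = cmul (p ^ 2) con (co u) (co w)"
    by (rule ext) (simp add: cmul_def sc_in)
  then show ?thesis using cm unfolding Phi_def by (simp add: theta_mul co_in[OF u] co_in[OF w])
qed

lemma Phi_add:
  assumes u: "u \<in> vecs R (p ^ 2)" and w: "w \<in> vecs R (p ^ 2)"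
  shows "sc_add R (p ^ 2) u w \<in> vecs R (p ^ 2) \<and> Phi (sc_add R (p ^ 2) u w) = Phi u + Phi w"
  using co_add[OF u w] unfolding Phi_def by (simp add: theta_add)

lemma Phi_smul:
  assumes u: "u \<in> vecs R (p ^ 2)" and a: "a \<in> carrier R"
  shows "sc_smul R (p ^ 2) a u \<in> vecs R (p ^ 2) \<and> Phi (sc_smul R (p ^ 2) a u) = smult (\<iota> a) (Phi u)"
  using co_smul[OF u a] unfolding Phi_def by (simp add: theta_smult)

lemma Phi_zero: "(\<lambda>_. \<zero>\<^bsub>R\<^esub>) \<in> vecs R (p ^ 2)" "Phi (\<lambda>_. \<zero>\<^bsub>R\<^esub>) = 0"
  using co_zero by (auto simp: Phi_def theta_def)

lemma Phi_one: "\<one>\<^bsub>A\<^esub> \<in> vecs R (p ^ 2)" "Phi \<one>\<^bsub>A\<^esub> = 1"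
proof -
  obtain e where e: "e \<in> vecs R (p ^ 2)" "Phi e = 1" using Phi_ex[OF D_1] by blast
  have unit: "sc_mult R (p ^ 2) sc e w = w \<and> sc_mult R (p ^ 2) sc w e = w" if w: "w \<in> vecs R (p ^ 2)" for w
    using Phi_mult[OF e(1) w] Phi_mult[OF w e(1)] w dm_1_right[OF Phi_in[OF w]]
    by (auto intro!: Phi_eqI simp: e(2) dm_1)
  have "sc_one R (p ^ 2) sc = e"
    unfolding sc_one_def by (rule the_equality) (use e unit in metis)+
  then show "\<one>\<^bsub>A\<^esub> \<in> vecs R (p ^ 2)" "Phi \<one>\<^bsub>A\<^esub> = 1" using e by (simp_all add: A_simps)
qed

lemma one_neq_zero: "\<one>\<^bsub>A\<^esub> \<noteq> \<zero>\<^bsub>A\<^esub>"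
proof
  assume "\<one>\<^bsub>A\<^esub> = \<zero>\<^bsub>A\<^esub>"
  then have "Phi \<one>\<^bsub>A\<^esub> = Phi (\<lambda>_. \<zero>\<^bsub>R\<^esub>)" unfolding A_simps(4) by (rule arg_cong)
  then show False unfolding Phi_one(2) Phi_zero(2) by simp
qed

lemma A_ring: "ring A"
proof (rule ring_transfer[where h = Phi and B = D and m = dmul and e = 1])
  show "bij_betw Phi (carrier A) D" unfolding A_simps by (rule Phi_bij)
  show "\<zero>\<^bsub>A\<^esub> \<in> carrier A" "Phi \<zero>\<^bsub>A\<^esub> = 0" unfolding A_simps by (rule Phi_zero)+
  show "\<one>\<^bsub>A\<^esub> \<in> carrier A" "Phi \<one>\<^bsub>A\<^esub> = 1" using Phi_one by (simp_all add: A_simps(1))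
  show "x \<oplus>\<^bsub>A\<^esub> y \<in> carrier A \<and> Phi (x \<oplus>\<^bsub>A\<^esub> y) = Phi x + Phi y" if "x \<in> carrier A" "y \<in> carrier A" for x y
    using Phi_add that unfolding A_simps by blast
  show "x \<otimes>\<^bsub>A\<^esub> y \<in> carrier A \<and> Phi (x \<otimes>\<^bsub>A\<^esub> y) = dmul (Phi x) (Phi y)" if "x \<in> carrier A" "y \<in> carrier A" for x y
    using Phi_mult that unfolding A_simps by blast
qed (auto intro: D_uminus dm_assoc dm_add1 dm_add2 dm_1 dm_1_right)

lemma central_division:
  assumes nn: "\<And>x. x \<in> M \<Longrightarrow> nrm p s x \<noteq> t"
  shows "is_central_division_algebra R p sc"
  unfolding is_central_division_algebra_def Let_def
proof (intro conjI)
  show "is_algebra R (p ^ 2) sc" unfolding is_algebra_def using sc_in A_ring by blast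
  show "\<one>\<^bsub>A\<^esub> \<noteq> \<zero>\<^bsub>A\<^esub>" by (rule one_neq_zero)
  show "Units A = carrier A - {\<zero>\<^bsub>A\<^esub>}"
  proof (intro equalityI subsetI)
    fix x assume "x \<in> Units A"
    then obtain y where xy: "x \<in> vecs R (p ^ 2)" "y \<in> vecs R (p ^ 2)" "sc_mult R (p ^ 2) sc x y = \<one>\<^bsub>A\<^esub>"
      unfolding Units_def A_simps(1,2) by blast
    then have "dmul (Phi x) (Phi y) = 1" using Phi_mult[OF xy(1,2)] Phi_one(2) by simp
    then have "Phi x \<noteq> 0" using dm_0 by auto
    then show "x \<in> carrier A - {\<zero>\<^bsub>A\<^esub>}" using xy(1) Phi_zero(2) by (auto simp: A_simps)
  next
    fix x assume "x \<in> carrier A - {\<zero>\<^bsub>A\<^esub>}"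
    then have x: "x \<in> vecs R (p ^ 2)" "x \<noteq> (\<lambda>_. \<zero>\<^bsub>R\<^esub>)" by (auto simp: A_simps)
    then have "Phi x \<noteq> 0" using Phi_eqI[OF x(1) Phi_zero(1)] Phi_zero(2) by auto
    then obtain d where d: "d \<in> D" "dmul d (Phi x) = 1" "dmul (Phi x) d = 1"
      using inverse_exists[OF nn Phi_in[OF x(1)]] by blast
    obtain y where y: "y \<in> vecs R (p ^ 2)" "Phi y = d" using Phi_ex[OF d(1)] by blast
    have "sc_mult R (p ^ 2) sc x y = \<one>\<^bsub>A\<^esub>" "sc_mult R (p ^ 2) sc y x = \<one>\<^bsub>A\<^esub>"
      using Phi_mult[OF x(1) y(1)] Phi_mult[OF y(1) x(1)] Phi_one d y(2) by (auto intro!: Phi_eqI)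
    then show "x \<in> Units A" unfolding Units_def A_simps(1,2) using x(1) y(1) by blast
  qed
  have com: "sc_mult R (p ^ 2) sc x y = sc_mult R (p ^ 2) sc y x \<longleftrightarrow> dmul (Phi x) (Phi y) = dmul (Phi y) (Phi x)"
    if "x \<in> vecs R (p ^ 2)" "y \<in> vecs R (p ^ 2)" for x y
    using Phi_mult[OF that] Phi_mult[OF that(2,1)] Phi_eqI by metis
  have "(\<forall>y\<in>vecs R (p ^ 2). sc_mult R (p ^ 2) sc x y = sc_mult R (p ^ 2) sc y x) \<longleftrightarrow>
    (\<exists>a\<in>carrier R. x = sc_smul R (p ^ 2) a \<one>\<^bsub>A\<^esub>)" if x: "x \<in> vecs R (p ^ 2)" for x
  proof -
    have "(\<forall>y\<in>vecs R (p ^ 2). sc_mult R (p ^ 2) sc x y = sc_mult R (p ^ 2) sc y x) \<longleftrightarrow>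
      (\<forall>d\<in>D. dmul (Phi x) d = dmul d (Phi x))"
      using com[OF x] Phi_ex Phi_in by metis
    also have "\<dots> \<longleftrightarrow> (\<exists>a\<in>K. Phi x = [:a:])" by (rule center[OF Phi_in[OF x]])
    also have "\<dots> \<longleftrightarrow> (\<exists>a\<in>carrier R. x = sc_smul R (p ^ 2) a \<one>\<^bsub>A\<^esub>)"
    proof
      assume "\<exists>a\<in>K. Phi x = [:a:]"
      then obtain a where a: "a \<in> K" "Phi x = [:a:]" by blast
      have "x = sc_smul R (p ^ 2) (io a) \<one>\<^bsub>A\<^esub>"
        using Phi_smul[OF Phi_one(1), of "io a"] io[OF a(1)] a(2) Phi_one(2) by (intro Phi_eqI x) (auto simp: one_pCons)
      then show "\<exists>a\<in>carrier R. x = sc_smul R (p ^ 2) a \<one>\<^bsub>A\<^esub>" using io[OF a(1)] by blast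
    next
      assume "\<exists>a\<in>carrier R. x = sc_smul R (p ^ 2) a \<one>\<^bsub>A\<^esub>"
      then obtain a where a: "a \<in> carrier R" "x = sc_smul R (p ^ 2) a \<one>\<^bsub>A\<^esub>" by blast
      have "Phi x = [:\<iota> a:]" using Phi_smul[OF Phi_one(1) a(1)] Phi_one(2) a(2) by (simp add: one_pCons)
      then show "\<exists>a\<in>K. Phi x = [:a:]" using cl[OF a(1)] by blast
    qed
    finally show ?thesis .
  qed
  moreover have "sc_smul R (p ^ 2) a \<one>\<^bsub>A\<^esub> \<in> vecs R (p ^ 2)" if "a \<in> carrier R" for a
    using Phi_smul[OF Phi_one(1) that] by blast
  ultimately show "{x \<in> carrier A. \<forall>y\<in>carrier A. x \<otimes>\<^bsub>A\<^esub> y = y \<otimes>\<^bsub>A\<^esub> x} = {sc_smul R (p ^ 2) a \<one>\<^bsub>A\<^esub> | a. a \<in> carrier R}"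
    unfolding A_simps(1,2) by blast
qed

text \<open>The embedding is a composite through \<open>adj K \<theta>\<close>. As
  \<open>adj_embeds\<close> dictates which root \<open>\<theta>\<close> is used,
  \<open>field_extension_embeds\<close> provides a map for every root of \<open>f\<close>.
  Injectivity is automatic for a homomorphism from a field to a nonzero ring.\<close>

lemma all_embed:
  assumes nn: "\<And>x. x \<in> M \<Longrightarrow> nrm p s x \<noteq> t"
    and sol: "\<And>f. f \<in> pol K \<Longrightarrow> degree f = p \<Longrightarrow> lead_coeff f = 1 \<Longrightarrow> irr M f \<Longrightarrow> solved p M s f t"
    and e: "is_field_extension R p e"
  shows "embeds R p e (p ^ 2) sc"
proof -
  let ?E = "sc_ring R p e"
  interpret E: field ?E using e unfolding is_field_extension_def by blast
  have Es: "carrier ?E = vecs R p" "x \<otimes>\<^bsub>?E\<^esub> y = sc_mult R p e x y" "x \<oplus>\<^bsub>?E\<^esub> y = sc_add R p x y" for x y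
    by (simp_all add: sc_ring_def)
  obtain f where f: "irr K f" "degree f = p" "lead_coeff f = 1" and ph:
    "\<forall>\<theta>. poly f \<theta> = 0 \<longrightarrow>
    (\<exists>\<phi>. (\<forall>x\<in>vecs R p. \<phi> x \<in> adj K \<theta>) \<and> \<phi> \<one>\<^bsub>?E\<^esub> = 1 \<and>
      (\<forall>x\<in>vecs R p. \<forall>y\<in>vecs R p. \<phi> (sc_add R p x y) = \<phi> x + \<phi> y \<and> \<phi> (sc_mult R p e x y) = \<phi> x * \<phi> y) \<and>
      (\<forall>a\<in>carrier R. \<forall>x\<in>vecs R p. \<phi> (sc_smul R p a x) = \<iota> a * \<phi> x))"
    using field_extension_embeds[OF KF p e] by blast
  obtain \<theta> j where r: "poly f \<theta> = 0" and j: "\<And>z. z \<in> adj K \<theta> \<Longrightarrow> j z \<in> D" "j 1 = 1"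
    "\<And>x y. x \<in> adj K \<theta> \<Longrightarrow> y \<in> adj K \<theta> \<Longrightarrow> j (x + y) = j x + j y"
    "\<And>x y. x \<in> adj K \<theta> \<Longrightarrow> y \<in> adj K \<theta> \<Longrightarrow> j (x * y) = dmul (j x) (j y)"
    "\<And>a x. a \<in> K \<Longrightarrow> x \<in> adj K \<theta> \<Longrightarrow> j (a * x) = smult a (j x)"
    using adj_embeds[OF nn f(1,2) sol[OF irrD(1)[OF f(1)] f(2,3)]] by blast
  obtain \<phi> where \<phi>: "\<forall>x\<in>vecs R p. \<phi> x \<in> adj K \<theta>" "\<phi> \<one>\<^bsub>?E\<^esub> = 1"
    "\<forall>x\<in>vecs R p. \<forall>y\<in>vecs R p. \<phi> (sc_add R p x y) = \<phi> x + \<phi> y \<and> \<phi> (sc_mult R p e x y) = \<phi> x * \<phi> y"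
    "\<forall>a\<in>carrier R. \<forall>x\<in>vecs R p. \<phi> (sc_smul R p a x) = \<iota> a * \<phi> x"
    using ph[THEN spec, THEN mp, OF r] by (elim exE conjE) (rule that; assumption)
  note \<phi> = \<phi>(1)[THEN bspec] \<phi>(2) \<phi>(3)[THEN bspec, THEN bspec, THEN conjunct1]
    \<phi>(3)[THEN bspec, THEN bspec, THEN conjunct2] \<phi>(4)[THEN bspec, THEN bspec]
  define F where "F x = (SOME u. u \<in> vecs R (p ^ 2) \<and> Phi u = j (\<phi> x))" for x
  have F: "F x \<in> vecs R (p ^ 2) \<and> Phi (F x) = j (\<phi> x)" if "x \<in> vecs R p" for x
    unfolding F_def using someI_ex[of "\<lambda>u. u \<in> vecs R (p ^ 2) \<and> Phi u = j (\<phi> x)"]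
      Phi_ex[OF j(1)[OF \<phi>(1)[OF that]]] by blast
  have cE: "sc_mult R p e x y \<in> vecs R p" "sc_add R p x y \<in> vecs R p" if "x \<in> vecs R p" "y \<in> vecs R p" for x y
    using E.m_closed[of x y] E.a_closed[of x y] that unfolding Es by blast+
  have oE: "\<one>\<^bsub>?E\<^esub> \<in> vecs R p" using E.one_closed unfolding Es .
  have F1: "F \<one>\<^bsub>?E\<^esub> = \<one>\<^bsub>A\<^esub>" using F[OF oE] Phi_one \<phi>(2) j(2) by (intro Phi_eqI) auto
  have hom: "F \<in> ring_hom ?E A"
  proof (rule ring_hom_memI)
    fix x y assume "x \<in> carrier ?E" "y \<in> carrier ?E"
    then have x: "x \<in> vecs R p" and y: "y \<in> vecs R p" by (simp_all add: Es)
    note Fx = F[OF x] and Fy = F[OF y]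
    show "F (x \<otimes>\<^bsub>?E\<^esub> y) = F x \<otimes>\<^bsub>A\<^esub> F y" unfolding Es A_simps
      using F[OF cE(1)[OF x y]] Phi_mult[of "F x" "F y"] Fx Fy by (intro Phi_eqI) (auto simp: \<phi> j x y)
    show "F (x \<oplus>\<^bsub>?E\<^esub> y) = F x \<oplus>\<^bsub>A\<^esub> F y" unfolding Es A_simps
      using F[OF cE(2)[OF x y]] Phi_add[of "F x" "F y"] Fx Fy by (intro Phi_eqI) (auto simp: \<phi> j x y)
  qed (use F F1 in \<open>auto simp: Es(1) A_simps(1)\<close>)
  have F_smul: "F (sc_smul R p a x) = sc_smul R (p ^ 2) a (F x)" if a: "a \<in> carrier R" and x: "x \<in> vecs R p" for a x
    using F[OF co_smul(1)[OF x a]] Phi_smul[of "F x" a] F[OF x] a x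
    by (intro Phi_eqI) (auto simp: \<phi> j cl)
  interpret ring_hom_ring ?E A F
    by (rule ring_hom_ringI2[OF E.ring_axioms A_ring hom])
  have "F ` carrier ?E \<noteq> {\<zero>\<^bsub>A\<^esub>}"
  proof
    assume "F ` carrier ?E = {\<zero>\<^bsub>A\<^esub>}"
    then have "\<one>\<^bsub>A\<^esub> = \<zero>\<^bsub>A\<^esub>" using F1 oE unfolding Es by (metis imageI singletonD)
    then show False using one_neq_zero by blast
  qed
  then have "inj_on F (vecs R p)" using non_trivial_field_hom_imp_inj[OF E.field_axioms] unfolding Es by blast
  moreover have "F \<in> alg_hom R p e (p ^ 2) sc" unfolding alg_hom_def using hom F_smul by simp
  ultimately show ?thesis unfolding embeds_def by (rule bexI)
qed

end

text \<open>Both algebras are described by the same \<open>R\<close>, \<open>\<iota>\<close> and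
  \<open>v\<close>, so the isomorphism becomes a map of \<open>D\<close> to itself that turns one
  product into the other and is linear over \<open>K\<close>; this is the situation of
  \<open>hom_norm\<close>.\<close>

lemma alg_isomorphic_norm:
  assumes m1: "model p M s t\<^sub>1 \<zeta> v R \<iota>" and m2: "model p M s t\<^sub>2 \<zeta> v R \<iota>"
    and nn: "\<And>x. x \<in> M \<Longrightarrow> nrm p s x \<noteq> t\<^sub>2"
    and iso: "alg_isomorphic R (p ^ 2) (model.sc p M s t\<^sub>1 v R \<iota>) (model.sc p M s t\<^sub>2 v R \<iota>)"
  shows "\<exists>x\<in>M. nrm p s x * t\<^sub>2 = t\<^sub>1"
proof -
  interpret m1: model p M s t\<^sub>1 \<zeta> v R \<iota> by (rule m1)
  interpret m2: model p M s t\<^sub>2 \<zeta> v R \<iota> by (rule m2)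
  obtain f where f: "f \<in> ring_hom m1.A m2.A"
    "\<And>a u. a \<in> carrier R \<Longrightarrow> u \<in> vecs R (p ^ 2) \<Longrightarrow> f (sc_smul R (p ^ 2) a u) = sc_smul R (p ^ 2) a (f u)"
    using iso unfolding alg_isomorphic_def alg_hom_def by blast
  have fv: "f u \<in> vecs R (p ^ 2)" if "u \<in> vecs R (p ^ 2)" for u
    using ring_hom_closed[OF f(1), of u] that by (simp add: m1.A_simps m2.A_simps)
  define g where "g d = inv_into (vecs R (p ^ 2)) m1.Phi d" for d
  have g: "g d \<in> vecs R (p ^ 2)" "m1.Phi (g d) = d" if "d \<in> m1.D" for d
  proof -
    have d: "d \<in> m1.Phi ` vecs R (p ^ 2)" using m1.Phi_bij that by (simp add: bij_betw_def)
    show "g d \<in> vecs R (p ^ 2)" unfolding g_def by (rule inv_into_into[OF d])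
    show "m1.Phi (g d) = d" unfolding g_def by (rule f_inv_into_f[OF d])
  qed
  have gI: "g d = u" if "u \<in> vecs R (p ^ 2)" "m1.Phi u = d" for d u
    using m1.Phi_eqI[of "g d" u] g[of d] that m1.Phi_in by auto
  show ?thesis
  proof (rule m2.hom_norm[OF nn m1.t, where f = "\<lambda>d. m2.Phi (f (g d))"])
    show "m2.Phi (f (g d)) \<in> m1.D" if "d \<in> m1.D" for d by (intro m2.Phi_in fv g that)
    show "m2.Phi (f (g (cyclic_mult p s t\<^sub>1 d e))) = cyclic_mult p s t\<^sub>2 (m2.Phi (f (g d))) (m2.Phi (f (g e)))"
      if d: "d \<in> m1.D" and e: "e \<in> m1.D" for d e
    proof -
      have "g (cyclic_mult p s t\<^sub>1 d e) = sc_mult R (p ^ 2) m1.sc (g d) (g e)"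
        using m1.Phi_mult[OF g(1)[OF d] g(1)[OF e]] g d e by (intro gI) auto
      then have "f (g (cyclic_mult p s t\<^sub>1 d e)) = sc_mult R (p ^ 2) m2.sc (f (g d)) (f (g e))"
        using ring_hom_mult[OF f(1), of "g d" "g e"] g d e by (simp add: m1.A_simps m2.A_simps)
      then show ?thesis using m2.Phi_mult[OF fv[OF g(1)[OF d]] fv[OF g(1)[OF e]]] by simp
    qed
    have "g 1 = \<one>\<^bsub>m1.A\<^esub>" by (rule gI[OF m1.Phi_one])
    then show "m2.Phi (f (g 1)) = 1" using ring_hom_one[OF f(1)] m2.Phi_one by simp
    show "m2.Phi (f (g (smult a d))) = smult a (m2.Phi (f (g d)))" if a: "a \<in> m1.K" and d: "d \<in> m1.D" for a d
    proof -
      note io = m1.io[OF a]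
      have "g (smult a d) = sc_smul R (p ^ 2) (m1.io a) (g d)"
        using m1.Phi_smul[OF g(1)[OF d], of "m1.io a"] io g d by (intro gI) auto
      then show ?thesis using m2.Phi_smul[OF fv[OF g(1)[OF d]], of "m1.io a"] io f(2)[of "m1.io a" "g d"] g d by simp
    qed
  qed
qed

lemma alg_isomorphic_refl: "alg_isomorphic R m c c"
  unfolding alg_isomorphic_def alg_hom_def ring_hom_def by (intro bexI[of _ id]) auto

theorem theorem4:
  fixes p :: nat
  assumes "Factorial_Ring.prime p"
  shows "\<exists>(K :: nat set set ring) d. field K \<and> is_central_division_algebra K p d \<and>
           infinite (genus K p d)"
proof -
  obtain M s \<zeta> v t where c: "cyc p M s" and z: "\<zeta> \<in> fixK M s" "\<zeta> ^ p = 1" "\<forall>i. 0 < i \<longrightarrow> i < p \<longrightarrow> \<zeta> ^ i \<noteq> 1"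
    and v: "v \<in> M" "v \<noteq> 0" "s v = \<zeta> * v"
    and t: "\<forall>n::nat. t n \<in> fixK M s \<and> t n \<noteq> 0 \<and> (\<forall>x\<in>M. nrm p s x \<noteq> t n)"
    and tt: "\<forall>i j. i \<noteq> j \<longrightarrow> (\<forall>x\<in>M. nrm p s x * t i \<noteq> t j)"
    and sol: "\<forall>f\<in>pol (fixK M s). \<forall>n. degree f = p \<longrightarrow> lead_coeff f = 1 \<longrightarrow> irr M f \<longrightarrow> solved p M s f (t n)"
    using field_tower[OF assms] by (elim exE conjE) (rule that; assumption)
  have KF: "sfield (fixK M s)" by (rule fixK_sfield[OF c])
  have "countable (fixK M s)" using cycD(2)[OF c] by (rule countable_subset[rotated]) (auto simp: fixK_def)
  then obtain R :: "nat set set ring" and \<iota> where R: "coords R \<iota> (fixK M s)" using coords_exist[OF KF] by blast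
  have m: "model p M s (t n) \<zeta> v R \<iota>" for n
    unfolding model_def csz_def csa_def csz_axioms_def using assms c z v t R by blast
  define d where "d n = model.sc p M s (t n) v R \<iota>" for n
  have nn: "nrm p s x \<noteq> t n" if "x \<in> M" for x n using t that by blast
  have cda: "is_central_division_algebra R p (d n)" for n
    unfolding d_def by (rule model.central_division[OF m nn])
  have emb: "embeds R p e (p ^ 2) (d n)" if "is_field_extension R p e" for e n
    unfolding d_def by (rule model.all_embed[OF m nn _ that]) (use sol in auto)
  have reps: "d n \<in> genus_reps R p (d 0)" for n
    unfolding genus_reps_def using cda emb by blast
  let ?r = "{(x, y). alg_isomorphic R (p ^ 2) x y}"
  have "inj (\<lambda>n. ?r `` {d n})"
  proof (rule injI)
    fix i j assume eq: "?r `` {d i} = ?r `` {d j}"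
    have "d j \<in> ?r `` {d j}" using alg_isomorphic_refl by auto
    then have "alg_isomorphic R (p ^ 2) (d i) (d j)" unfolding eq[symmetric] by auto
    then have "\<exists>x\<in>M. nrm p s x * t j = t i"
      unfolding d_def by (rule alg_isomorphic_norm[OF m m nn, rotated])
    then obtain x where "x \<in> M" "nrm p s x * t j = t i" by (rule bexE)
    then show "i = j" using tt[rule_format, of j i x] by fastforce
  qed
  then have "infinite (range (\<lambda>n. ?r `` {d n}))" using finite_imageD infinite_UNIV_nat by blast
  moreover have "range (\<lambda>n. ?r `` {d n}) \<subseteq> genus R p (d 0)"
    unfolding genus_def by (rule image_subsetI) (rule quotientI[OF reps])
  ultimately have "infinite (genus R p (d 0))" using finite_subset by blast
  moreover have "field R" using R unfolding coords_def by blast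
  ultimately show ?thesis using cda by blast
qed

end
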